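(* Let $f$ be a square-free monic integral polynomial and put $R=\mathbb{Z}[x]/(f)$. (a) There is a bijection $$\mathcal{M}_{f,f}(\mathbb{Z})/\sim_{\mathbb Z}\ \longleftrightarrow\ \mathrm{ICM}(R).$$ (b) Assume that $R$ is a Bass order. Let $N$ be a positive integer. There is a bijection $$\mathcal{M}_{f,f^N}(\mathbb{Z})/\sim_{\mathbb Z}\ \longleftrightarrow\ \mathcal{C}/\simeq_R,$$ where the objects of $\mathcal{C}$ are the $R$-modules of the form $I_1\oplus\cdots\oplus I_N$, with $I_i$ fractional $R$-ideals satisfying $(I_i:I_i)\subseteq(I_{i+1}:I_{i+1})$ for all $i$, and two such modules $I_1\oplus\cdots\oplus I_N$ and $I_1'\oplus\cdots\oplus I_N'$ are isomorphic if and only if $(I_i:I_i)=(I_i':I_i')$ for every $i$ and $\{I_1\cdots I_N\}=\{I_1'\cdots I_N'\}$ in $\mathrm{ICM}(R)$.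
   Context: For monic integer polynomials $m,c$, $\mathcal{M}_{m,c}(\mathbb{Z})$ is the set of $\deg(c)\times\deg(c)$ integer matrices with minimal polynomial $m$ and characteristic polynomial $c$. $A\sim_{\mathbb Z}B$ means that $OAO^{-1}=B$ for some integer matrix $O$ invertible over $\mathbb{Z}$. An order is a commutative reduced ring $R$ with unit that is free and finitely generated as a $\mathbb{Z}$-module; its total quotient ring $K$ is a finite product of number fields (here $K=\mathbb{Q}[x]/(f)$). A fractional $R$-ideal is a finitely generated sub-$R$-module $I$ of $K$ with $I\otimes_{\mathbb Z}\mathbb{Q}=K$; $(I:J)=\{x\in K:xJ\subseteq I\}$, and $(I:I)$ is the multiplicator ring of $I$. $\mathrm{ICM}(R)$ is the monoid, under ideal multiplication, of $R$-module isomorphism classes $\{I\}$ of fractional $R$-ideals (equivalently, $I\simeq J$ iff $I=\alpha J$ for some $\alpha\in K^\times$). An over-order of $R$ is a fractional $R$-ideal that is a subring of $K$. An order $S$ in $K$ is Gorenstein if its trace dual $S^t=\{x\in K:\mathrm{Tr}_{K/\mathbb Q}(xS)\subseteq\mathbb{Z}\}$ is an invertible fractional $S$-ideal (i.e. $S^tJ=S$ for some fractional $S$-ideal $J$). An order is Bass if every over-order of it is Gorenstein. $\simeq_R$ denotes isomorphism of $R$-modules. *)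

theory Defs
  imports
    "HOL-Algebra.Algebraic_Closure_Type"
    "HOL-Algebra.Ideal_Product"
    "HOL-Algebra.Subrings"
    "HOL-Algebra.Module"
    "HOL-Library.FuncSet"
    "HOL-Computational_Algebra.Squarefree"
    "Jordan_Normal_Form.Char_Poly"
begin

section \<open>Integer matrices with given minimal and characteristic polynomial\<close>

definition mat_eval :: "'a::comm_ring_1 poly \<Rightarrow> 'a mat \<Rightarrow> 'a mat" where
  "mat_eval p A =
     mat (dim_row A) (dim_row A) (\<lambda>ij. \<Sum>k\<le>degree p. coeff p k * (A ^\<^sub>m k) $$ ij)"

definition is_minimal_poly :: "'a::field mat \<Rightarrow> 'a poly \<Rightarrow> bool" where
  "is_minimal_poly A m \<longleftrightarrow>
     lead_coeff m = 1 \<and> mat_eval m A = 0\<^sub>m (dim_row A) (dim_row A) \<and>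
     (\<forall>q. q \<noteq> 0 \<longrightarrow> mat_eval q A = 0\<^sub>m (dim_row A) (dim_row A) \<longrightarrow> degree m \<le> degree q)"

text \<open>The minimal polynomial of an integer matrix is its minimal polynomial as a rational matrix.\<close>

definition int_mats :: "int poly \<Rightarrow> int poly \<Rightarrow> int mat set" where
  "int_mats m c =
     {A \<in> carrier_mat (degree c) (degree c).
        char_poly A = c \<and> is_minimal_poly (map_mat rat_of_int A) (map_poly rat_of_int m)}"

text \<open>\<^const>\<open>similar_mat\<close> at type \<^typ>\<open>int mat\<close> asks for a conjugating matrix and an inverse
  of it that are both integral.\<close>

definition int_mat_classes :: "int poly \<Rightarrow> int poly \<Rightarrow> int mat set set" where
  "int_mat_classes m c =
     int_mats m c // {(A, B). A \<in> int_mats m c \<and> B \<in> int_mats m c \<and> similar_mat A B}"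


section \<open>The algebra \<open>K = \<rat>[x]/(f)\<close> and the order \<open>R = \<int>[x]/(f)\<close>\<close>

definition quot_ring :: "'a::comm_ring_1 poly \<Rightarrow> 'a poly set ring" where
  "quot_ring g = ring_of_type_algebra Quot (PIdl\<^bsub>ring_of_type_algebra\<^esub> g)"

definition res_class :: "'a::comm_ring_1 poly \<Rightarrow> 'a poly \<Rightarrow> 'a poly set" where
  "res_class g p = (PIdl\<^bsub>ring_of_type_algebra\<^esub> g) +>\<^bsub>ring_of_type_algebra\<^esub> p"

lemma res_class_eq: "res_class g p = {x * g + p | x. True}"
  by (auto simp: res_class_def a_r_coset_def' cgenideal_def ring_of_type_algebra_def)

lemma res_class_eq_iff: "res_class g p = res_class g q \<longleftrightarrow> g dvd p - q"
proof
  assume *: "res_class g p = res_class g q"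
  have "p \<in> res_class g p"
    by (auto simp: res_class_eq intro: exI[of _ 0])
  then obtain x where "p = x * g + q"
    unfolding * by (auto simp: res_class_eq)
  then show "g dvd p - q" by simp
next
  assume "g dvd p - q"
  then obtain k where k: "p = k * g + q" by (metis diff_eq_eq dvdE mult.commute)
  have "x * g + p = (x + k) * g + q" "x * g + q = (x - k) * g + p" for x
    by (simp_all add: k algebra_simps)
  then show "res_class g p = res_class g q"
    unfolding res_class_eq by blast
qed

lemma ideal_PIdl: "ideal (PIdl\<^bsub>ring_of_type_algebra\<^esub> g) (ring_of_type_algebra :: 'a::comm_ring_1 poly ring)"
  by (rule cring.cgenideal_ideal[OF cring_from_type_algebra]) (simp add: ring_of_type_algebra_def)

lemma quot_ring_cring: "cring (quot_ring (g :: 'a::comm_ring_1 poly))"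
  unfolding quot_ring_def by (rule ideal.quotient_is_cring[OF ideal_PIdl cring_from_type_algebra])

lemma carrier_quot_ring: "carrier (quot_ring g) = range (res_class g)"
  by (auto simp: quot_ring_def res_class_def FactRing_def A_RCOSETS_def' ring_of_type_algebra_def)

lemma res_class_hom: "res_class g \<in> Ring.ring_hom ring_of_type_algebra (quot_ring g)"
  unfolding quot_ring_def res_class_def by (rule ideal.rcos_ring_hom[OF ideal_PIdl])

lemma
  shows mult_res_class: "res_class g p \<otimes>\<^bsub>quot_ring g\<^esub> res_class g q = res_class g (p * q)"
    and add_res_class: "res_class g p \<oplus>\<^bsub>quot_ring g\<^esub> res_class g q = res_class g (p + q)"
    and one_res_class: "\<one>\<^bsub>quot_ring g\<^esub> = res_class g 1"
  using ring_hom_memE(2-4)[OF res_class_hom[of g]] by (simp_all add: ring_of_type_algebra_def)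

lemma zero_res_class: "\<zero>\<^bsub>quot_ring g\<^esub> = res_class g 0"
  by (auto simp: quot_ring_def FactRing_def res_class_eq cgenideal_def ring_of_type_algebra_def)

definition K_alg :: "int poly \<Rightarrow> rat poly set ring" where
  "K_alg f = quot_ring (map_poly rat_of_int f)"

text \<open>\<open>R\<close> is taken inside \<open>K\<close>, as the image of \<open>\<int>[x]\<close>; see \<open>R_ord_iso\<close> below.\<close>

definition R_ord :: "int poly \<Rightarrow> rat poly set set" where
  "R_ord f = range (\<lambda>p. res_class (map_poly rat_of_int f) (map_poly rat_of_int p))"

lemma K_alg_cring: "cring (K_alg f)"
  unfolding K_alg_def by (rule quot_ring_cring)

lemma R_ord_hom:
  "(\<lambda>p. res_class (map_poly rat_of_int f) (map_poly rat_of_int p))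
     \<in> Ring.ring_hom ring_of_type_algebra (K_alg f)"
  by (rule ring_hom_memI)
     (auto simp: K_alg_def carrier_quot_ring mult_res_class add_res_class one_res_class
        ring_of_type_algebra_def of_int_poly_hom.hom_mult of_int_poly_hom.hom_add)

lemma R_ord_subring: "subring (R_ord f) (K_alg f)"
proof -
  interpret ring_hom_ring ring_of_type_algebra "K_alg f"
    "\<lambda>p. res_class (map_poly rat_of_int f) (map_poly rat_of_int p)"
    by (rule ring_hom_ringI2[OF ring_from_type_algebra cring.axioms(1)[OF K_alg_cring] R_ord_hom])
  show ?thesis
    using img_is_subring[OF R.carrier_is_subring]
    by (simp add: R_ord_def ring_of_type_algebra_def)
qed

lemma R_ord_iso:
  assumes "lead_coeff f = 1"
  shows "quot_ring f \<simeq> (K_alg f)\<lparr>carrier := R_ord f\<rparr>"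
proof -
  let ?h = "\<lambda>p. res_class (map_poly rat_of_int f) (map_poly rat_of_int p)"
  let ?P = "ring_of_type_algebra :: int poly ring"
  let ?R = "(K_alg f)\<lparr>carrier := R_ord f\<rparr>"
  have carP: "carrier ?P = UNIV" and zeroR: "\<zero>\<^bsub>?R\<^esub> = \<zero>\<^bsub>K_alg f\<^esub>"
    by (simp_all add: ring_of_type_algebra_def)
  have "ring ?R"
    using ring.subring_is_ring[OF cring.axioms(1)[OF K_alg_cring] R_ord_subring] .
  moreover have "?h \<in> Ring.ring_hom ?P ?R"
    using R_ord_hom[of f] by (auto simp: Ring.ring_hom_def R_ord_def)
  ultimately interpret ring_hom_ring ?P ?R ?h
    by (intro ring_hom_ringI2 ring_from_type_algebra)
  have "a_kernel ?P ?R ?h = {p. ?h p = \<zero>\<^bsub>K_alg f\<^esub>}"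
    by (simp only: a_kernel_def' carP zeroR UNIV_I simp_thms)
  also have "\<dots> = {p. map_poly rat_of_int f dvd map_poly rat_of_int p}"
    by (simp add: K_alg_def zero_res_class res_class_eq_iff)
  finally have ker: "a_kernel ?P ?R ?h = {p. map_poly rat_of_int f dvd map_poly rat_of_int p}" .
  have dvd_iff: "map_poly rat_of_int f dvd map_poly rat_of_int p \<longleftrightarrow> f dvd p" for p
  proof
    assume dvd: "map_poly rat_of_int f dvd map_poly rat_of_int p"
    obtain q r where qr: "pseudo_divmod p f = (q, r)" by force
    have "f \<noteq> 0" using assms by auto
    from pseudo_divmod[OF this qr] assms
    have p: "p = f * q + r" and r: "r = 0 \<or> degree r < degree f" by auto
    have "map_poly rat_of_int f dvd map_poly rat_of_int r"
      using dvd unfolding p of_int_poly_hom.hom_add of_int_poly_hom.hom_mult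
      using dvd_add_right_iff[OF dvd_triv_left] by blast
    then have "r = 0 \<or> degree f \<le> degree r"
      using dvd_imp_degree_le[of "map_poly rat_of_int f" "map_poly rat_of_int r"] by auto
    with r have "r = 0" by auto
    with p show "f dvd p" by simp
  qed (rule of_int_poly_hom.hom_dvd)
  have "a_kernel ?P ?R ?h = {p. f dvd p}"
    unfolding ker dvd_iff ..
  also have "\<dots> = PIdl\<^bsub>?P\<^esub> f"
    by (auto simp: cgenideal_def ring_of_type_algebra_def elim: dvdE)
  finally have "a_kernel ?P ?R ?h = PIdl\<^bsub>?P\<^esub> f" .
  moreover have "?h ` carrier ?P = carrier ?R"
    by (auto simp: R_ord_def ring_of_type_algebra_def)
  ultimately show ?thesis
    using FactRing_iso by (simp add: quot_ring_def)
qed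

definition Q_const :: "int poly \<Rightarrow> rat poly set set" where
  "Q_const f = range (\<lambda>c. res_class (map_poly rat_of_int f) [:c:])"

text \<open>The trace of multiplication by \<open>a\<close> on the \<open>\<rat>\<close>-basis \<open>1, x, \<dots>, x\<^sup>n\<^sup>-\<^sup>1\<close> of \<open>K\<close>, where
  \<open>n = deg f\<close>: the \<open>j\<close>-th diagonal entry is the \<open>j\<close>-th coefficient of \<open>a x\<^sup>j\<close> reduced
  modulo \<open>f\<close>. The choice of a representative of \<open>a\<close> does not matter.\<close>

definition K_trace :: "int poly \<Rightarrow> rat poly set \<Rightarrow> rat" where
  "K_trace f a =
     (\<Sum>j<degree f. coeff (((SOME p. p \<in> a) * monom 1 j) mod map_poly rat_of_int f) j)"

lemma K_trace_res_class:
  "K_trace f (res_class (map_poly rat_of_int f) p) =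
     (\<Sum>j<degree f. coeff ((p * monom 1 j) mod map_poly rat_of_int f) j)"
proof -
  let ?F = "map_poly rat_of_int f"
  have "p \<in> res_class ?F p"
    by (auto simp: res_class_eq intro: exI[of _ 0])
  then have "(SOME q. q \<in> res_class ?F p) \<in> res_class ?F p"
    by (rule someI)
  then obtain x where "(SOME q. q \<in> res_class ?F p) = x * ?F + p"
    by (auto simp: res_class_eq)
  moreover have "((x * ?F + p) * r) mod ?F = (p * r) mod ?F" for r
  proof -
    have "(x * ?F + p) * r = p * r + (x * r) * ?F" by (simp add: algebra_simps)
    then show ?thesis by (metis mod_mult_self1)
  qed
  ultimately show ?thesis
    by (simp add: K_trace_def)
qed


section \<open>Modules\<close>

definition modules_iso ::
    "('a, 'r) ring_scheme \<Rightarrow> ('a, 'b, 'm) module_scheme \<Rightarrow> ('a, 'c, 'n) module_scheme \<Rightarrow> bool" where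
  "modules_iso R M N \<longleftrightarrow>
     (\<exists>h \<in> iso (add_monoid M) (add_monoid N).
        \<forall>r\<in>carrier R. \<forall>x\<in>carrier M. h (r \<odot>\<^bsub>M\<^esub> x) = r \<odot>\<^bsub>N\<^esub> h x)"

definition module_span :: "('a, 'r) ring_scheme \<Rightarrow> ('a, 'b, 'm) module_scheme \<Rightarrow> 'b set \<Rightarrow> 'b set" where
  "module_span R M A = (\<lambda>H. submodule H R M) hull A"

definition subring_of :: "int poly \<Rightarrow> rat poly set set \<Rightarrow> rat poly set ring" where
  "subring_of f S = (K_alg f)\<lparr>carrier := S\<rparr>"

text \<open>An additive subgroup of \<open>K\<close>, acted on by (subrings of) \<open>K\<close> through multiplication.\<close>

definition sub_module :: "int poly \<Rightarrow> rat poly set set \<Rightarrow> (rat poly set, rat poly set) module" where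
  "sub_module f I =
     \<lparr>carrier = I, monoid.mult = monoid.mult (K_alg f), one = \<one>\<^bsub>K_alg f\<^esub>,
      zero = \<zero>\<^bsub>K_alg f\<^esub>, add = add (K_alg f), module.smult = monoid.mult (K_alg f)\<rparr>"

abbreviation K_module :: "int poly \<Rightarrow> (rat poly set, rat poly set) module" where
  "K_module f \<equiv> sub_module f (carrier (K_alg f))"

text \<open>\<open>I 0 \<oplus> \<dots> \<oplus> I (N - 1)\<close> inside \<open>K\<^sup>N\<close>. The fields \<open>mult\<close> and \<open>one\<close> of the record play no role
  in a module.\<close>

definition dsum :: "int poly \<Rightarrow> nat \<Rightarrow> (nat \<Rightarrow> rat poly set set) \<Rightarrow>
    (rat poly set, nat \<Rightarrow> rat poly set) module" where
  "dsum f N I =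
     \<lparr>carrier = (\<Pi>\<^sub>E i\<in>{..<N}. I i),
      monoid.mult = (\<lambda>x y. \<lambda>i\<in>{..<N}. x i \<otimes>\<^bsub>K_alg f\<^esub> y i),
      one = (\<lambda>i\<in>{..<N}. \<one>\<^bsub>K_alg f\<^esub>),
      zero = (\<lambda>i\<in>{..<N}. \<zero>\<^bsub>K_alg f\<^esub>),
      add = (\<lambda>x y. \<lambda>i\<in>{..<N}. x i \<oplus>\<^bsub>K_alg f\<^esub> y i),
      module.smult = (\<lambda>r x. \<lambda>i\<in>{..<N}. r \<otimes>\<^bsub>K_alg f\<^esub> x i)\<rparr>"


section \<open>Fractional ideals\<close>

text \<open>As \<open>I\<close> is torsion-free, \<open>I \<otimes> \<rat>\<close> is its \<open>\<rat>\<close>-span in \<open>K\<close>.\<close>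

definition frac_ideal :: "int poly \<Rightarrow> rat poly set set \<Rightarrow> rat poly set set \<Rightarrow> bool" where
  "frac_ideal f S I \<longleftrightarrow>
     submodule I (subring_of f S) (K_module f) \<and>
     (\<exists>A. finite A \<and> A \<subseteq> carrier (K_alg f) \<and> I = module_span (subring_of f S) (K_module f) A) \<and>
     module_span (subring_of f (Q_const f)) (K_module f) I = carrier (K_alg f)"

definition colon :: "int poly \<Rightarrow> rat poly set set \<Rightarrow> rat poly set set \<Rightarrow> rat poly set set" where
  "colon f I J = {x \<in> carrier (K_alg f). \<forall>y\<in>J. x \<otimes>\<^bsub>K_alg f\<^esub> y \<in> I}"

definition ideals_iso :: "int poly \<Rightarrow> (rat poly set set \<times> rat poly set set) set" where
  "ideals_iso f =
     {(I, J). frac_ideal f (R_ord f) I \<and> frac_ideal f (R_ord f) J \<and>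
        modules_iso (subring_of f (R_ord f)) (sub_module f I) (sub_module f J)}"

definition ideal_class :: "int poly \<Rightarrow> rat poly set set \<Rightarrow> rat poly set set set" where
  "ideal_class f I = ideals_iso f `` {I}"

definition ICM :: "int poly \<Rightarrow> rat poly set set set monoid" where
  "ICM f =
     \<lparr>carrier = {I. frac_ideal f (R_ord f) I} // ideals_iso f,
      monoid.mult = (\<lambda>A B. \<Union>I\<in>A. \<Union>J\<in>B. ideal_class f (ideal_prod (K_alg f) I J)),
      one = ideal_class f (R_ord f)\<rparr>"

primrec ideals_prod :: "int poly \<Rightarrow> (nat \<Rightarrow> rat poly set set) \<Rightarrow> nat \<Rightarrow> rat poly set set" where
  "ideals_prod f I 0 = R_ord f"
| "ideals_prod f I (Suc n) = ideal_prod (K_alg f) (ideals_prod f I n) (I n)"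


section \<open>Bass orders\<close>

definition over_order :: "int poly \<Rightarrow> rat poly set set \<Rightarrow> bool" where
  "over_order f S \<longleftrightarrow> frac_ideal f (R_ord f) S \<and> subring S (K_alg f)"

definition trace_dual :: "int poly \<Rightarrow> rat poly set set \<Rightarrow> rat poly set set" where
  "trace_dual f S = {x \<in> carrier (K_alg f). \<forall>s\<in>S. K_trace f (x \<otimes>\<^bsub>K_alg f\<^esub> s) \<in> \<int>}"

definition invertible_ideal :: "int poly \<Rightarrow> rat poly set set \<Rightarrow> rat poly set set \<Rightarrow> bool" where
  "invertible_ideal f S I \<longleftrightarrow>
     frac_ideal f S I \<and> (\<exists>J. frac_ideal f S J \<and> ideal_prod (K_alg f) I J = S)"

definition gorenstein :: "int poly \<Rightarrow> rat poly set set \<Rightarrow> bool" where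
  "gorenstein f S \<longleftrightarrow> invertible_ideal f S (trace_dual f S)"

text \<open>Over-orders are taken of \<open>R\<close> only, so this says that \<open>R\<close> is Bass.\<close>

definition R_bass :: "int poly \<Rightarrow> bool" where
  "R_bass f \<longleftrightarrow> (\<forall>S. over_order f S \<longrightarrow> gorenstein f S)"


section \<open>The modules of the second bijection\<close>

definition ideal_chain :: "int poly \<Rightarrow> nat \<Rightarrow> (nat \<Rightarrow> rat poly set set) \<Rightarrow> bool" where
  "ideal_chain f N I \<longleftrightarrow>
     (\<forall>i<N. frac_ideal f (R_ord f) (I i)) \<and>
     (\<forall>i. Suc i < N \<longrightarrow> colon f (I i) (I i) \<subseteq> colon f (I (Suc i)) (I (Suc i)))"

definition chain_modules :: "int poly \<Rightarrow> nat \<Rightarrow> (rat poly set, nat \<Rightarrow> rat poly set) module set" where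
  "chain_modules f N = {dsum f N I | I. ideal_chain f N I}"

definition chain_module_classes ::
    "int poly \<Rightarrow> nat \<Rightarrow> (rat poly set, nat \<Rightarrow> rat poly set) module set set" where
  "chain_module_classes f N =
     chain_modules f N // {(M, M'). M \<in> chain_modules f N \<and> M' \<in> chain_modules f N \<and>
        modules_iso (subring_of f (R_ord f)) M M'}"

end

theory Submission
  imports Defs "Berlekamp_Zassenhaus.Square_Free_Int_To_Square_Free_GFp"
    "HOL-Library.Function_Algebras" "HOL-Computational_Algebra.Fundamental_Theorem_Algebra"
begin

text \<open>An integer matrix with characteristic polynomial \<open>f\<^sup>N\<close> that is annihilated by \<open>f\<close> is the matrix of
  multiplication by \<open>x\<close> on an \<open>R\<close>-lattice \<open>L\<close> of rank \<open>N\<close>, and integral conjugacy is isomorphism of lattices;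
  for \<open>N = 1\<close> a \<open>K\<close>-linear form with value \<open>1\<close> embeds \<open>L\<close> into \<open>K\<close> as a fractional ideal, which gives (a).

  For Bass \<open>R\<close>, let \<open>S\<close> be the multiplicator ring of \<open>L\<close>. The ideal of \<open>R\<close> generated by the values of the forms
  \<open>L \<rightarrow> R\<close> is dual to \<open>S\<close>, and duality shows that every ideal is invertible over its own multiplicator ring.
  Since \<open>S\<close> modulo an integer is semilocal, idempotents can be lifted and a single form maps \<open>L\<close> onto an invertible
  \<open>S\<close>-ideal. It splits, its kernel is stable under \<open>S\<close>, and induction on \<open>N\<close> produces the chain of ideals. Steinitz'
  \<open>2 \<times> 2\<close> unimodular matrices bring a chain into a normal form in which all but one ideal are rings, so the
  multiplicator rings and the product of the ideals determine the module. Conversely an isomorphism between two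
  sums of ideals is a matrix over \<open>K\<close>; its determinant maps the one product onto the other, and the
  multiplicator rings are recovered by expanding minors.\<close>

section \<open>Bases and matrices of endomorphisms\<close>

text \<open>The pairing used throughout is \<open>lam\<close>, the coefficient of x^(n-1), rather
  than the trace. For \<open>lam\<close> the order \<open>R\<close> is its own dual, and by Euler's
  formula the trace dual is the \<open>lam\<close>-dual divided by the unit \<open>del\<close> of
  \<open>K\<close>; so Gorenstein rings are those whose \<open>lam\<close>-dual is invertible. The
  obstacle is that \<open>K\<close> is only a product of fields. A form on \<open>L\<close> may
  vanish on some factors, so 1 appears at first as a sum of values of several forms, while values of
  one form at one vector are not closed under addition. They can be merged along orthogonal
  idempotents, which an order offers only modulo an integer \<open>d\<close>, so the merged form
  takes a value that is merely 1 modulo \<open>d\<close>. With \<open>d = 2 * e\<close>, where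
  \<open>e\<close> clears the denominators of every over-order of \<open>R\<close> at once, the
  congruence becomes exact information: the value is a unit of \<open>K\<close>, and the image of
  \<open>L\<close> has the same multiplicator ring as \<open>L\<close>. Recovering the rings from an
  isomorphism is harder than recovering the product: for the k-th ring, 1 is compared with a
  determinant of size k + 1 that vanishes because it factors through k columns.\<close>

text \<open>Modules over \<open>\<int>\<close> and \<open>\<rat>\<close> are subsets of a commutative ring, on which scalars act through a ring
  homomorphism \<open>\<rho>\<close>; this covers ideals in \<open>K\<close> as well as functions \<open>nat \<Rightarrow> K\<close> with pointwise operations.\<close>

definition comb :: "('d \<Rightarrow> 'v::comm_ring_1) \<Rightarrow> nat \<Rightarrow> (nat \<Rightarrow> 'v) \<Rightarrow> (nat \<Rightarrow> 'd) \<Rightarrow> 'v" where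
  "comb \<rho> m w c = (\<Sum>i<m. \<rho> (c i) * w i)"

definition basis :: "('d::comm_ring_1 \<Rightarrow> 'v::comm_ring_1) \<Rightarrow> nat \<Rightarrow> (nat \<Rightarrow> 'v) \<Rightarrow> 'v set \<Rightarrow> bool" where
  "basis \<rho> m w L \<longleftrightarrow> L = range (comb \<rho> m w) \<and> (\<forall>c. comb \<rho> m w c = 0 \<longrightarrow> (\<forall>i<m. c i = 0))"

definition rep :: "('d::comm_ring_1 \<Rightarrow> 'v::comm_ring_1) \<Rightarrow> ('v \<Rightarrow> 'v) \<Rightarrow> 'v set \<Rightarrow> nat \<Rightarrow> (nat \<Rightarrow> 'v) \<Rightarrow> 'd mat \<Rightarrow> bool" where
  "rep \<rho> T L m w A \<longleftrightarrow> basis \<rho> m w L \<and> A \<in> carrier_mat m m \<and>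
     (\<forall>j<m. T (w j) = comb \<rho> m w (\<lambda>i. A $$ (i,j)))"

definition linmap :: "('d \<Rightarrow> 'v::comm_ring_1) \<Rightarrow> ('v \<Rightarrow> 'v) \<Rightarrow> bool" where
  "linmap \<rho> T \<longleftrightarrow> (\<forall>u v. T (u + v) = T u + T v) \<and> (\<forall>c v. T (\<rho> c * v) = \<rho> c * T v)"

definition asub :: "'v::ab_group_add set \<Rightarrow> bool" where
  "asub L \<longleftrightarrow> 0 \<in> L \<and> (\<forall>x\<in>L. \<forall>y\<in>L. x - y \<in> L)"

lemma asub_0: "asub L \<Longrightarrow> 0 \<in> L"
  and asub_diff: "asub L \<Longrightarrow> x \<in> L \<Longrightarrow> y \<in> L \<Longrightarrow> x - y \<in> L"
  by (auto simp: asub_def)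

lemma asub_neg: "asub L \<Longrightarrow> x \<in> L \<Longrightarrow> - x \<in> L"
  using asub_diff[of L 0 x] asub_0 by fastforce

lemma asub_add: "asub L \<Longrightarrow> x \<in> L \<Longrightarrow> y \<in> L \<Longrightarrow> x + y \<in> L"
  using asub_diff[of L x "- y"] asub_neg by fastforce

lemma asub_sum: "asub L \<Longrightarrow> (\<And>i. i \<in> I \<Longrightarrow> g i \<in> L) \<Longrightarrow> sum g I \<in> L"
  by (induction I rule: infinite_finite_induct) (auto intro: asub_0 asub_add)

lemma asub_of_nat: "asub L \<Longrightarrow> (x::'v::comm_ring_1) \<in> L \<Longrightarrow> of_nat k * x \<in> L"
  by (induction k) (auto intro: asub_0 asub_add simp: algebra_simps)

lemma asub_of_int: "asub L \<Longrightarrow> (x::'v::comm_ring_1) \<in> L \<Longrightarrow> of_int k * x \<in> L"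
  using asub_of_nat[of L x "nat k"] asub_of_nat[of L x "nat (- k)"] asub_neg[of L]
  by (cases "k \<ge> 0") fastforce+

lemma asub_comb: "asub L \<Longrightarrow> (\<And>i. i < m \<Longrightarrow> w i \<in> L) \<Longrightarrow> comb of_int m w c \<in> L"
  unfolding comb_def by (intro asub_sum asub_of_int) auto

text \<open>Division with remainder by the least positive element; the zero subgroup has the
  generator 0.\<close>

lemma asub_int:
  assumes "asub (Z :: int set)"
  obtains g where "g \<in> Z" "\<And>z. z \<in> Z \<Longrightarrow> g dvd z"
proof (cases "\<exists>z\<in>Z. z \<noteq> 0")
  case False
  with that[of 0] assms show ?thesis by (auto simp: asub_def)
next
  case True
  then obtain z where "z \<in> Z" "z \<noteq> 0" by blast
  then have "\<exists>k::nat. k > 0 \<and> int k \<in> Z"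
    using asub_neg[OF assms, of z] by (intro exI[of _ "nat \<bar>z\<bar>"]) (auto simp: abs_if split: if_splits)
  then have ex: "\<exists>k. k > 0 \<and> int k \<in> Z" .
  define g where "g = (LEAST k. k > 0 \<and> int k \<in> Z)"
  have g: "g > 0" "int g \<in> Z" using LeastI_ex[OF ex] by (auto simp: g_def)
  have "int g dvd z" if "z \<in> Z" for z
  proof -
    have "z - (z div int g) * int g \<in> Z"
      using asub_diff[OF assms that] asub_of_int[OF assms g(2), of "z div int g"] by simp
    then have "z mod int g \<in> Z" by (simp add: minus_div_mult_eq_mod)
    moreover have "0 \<le> z mod int g" "z mod int g < int g" using g by auto
    ultimately have "\<not> nat (z mod int g) > 0"
      using not_less_Least[of "nat (z mod int g)" "\<lambda>k. k > 0 \<and> int k \<in> Z"] g_def by fastforce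
    then show ?thesis using \<open>0 \<le> z mod int g\<close> by auto
  qed
  then show ?thesis using that g by blast
qed

lemma index_mult_sum:
  assumes "P \<in> carrier_mat l m" "Q \<in> carrier_mat m n" "i < l" "j < n"
  shows "(P * Q) $$ (i,j) = (\<Sum>k<m. P $$ (i,k) * Q $$ (k,j))"
  using assms by (auto simp: scalar_prod_def atLeast0LessThan)

section \<open>Coordinates and transition matrices\<close>

context comm_ring_hom
begin

lemma comb_add: "comb hom m w c + comb hom m w d = comb hom m w (\<lambda>i. c i + d i)"
  by (simp add: comb_def hom_distribs sum.distrib algebra_simps)

lemma comb_diff: "comb hom m w c - comb hom m w d = comb hom m w (\<lambda>i. c i - d i)"
  by (simp add: comb_def hom_distribs sum_subtractf algebra_simps)

lemma comb_scale: "hom a * comb hom m w c = comb hom m w (\<lambda>i. a * c i)"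
  by (simp add: comb_def hom_distribs sum_distrib_left algebra_simps)

lemma comb_zero: "comb hom m w (\<lambda>_. 0) = 0"
  by (simp add: comb_def)

lemma comb_cong: "(\<And>i. i < m \<Longrightarrow> c i = d i) \<Longrightarrow> (\<And>i. i < m \<Longrightarrow> w i = v i) \<Longrightarrow> comb hom m w c = comb hom m v d"
  by (simp add: comb_def)

lemma comb_unit: "j < m \<Longrightarrow> comb hom m w (\<lambda>i. if i = j then 1 else 0) = w j"
  by (simp add: comb_def if_distrib[of hom] if_distrib[of "\<lambda>x. x * _"] sum.delta cong: if_cong)

lemma comb_comb:
  "comb hom m' (\<lambda>j. comb hom m w (\<lambda>i. P i j)) c = comb hom m w (\<lambda>i. \<Sum>j<m'. P i j * c j)"
proof -
  have "comb hom m' (\<lambda>j. comb hom m w (\<lambda>i. P i j)) c = (\<Sum>j<m'. \<Sum>i<m. hom (P i j * c j) * w i)"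
    by (simp add: comb_def sum_distrib_left hom_distribs algebra_simps)
  also have "\<dots> = (\<Sum>i<m. \<Sum>j<m'. hom (P i j * c j) * w i)" by (rule sum.swap)
  also have "\<dots> = comb hom m w (\<lambda>i. \<Sum>j<m'. P i j * c j)"
    by (simp add: comb_def sum_distrib_right hom_distribs)
  finally show ?thesis .
qed

lemma basis_mem: "basis hom m w L \<Longrightarrow> comb hom m w c \<in> L"
  by (auto simp: basis_def)

lemma basis_vec: "basis hom m w L \<Longrightarrow> j < m \<Longrightarrow> w j \<in> L"
  using basis_mem[of m w L] comb_unit by metis

lemma basis_obtain: "basis hom m w L \<Longrightarrow> v \<in> L \<Longrightarrow> \<exists>c. v = comb hom m w c"
  by (auto simp: basis_def)

lemma basis_inj: "basis hom m w L \<Longrightarrow> comb hom m w c = comb hom m w d \<Longrightarrow> i < m \<Longrightarrow> c i = d i"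
  using comb_diff[of m w c d] unfolding basis_def by fastforce

lemma basis_asub: "basis hom m w L \<Longrightarrow> asub L"
  unfolding basis_def asub_def using rangeI[of "comb hom m w" "\<lambda>_. 0"] by (auto simp: comb_zero comb_diff)

lemma linmap_comb:
  assumes "linmap hom T" shows "T (comb hom m w c) = comb hom m (\<lambda>i. T (w i)) c"
proof -
  have "T 0 = 0" using assms unfolding linmap_def by (metis add_cancel_right_right)
  then show ?thesis
    unfolding comb_def
    by (induction m) (use assms in \<open>auto simp: linmap_def\<close>)
qed

lemma basis_transition:
  assumes "basis hom m w L" "\<And>j. j < m' \<Longrightarrow> w' j \<in> L"
  shows "\<exists>P\<in>carrier_mat m m'. \<forall>j<m'. w' j = comb hom m w (\<lambda>i. P $$ (i,j))"
proof -
  have "\<forall>j. \<exists>c. j < m' \<longrightarrow> w' j = comb hom m w c"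
    using basis_obtain[OF assms(1)] assms(2) by blast
  then obtain c where c: "\<And>j. j < m' \<Longrightarrow> w' j = comb hom m w (c j)" by metis
  show ?thesis
    by (intro bexI[of _ "mat m m' (\<lambda>(i,j). c j i)"]) (auto simp: c intro!: comb_cong)
qed

lemma basis_transition_inverse:
  assumes b: "basis hom m w L" and P: "P \<in> carrier_mat m m'" "Q \<in> carrier_mat m' m"
    and w': "\<And>j. j < m' \<Longrightarrow> w' j = comb hom m w (\<lambda>i. P $$ (i,j))"
    and w: "\<And>j. j < m \<Longrightarrow> w j = comb hom m' w' (\<lambda>i. Q $$ (i,j))"
  shows "P * Q = 1\<^sub>m m"
proof (rule eq_matI)
  fix i j assume ij: "i < dim_row (1\<^sub>m m)" "j < dim_col (1\<^sub>m m)"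
  have "comb hom m w (\<lambda>i. if i = j then 1 else 0) = w j" using ij comb_unit by simp
  also have "\<dots> = comb hom m' w' (\<lambda>i. Q $$ (i,j))" using w ij by simp
  also have "\<dots> = comb hom m' (\<lambda>k. comb hom m w (\<lambda>i. P $$ (i,k))) (\<lambda>i. Q $$ (i,j))"
    by (intro comb_cong) (auto simp: w')
  also have "\<dots> = comb hom m w (\<lambda>i. \<Sum>k<m'. P $$ (i,k) * Q $$ (k,j))" by (rule comb_comb)
  finally have "(if i = j then 1 else 0) = (\<Sum>k<m'. P $$ (i,k) * Q $$ (k,j))"
    using basis_inj[OF b] ij by fastforce
  then show "(P * Q) $$ (i,j) = 1\<^sub>m m $$ (i,j)"
    using ij P by (auto simp: scalar_prod_def atLeast0LessThan)
qed (use P in auto)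

end

text \<open>The traces of \<open>P * Q\<close> and \<open>Q * P\<close> agree, so \<open>m\<close>
  and \<open>m'\<close> have the same image in a ring of characteristic 0. This gives invariance of
  rank over the integers and over the rationals at the same time.\<close>

lemma inverse_mats_square:
  fixes P :: "'d::{comm_ring_1,ring_char_0} mat"
  assumes P: "P \<in> carrier_mat m m'" "Q \<in> carrier_mat m' m" and "P * Q = 1\<^sub>m m" "Q * P = 1\<^sub>m m'"
  shows "m = m'"
proof -
  have 1: "(\<Sum>i<m. \<Sum>k<m'. P $$ (i,k) * Q $$ (k,i)) = of_nat m"
  proof -
    have "(\<Sum>k<m'. P $$ (i,k) * Q $$ (k,i)) = 1" if "i < m" for i
      using arg_cong[OF assms(3), of "\<lambda>M. M $$ (i,i)"] P that
      by (auto simp: scalar_prod_def atLeast0LessThan)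
    then show ?thesis by simp
  qed
  have 2: "(\<Sum>k<m'. \<Sum>i<m. Q $$ (k,i) * P $$ (i,k)) = of_nat m'"
  proof -
    have "(\<Sum>k<m. Q $$ (i,k) * P $$ (k,i)) = 1" if "i < m'" for i
      using arg_cong[OF assms(4), of "\<lambda>M. M $$ (i,i)"] P that
      by (auto simp: scalar_prod_def atLeast0LessThan)
    then show ?thesis by simp
  qed
  have "(of_nat m :: 'd) = of_nat m'"
    unfolding 1[symmetric] 2[symmetric] by (subst sum.swap) (simp add: mult.commute)
  then show ?thesis by simp
qed

lemma basis_size_unique:
  fixes \<rho> :: "'d::{comm_ring_1,ring_char_0} \<Rightarrow> 'v::comm_ring_1"
  assumes "comm_ring_hom \<rho>" "basis \<rho> m w L" "basis \<rho> m' w' L"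
  shows "\<exists>P Q. P \<in> carrier_mat m m' \<and> Q \<in> carrier_mat m' m \<and> P * Q = 1\<^sub>m m \<and> Q * P = 1\<^sub>m m' \<and> m = m'
    \<and> (\<forall>j<m'. w' j = comb \<rho> m w (\<lambda>i. P $$ (i,j)))"
proof -
  interpret comm_ring_hom \<rho> by fact
  obtain P where P: "P \<in> carrier_mat m m'" "\<forall>j<m'. w' j = comb \<rho> m w (\<lambda>i. P $$ (i,j))"
    using basis_transition[OF assms(2)] basis_vec[OF assms(3)] by metis
  obtain Q where Q: "Q \<in> carrier_mat m' m" "\<forall>j<m. w j = comb \<rho> m' w' (\<lambda>i. Q $$ (i,j))"
    using basis_transition[OF assms(3)] basis_vec[OF assms(2)] by metis
  have "P * Q = 1\<^sub>m m" "Q * P = 1\<^sub>m m'"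
    using basis_transition_inverse[OF assms(2) P(1) Q(1)] basis_transition_inverse[OF assms(3) Q(1) P(1)] P Q by auto
  moreover from this have "m = m'" using inverse_mats_square P Q by blast
  ultimately show ?thesis using P Q by blast
qed

lemma rep_unique:
  fixes \<rho> :: "'d::{comm_ring_1,ring_char_0} \<Rightarrow> 'v::comm_ring_1"
  assumes h: "comm_ring_hom \<rho>" and T: "linmap \<rho> T" and r: "rep \<rho> T L m w A" "rep \<rho> T L m' w' A'"
  shows "m = m' \<and> similar_mat A A'"
proof -
  interpret comm_ring_hom \<rho> by fact
  from r have b: "basis \<rho> m w L" "basis \<rho> m' w' L" and A: "A \<in> carrier_mat m m" "A' \<in> carrier_mat m' m'"
    and Aw: "\<And>j. j < m \<Longrightarrow> T (w j) = comb \<rho> m w (\<lambda>i. A $$ (i,j))"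
    and Aw': "\<And>j. j < m' \<Longrightarrow> T (w' j) = comb \<rho> m' w' (\<lambda>i. A' $$ (i,j))"
    by (auto simp: rep_def)
  obtain P Q where PQ: "P \<in> carrier_mat m m'" "Q \<in> carrier_mat m' m" "P * Q = 1\<^sub>m m" "Q * P = 1\<^sub>m m'"
    and m: "m = m'" and w': "\<And>j. j < m' \<Longrightarrow> w' j = comb \<rho> m w (\<lambda>i. P $$ (i,j))"
    using basis_size_unique[OF h b] by blast
  have AP: "A * P = P * A'"
  proof (rule eq_matI)
    fix i j assume "i < dim_row (P * A')" "j < dim_col (P * A')"
    then have ij: "i < m" "j < m'" using PQ A by auto
    have "comb \<rho> m w (\<lambda>i. \<Sum>k<m. A $$ (i,k) * P $$ (k,j)) = comb \<rho> m (\<lambda>k. comb \<rho> m w (\<lambda>i. A $$ (i,k))) (\<lambda>k. P $$ (k,j))"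
      by (simp add: comb_comb)
    also have "\<dots> = comb \<rho> m (\<lambda>k. T (w k)) (\<lambda>k. P $$ (k,j))"
      by (intro comb_cong) (auto simp: Aw)
    also have "\<dots> = T (w' j)" using ij by (simp add: w' linmap_comb[OF T])
    also have "\<dots> = comb \<rho> m' (\<lambda>k. comb \<rho> m w (\<lambda>i. P $$ (i,k))) (\<lambda>i. A' $$ (i,j))"
      unfolding Aw'[OF ij(2)] by (intro comb_cong) (auto simp: w')
    also have "\<dots> = comb \<rho> m w (\<lambda>i. \<Sum>k<m'. P $$ (i,k) * A' $$ (k,j))" by (rule comb_comb)
    finally have "(\<Sum>k<m. A $$ (i,k) * P $$ (k,j)) = (\<Sum>k<m'. P $$ (i,k) * A' $$ (k,j))"
      using basis_inj[OF b(1)] ij by blast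
    then show "(A * P) $$ (i,j) = (P * A') $$ (i,j)"
      using ij PQ A by (auto simp: scalar_prod_def atLeast0LessThan)
  qed (use PQ A in auto)
  have "A = A * (P * Q)" using PQ A by simp
  also have "\<dots> = A * P * Q" using PQ A by (simp add: assoc_mult_mat)
  finally have "A = P * A' * Q" using AP by simp
  then have "similar_mat A A'" using PQ A m by (intro similar_matI[of _ _ P Q m]) auto
  with m show ?thesis by blast
qed

lemma rep_exists:
  assumes "comm_ring_hom \<rho>" "basis \<rho> m w L" "T ` L \<subseteq> L"
  shows "\<exists>A. rep \<rho> T L m w A"
proof -
  interpret comm_ring_hom \<rho> by fact
  have "\<exists>P\<in>carrier_mat m m. \<forall>j<m. T (w j) = comb \<rho> m w (\<lambda>i. P $$ (i,j))"
    using basis_transition[OF assms(2), of m "\<lambda>j. T (w j)"] basis_vec[OF assms(2)] assms(3) by blast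
  then show ?thesis using assms(2) by (auto simp: rep_def)
qed

lemma basis_direct_sum:
  assumes "comm_ring_hom \<rho>" "basis \<rho> m1 w1 L1" "basis \<rho> m2 w2 L2" "L1 \<inter> L2 \<subseteq> {0}"
    and L: "L = {x + y | x y. x \<in> L1 \<and> y \<in> L2}"
  shows "basis \<rho> (m1 + m2) (\<lambda>i. if i < m1 then w1 i else w2 (i - m1)) L" (is "basis \<rho> _ ?w L")
proof -
  interpret comm_ring_hom \<rho> by fact
  have split: "comb \<rho> (m1 + m2) ?w c = comb \<rho> m1 w1 c + comb \<rho> m2 w2 (\<lambda>i. c (m1 + i))" for c
    unfolding comb_def lessThan_atLeast0 sum.atLeastLessThan_concat[of 0 m1 "m1+m2", simplified, symmetric]
    using sum.shift_bounds_nat_ivl[of "\<lambda>i. \<rho> (c i) * ?w i" 0 m1 m2] by (simp add: add.commute)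
  show ?thesis unfolding basis_def
  proof (intro conjI allI impI)
    show "L = range (comb \<rho> (m1 + m2) ?w)"
    proof (intro equalityI subsetI)
      fix v assume "v \<in> L"
      then obtain c d where v: "v = comb \<rho> m1 w1 c + comb \<rho> m2 w2 d"
        using assms(2,3) L by (auto simp: basis_def)
      have "v = comb \<rho> (m1 + m2) ?w (\<lambda>i. if i < m1 then c i else d (i - m1))"
        unfolding split v by (intro arg_cong2[of _ _ _ _ "(+)"] comb_cong) auto
      then show "v \<in> range (comb \<rho> (m1 + m2) ?w)" by blast
    next
      fix v assume "v \<in> range (comb \<rho> (m1 + m2) ?w)"
      then show "v \<in> L" unfolding L using basis_mem[OF assms(2)] basis_mem[OF assms(3)] split by blast
    qed
  next
    fix c i assume "comb \<rho> (m1 + m2) ?w c = 0" and i: "i < m1 + m2"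
    then have e: "comb \<rho> m1 w1 c = - comb \<rho> m2 w2 (\<lambda>i. c (m1 + i))"
      by (simp add: split eq_neg_iff_add_eq_0)
    then have "comb \<rho> m1 w1 c \<in> L2"
      using basis_mem[OF assms(3)] asub_neg[OF basis_asub[OF assms(3)]] by simp
    then have 0: "comb \<rho> m1 w1 c = 0" using basis_mem[OF assms(2)] assms(4) by blast
    then have "comb \<rho> m2 w2 (\<lambda>i. c (m1 + i)) = 0" using e by simp
    then have *: "\<And>i. i < m2 \<Longrightarrow> c (m1 + i) = 0" using assms(3) by (auto simp: basis_def)
    show "c i = 0"
    proof (cases "i < m1")
      case True then show ?thesis using 0 assms(2) by (auto simp: basis_def)
    next
      case False then show ?thesis using *[of "i - m1"] i by simp
    qed
  qed
qed

lemma char_poly_four_block_diag: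
  fixes A1 :: "'d::idom mat"
  assumes A: "A1 \<in> carrier_mat m1 m1" "A2 \<in> carrier_mat m2 m2"
  shows "char_poly (four_block_mat A1 (0\<^sub>m m1 m2) (0\<^sub>m m2 m1) A2) = char_poly A1 * char_poly A2"
proof -
  have "char_poly_matrix (four_block_mat A1 (0\<^sub>m m1 m2) (0\<^sub>m m2 m1) A2)
      = four_block_mat (char_poly_matrix A1) (0\<^sub>m m1 m2) (0\<^sub>m m2 m1) (char_poly_matrix A2)"
    using A by (intro eq_matI) (auto simp: char_poly_matrix_def)
  then show ?thesis
    unfolding char_poly_def
    using det_four_block_mat_lower_left_zero[of "char_poly_matrix A1" m1 "0\<^sub>m m1 m2" m2 _ "char_poly_matrix A2"] A by simp
qed

lemma rep_direct_sum:
  assumes "comm_ring_hom \<rho>" "rep \<rho> T L1 m1 w1 A1" "rep \<rho> T L2 m2 w2 A2" "L1 \<inter> L2 \<subseteq> {0}"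
    and L: "L = {x + y | x y. x \<in> L1 \<and> y \<in> L2}"
  shows "rep \<rho> T L (m1 + m2) (\<lambda>i. if i < m1 then w1 i else w2 (i - m1)) (four_block_mat A1 (0\<^sub>m m1 m2) (0\<^sub>m m2 m1) A2)"
    (is "rep \<rho> T L _ ?w ?A")
proof -
  interpret comm_ring_hom \<rho> by fact
  have split: "comb \<rho> (m1 + m2) ?w c = comb \<rho> m1 w1 c + comb \<rho> m2 w2 (\<lambda>i. c (m1 + i))" for c
    unfolding comb_def lessThan_atLeast0 sum.atLeastLessThan_concat[of 0 m1 "m1+m2", simplified, symmetric]
    using sum.shift_bounds_nat_ivl[of "\<lambda>i. \<rho> (c i) * ?w i" 0 m1 m2] by (simp add: add.commute)
  have b: "basis \<rho> (m1 + m2) ?w L"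
    using assms by (intro basis_direct_sum[OF assms(1) _ _ assms(4) L]) (auto simp: rep_def)
  have A: "A1 \<in> carrier_mat m1 m1" "A2 \<in> carrier_mat m2 m2" using assms by (auto simp: rep_def)
  have "T (?w j) = comb \<rho> (m1 + m2) ?w (\<lambda>i. ?A $$ (i,j))" if j: "j < m1 + m2" for j
  proof (cases "j < m1")
    case True
    have "comb \<rho> m1 w1 (\<lambda>i. ?A $$ (i,j)) = comb \<rho> m1 w1 (\<lambda>i. A1 $$ (i,j))"
      using A True by (intro comb_cong) auto
    moreover have "comb \<rho> m2 w2 (\<lambda>i. ?A $$ (m1 + i,j)) = comb \<rho> m2 w2 (\<lambda>_. 0)"
      using A True by (intro comb_cong) auto
    ultimately show ?thesis using True assms(2) by (simp add: split comb_zero rep_def)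
  next
    case False
    have "comb \<rho> m1 w1 (\<lambda>i. ?A $$ (i,j)) = comb \<rho> m1 w1 (\<lambda>i. 0)"
      using A False j by (intro comb_cong) auto
    moreover have "comb \<rho> m2 w2 (\<lambda>i. ?A $$ (m1 + i,j)) = comb \<rho> m2 w2 (\<lambda>i. A2 $$ (i,j-m1))"
      using A False j by (intro comb_cong) auto
    ultimately show ?thesis using False assms(3) j by (simp add: split comb_zero rep_def)
  qed
  then show ?thesis using b A by (auto simp: rep_def)
qed

text \<open>Induction on the rank. The last coordinates of elements of \<open>L\<close> form a
  subgroup \<open>Z\<close> of the integers, generated by some \<open>g\<close>; an element
  \<open>u\<close> of \<open>L\<close> with last coordinate \<open>g\<close> splits off, and the
  rest of \<open>L\<close> has last coordinate 0. If \<open>g = 0\<close>, then \<open>L\<close>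
  already lies in the smaller span.\<close>

lemma sub_basis:
  assumes "basis of_int m w M" "asub L" "L \<subseteq> M"
  shows "\<exists>m' w'. basis of_int m' w' (L :: 'v::comm_ring_1 set)"
  using assms
proof (induction m arbitrary: L M)
  case 0
  then have "L = {0}" by (auto simp: basis_def comb_def asub_def)
  then show ?case by (intro exI[of _ 0] exI) (auto simp: basis_def comb_def)
next
  case (Suc m)
  interpret of_int_hom: comm_ring_hom "of_int :: int \<Rightarrow> 'v" by (rule of_int_hom.comm_ring_hom_axioms)
  note Lsub = Suc.prems(2)
  let ?C = "comb (of_int :: int \<Rightarrow> 'v)"
  have Suc_comb: "?C (Suc m) w c = ?C m w c + of_int (c m) * w m" for c
    by (simp add: comb_def)
  have "basis of_int m w (range (?C m w))" unfolding basis_def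
  proof (intro conjI allI impI refl)
    fix c i assume "?C m w c = 0" "i < m"
    then have "?C (Suc m) w (c(m := 0)) = 0"
      unfolding Suc_comb using of_int_hom.comb_cong[of m "c(m:=0)" c w w] by simp
    then have "(c(m := 0)) i = 0" using Suc.prems(1) \<open>i < m\<close> unfolding basis_def
      by (metis less_SucI)
    then show "c i = 0" using \<open>i < m\<close> by simp
  qed
  then have IH: "\<exists>m' w'. basis of_int m' w' (L \<inter> range (?C m w))"
  proof (rule Suc.IH)
    show "asub (L \<inter> range (?C m w))"
      using Lsub of_int_hom.basis_asub[OF \<open>basis of_int m w _\<close>] by (auto simp: asub_def)
  qed auto
  define Z where "Z = {c m | c. ?C (Suc m) w c \<in> L}"
  have "asub Z" unfolding asub_def Z_def
  proof (intro conjI ballI; clarsimp)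
    show "\<exists>c. c m = 0 \<and> ?C (Suc m) w c \<in> L"
      by (rule exI[of _ "\<lambda>_. 0"]) (simp add: of_int_hom.comb_zero asub_0[OF Lsub])
    fix c d assume "?C (Suc m) w c \<in> L" "?C (Suc m) w d \<in> L"
    then have "?C (Suc m) w (\<lambda>i. c i - d i) \<in> L"
      using asub_diff[OF Lsub] by (simp flip: of_int_hom.comb_diff)
    then show "\<exists>e. c m - d m = e m \<and> ?C (Suc m) w e \<in> L" by (intro exI[of _ "\<lambda>i. c i - d i"]) auto
  qed
  then obtain g where g: "g \<in> Z" "\<And>z. z \<in> Z \<Longrightarrow> g dvd z"
    using asub_int[of Z] by metis
  then obtain c where c: "g = c m" "?C (Suc m) w c \<in> L" by (auto simp: Z_def)
  define u where "u = ?C (Suc m) w c"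
  have in_range: "?C (Suc m) w d \<in> range (?C m w)" if "d m = 0" for d
    using that by (simp add: Suc_comb)
  show ?case
  proof (cases "g = 0")
    case True
    have "L \<subseteq> range (?C m w)"
    proof
      fix v assume v: "v \<in> L"
      then obtain d where d: "v = ?C (Suc m) w d" using Suc.prems(1,3) by (auto simp: basis_def)
      then have "d m \<in> Z" using v Z_def by auto
      then have "d m = 0" using g(2) True by auto
      then show "v \<in> range (?C m w)" using in_range d by blast
    qed
    then show ?thesis using IH by (simp add: Int_absorb2)
  next
    case False
    obtain m' w' where b': "basis of_int m' w' (L \<inter> range (?C m w))" using IH by blast
    have bu: "basis of_int 1 (\<lambda>_. u) (range (\<lambda>k::int. of_int k * u))" unfolding basis_def
    proof (intro conjI allI impI)
      show "range (\<lambda>k. of_int k * u) = range (?C 1 (\<lambda>_. u))"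
        unfolding comb_def by (auto intro: image_eqI[of _ _ "\<lambda>_. _"])
      fix k :: "nat \<Rightarrow> int" and i assume "?C 1 (\<lambda>_. u) k = 0" and i: "i < (1::nat)"
      then have "?C (Suc m) w (\<lambda>i. k 0 * c i) = 0"
        by (simp add: comb_def[of _ "Suc 0"] u_def flip: of_int_hom.comb_scale)
      then have "k 0 * c m = 0" using Suc.prems(1) unfolding basis_def by blast
      then show "k i = 0" using i False c by simp
    qed
    have "basis of_int (m' + 1) (\<lambda>i. if i < m' then w' i else u) L"
    proof (rule basis_direct_sum[OF of_int_hom.comm_ring_hom_axioms b' bu])
      show "L \<inter> range (?C m w) \<inter> range (\<lambda>k::int. of_int k * u) \<subseteq> {0}"
      proof clarsimp
        fix d k assume e: "of_int k * u = ?C m w d"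
        have "?C (Suc m) w (\<lambda>i. k * c i) = ?C (Suc m) w (d(m := 0))"
          using e of_int_hom.comb_cong[of m "d(m:=0)" d w w] 
          unfolding u_def of_int_hom.comb_scale by (simp add: Suc_comb[of "d(m:=0)"])
        from of_int_hom.basis_inj[OF Suc.prems(1) this, of m] have "k = 0" using False c by simp
        then show "?C m w d = 0" using e by simp
      qed
      show "L = {x + y |x y. x \<in> L \<inter> range (?C m w) \<and> y \<in> range (\<lambda>k::int. of_int k * u)}"
      proof (intro equalityI subsetI)
        fix v assume v: "v \<in> L"
        then obtain d where d: "v = ?C (Suc m) w d" using Suc.prems(1,3) by (auto simp: basis_def)
        then have "d m \<in> Z" using v Z_def by auto
        then obtain k where k: "d m = g * k" using g(2) by blast
        have "v - of_int k * u = ?C (Suc m) w (\<lambda>i. d i - k * c i)"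
          by (simp add: d u_def of_int_hom.comb_scale of_int_hom.comb_diff)
        then have "v - of_int k * u \<in> range (?C m w)" using in_range[of "\<lambda>i. d i - k * c i"] k c by simp
        moreover have "v - of_int k * u \<in> L"
          using v c(2) by (auto simp: u_def intro!: asub_diff[OF Lsub] asub_of_int[OF Lsub])
        ultimately show "v \<in> {x + y |x y. x \<in> L \<inter> range (?C m w) \<and> y \<in> range (\<lambda>k::int. of_int k * u)}"
          by (intro CollectI exI[of _ "v - of_int k * u"] exI[of _ "of_int k * u"]) auto
      next
        fix v assume "v \<in> {x + y |x y. x \<in> L \<inter> range (?C m w) \<and> y \<in> range (\<lambda>k::int. of_int k * u)}"
        then show "v \<in> L" using c(2) asub_add[OF Lsub] asub_of_int[OF Lsub] by (auto simp: u_def)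
      qed
    qed
    then show ?thesis by blast
  qed
qed

text \<open>Linearity over \<open>R\<close> is encoded as additivity together with compatibility
  with the operator, because \<open>xi\<close> generates \<open>R\<close> as a ring;
  \<open>module_R_linear\<close> recovers the scalars from all of \<open>R\<close>. The two lattices
  may live in different types, as columns of rationals and tuples over \<open>K\<close> do.\<close>

definition op_iso :: "('v::comm_ring_1 \<Rightarrow> 'v) \<Rightarrow> 'v set \<Rightarrow> ('u::comm_ring_1 \<Rightarrow> 'u) \<Rightarrow> 'u set \<Rightarrow> ('v \<Rightarrow> 'u) \<Rightarrow> bool" where
  "op_iso T L T' L' h \<longleftrightarrow> bij_betw h L L' \<and> (\<forall>u\<in>L. \<forall>v\<in>L. h (u + v) = h u + h v) \<and> (\<forall>v\<in>L. h (T v) = T' (h v))"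

lemma additive_comb:
  assumes L: "asub L" and add: "\<And>u v. u \<in> L \<Longrightarrow> v \<in> L \<Longrightarrow> h (u + v) = h u + h v"
    and w: "\<And>i. i < m \<Longrightarrow> w i \<in> L"
  shows "h (comb of_int m w c) = comb of_int m (\<lambda>i. h (w i)) c"
proof -
  have h0: "h 0 = 0" using add[OF asub_0[OF L] asub_0[OF L]] by simp
  have neg: "h (- v) = - h v" if "v \<in> L" for v
    using add[OF that asub_neg[OF L that]] h0 by (simp add: eq_neg_iff_add_eq_0 add.commute)
  have nat: "h (of_nat k * v) = of_nat k * h v" if "v \<in> L" for k v
    using that by (induction k) (auto simp: h0 add asub_of_nat[OF L] distrib_right)
  have int: "h (of_int k * v) = of_int k * h v" if "v \<in> L" for k v
  proof (cases "k \<ge> 0")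
    case True then show ?thesis using nat[OF that, of "nat k"] by simp
  next
    case False
    then have "of_int k * v = - (of_nat (nat (- k)) * v)" "of_int k * h v = - (of_nat (nat (- k)) * h v)" by simp_all
    then show ?thesis using neg[OF asub_of_nat[OF L that]] nat[OF that] by metis
  qed
  show ?thesis using w unfolding comb_def
  proof (induction m)
    case (Suc m)
    have "(\<Sum>i<m. of_int (c i) * w i) \<in> L" using Suc.prems by (intro asub_sum[OF L] asub_of_int[OF L]) auto
    then show ?case using Suc asub_of_int[OF L] by (simp add: add int)
  qed (simp add: h0)
qed

lemma rep_transport:
  assumes "rep of_int T L m w A" "op_iso T L T' L' h"
  shows "rep of_int T' L' m (\<lambda>i. h (w i)) A"
proof -
  have b: "basis of_int m w L" using assms by (simp add: rep_def)
  note L = of_int_hom.basis_asub[OF b]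
  have h: "bij_betw h L L'" "\<And>u v. u \<in> L \<Longrightarrow> v \<in> L \<Longrightarrow> h (u + v) = h u + h v" "\<And>v. v \<in> L \<Longrightarrow> h (T v) = T' (h v)"
    using assms by (auto simp: op_iso_def)
  note w = of_int_hom.basis_vec[OF b]
  have hc: "h (comb of_int m w c) = comb of_int m (\<lambda>i. h (w i)) c" for c
    using additive_comb[OF L h(2) w] .
  have "basis of_int m (\<lambda>i. h (w i)) L'" unfolding basis_def
  proof (intro conjI allI impI)
    show "L' = range (comb of_int m (\<lambda>i. h (w i)))"
    proof -
      have "L' = h ` range (comb of_int m w)" using h(1) b unfolding bij_betw_def basis_def by blast
      also have "\<dots> = range (comb of_int m (\<lambda>i. h (w i)))" unfolding image_image hc ..
      finally show ?thesis .
    qed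
    fix c i assume "comb of_int m (\<lambda>i. h (w i)) c = 0" "i < m"
    then have "h (comb of_int m w c) = h 0"
      using hc[of c] hc[of "\<lambda>_. 0"] by (simp add: of_int_hom.comb_zero)
    then have "comb of_int m w c = 0"
      using h(1) of_int_hom.basis_mem[OF b] asub_0[OF L] by (auto simp: bij_betw_def inj_on_def)
    then show "c i = 0" using b \<open>i < m\<close> by (auto simp: basis_def)
  qed
  moreover have "T' (h (w j)) = comb of_int m (\<lambda>i. h (w i)) (\<lambda>i. A $$ (i,j))" if "j < m" for j
  proof -
    have "T' (h (w j)) = h (T (w j))" using h(3)[OF w[OF that]] by simp
    also have "T (w j) = comb of_int m w (\<lambda>i. A $$ (i,j))" using assms(1) that by (simp add: rep_def)
    finally show ?thesis by (simp only: hc)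
  qed
  ultimately show ?thesis using assms(1) by (simp add: rep_def)
qed

lemma op_iso_sym:
  assumes "op_iso T L T' L' h" "asub L" "T ` L \<subseteq> L" shows "op_iso T' L' T L (inv_into L h)"
proof -
  have h: "bij_betw h L L'" "\<And>u v. u \<in> L \<Longrightarrow> v \<in> L \<Longrightarrow> h (u + v) = h u + h v" "\<And>v. v \<in> L \<Longrightarrow> h (T v) = T' (h v)"
    using assms by (auto simp: op_iso_def)
  have inv: "inv_into L h (h v) = v" if "v \<in> L" for v using h(1) that by (simp add: bij_betw_inv_into_left)
  show ?thesis unfolding op_iso_def
  proof (intro conjI ballI)
    show "bij_betw (inv_into L h) L' L" using bij_betw_inv_into[OF h(1)] .
    fix u v assume "u \<in> L'" "v \<in> L'"
    then obtain a b where ab: "a \<in> L" "b \<in> L" "u = h a" "v = h b" using h(1) by (auto simp: bij_betw_def)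
    then show "inv_into L h (u + v) = inv_into L h u + inv_into L h v"
      using h(2)[of a b] inv asub_add[OF assms(2)] by metis
  next
    fix v assume "v \<in> L'"
    then obtain a where a: "a \<in> L" "v = h a" using h(1) by (auto simp: bij_betw_def)
    then show "inv_into L h (T' v) = T (inv_into L h v)"
      using h(3)[of a] inv assms(3) by (metis image_subset_iff)
  qed
qed

lemma op_iso_trans:
  "op_iso T L T' L' h \<Longrightarrow> op_iso T' L' T'' L'' k \<Longrightarrow> op_iso T L T'' L'' (k \<circ> h)"
  unfolding op_iso_def using bij_betw_trans[of h L L' k L''] bij_betwE[of h L L'] by simp

lemma rep_same_iso:
  assumes r: "rep of_int T L m w A" "rep of_int T' L' m w' A" and T: "linmap of_int T" "linmap of_int T'"
  shows "\<exists>h. op_iso T L T' L' h"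
proof -
  have b: "basis of_int m w L" "basis of_int m w' L'" and A: "A \<in> carrier_mat m m"
    and Aw: "\<And>j. j < m \<Longrightarrow> T (w j) = comb of_int m w (\<lambda>i. A $$ (i,j))"
    and Aw': "\<And>j. j < m \<Longrightarrow> T' (w' j) = comb of_int m w' (\<lambda>i. A $$ (i,j))"
    using r by (auto simp: rep_def)
  define cf where "cf v = (SOME c. v = comb of_int m w c)" for v
  define h where "h v = comb of_int m w' (cf v)" for v
  have hc: "h (comb of_int m w c) = comb of_int m w' c" for c
  proof -
    have "comb of_int m w c = comb of_int m w (cf (comb of_int m w c))"
      unfolding cf_def by (rule someI[of "\<lambda>d. comb of_int m w c = comb of_int m w d" c]) (rule refl)
    from of_int_hom.basis_inj[OF b(1) this] show ?thesis unfolding h_def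
      by (intro of_int_hom.comb_cong) auto
  qed
  have "op_iso T L T' L' h" unfolding op_iso_def
  proof (intro conjI ballI)
    show "bij_betw h L L'" unfolding bij_betw_def inj_on_def
    proof (intro conjI ballI impI)
      fix u v assume "u \<in> L" "v \<in> L" and e: "h u = h v"
      then obtain c d where "u = comb of_int m w c" "v = comb of_int m w d" using b by (auto simp: basis_def)
      with e show "u = v" using of_int_hom.basis_inj[OF b(2)] by (auto simp: hc intro: of_int_hom.comb_cong)
    qed (use b in \<open>simp add: basis_def hc image_image\<close>)
    fix u v assume "u \<in> L" "v \<in> L"
    then show "h (u + v) = h u + h v"
      using b(1) by (auto simp: basis_def hc of_int_hom.comb_add)
  next
    fix v assume "v \<in> L"
    then obtain c where v: "v = comb of_int m w c" using b by (auto simp: basis_def)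
    have "T v = comb of_int m (\<lambda>j. comb of_int m w (\<lambda>i. A $$ (i,j))) c"
      unfolding v of_int_hom.linmap_comb[OF T(1)] by (intro of_int_hom.comb_cong) (auto simp: Aw)
    moreover have "T' (h v) = comb of_int m (\<lambda>j. comb of_int m w' (\<lambda>i. A $$ (i,j))) c"
      unfolding v hc of_int_hom.linmap_comb[OF T(2)] by (intro of_int_hom.comb_cong) (auto simp: Aw')
    ultimately show "h (T v) = T' (h v)" by (simp add: of_int_hom.comb_comb hc)
  qed
  then show ?thesis by blast
qed

lemma rep_change:
  assumes r: "rep of_int T L m w A" and s: "similar_mat A B" and T: "linmap of_int T"
  shows "\<exists>w'. rep of_int T L m w' B"
proof -
  have b: "basis of_int m w L" and A: "A \<in> carrier_mat m m"
    and Aw: "\<And>j. j < m \<Longrightarrow> T (w j) = comb of_int m w (\<lambda>i. A $$ (i,j))"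
    using r by (auto simp: rep_def)
  from s A obtain P Q where PQ: "P \<in> carrier_mat m m" "Q \<in> carrier_mat m m" "B \<in> carrier_mat m m"
    "P * Q = 1\<^sub>m m" "Q * P = 1\<^sub>m m" "A = P * B * Q"
    unfolding similar_mat_def similar_mat_wit_def Let_def by (metis carrier_matD(1) insert_subset)
  define w' where "w' j = comb of_int m w (\<lambda>i. P $$ (i,j))" for j
  have w'c: "comb of_int m w' c = comb of_int m w (\<lambda>i. \<Sum>j<m. P $$ (i,j) * c j)" for c
    unfolding w'_def by (rule of_int_hom.comb_comb)
  have PQe: "(\<Sum>k<m. P $$ (i,k) * Q $$ (k,j)) = (if i = j then 1 else 0)" 
    "(\<Sum>k<m. Q $$ (i,k) * P $$ (k,j)) = (if i = j then 1 else 0)" if "i < m" "j < m" for i j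
    using index_mult_sum[OF PQ(1,2) that] index_mult_sum[OF PQ(2,1) that] PQ(4,5) that by simp_all
  have ww': "w j = comb of_int m w' (\<lambda>i. Q $$ (i,j))" if "j < m" for j
  proof -
    have "w j = comb of_int m w (\<lambda>i. if i = j then 1 else 0)" using that of_int_hom.comb_unit by metis
    also have "\<dots> = comb of_int m w' (\<lambda>i. Q $$ (i,j))"
      unfolding w'c using PQe that by (intro of_int_hom.comb_cong) auto
    finally show ?thesis .
  qed
  have "basis of_int m w' L" unfolding basis_def
  proof (intro conjI allI impI)
    have "comb of_int m w c \<in> range (comb of_int m w')" for c
    proof -
      have "comb of_int m w c = comb of_int m (\<lambda>j. comb of_int m w' (\<lambda>i. Q $$ (i,j))) c"
        using ww' by (intro of_int_hom.comb_cong) auto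
      then show ?thesis by (simp only: of_int_hom.comb_comb rangeI)
    qed
    then show "L = range (comb of_int m w')" using b w'c by (auto simp: basis_def)
    fix c i assume c: "comb of_int m w' c = 0" and i: "i < m"
    then have 0: "(\<Sum>j<m. P $$ (k,j) * c j) = 0" if "k < m" for k
      using b that unfolding w'c basis_def by blast
    have "c i = (\<Sum>j<m. (\<Sum>k<m. Q $$ (i,k) * P $$ (k,j)) * c j)"
      using i by (simp add: PQe if_distrib[of "\<lambda>x. x * _"] cong: if_cong)
    also have "\<dots> = (\<Sum>j<m. \<Sum>k<m. Q $$ (i,k) * (P $$ (k,j) * c j))"
      by (simp add: sum_distrib_right mult.assoc)
    also have "\<dots> = (\<Sum>k<m. Q $$ (i,k) * (\<Sum>j<m. P $$ (k,j) * c j))"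
      by (subst sum.swap) (simp add: sum_distrib_left)
    finally show "c i = 0" using 0 by simp
  qed
  moreover have "T (w' j) = comb of_int m w' (\<lambda>i. B $$ (i,j))" if j: "j < m" for j
  proof -
    have "A * P = P * B"
    proof -
      have "A * P = P * B * (Q * P)" unfolding PQ(6) using PQ(1-3) by (simp add: assoc_mult_mat[of _ m m _ m _ m])
      then show ?thesis using PQ by simp
    qed
    then have e: "(\<Sum>k<m. A $$ (i,k) * P $$ (k,j)) = (\<Sum>k<m. P $$ (i,k) * B $$ (k,j))" if "i < m" for i
      using index_mult_sum[OF A PQ(1) that j] index_mult_sum[OF PQ(1,3) that j] by simp
    have "T (w' j) = comb of_int m (\<lambda>k. comb of_int m w (\<lambda>i. A $$ (i,k))) (\<lambda>k. P $$ (k,j))"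
      unfolding w'_def of_int_hom.linmap_comb[OF T] by (intro of_int_hom.comb_cong) (auto simp: Aw)
    also have "\<dots> = comb of_int m w' (\<lambda>i. B $$ (i,j))"
      unfolding of_int_hom.comb_comb w'c using e by (intro of_int_hom.comb_cong) auto
    finally show ?thesis .
  qed
  ultimately show ?thesis using PQ(3) by (auto simp: rep_def)
qed

text \<open>An isomorphism carries a basis to a basis with the same matrix, so only the choice of a
  basis is left, and changing it is conjugation by a matrix invertible over the integers. Both
  bijections rest on this equivalence.\<close>

lemma rep_iso_iff_similar:
  assumes r: "rep of_int T L m w A" "rep of_int T' L' m' w' A'" and T: "linmap of_int T" "linmap of_int T'"
  shows "(\<exists>h. op_iso T L T' L' h) \<longleftrightarrow> similar_mat A A'"
proof
  assume "\<exists>h. op_iso T L T' L' h"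
  then obtain h where "op_iso T L T' L' h" ..
  from rep_transport[OF r(1) this] show "similar_mat A A'"
    using rep_unique[OF of_int_hom.comm_ring_hom_axioms T(2)] r(2) by blast
next
  assume s: "similar_mat A A'"
  then obtain v where v: "rep of_int T L m v A'" using rep_change[OF r(1) _ T(1)] by blast
  have "m = m'" using r(2) v by (auto simp: rep_def)
  then show "\<exists>h. op_iso T L T' L' h" using rep_same_iso[OF v _ T] r(2) by blast
qed

text \<open>A relation takes the place of a function because a matrix determines its ideal only up
  to isomorphism. Totality on both sides gives a map on classes and its surjectivity;
  \<open>EF\<close> makes the map well defined and injective.\<close>

lemma quotient_bij:
  assumes E: "\<And>x y z. x \<in> U \<Longrightarrow> y \<in> U \<Longrightarrow> E x y \<Longrightarrow> E y x"
    and tr: "\<And>x y z. x \<in> U \<Longrightarrow> y \<in> U \<Longrightarrow> z \<in> U \<Longrightarrow> E x y \<Longrightarrow> E y z \<Longrightarrow> E x z"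
    and refl: "\<And>x. x \<in> U \<Longrightarrow> E x x"
    and l: "\<And>x. x \<in> U \<Longrightarrow> \<exists>y\<in>Y. R x y" and r: "\<And>y. y \<in> Y \<Longrightarrow> \<exists>x\<in>U. R x y"
    and EF: "\<And>x y x' y'. x \<in> U \<Longrightarrow> y \<in> Y \<Longrightarrow> x' \<in> U \<Longrightarrow> y' \<in> Y \<Longrightarrow> R x y \<Longrightarrow> R x' y' \<Longrightarrow> E x x' \<longleftrightarrow> F y y'"
  shows "\<exists>\<phi>. bij_betw \<phi> (U // {(x, x'). x \<in> U \<and> x' \<in> U \<and> E x x'}) (Y // {(y, y'). y \<in> Y \<and> y' \<in> Y \<and> F y y'})"
proof -
  let ?E = "{(x, x'). x \<in> U \<and> x' \<in> U \<and> E x x'}" and ?F = "{(y, y'). y \<in> Y \<and> y' \<in> Y \<and> F y y'}"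
  define \<phi> where "\<phi> C = {y \<in> Y. \<exists>x\<in>C. R x y}" for C
  have cl: "\<phi> (?E `` {x}) = ?F `` {y}" if "x \<in> U" "y \<in> Y" "R x y" for x y
  proof (intro equalityI subsetI)
    fix y' assume "y' \<in> \<phi> (?E `` {x})"
    then obtain x' where "y' \<in> Y" "x' \<in> U" "E x x'" "R x' y'" by (auto simp: \<phi>_def)
    then show "y' \<in> ?F `` {y}" using EF that by auto
  next
    fix y' assume "y' \<in> ?F `` {y}"
    then have y': "y' \<in> Y" "F y y'" by auto
    then obtain x' where "x' \<in> U" "R x' y'" using r by blast
    then show "y' \<in> \<phi> (?E `` {x})" using EF[of x y x' y'] that y' by (auto simp: \<phi>_def)
  qed
  have "inj_on \<phi> (U // ?E)"
  proof (intro inj_onI)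
    fix C D assume "C \<in> U // ?E" "D \<in> U // ?E" and e: "\<phi> C = \<phi> D"
    then obtain x x' where x: "x \<in> U" "x' \<in> U" "C = ?E `` {x}" "D = ?E `` {x'}" by (auto simp: quotient_def)
    obtain y y' where y: "y \<in> Y" "R x y" "y' \<in> Y" "R x' y'" using l x by meson
    have F: "?F `` {y} = ?F `` {y'}"
      using e cl[OF x(1) y(1,2)] cl[OF x(2) y(3,4)] unfolding x(3,4) by (rule_tac box_equals)
    have "F y' y'" using EF[of x' y' x' y'] refl x y by blast
    then have "F y y'" using F y by auto
    then have "E x x'" using EF[OF x(1) y(1) x(2) y(3) y(2,4)] by blast
    have iff: "E x z \<longleftrightarrow> E x' z" if "z \<in> U" for z
      using tr[OF x(1,2) that] tr[OF x(2,1) that] E[OF x(1,2)] \<open>E x x'\<close> by blast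
    show "C = D" unfolding x(3,4) using x(1,2) iff by blast
  qed
  moreover have "\<phi> ` (U // ?E) = Y // ?F"
  proof (intro equalityI subsetI)
    fix D assume "D \<in> \<phi> ` (U // ?E)"
    then obtain x where x: "x \<in> U" "D = \<phi> (?E `` {x})" by (auto simp: quotient_def)
    then obtain y where "y \<in> Y" "R x y" using l by blast
    then show "D \<in> Y // ?F" using cl x by (auto simp: quotient_def)
  next
    fix D assume "D \<in> Y // ?F"
    then obtain y where y: "y \<in> Y" "D = ?F `` {y}" by (auto simp: quotient_def)
    then obtain x where x: "x \<in> U" "R x y" using r by blast
    then have "D = \<phi> (?E `` {x})" using cl y by simp
    then show "D \<in> \<phi> ` (U // ?E)" using x by (auto simp: quotient_def)
  qed
  ultimately show ?thesis unfolding bij_betw_def by blast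
qed

section \<open>Fractional ideals and duality\<close>

lemma common_denominator:
  fixes q :: "nat \<Rightarrow> rat"
  shows "\<exists>N>0::int. \<forall>i<m. of_int N * q i \<in> \<int>"
proof (induction m)
  case 0 show ?case by (intro exI[of _ 1]) auto
next
  case (Suc m)
  then obtain N where N: "N > 0" "\<forall>i<m. of_int N * q i \<in> \<int>" by blast
  obtain a b where ab: "quotient_of (q m) = (a, b)" by force
  have b: "b > 0" "q m = of_int a / of_int b" using quotient_of_denom_pos[OF ab] quotient_of_div[OF ab] by auto
  show ?case
  proof (intro exI[of _ "N * b"] conjI allI impI)
    fix i assume i: "i < Suc m"
    show "of_int (N * b) * q i \<in> \<int>"
    proof (cases "i = m")
      case True
      then have "of_int b * q i = of_int a" using b by simp
      then have "of_int (N * b) * q i = of_int (N * a)" by (simp add: mult.assoc)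
      then show ?thesis by (metis Ints_of_int)
    next
      case False
      then have "of_int N * q i \<in> \<int>" using N i by auto
      then have "of_int b * (of_int N * q i) \<in> \<int>" using Ints_mult[OF Ints_of_int] by blast
      then show ?thesis by (simp add: ac_simps)
    qed
  qed (use N b in auto)
qed

lemma poly_shift_split: "monom 1 k * poly_shift k p + poly_cutoff k p = (p :: 'a::comm_ring_1 poly)"
  by (rule poly_eqI) (auto simp: coeff_monom_mult coeff_poly_shift coeff_poly_cutoff)

lemma comm_ring_hom_ident: "comm_ring_hom (\<lambda>x. x :: 'a::comm_ring_1)"
  by unfold_locales auto

section \<open>Products of additive subgroups\<close>

inductive_set kprod :: "'k::comm_ring_1 set \<Rightarrow> 'k set \<Rightarrow> 'k set" for I J where
  mult: "a \<in> I \<Longrightarrow> b \<in> J \<Longrightarrow> a * b \<in> kprod I J"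
| add: "a \<in> kprod I J \<Longrightarrow> b \<in> kprod I J \<Longrightarrow> a + b \<in> kprod I J"

lemma kprod_subset: "asub L \<Longrightarrow> (\<And>a b. a \<in> I \<Longrightarrow> b \<in> J \<Longrightarrow> a * b \<in> L) \<Longrightarrow> kprod I J \<subseteq> L"
proof
  fix x assume L: "asub L" "\<And>a b. a \<in> I \<Longrightarrow> b \<in> J \<Longrightarrow> a * b \<in> L" and "x \<in> kprod I J"
  from this(3) show "x \<in> L" by induction (auto simp: L asub_add)
qed

lemma kprod_asub: "asub I \<Longrightarrow> b \<in> J \<Longrightarrow> asub (kprod I J)"
proof -
  assume I: "asub I" and b: "b \<in> J"
  have n: "- x \<in> kprod I J" if "x \<in> kprod I J" for x
    using that
  proof induction
    case (mult a b) then show ?case using kprod.mult[of "-a" I b J] asub_neg[OF I] by simp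
  next
    case (add a b) then show ?case using kprod.add[of "-a" I J "-b"] by simp
  qed
  show ?thesis unfolding asub_def
  proof (intro conjI ballI)
    show "0 \<in> kprod I J" using kprod.mult[OF asub_0[OF I] b] by simp
    fix x y assume "x \<in> kprod I J" "y \<in> kprod I J"
    then show "x - y \<in> kprod I J" using kprod.add[OF _ n[of y], of x] by simp
  qed
qed

lemma kprod_scale:
  assumes "\<And>a. a \<in> I \<Longrightarrow> s * a \<in> I'" "x \<in> kprod I J" shows "s * x \<in> kprod I' J"
  using assms(2)
proof induction
  case (mult a b) then show ?case using kprod.mult[OF assms(1), of a b J] by (simp add: mult.assoc)
qed (auto simp: distrib_left intro: kprod.add)

lemma kprod_commute: "kprod I J = kprod J I"
proof -
  have "kprod I J \<subseteq> kprod J I" for I J :: "'a set"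
  proof
    fix x assume "x \<in> kprod I J"
    then show "x \<in> kprod J I"
      by induction (metis kprod.mult mult.commute, rule kprod.add)
  qed
  then show ?thesis by blast
qed

lemma kprod_obtain_sum:
  assumes "x \<in> kprod I J"
  obtains r :: nat and a b where "\<And>l. l < r \<Longrightarrow> a l \<in> I" "\<And>l. l < r \<Longrightarrow> b l \<in> J" "x = (\<Sum>l<r. a l * b l)"
proof -
  from assms have "\<exists>(r::nat) a b. (\<forall>l<r. a l \<in> I \<and> b l \<in> J) \<and> x = (\<Sum>l<r. a l * b l)"
  proof induction
    case (mult a b) then show ?case by (intro exI[of _ 1] exI[of _ "\<lambda>_. a"] exI[of _ "\<lambda>_. b"]) auto
  next
    case (add x y)
    then obtain r s :: nat and a b a' b' where h: "\<forall>l<r. a l \<in> I \<and> b l \<in> J" "x = (\<Sum>l<r. a l * b l)"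
      "\<forall>l<s. a' l \<in> I \<and> b' l \<in> J" "y = (\<Sum>l<s. a' l * b' l)" by blast
    let ?a = "\<lambda>l. if l < r then a l else a' (l - r)" and ?b = "\<lambda>l. if l < r then b l else b' (l - r)"
    have "(\<Sum>l<r+s. ?a l * ?b l) = x + y"
      unfolding lessThan_atLeast0 sum.atLeastLessThan_concat[of 0 r "r+s", simplified, symmetric]
      using sum.shift_bounds_nat_ivl[of "\<lambda>l. ?a l * ?b l" 0 r s] h by (simp add: add.commute lessThan_atLeast0)
    then show ?case using h by (intro exI[of _ "r + s"] exI[of _ ?a] exI[of _ ?b]) auto
  qed
  then show ?thesis using that by blast
qed

text \<open>The algebra \<open>\<rat>[x]/(f)\<close> is realised as the range of \<open>io\<close>, inside a type that is a commutative ring but need not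
  be \<open>K\<close> itself. In the end the type is \<open>complex \<Rightarrow> complex\<close>, and \<open>io p\<close> lists the values of \<open>p\<close> at the roots of \<open>f\<close>.\<close>

locale residue_alg =
  fixes f :: "int poly" and io :: "rat poly \<Rightarrow> 'k::comm_ring_1"
  assumes monic: "lead_coeff f = 1"
    and sep: "\<exists>a b. a * map_poly rat_of_int f + b * pderiv (map_poly rat_of_int f) = 1"
    and io_hom: "comm_ring_hom io"
    and io_zero_iff: "\<And>p. io p = 0 \<longleftrightarrow> map_poly rat_of_int f dvd p"
begin

abbreviation "F \<equiv> map_poly rat_of_int f"
abbreviation "n \<equiv> degree f"
text \<open>Euler: \<open>bd j\<close> is the basis dual to \<open>x\<^sup>j\<close> for the pairing \<open>lam (y * z)\<close>, and the trace of \<open>y\<close> is \<open>lam (del * y)\<close>.\<close>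

definition "xi = io [:0,1:]"
definition "K = range io"
definition "qs q = io [:q:]"
definition "R = range (\<lambda>p. io (map_poly rat_of_int p))"
definition "cf y j = coeff ((SOME p. io p = y) mod F) j"
definition "lam y = cf y (n - 1)"
definition "bd j = io (map_poly rat_of_int (poly_shift (Suc j) f))"
definition "del = io (pderiv F)"

sublocale io: comm_ring_hom io by (rule io_hom)

lemma io_eq_iff: "io p = io q \<longleftrightarrow> F dvd p - q"
  using io_zero_iff[of "p - q"] by (simp add: io.hom_minus)

lemma io_mod: "io (p mod F) = io p"
  unfolding io_eq_iff by (metis dvd_minus_mod dvd_minus_iff minus_diff_eq)

lemma monic_F: "lead_coeff F = 1" and degF: "degree F = n" and F0: "F \<noteq> 0"
  using monic by (auto simp: of_int_hom.hom_lead_coeff)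

lemma n_pos: "n > 0"
proof (rule ccontr)
  assume "\<not> n > 0"
  then have "degree F = 0" using degF by simp
  then have "F dvd 1" using F0 is_unit_iff_degree by blast
  then show False using io_zero_iff[of 1] by simp
qed

lemma K_I: "io p \<in> K" by (simp add: K_def)

lemma K_0: "0 \<in> K" and K_1: "1 \<in> K"
  using K_I[of 0] K_I[of 1] by auto

lemma K_add: "x \<in> K \<Longrightarrow> y \<in> K \<Longrightarrow> x + y \<in> K" unfolding K_def by (auto simp flip: io.hom_add)
lemma K_diff: "x \<in> K \<Longrightarrow> y \<in> K \<Longrightarrow> x - y \<in> K" unfolding K_def by (auto simp flip: io.hom_minus)
lemma K_mult: "x \<in> K \<Longrightarrow> y \<in> K \<Longrightarrow> x * y \<in> K" unfolding K_def by (auto simp flip: io.hom_mult)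
lemma K_asub: "asub K" by (auto simp: asub_def K_0 K_diff)
lemma K_of_int: "of_int c \<in> K" using asub_of_int[OF K_asub K_1, of c] by simp
lemma K_power: "x \<in> K \<Longrightarrow> x ^ k \<in> K" by (induction k) (auto simp: K_1 K_mult)
lemma K_xi: "xi \<in> K" by (simp add: xi_def K_I)
lemma K_qs: "qs q \<in> K" by (simp add: qs_def K_I)
lemma K_bd: "bd j \<in> K" by (simp add: bd_def K_I)
lemma K_del: "del \<in> K" by (simp add: del_def K_I)
lemmas K_closed = K_0 K_1 K_add K_diff K_mult K_of_int K_power K_xi K_qs K_bd K_del K_I

sublocale qs: comm_ring_hom qs
proof unfold_locales
  show "qs (x + y) = qs x + qs y" for x y unfolding qs_def io.hom_add[symmetric] by simp
  show "qs (x * y) = qs x * qs y" for x y unfolding qs_def io.hom_mult[symmetric] by (simp add: mult.commute)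
  show "qs 1 = 1" unfolding qs_def one_pCons[symmetric] by simp
  show "qs 0 = 0" unfolding qs_def by simp
qed

lemma io_pCons: "io (pCons a p) = qs a + xi * io p"
  unfolding qs_def xi_def by (simp flip: io.hom_mult io.hom_add)

lemma io_expand: "degree p < m \<Longrightarrow> io p = comb qs m (\<lambda>j. xi ^ j) (coeff p)"
proof (induction p arbitrary: m)
  case 0 then show ?case by (simp add: comb_def)
next
  case (pCons a p)
  show ?case
  proof (cases m)
    case 0 then show ?thesis using pCons by simp
  next
    case (Suc k)
    have "comb qs m (\<lambda>j. xi ^ j) (coeff (pCons a p)) = qs a + xi * comb qs k (\<lambda>j. xi ^ j) (coeff p)"
      unfolding comb_def Suc sum.lessThan_Suc_shift by (simp add: sum_distrib_left algebra_simps)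
    also have "comb qs k (\<lambda>j. xi ^ j) (coeff p) = io p"
    proof (cases "p = 0")
      case True then show ?thesis by (simp add: comb_def)
    next
      case False then show ?thesis using pCons Suc by simp
    qed
    finally show ?thesis using io_pCons[of a p] by simp
  qed
qed

lemma deg_mod: "degree (p mod F) < n"
  using degree_mod_less[of F p] F0 n_pos degF by auto

lemma cf_io: "cf (io p) j = coeff (p mod F) j"
proof -
  have "io (SOME q. io q = io p) = io p" by (rule someI[of "\<lambda>q. io q = io p" p]) simp
  then have "(SOME q. io q = io p) mod F = p mod F"
    unfolding io_eq_iff by (metis mod_eq_dvd_iff)
  then show ?thesis by (simp add: cf_def)
qed

lemma expand: "y \<in> K \<Longrightarrow> y = comb qs n (\<lambda>j. xi ^ j) (cf y)"
proof -
  assume "y \<in> K"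
  then obtain p where p: "y = io p" by (auto simp: K_def)
  have "io (p mod F) = comb qs n (\<lambda>j. xi ^ j) (coeff (p mod F))" by (rule io_expand[OF deg_mod])
  also have "coeff (p mod F) = cf y" unfolding p by (rule ext) (simp add: cf_io)
  finally show ?thesis unfolding io_mod p .
qed

lemma cf_add: "x \<in> K \<Longrightarrow> y \<in> K \<Longrightarrow> cf (x + y) j = cf x j + cf y j"
  by (auto simp: K_def cf_io poly_mod_add_left simp flip: io.hom_add)

lemma cf_diff: "x \<in> K \<Longrightarrow> y \<in> K \<Longrightarrow> cf (x - y) j = cf x j - cf y j"
  by (auto simp: K_def cf_io poly_mod_diff_left simp flip: io.hom_minus)

lemma cf_qs: "y \<in> K \<Longrightarrow> cf (qs q * y) j = q * cf y j"
  by (auto simp: K_def qs_def cf_io mod_smult_left simp flip: io.hom_mult)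

lemma cf_0: "cf 0 j = 0"
  using cf_io[of 0 j] by simp

lemma cf_sum: "(\<And>i. i \<in> A \<Longrightarrow> g i \<in> K) \<Longrightarrow> cf (\<Sum>i\<in>A. g i) j = (\<Sum>i\<in>A. cf (g i) j)"
  by (induction A rule: infinite_finite_induct) (auto simp: cf_0 cf_add asub_sum[OF K_asub])

lemma cf_zero: "y \<in> K \<Longrightarrow> (\<And>j. j < n \<Longrightarrow> cf y j = 0) \<Longrightarrow> y = 0"
  using expand[of y] by (simp add: comb_def)

lemma cf_xi: "m < n \<Longrightarrow> cf (xi ^ m) j = (if j = m then 1 else 0)"
proof -
  assume m: "m < n"
  have x: "xi ^ m = io (monom 1 m)" by (simp add: xi_def monom_altdef io.hom_power)
  have "monom 1 m mod F = monom 1 m"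
    using m degF by (intro mod_poly_less) (simp add: degree_monom_eq)
  then show ?thesis unfolding x cf_io by auto
qed

lemma lam_add: "x \<in> K \<Longrightarrow> y \<in> K \<Longrightarrow> lam (x + y) = lam x + lam y"
  and lam_diff: "x \<in> K \<Longrightarrow> y \<in> K \<Longrightarrow> lam (x - y) = lam x - lam y"
  and lam_qs: "y \<in> K \<Longrightarrow> lam (qs q * y) = q * lam y"
  and lam_0: "lam 0 = 0"
  by (simp_all add: lam_def cf_add cf_diff cf_qs cf_0)

lemma lam_sum: "(\<And>i. i \<in> A \<Longrightarrow> g i \<in> K) \<Longrightarrow> lam (\<Sum>i\<in>A. g i) = (\<Sum>i\<in>A. lam (g i))"
  unfolding lam_def by (rule cf_sum)

text \<open>\<open>F\<close> is x^(j+1) times \<open>?b\<close> plus a remainder of degree at most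
  j. For m <= j the product of x^m and \<open>?b\<close> is already reduced modulo \<open>F\<close>,
  and its coefficient at x^(n-1) is the coefficient of the monic \<open>F\<close> of index n + j -
  m. For m > j the product is congruent to the negative of x^(m-j-1) times the remainder, which has
  degree below m and therefore no term x^(n-1).\<close>

lemma lam_bd_xi:
  assumes j: "j < n" and m: "m < n"
  shows "lam (bd j * xi ^ m) = (if j = m then 1 else 0)"
proof -
  let ?b = "poly_shift (Suc j) F"
  have bF: "map_poly rat_of_int (poly_shift (Suc j) f) = ?b"
    by (rule poly_eqI) (simp add: coeff_map_poly coeff_poly_shift)
  have e: "bd j * xi ^ m = io (monom 1 m * ?b)"
    by (simp add: xi_def bd_def bF monom_altdef io.hom_power io.hom_mult mult.commute)
  show ?thesis
  proof (cases "m \<le> j")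
    case True
    have "degree (monom 1 m * ?b) < n"
    proof (rule degree_lessI)
      show "\<forall>k\<ge>n. coeff (monom 1 m * ?b) k = 0"
      proof (intro allI impI)
        fix k assume "k \<ge> n"
        then have "coeff F (k - m + Suc j) = 0" using True degF by (intro coeff_eq_0) auto
        then show "coeff (monom 1 m * ?b) k = 0"
          by (simp only: coeff_monom_mult coeff_poly_shift mult_zero_right if_cancel)
      qed
    qed (use n_pos in auto)
    then have "monom 1 m * ?b mod F = monom 1 m * ?b" using degF by (intro mod_poly_less) simp
    then have "lam (bd j * xi ^ m) = coeff (monom 1 m * ?b) (n - 1)"
      unfolding lam_def e cf_io by simp
    also have "\<dots> = coeff F (n - 1 - m + Suc j)" using m by (simp add: coeff_monom_mult coeff_poly_shift)
    also have "\<dots> = (if j = m then 1 else 0)"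
    proof (cases "j = m")
      case True
      then show ?thesis using monic_F m unfolding degF by simp
    next
      case False
      then have "n < n - 1 - m + Suc j" using True m by linarith
      then show ?thesis using False degF by (auto intro: coeff_eq_0)
    qed
    finally show ?thesis .
  next
    case False
    let ?r = "poly_cutoff (Suc j) F" and ?k = "m - Suc j"
    have m': "monom (1::rat) m = monom 1 ?k * monom 1 (Suc j)" using False by (simp add: mult_monom)
    have "monom 1 m * ?b = monom 1 ?k * (monom 1 (Suc j) * ?b + ?r) - monom 1 ?k * ?r"
      unfolding m' by (simp add: algebra_simps)
    then have "monom 1 m * ?b = monom 1 ?k * F - monom 1 ?k * ?r" unfolding poly_shift_split .
    then have e2: "io (monom 1 m * ?b) = io (- (monom 1 ?k * ?r))"
      unfolding io_eq_iff by simp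
    have d: "coeff (monom 1 ?k * ?r) i = 0" if "i \<ge> m" for i
      using that False by (auto simp: coeff_monom_mult coeff_poly_cutoff)
    then have "degree (monom 1 ?k * ?r) < n" by (intro degree_lessI) (use m in auto)
    then have "- (monom 1 ?k * ?r) mod F = - (monom 1 ?k * ?r)" using degF by (intro mod_poly_less) simp
    then have "lam (bd j * xi ^ m) = - coeff (monom 1 ?k * ?r) (n - 1)"
      unfolding lam_def e e2 cf_io by simp
    then show ?thesis using d[of "n - 1"] m False by simp
  qed
qed

lemma lam_comb:
  assumes "\<And>i. i < m \<Longrightarrow> w i \<in> K" "u \<in> K"
  shows "lam (u * comb qs m w c) = (\<Sum>i<m. c i * lam (u * w i))"
proof -
  have "u * comb qs m w c = (\<Sum>i<m. qs (c i) * (u * w i))"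
    by (simp add: comb_def sum_distrib_left algebra_simps)
  also have "lam \<dots> = (\<Sum>i<m. lam (qs (c i) * (u * w i)))" using assms by (intro lam_sum) (auto simp: K_closed)
  also have "\<dots> = (\<Sum>i<m. c i * lam (u * w i))" using assms by (intro sum.cong) (auto simp: lam_qs K_closed)
  finally show ?thesis .
qed

lemma lam_bd: "j < n \<Longrightarrow> y \<in> K \<Longrightarrow> lam (bd j * y) = cf y j"
proof -
  assume j: "j < n" and y: "y \<in> K"
  have "lam (bd j * y) = lam (bd j * comb qs n (\<lambda>j. xi ^ j) (cf y))" using expand[OF y] by simp
  also have "\<dots> = (\<Sum>i<n. cf y i * lam (bd j * xi ^ i))" by (intro lam_comb) (auto simp: K_closed)
  also have "\<dots> = (\<Sum>i<n. if i = j then cf y i else 0)" using j by (intro sum.cong) (auto simp: lam_bd_xi)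
  finally show ?thesis using j by simp
qed

lemma lam_nondeg: "y \<in> K \<Longrightarrow> (\<And>z. z \<in> K \<Longrightarrow> lam (y * z) = 0) \<Longrightarrow> y = 0"
proof (rule cf_zero)
  fix j assume y: "y \<in> K" "\<And>z. z \<in> K \<Longrightarrow> lam (y * z) = 0" and j: "j < n"
  show "cf y j = 0" using lam_bd[OF j y(1)] y(2)[OF K_bd[of j]] by (simp add: mult.commute)
qed

text \<open>A rational form on \<open>K\<close> is determined by its values on the powers of
  \<open>xi\<close>, and these are the coefficients of the representing element in the dual basis
  \<open>bd\<close>. Coordinate functions thereby become elements of \<open>K\<close>.\<close>

lemma lam_represent:
  assumes add: "\<And>y z. y \<in> K \<Longrightarrow> z \<in> K \<Longrightarrow> k (y + z) = k y + k z"
    and sc: "\<And>q y. y \<in> K \<Longrightarrow> k (qs q * y) = q * k y" and y: "y \<in> K"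
  shows "k y = lam (comb qs n bd (\<lambda>j. k (xi ^ j)) * y)"
proof -
  have k0: "k 0 = 0" using sc[OF K_0, of 0] by simp
  have ks: "(\<And>i. i \<in> A \<Longrightarrow> g i \<in> K) \<Longrightarrow> k (\<Sum>i\<in>A. g i) = (\<Sum>i\<in>A. k (g i))" for A :: "nat set" and g
    by (induction A rule: infinite_finite_induct) (auto simp: k0 add asub_sum[OF K_asub])
  have "k y = k (comb qs n (\<lambda>j. xi ^ j) (cf y))" using expand[OF y] by simp
  also have "\<dots> = (\<Sum>j<n. k (xi ^ j) * cf y j)"
    unfolding comb_def by (subst ks) (auto simp: K_closed sc intro!: sum.cong)
  also have "\<dots> = (\<Sum>j<n. k (xi ^ j) * lam (y * bd j))"
    by (intro sum.cong) (auto simp: y mult.commute simp flip: lam_bd)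
  also have "\<dots> = lam (y * comb qs n bd (\<lambda>j. k (xi ^ j)))"
    by (rule lam_comb[symmetric]) (auto simp: K_closed y)
  finally show ?thesis by (simp add: mult.commute)
qed

text \<open>The coefficient of x^i collects \<open>Suc i\<close> equal contributions, one for each j
  <= i, which is the factor produced by the derivative. Since \<open>bd\<close> is dual to the
  powers of \<open>xi\<close>, the identity turns \<open>lam (del * y)\<close> into the sum of the
  diagonal entries of multiplication by \<open>y\<close>.\<close>

lemma del_eq: "del = (\<Sum>j<n. bd j * xi ^ j)"
proof -
  have bF: "map_poly rat_of_int (poly_shift (Suc j) f) = poly_shift (Suc j) F" for j
    by (rule poly_eqI) (simp add: coeff_map_poly coeff_poly_shift)
  have "pderiv F = (\<Sum>j<n. monom 1 j * poly_shift (Suc j) F)"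
  proof (rule poly_eqI)
    fix i
    have "coeff (\<Sum>j<n. monom 1 j * poly_shift (Suc j) F) i = (\<Sum>j<n. if j \<le> i then coeff F (Suc i) else 0)"
      unfolding coeff_sum by (intro sum.cong) (auto simp: coeff_monom_mult coeff_poly_shift)
    also have "\<dots> = of_nat (Suc i) * coeff F (Suc i)"
    proof (cases "i < n")
      case True
      then have "{j. j < n \<and> j \<le> i} = {..i}" by auto
      then show ?thesis by (simp add: sum.If_cases lessThan_def Collect_conj_eq[symmetric])
    next
      case False
      then have "coeff F (Suc i) = 0" using degF by (intro coeff_eq_0) auto
      then show ?thesis by (simp only: if_cancel mult_zero_right sum.neutral_const)
    qed
    finally show "coeff (pderiv F) i = coeff (\<Sum>j<n. monom 1 j * poly_shift (Suc j) F) i"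
      by (simp add: coeff_pderiv)
  qed
  then show ?thesis
    by (simp add: xi_def del_def bd_def bF io.hom_sum io.hom_mult monom_altdef io.hom_power mult.commute)
qed

lemma del_unit: "\<exists>e\<in>K. del * e = 1"
proof -
  obtain a b where "a * F + b * pderiv F = 1" using sep by blast
  then have "io (a * F + b * pderiv F) = 1" by simp
  moreover have "io F = 0" by (simp add: io_zero_iff)
  ultimately have "io b * del = 1" by (simp add: io.hom_add io.hom_mult del_def)
  then show ?thesis using K_I mult.commute by metis
qed

lemma basis_K: "basis qs n (\<lambda>j. xi ^ j) K" unfolding basis_def
proof (intro conjI allI impI)
  show "K = range (comb qs n (\<lambda>j. xi ^ j))"
    using expand by (auto simp: comb_def intro!: asub_sum[OF K_asub] K_closed)
  fix c i assume "comb qs n (\<lambda>j. xi ^ j) c = 0" "i < n"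
  then have "0 = cf (\<Sum>j<n. qs (c j) * xi ^ j) i" by (simp add: comb_def cf_0)
  also have "\<dots> = (\<Sum>j<n. c j * cf (xi ^ j) i)" by (subst cf_sum) (auto simp: K_closed cf_qs)
  also have "\<dots> = (\<Sum>j<n. if j = i then c j else 0)" by (intro sum.cong) (auto simp: cf_xi)
  finally show "c i = 0" using \<open>i < n\<close> by simp
qed

text \<open>As \<open>f\<close> is monic, pseudo-division by it is honest division over the
  integers, so an integral polynomial has an integral residue.\<close>

lemma R_iff: "y \<in> R \<longleftrightarrow> y \<in> K \<and> (\<forall>j<n. cf y j \<in> \<int>)"
proof
  assume "y \<in> R"
  then obtain p where p: "y = io (map_poly rat_of_int p)" by (auto simp: R_def)
  obtain q r where qr: "pseudo_divmod p f = (q, r)" by force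
  have "f \<noteq> 0" using monic by auto
  from pseudo_divmod[OF this qr] monic
  have pq: "p = f * q + r" and r: "r = 0 \<or> degree r < n" by auto
  have "map_poly rat_of_int p = map_poly rat_of_int r + F * map_poly rat_of_int q"
    unfolding pq by (simp add: of_int_poly_hom.hom_add of_int_poly_hom.hom_mult)
  then have "map_poly rat_of_int p mod F = map_poly rat_of_int r mod F" by simp
  also have "\<dots> = map_poly rat_of_int r" using r degF n_pos by (intro mod_poly_less) auto
  finally show "y \<in> K \<and> (\<forall>j<n. cf y j \<in> \<int>)" unfolding p by (simp add: K_closed cf_io coeff_map_poly)
next
  assume y: "y \<in> K \<and> (\<forall>j<n. cf y j \<in> \<int>)"
  then have "\<forall>j. \<exists>c. j < n \<longrightarrow> cf y j = of_int c" by (auto elim: Ints_cases)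
  then obtain c where c: "\<And>j. j < n \<Longrightarrow> cf y j = of_int (c j)" by metis
  have "y = comb qs n (\<lambda>j. xi ^ j) (cf y)" using expand y by blast
  also have "\<dots> = (\<Sum>j<n. io (map_poly rat_of_int (monom (c j) j)))"
    unfolding comb_def
  proof (intro sum.cong refl)
    fix j assume "j \<in> {..<n}"
    have "map_poly rat_of_int (monom (c j) j) = monom (of_int (c j)) j"
      by (simp add: of_int_hom.map_poly_hom_monom)
    also have "\<dots> = [:of_int (c j):] * [:0,1:] ^ j" by (simp add: monom_altdef)
    finally have "map_poly rat_of_int (monom (c j) j) = [:of_int (c j):] * [:0,1:] ^ j" .
    then show "qs (cf y j) * xi ^ j = io (map_poly rat_of_int (monom (c j) j))"
      using c \<open>j \<in> _\<close> by (simp add: xi_def qs_def io.hom_mult io.hom_power del: mult_pCons_left mult_pCons_right)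
  qed
  also have "\<dots> = io (map_poly rat_of_int (\<Sum>j<n. monom (c j) j))"
    by (simp add: io.hom_sum of_int_poly_hom.hom_sum)
  finally show "y \<in> R" by (auto simp: R_def)
qed

lemma R_mult: "x \<in> R \<Longrightarrow> y \<in> R \<Longrightarrow> x * y \<in> R"
  by (auto simp: R_def simp flip: io.hom_mult of_int_poly_hom.hom_mult)

lemma R_asub: "asub R" unfolding asub_def R_def
proof (intro conjI ballI)
  show "0 \<in> range (\<lambda>p. io (map_poly rat_of_int p))" by (rule range_eqI[of _ _ 0]) simp
qed (auto simp flip: io.hom_minus of_int_poly_hom.hom_minus)

lemma R_1: "1 \<in> R" unfolding R_def by (rule range_eqI[of _ _ 1]) simp
lemma R_xi: "xi \<in> R" unfolding R_def xi_def by (rule range_eqI[of _ _ "[:0,1:]"]) simp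
lemma R_K: "R \<subseteq> K" by (auto simp: R_def K_I)
lemma R_bd: "bd j \<in> R" by (auto simp: R_def bd_def)
lemma R_of_int: "of_int c \<in> R" using asub_of_int[OF R_asub R_1, of c] by simp

text \<open>Fractional \<open>R\<close>-ideals: full rank means that \<open>I\<close> contains a positive integer, and finite generation that the
  denominators are bounded.\<close>

definition "lat I \<longleftrightarrow> I \<subseteq> K \<and> asub I \<and> (\<forall>y\<in>I. xi * y \<in> I) \<and> (\<exists>c>0. of_int c \<in> I) \<and>
  (\<exists>d>0. \<forall>y\<in>I. of_int d * y \<in> R)"

lemma latD:
  assumes "lat I"
  shows "I \<subseteq> K" "asub I" "\<And>y. y \<in> I \<Longrightarrow> xi * y \<in> I" "\<exists>c>0. of_int c \<in> I" "\<exists>d>0. \<forall>y\<in>I. of_int d * y \<in> R"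
    "\<And>y. y \<in> I \<Longrightarrow> y \<in> K"
  using assms by (auto simp: lat_def)

lemma xi_closed_R:
  assumes I: "asub I" "\<And>y. y \<in> I \<Longrightarrow> xi * y \<in> I" and r: "r \<in> R" "y \<in> I"
  shows "r * y \<in> I"
proof -
  obtain p where p: "r = io (map_poly rat_of_int p)" using r by (auto simp: R_def)
  have "io (map_poly rat_of_int p) * y \<in> I"
  proof (induction p)
    case 0 then show ?case using I by (simp add: asub_0)
  next
    case (pCons a p)
    have "map_poly rat_of_int (pCons a p) = pCons (of_int a) (map_poly rat_of_int p)"
      by (rule poly_eqI) (simp add: coeff_map_poly coeff_pCons split: nat.split)
    then have "io (map_poly rat_of_int (pCons a p)) * y = of_int a * y + xi * (io (map_poly rat_of_int p) * y)"
      using io_pCons[of "of_int a" "map_poly rat_of_int p"] by (simp add: qs.hom_of_int distrib_right mult.assoc)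
    then show ?case using pCons I r by (simp add: asub_add asub_of_int)
  qed
  then show ?thesis by (simp add: p)
qed

lemma lat_R: "lat I \<Longrightarrow> r \<in> R \<Longrightarrow> y \<in> I \<Longrightarrow> r * y \<in> I"
  by (rule xi_closed_R) (auto simp: lat_def)

lemma lat_RR: "lat R"
  unfolding lat_def using R_K R_asub R_mult[OF R_xi] R_1 by (auto intro!: exI[of _ 1])

lemma to_R: "y \<in> K \<Longrightarrow> \<exists>e>0. of_int e * y \<in> R"
proof -
  assume y: "y \<in> K"
  obtain N where N: "N > 0" "\<forall>i<n. of_int N * cf y i \<in> \<int>" using common_denominator by blast
  have "of_int N * y = qs (of_int N) * y" by (simp add: qs.hom_of_int)
  then have "of_int N * y \<in> R" using N y by (simp add: R_iff cf_qs K_closed)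
  then show ?thesis using N by blast
qed

lemma of_int_inv: "c \<noteq> 0 \<Longrightarrow> qs (1 / of_int c) * (of_int c * y) = y"
proof -
  assume c: "c \<noteq> 0"
  have "qs (1 / of_int c) * (of_int c * y) = qs (1 / of_int c) * qs (of_int c) * y"
    by (simp add: qs.hom_of_int mult.assoc)
  also have "\<dots> = qs (1 / of_int c * of_int c) * y" by (simp only: qs.hom_mult)
  also have "1 / of_int c * of_int c = (1 :: rat)" using c by simp
  finally show "qs (1 / of_int c) * (of_int c * y) = y" by simp
qed

lemma K_of_int_cancel: "c \<noteq> 0 \<Longrightarrow> of_int c * (y::'k) = of_int c * z \<Longrightarrow> y = z"
proof -
  assume c: "c \<noteq> 0" and e: "of_int c * y = of_int c * z"
  have "y = qs (1 / of_int c) * (of_int c * y)" by (rule of_int_inv[OF c, symmetric])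
  also have "\<dots> = z" unfolding e by (rule of_int_inv[OF c])
  finally show "y = z" .
qed

text \<open>A common denominator \<open>d\<close> puts \<open>I\<close> inside the free group with
  basis \<open>?u\<close>, so \<open>I\<close> is free itself. The positive integer contained in
  \<open>I\<close> makes its basis span \<open>K\<close> over the rationals, and comparison with the
  powers of \<open>xi\<close> fixes the size \<open>n\<close>.\<close>

lemma lat_basis:
  assumes I: "lat I"
  shows "\<exists>w. basis of_int n w I \<and> basis qs n w K"
proof -
  note l = latD[OF I]
  obtain d where d: "d > 0" "\<forall>y\<in>I. of_int d * y \<in> R" using l by blast
  obtain c where c: "c > 0" "of_int c \<in> I" using l by blast
  let ?u = "\<lambda>j. qs (1 / of_int d) * xi ^ j"
  have cu: "comb of_int n ?u g = comb qs n (\<lambda>j. xi ^ j) (\<lambda>j. of_int (g j) / of_int d)" for g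
    unfolding comb_def by (intro sum.cong) (auto simp: divide_inverse mult.assoc qs.hom_mult qs.hom_of_int)
  have "basis of_int n ?u (range (comb of_int n ?u))" unfolding basis_def
  proof (intro conjI allI impI refl)
    fix g i assume "comb of_int n ?u g = 0" "i < n"
    then have "\<forall>i<n. of_int (g i) / of_int d = (0::rat)" using basis_K unfolding cu basis_def by blast
    then have "of_int (g i) / of_int d = (0::rat)" using \<open>i < n\<close> by blast
    then show "g i = 0" using d by simp
  qed
  moreover have "I \<subseteq> range (comb of_int n ?u)"
  proof
    fix y assume y: "y \<in> I"
    then have "of_int d * y \<in> R" using d by blast
    then have "\<forall>j. \<exists>g. j < n \<longrightarrow> cf (of_int d * y) j = of_int g" by (auto simp: R_iff elim: Ints_cases)
    then obtain g where g: "\<And>j. j < n \<Longrightarrow> cf (of_int d * y) j = of_int (g j)" by metis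
    have "cf y j = of_int (g j) / of_int d" if "j < n" for j
      using g[OF that] cf_qs[of y "of_int d" j] l(6)[OF y] d by (simp add: qs.hom_of_int field_simps)
    then have "y = comb of_int n ?u g"
      unfolding cu using expand[OF l(6)[OF y]] qs.comb_cong[of n "cf y" "\<lambda>j. of_int (g j) / of_int d"] by simp
    then show "y \<in> range (comb of_int n ?u)" by (rule ssubst) (rule rangeI)
  qed
  ultimately obtain m w where w: "basis of_int m w I" using sub_basis l(2) by blast
  have wI: "\<And>i. i < m \<Longrightarrow> w i \<in> I" using of_int_hom.basis_vec[OF w] .
  have ci: "comb of_int m w g = comb qs m w (\<lambda>i. of_int (g i))" for g
    by (simp add: comb_def qs.hom_of_int)
  have wq: "basis qs m w K" unfolding basis_def
  proof (intro conjI allI impI equalityI subsetI)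
    fix y assume y: "y \<in> K"
    obtain e where e: "e > 0" "of_int e * y \<in> R" using to_R[OF y] by blast
    have "of_int e * y * of_int c \<in> I" using lat_R[OF I e(2) c(2)] .
    then obtain g where g: "of_int (e * c) * y = comb of_int m w g"
      using of_int_hom.basis_obtain[OF w] by (auto simp: ac_simps)
    have "y = qs (1 / of_int (e * c)) * (of_int (e * c) * y)" using of_int_inv[of "e * c" y] e c by simp
    then have "y = comb qs m w (\<lambda>i. 1 / of_int (e * c) * of_int (g i))"
      unfolding g ci qs.comb_scale .
    then show "y \<in> range (comb qs m w)" by (rule ssubst) (rule rangeI)
  next
    fix y assume "y \<in> range (comb qs m w)"
    then show "y \<in> K" using wI l(1) unfolding comb_def by (auto intro!: asub_sum[OF K_asub] K_closed)
  next
    fix q i assume 0: "comb qs m w q = 0" and i: "i < m"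
    obtain N where N: "N > 0" "\<forall>i<m. of_int N * q i \<in> \<int>" using common_denominator by blast
    then have "\<forall>j. \<exists>g. j < m \<longrightarrow> of_int N * q j = of_int g" by (auto elim: Ints_cases)
    then obtain g where g: "\<And>j. j < m \<Longrightarrow> of_int N * q j = of_int (g j)" by metis
    have "comb of_int m w g = qs (of_int N) * comb qs m w q"
      unfolding ci qs.comb_scale using g by (intro qs.comb_cong) auto
    then have "g i = 0" using w i 0 unfolding basis_def by auto
    then show "q i = 0" using g[OF i] N by simp
  qed
  moreover have "m = n" using basis_size_unique[OF qs.comm_ring_hom_axioms wq basis_K] by blast
  ultimately show ?thesis using w by blast
qed

text \<open>\<open>v\<close> is the basis dual to \<open>w\<close> for the pairing of
  \<open>lam\<close>; it arises by representing the coordinate functions of \<open>w\<close> as in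
  \<open>lam_represent\<close>.\<close>

lemma lat_coords:
  assumes I: "lat I"
  shows "\<exists>w v. basis of_int n w I \<and> (\<forall>i<n. w i \<in> I) \<and> (\<forall>i<n. v i \<in> K) \<and> 
    (\<forall>y\<in>K. y = comb qs n w (\<lambda>i. lam (v i * y))) \<and> (\<forall>y\<in>I. \<forall>i<n. lam (v i * y) \<in> \<int>)"
proof -
  obtain w where w: "basis of_int n w I" "basis qs n w K" using lat_basis[OF I] by blast
  have ci: "comb of_int n w g = comb qs n w (\<lambda>i. of_int (g i))" for g
    by (simp add: comb_def qs.hom_of_int)
  define co where "co y = (SOME c. y = comb qs n w c)" for y
  have co: "y = comb qs n w (co y)" if "y \<in> K" for y
    unfolding co_def using qs.basis_obtain[OF w(2) that] by (rule someI_ex)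
  have couniq: "co y i = c i" if "i < n" "y = comb qs n w c" for y c i
  proof -
    have "y \<in> K" using that qs.basis_mem[OF w(2)] by simp
    then show ?thesis using qs.basis_inj[OF w(2), of "co y" c i] co that by simp
  qed
  define v where "v i = comb qs n bd (\<lambda>j. co (xi ^ j) i)" for i
  have v: "co y i = lam (v i * y)" if "i < n" "y \<in> K" for i y
    unfolding v_def
  proof (rule lam_represent[OF _ _ \<open>y \<in> K\<close>])
    fix y z assume "y \<in> K" "z \<in> K"
    then have "y + z = comb qs n w (\<lambda>i. co y i + co z i)" using co qs.comb_add[of n w "co y" "co z"] by simp
    then show "co (y + z) i = co y i + co z i" by (rule couniq[OF that(1)])
  next
    fix q y assume "y \<in> K"
    then have "qs q * y = comb qs n w (\<lambda>i. q * co y i)" using co qs.comb_scale[of q n w "co y"] by simp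
    then show "co (qs q * y) i = q * co y i" by (rule couniq[OF that(1)])
  qed
  have "v i \<in> K" for i unfolding v_def comb_def by (intro asub_sum[OF K_asub] K_closed)
  moreover have "y = comb qs n w (\<lambda>i. lam (v i * y))" if "y \<in> K" for y
  proof -
    have "comb qs n w (co y) = comb qs n w (\<lambda>i. lam (v i * y))" using v that by (intro qs.comb_cong) auto
    then show ?thesis using co[OF that] by simp
  qed
  moreover have "lam (v i * y) \<in> \<int>" if "y \<in> I" "i < n" for y i
  proof -
    obtain g where g: "y = comb qs n w (\<lambda>i. of_int (g i))"
      using of_int_hom.basis_obtain[OF w(1)] \<open>y \<in> I\<close> ci by metis
    have "y \<in> K" using latD(6)[OF I that(1)] .
    then show ?thesis using couniq[OF that(2) g] v[OF that(2)] by simp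
  qed
  ultimately show ?thesis using w of_int_hom.basis_vec[OF w(1)] by blast
qed

section \<open>Duals, colon ideals and orders\<close>

definition "dual I = {y \<in> K. \<forall>z\<in>I. lam (y * z) \<in> \<int>}"

lemma dualD: "y \<in> dual I \<Longrightarrow> z \<in> I \<Longrightarrow> lam (y * z) \<in> \<int>"
  by (simp add: dual_def)

text \<open>The basis dual to one of \<open>I\<close> lies in \<open>dual I\<close>, so pairing an
  element of the bidual with it shows that its coordinates with respect to the basis of
  \<open>I\<close> are integers.\<close>

lemma dual_dual:
  assumes I: "lat I" shows "dual (dual I) = I"
proof (intro equalityI subsetI)
  fix y assume y: "y \<in> I"
  then show "y \<in> dual (dual I)" using latD(6)[OF I] by (auto simp: dual_def mult.commute)
next
  fix y assume y: "y \<in> dual (dual I)"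
  obtain w v where wv: "basis of_int n w I" "\<forall>i<n. v i \<in> K" "\<forall>y\<in>K. y = comb qs n w (\<lambda>i. lam (v i * y))"
    "\<forall>y\<in>I. \<forall>i<n. lam (v i * y) \<in> \<int>" using lat_coords[OF I] by blast
  have "v i \<in> dual I" if "i < n" for i using wv that by (auto simp: dual_def)
  then have "lam (v i * y) \<in> \<int>" if "i < n" for i
    using dualD[OF y, of "v i"] that mult.commute[of y "v i"] by metis
  then have "\<forall>i. \<exists>g. i < n \<longrightarrow> lam (v i * y) = of_int g" by (auto elim: Ints_cases)
  then obtain g where g: "\<And>i. i < n \<Longrightarrow> lam (v i * y) = of_int (g i)" by metis
  have "y = comb qs n w (\<lambda>i. lam (v i * y))" using wv y by (auto simp: dual_def)
  also have "\<dots> = comb of_int n w g" using g by (simp add: comb_def qs.hom_of_int)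
  finally show "y \<in> I" using of_int_hom.basis_mem[OF wv(1)] by metis
qed

lemma R_lam: "y \<in> R \<Longrightarrow> lam y \<in> \<int>"
  using n_pos by (simp add: R_iff lam_def)

text \<open>Each \<open>bd j\<close> lies in \<open>R\<close>, and pairing with it reads off the
  coordinate at \<open>xi ^ j\<close>.\<close>

lemma dual_R: "dual R \<subseteq> R"
proof
  fix y assume "y \<in> dual R"
  then have y: "y \<in> K" "\<And>j. lam (y * bd j) \<in> \<int>" using R_bd by (auto simp: dual_def)
  have "cf y j \<in> \<int>" if "j < n" for j
    using lam_bd[OF that y(1)] y(2)[of j] by (simp add: mult.commute)
  then show "y \<in> R" using y by (simp add: R_iff)
qed

lemma dual_asub: "I \<subseteq> K \<Longrightarrow> asub (dual I)"
  unfolding asub_def dual_def by (auto simp: K_closed lam_0 lam_diff left_diff_distrib subset_iff)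

lemma lat_dual:
  assumes I: "lat I" shows "lat (dual I)"
proof -
  note l = latD[OF I]
  obtain d where d: "d > 0" "\<forall>y\<in>I. of_int d * y \<in> R" using l by blast
  obtain c where c: "c > 0" "of_int c \<in> I" using l by blast
  show ?thesis unfolding lat_def
  proof (intro conjI ballI)
    show "dual I \<subseteq> K" by (auto simp: dual_def)
    show "asub (dual I)" using dual_asub[OF l(1)] .
    fix y assume y: "y \<in> dual I"
    show "xi * y \<in> dual I" using y l(3) unfolding dual_def
      by (auto simp: K_closed) (metis mult.assoc mult.commute)
  next
    show "\<exists>c>0. of_int c \<in> dual I"
      using d R_lam by (intro exI[of _ d]) (auto simp: dual_def K_closed)
    show "\<exists>d>0. \<forall>y\<in>dual I. of_int d * y \<in> R"
    proof (intro exI[of _ c] conjI ballI)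
      fix y assume y: "y \<in> dual I"
      then have yK: "y \<in> K" by (simp add: dual_def)
      show "of_int c * y \<in> R" unfolding R_iff
      proof (intro conjI allI impI)
        fix j assume j: "j < n"
        have "bd j * of_int c \<in> I" using lat_R[OF I R_bd c(2)] .
        then have "lam (y * (bd j * of_int c)) \<in> \<int>" using y by (simp add: dual_def)
        moreover have "y * (bd j * of_int c) = bd j * (of_int c * y)" by (simp add: ac_simps)
        ultimately show "cf (of_int c * y) j \<in> \<int>" using lam_bd[OF j] yK by (simp add: K_closed)
      qed (simp add: yK K_closed)
    qed (use c in auto)
  qed
qed

definition "kcol I J = {x \<in> K. \<forall>y\<in>J. x * y \<in> I}"

lemma lat_kcol:
  assumes I: "lat I" and J: "lat J" shows "lat (kcol I J)"
proof -
  note l = latD[OF I] and m = latD[OF J]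
  obtain d where d: "d > 0" "\<forall>y\<in>I. of_int d * y \<in> R" using l by blast
  obtain c where c: "c > 0" "of_int c \<in> I" using l by blast
  obtain d' where d': "d' > 0" "\<forall>y\<in>J. of_int d' * y \<in> R" using m by blast
  obtain c' where c': "c' > 0" "of_int c' \<in> J" using m by blast
  show ?thesis unfolding lat_def
  proof (intro conjI ballI)
    show "asub (kcol I J)" unfolding asub_def kcol_def
      using asub_0[OF l(2)] asub_diff[OF l(2)] by (auto simp: K_closed left_diff_distrib)
    fix y assume y: "y \<in> kcol I J"
    then show "xi * y \<in> kcol I J" using l(3) by (auto simp: kcol_def K_closed mult.assoc)
  next
    show "\<exists>c>0. of_int c \<in> kcol I J"
    proof (intro exI[of _ "c * d'"] conjI)
      have "of_int (c * d') * y \<in> I" if "y \<in> J" for y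
        using lat_R[OF I, of "of_int d' * y" "of_int c"] d' c that by (simp add: ac_simps)
      then show "of_int (c * d') \<in> kcol I J" unfolding kcol_def using K_of_int by blast
    qed (use c d' in auto)
    show "\<exists>d>0. \<forall>y\<in>kcol I J. of_int d * y \<in> R"
    proof (intro exI[of _ "d * c'"] conjI ballI)
      fix y assume "y \<in> kcol I J"
      then have "y * of_int c' \<in> I" using c' by (auto simp: kcol_def)
      then have "of_int d * (y * of_int c') \<in> R" using d by blast
      then show "of_int (d * c') * y \<in> R" by (simp add: ac_simps)
    qed (use d c' in auto)
  qed (auto simp: kcol_def)
qed

lemma lat_kprod:
  assumes I: "lat I" and J: "lat J" shows "lat (kprod I J)"
proof -
  note l = latD[OF I] and m = latD[OF J]
  obtain d where d: "d > 0" "\<forall>y\<in>I. of_int d * y \<in> R" using l by blast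
  obtain c where c: "c > 0" "of_int c \<in> I" using l by blast
  obtain d' where d': "d' > 0" "\<forall>y\<in>J. of_int d' * y \<in> R" using m by blast
  obtain c' where c': "c' > 0" "of_int c' \<in> J" using m by blast
  show ?thesis unfolding lat_def
  proof (intro conjI ballI)
    show "kprod I J \<subseteq> K" by (rule kprod_subset[OF K_asub]) (use l m in \<open>auto intro: K_mult\<close>)
    show "asub (kprod I J)" by (rule kprod_asub[OF l(2) c'(2)])
    show "xi * y \<in> kprod I J" if "y \<in> kprod I J" for y using kprod_scale[OF l(3) that] .
    show "\<exists>c>0. of_int c \<in> kprod I J"
      using kprod.mult[OF c(2) c'(2)] c c' by (intro exI[of _ "c * c'"]) auto
    have "kprod I J \<subseteq> {y. of_int (d * d') * y \<in> R}"
    proof (rule kprod_subset)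
      show "asub {y. of_int (d * d') * y \<in> R}"
        using R_asub by (auto simp: asub_def right_diff_distrib)
      fix a b assume "a \<in> I" "b \<in> J"
      then have "(of_int d * a) * (of_int d' * b) \<in> R" using d d' R_mult by blast
      then show "a * b \<in> {y. of_int (d * d') * y \<in> R}" by (simp add: ac_simps)
    qed
    then show "\<exists>d>0. \<forall>y\<in>kprod I J. of_int d * y \<in> R" using d d' by (intro exI[of _ "d * d'"]) auto
  qed
qed

definition "korder S \<longleftrightarrow> lat S \<and> 1 \<in> S \<and> (\<forall>x\<in>S. \<forall>y\<in>S. x * y \<in> S)"

lemma order_kcol: "lat I \<Longrightarrow> korder (kcol I I)"
  unfolding korder_def using lat_kcol[of I I] by (auto simp: kcol_def K_closed mult.assoc)

lemma R_subset_order: "korder S \<Longrightarrow> R \<subseteq> S"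
  using lat_R[of S _ 1] by (auto simp: korder_def)

text \<open>\<open>lam (del * y)\<close> is the trace of multiplication by \<open>y\<close>.
  Computed on an integral basis of \<open>S\<close> instead of the powers of \<open>xi\<close>, its
  diagonal entries are \<open>lam (v i * (y * w i))\<close>, which are integers because
  \<open>y * w i\<close> stays in \<open>S\<close>. The double sum expresses that the trace does not
  depend on the basis, written with the two dual bases.\<close>

lemma order_trace:
  assumes S: "korder S" and y: "y \<in> S"
  shows "lam (del * y) \<in> \<int>"
proof -
  have lS: "lat S" and mS: "\<And>x y. x \<in> S \<Longrightarrow> y \<in> S \<Longrightarrow> x * y \<in> S" using S by (auto simp: korder_def)
  note l = latD[OF lS]
  obtain w v where wv: "\<forall>i<n. w i \<in> S" "\<forall>i<n. v i \<in> K" "\<forall>y\<in>K. y = comb qs n w (\<lambda>i. lam (v i * y))"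
    "\<forall>y\<in>S. \<forall>i<n. lam (v i * y) \<in> \<int>" using lat_coords[OF lS] by blast
  have yK: "y \<in> K" using l y by blast
  have wK: "\<And>i. i < n \<Longrightarrow> w i \<in> K" using wv l by blast
  have "lam (del * y) = (\<Sum>j<n. lam (bd j * y * xi ^ j))"
    unfolding del_eq sum_distrib_right by (subst lam_sum) (auto simp: K_closed yK ac_simps)
  also have "\<dots> = (\<Sum>j<n. lam (bd j * y * comb qs n w (\<lambda>i. lam (v i * xi ^ j))))"
  proof (intro sum.cong refl)
    fix j
    have "xi ^ j = comb qs n w (\<lambda>i. lam (v i * xi ^ j))" using wv(3) K_power[OF K_xi, of j] by blast
    then show "lam (bd j * y * xi ^ j) = lam (bd j * y * comb qs n w (\<lambda>i. lam (v i * xi ^ j)))" by simp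
  qed
  also have "\<dots> = (\<Sum>j<n. \<Sum>i<n. lam (v i * xi ^ j) * lam (bd j * y * w i))"
    using wK by (intro sum.cong refl lam_comb) (auto simp: K_closed yK)
  also have "\<dots> = (\<Sum>i<n. \<Sum>j<n. lam (v i * xi ^ j) * lam (bd j * y * w i))" by (rule sum.swap)
  also have "\<dots> = (\<Sum>i<n. lam (v i * (y * w i)))"
  proof (intro sum.cong refl)
    fix i assume "i \<in> {..<n}"
    then have i: "i < n" by simp
    have "lam (v i * (y * w i)) = lam (v i * comb qs n (\<lambda>j. xi ^ j) (cf (y * w i)))"
      using expand[of "y * w i"] yK wK[OF i] K_mult by simp
    also have "\<dots> = (\<Sum>j<n. cf (y * w i) j * lam (v i * xi ^ j))"
      using wv(2) i by (intro lam_comb) (auto simp: K_closed)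
    also have "\<dots> = (\<Sum>j<n. lam (v i * xi ^ j) * lam (bd j * y * w i))"
    proof (intro sum.cong refl)
      fix j assume "j \<in> {..<n}"
      then have "cf (y * w i) j = lam (bd j * (y * w i))" using lam_bd[of j "y * w i"] yK wK[OF i] K_mult by simp
      then show "cf (y * w i) j * lam (v i * xi ^ j) = lam (v i * xi ^ j) * lam (bd j * y * w i)"
        by (simp only: mult.assoc) (rule mult.commute)
    qed
    finally show "(\<Sum>j<n. lam (v i * xi ^ j) * lam (bd j * y * w i)) = lam (v i * (y * w i))" ..
  qed
  also have "\<dots> \<in> \<int>" using wv mS y by (intro Ints_sum) auto
  finally show ?thesis .
qed

text \<open>Traces of an order are integral, so \<open>del * y\<close> lies in
  \<open>dual R\<close>, hence in \<open>R\<close>, for every \<open>y\<close> of the order, and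
  \<open>del\<close> is a unit of \<open>K\<close> that does not depend on the order. The uniformity
  is what \<open>split_off\<close> uses, where the multiplicator ring in question is not yet
  identified.\<close>

lemma order_bound: "\<exists>e>0. \<forall>S. korder S \<longrightarrow> (\<forall>y\<in>S. of_int e * y \<in> R)"
proof -
  obtain u where u: "u \<in> K" "del * u = 1" using del_unit by blast
  obtain e where e: "e > 0" "of_int e * u \<in> R" using to_R[OF u(1)] by blast
  have "of_int e * y \<in> R" if S: "korder S" and y: "y \<in> S" for S y
  proof -
    have lS: "lat S" using S by (simp add: korder_def)
    have "lam (del * y * z) \<in> \<int>" if "z \<in> R" for z
      using order_trace[OF S, of "y * z"] lat_R[OF lS that y] by (simp add: ac_simps)
    then have "del * y \<in> R" using dual_R latD(6)[OF lS y] by (auto simp: dual_def K_closed)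
    then have "(of_int e * u) * (del * y) \<in> R" using e R_mult by blast
    moreover have "(of_int e * u) * (del * y) = of_int e * y * (del * u)" by (simp add: ac_simps)
    ultimately show ?thesis by (simp add: u)
  qed
  then show ?thesis using e by blast
qed

text \<open>The dual for the trace form \<open>lam (del * y)\<close>, that is \<open>dual S\<close>
  divided by \<open>del\<close>. In \<open>bass\<close>, the Gorenstein property is expressed by the
  identity between \<open>tdual S * J\<close> and \<open>S\<close>.\<close>

definition "tdual S = {y \<in> K. \<forall>z\<in>S. lam (del * (y * z)) \<in> \<int>}"
definition "bass \<longleftrightarrow> (\<forall>S. korder S \<longrightarrow> (\<exists>J\<subseteq>K. kprod (tdual S) J = S))"

text \<open>An element \<open>y\<close> pairs integrally with all products \<open>a * b\<close>
  exactly if every \<open>y * a\<close> lies in the bidual of \<open>I\<close>, which is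
  \<open>I\<close>. So the dual of the product is \<open>(I : I)\<close>, and dualizing once more
  gives the claim.\<close>

lemma dual_kprod:
  assumes I: "lat I" shows "kprod I (dual I) = dual (kcol I I)"
proof -
  note l = latD[OF I] and dI = latD[OF lat_dual[OF I]]
  let ?P = "kprod I (dual I)"
  have P: "lat ?P" using lat_kprod[OF I lat_dual[OF I]] .
  have "dual ?P = kcol I I"
  proof (intro equalityI subsetI)
    fix y assume y: "y \<in> dual ?P"
    then have yK: "y \<in> K" by (simp add: dual_def)
    have "y * a \<in> I" if a: "a \<in> I" for a
    proof -
      have "lam (y * a * b) \<in> \<int>" if "b \<in> dual I" for b
        using y kprod.mult[OF a that] by (auto simp: dual_def mult.assoc)
      then have "y * a \<in> dual (dual I)" using yK l(6)[OF a] by (simp add: dual_def[of "dual I"] K_closed)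
      then show ?thesis using dual_dual[OF I] by simp
    qed
    then show "y \<in> kcol I I" using yK by (simp add: kcol_def)
  next
    fix y assume y: "y \<in> kcol I I"
    then have yK: "y \<in> K" by (simp add: kcol_def)
    have "?P \<subseteq> {z \<in> K. lam (y * z) \<in> \<int>}"
    proof (rule kprod_subset)
      show "asub {z \<in> K. lam (y * z) \<in> \<int>}"
        by (auto simp: asub_def K_closed lam_0 lam_diff right_diff_distrib yK)
      fix a b assume a: "a \<in> I" and b: "b \<in> dual I"
      have "y * a \<in> I" using y a by (simp add: kcol_def)
      then have "lam (b * (y * a)) \<in> \<int>" using b by (simp add: dual_def)
      then show "a * b \<in> {z \<in> K. lam (y * z) \<in> \<int>}" using l(6)[OF a] dI(6)[OF b] by (simp add: K_closed ac_simps)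
    qed
    then show "y \<in> dual ?P" using yK by (auto simp: dual_def)
  qed
  then show ?thesis using dual_dual[OF P] by simp
qed

text \<open>By \<open>dual_kprod\<close>, \<open>I\<close> times its dual is the dual of \<open>(I : I)\<close>, which is invertible over \<open>(I : I)\<close>.\<close>

lemma bass_invertible:
  assumes b: bass and I: "lat I"
  shows "1 \<in> kprod I (kcol (kcol I I) I)"
proof -
  note l = latD[OF I] and dI = latD[OF lat_dual[OF I]]
  let ?S = "kcol I I"
  have S: "korder ?S" using order_kcol[OF I] .
  obtain J where J: "J \<subseteq> K" "kprod (tdual ?S) J = ?S" using b S by (auto simp: bass_def)
  obtain u where u: "u \<in> K" "del * u = 1" using del_unit by blast
  note lS = latD[OF lat_kcol[OF I I]]
  have tS: "t \<in> tdual ?S \<longleftrightarrow> t \<in> K \<and> del * t \<in> kprod I (dual I)" for t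
    unfolding dual_kprod[OF I] by (auto simp: dual_def tdual_def K_closed mult.assoc)
  \<comment> \<open>As \<open>u\<close> inverts \<open>del\<close>, every \<open>u * (y * b)\<close>
    with \<open>y\<close> in \<open>I\<close> and \<open>b\<close> in \<open>dual I\<close> lies in
    \<open>tdual ?S\<close>. Hence \<open>u * b * j\<close> multiplies \<open>I\<close> into
    \<open>tdual ?S * J = ?S\<close>, which places it in \<open>(?S : I)\<close>.\<close>
  have gen: "u * c * j \<in> kprod I (kcol ?S I)" if c: "c \<in> kprod I (dual I)" and j: "j \<in> J" for c j
    using c
  proof induction
    case (mult a b)
    have "u * b * j \<in> kcol ?S I" unfolding kcol_def[of ?S]
    proof (intro CollectI conjI ballI)
      show "u * b * j \<in> K" using u dI(6)[OF mult(2)] j J by (auto intro: K_closed)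
      fix y assume y: "y \<in> I"
      have "u * (y * b) \<in> tdual ?S" unfolding tS
      proof
        show "u * (y * b) \<in> K" using u dI(6)[OF mult(2)] l(6)[OF y] by (auto intro: K_closed)
        have "del * (u * (y * b)) = y * b" using u(2) by (simp add: mult.assoc[symmetric])
        then show "del * (u * (y * b)) \<in> kprod I (dual I)" using kprod.mult[OF y mult(2)] by simp
      qed
      then have "u * (y * b) * j \<in> ?S" using kprod.mult[OF _ j, of _ "tdual ?S"] J(2) by blast
      then show "u * b * j * y \<in> ?S" by (simp add: ac_simps)
    qed
    then have "a * (u * b * j) \<in> kprod I (kcol ?S I)" using kprod.mult mult(1) by blast
    then show ?case by (simp add: ac_simps)
  qed (auto simp: distrib_left distrib_right intro: kprod.add)
  have "1 \<in> kprod (tdual ?S) J" using J S by (simp add: korder_def)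
  moreover have "x \<in> kprod I (kcol ?S I)" if "x \<in> kprod (tdual ?S) J" for x
    using that
  proof induction
    case (mult t j)
    then have "u * (del * t) * j \<in> kprod I (kcol ?S I)" using gen tS by blast
    moreover have "u * (del * t) * j = t * j * (del * u)" by (simp add: ac_simps)
    ultimately show ?case using u by simp
  qed (rule kprod.add)
  ultimately show ?thesis by blast
qed

end

section \<open>Lifting idempotents and the Steinitz step\<close>

text \<open>The elements of \<open>G\<close> will be the values of linear forms and \<open>D\<close> the multiples of an integer. Hypothesis \<open>exch\<close>
  splits \<open>eps\<close> into a part on which the last summand is a unit and a part on which the other summands suffice.\<close>

lemma lift_idempotent:
  fixes S :: "'k::comm_ring_1 set"
  assumes S: "asub S" "1 \<in> S" "\<And>x y. x \<in> S \<Longrightarrow> y \<in> S \<Longrightarrow> x * y \<in> S"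
    and D: "asub D" "\<And>x y. x \<in> S \<Longrightarrow> y \<in> D \<Longrightarrow> x * y \<in> D"
    and exch: "\<And>t. t \<in> S \<Longrightarrow> \<exists>e\<in>S. e * e - e \<in> D \<and> (\<exists>u\<in>S. e - t * u \<in> D) \<and> (\<exists>u\<in>S. (1 - e) - (1 - t) * u \<in> D)"
    and G: "G \<subseteq> S" "0 \<in> G" "\<And>g s. g \<in> G \<Longrightarrow> s \<in> S \<Longrightarrow> s * g \<in> G"
    and G2: "\<And>g h e e'. g \<in> G \<Longrightarrow> h \<in> G \<Longrightarrow> e \<in> S \<Longrightarrow> e' \<in> S \<Longrightarrow> e * e' \<in> D \<Longrightarrow>
      \<exists>k\<in>G. k - (e * e * g + e' * e' * h) \<in> D"
    and t: "\<And>l. l < r \<Longrightarrow> t l \<in> G" and eps: "eps \<in> S" "eps * eps - eps \<in> D" "eps - (\<Sum>l<(r::nat). t l) \<in> D"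
  shows "\<exists>g\<in>G. g - eps \<in> D"
  using t eps
proof (induction r arbitrary: t eps)
  case 0
  then show ?case using asub_neg[OF D(1)] G(2) by (intro bexI[of _ 0]) auto
next
  case (Suc r)
  have tS: "t r \<in> S" "t r \<in> G" using Suc.prems G by auto
  obtain e u u' where e: "e \<in> S" "e * e - e \<in> D" and u: "u \<in> S" "e - (eps * t r) * u \<in> D"
    and u': "u' \<in> S" "(1 - e) - (1 - eps * t r) * u' \<in> D"
    using exch[of "eps * t r"] S(3) Suc.prems(2) tS by blast
  note mem = S Suc.prems(2) tS e(1) u(1) u'(1)
  note [intro] = S(3) asub_add[OF S(1)] asub_diff[OF S(1)] D(2) asub_add[OF D(1)] asub_diff[OF D(1)] asub_neg[OF D(1)]
  let ?p = "eps * eps - eps" and ?q = "e * e - e" and ?a = "e - (eps * t r) * u"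
  let ?b = "(1 - e) - (1 - eps * t r) * u'" and ?c = "eps - (\<Sum>l<Suc r. t l)"
  \<comment> \<open>\<open>eps * e\<close> and \<open>?f\<close> are orthogonal idempotents modulo
    \<open>D\<close> with sum \<open>eps\<close>. On the first one \<open>t r\<close> is invertible,
    on the second one the induction hypothesis is applied.\<close>
  let ?f = "eps * (1 - e)"
  have m2: "?f * ?f - ?f \<in> D"
  proof -
    have "?f * ?f - ?f = ((1 - e) * (1 - e)) * ?p + eps * ?q" by (simp add: algebra_simps)
    also have "\<dots> \<in> D" using mem e Suc.prems(3) by blast
    finally show ?thesis .
  qed
  \<comment> \<open>Modulo \<open>D\<close>, \<open>?f\<close> is
    \<open>u' * (eps - eps * t r)\<close>, and \<open>eps - t r\<close> is the sum of the remaining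
    summands.\<close>
  have "?f - (\<Sum>l<r. (u' * eps) * t l) \<in> D"
  proof -
    have "?f - (\<Sum>l<r. (u' * eps) * t l) = ?f - (u' * eps) * (\<Sum>l<r. t l)" by (simp add: sum_distrib_left)
    also have "\<dots> = eps * ?b + (u' * eps) * ?c - (u' * (1 + t r)) * ?p" by (simp add: algebra_simps)
    also have "\<dots> \<in> D" using mem u' Suc.prems(3,4) by blast
    finally show ?thesis .
  qed
  then have "\<exists>g\<in>G. g - ?f \<in> D"
    using Suc.prems(1) G(3) m2 mem by (intro Suc.IH[of "\<lambda>l. (u' * eps) * t l"]) auto
  then obtain g2 where g2: "g2 \<in> G" "g2 - ?f \<in> D" by blast
  \<comment> \<open>\<open>g1\<close> is congruent to \<open>eps * e\<close>, because
    \<open>e\<close> is congruent to \<open>eps * t r * u\<close>; it is the value that settles the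
    first part.\<close>
  define g1 where "g1 = (eps * eps * u) * t r"
  have g1: "g1 \<in> G" using G(3)[OF tS(2)] mem by (auto simp: g1_def)
  have "(eps * e) * ?f \<in> D"
  proof -
    have "(eps * e) * ?f = - ((eps * eps) * ?q)" by (simp add: algebra_simps)
    also have "\<dots> \<in> D" using mem e by blast
    finally show ?thesis .
  qed
  then obtain k where k: "k \<in> G" "k - ((eps * e) * (eps * e) * g1 + ?f * ?f * g2) \<in> D"
    using G2[OF g1 g2(1), of "eps * e" ?f] mem by blast
  have m1: "(eps * e) * (eps * e) - eps * e \<in> D"
  proof -
    have "(eps * e) * (eps * e) - eps * e = (e * e) * ?p + eps * ?q" by (simp add: algebra_simps)
    also have "\<dots> \<in> D" using mem e Suc.prems(3) by blast
    finally show ?thesis .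
  qed
  have "k - eps = (k - ((eps * e) * (eps * e) * g1 + ?f * ?f * g2)) + (eps * e + 1) * ((eps * e) * (eps * e) - eps * e)
    + (?f + 1) * (?f * ?f - ?f) - ((eps * e) * (eps * e) * eps) * ?a + (?f * ?f) * (g2 - ?f)"
  proof -
    have id: "k - eps = (k - (ee * ee * g + ff * ff * g2)) + (ee + 1) * (ee * ee - ee)
      + (ff + 1) * (ff * ff - ff) - (ee * ee * eps) * a + (ff * ff) * (g2 - ff)"
      if "ee + ff = eps" "g = ee - eps * a" for ee ff g a :: 'k
      unfolding that(2) that(1)[symmetric] by (simp add: algebra_simps)
    show ?thesis by (rule id) (simp_all add: g1_def algebra_simps)
  qed
  also have "\<dots> \<in> D"
  proof -
    have 1: "eps * e + 1 \<in> S" "?f + 1 \<in> S" "(eps * e) * (eps * e) * eps \<in> S" "?f * ?f \<in> S"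
      by (intro S(3) asub_add[OF S(1)] asub_diff[OF S(1)] mem)+
    show ?thesis
      using asub_add[OF D(1) asub_diff[OF D(1) asub_add[OF D(1) asub_add[OF D(1) k(2) D(2)[OF 1(1) m1]]
        D(2)[OF 1(2) m2]] D(2)[OF 1(3) u(2)]] D(2)[OF 1(4) g2(2)]] .
  qed
  finally show ?case using k by blast
qed

section \<open>Orders modulo an integer, and the exchange property\<close>

context residue_alg
begin

lemma korderD:
  assumes "korder S"
  shows "lat S" "asub S" "1 \<in> S" "\<And>x y. x \<in> S \<Longrightarrow> y \<in> S \<Longrightarrow> x * y \<in> S" "S \<subseteq> K" "\<And>y. y \<in> S \<Longrightarrow> y \<in> K"
    "\<And>c. of_int c \<in> S"
proof -
  from assms have S: "lat S" "1 \<in> S" "\<forall>x\<in>S. \<forall>y\<in>S. x * y \<in> S" by (simp_all add: korder_def)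
  show "lat S" "asub S" "1 \<in> S" "S \<subseteq> K" "\<And>y. y \<in> S \<Longrightarrow> y \<in> K" "\<And>x y. x \<in> S \<Longrightarrow> y \<in> S \<Longrightarrow> x * y \<in> S"
    using S latD(1,2,6)[OF S(1)] by blast+
  show "of_int c \<in> S" for c using asub_of_int[OF latD(2)[OF S(1)] S(2), of c] by simp
qed

text \<open>\<open>S\<close> modulo \<open>d\<close> is finite: reduce the coordinates in an
  integral basis to remainders modulo \<open>d\<close>.\<close>

lemma order_pigeonhole:
  assumes S: "korder S" and d: "d > 0" and h: "\<And>i::nat. h i \<in> S"
  shows "\<exists>a b. a < b \<and> (\<exists>s\<in>S. h b - h a = of_int d * s)"
proof -
  obtain w where w: "basis of_int n w S" using lat_basis[OF korderD(1)[OF S]] by blast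
  have "\<forall>i. \<exists>c. h i = comb of_int n w c" using of_int_hom.basis_obtain[OF w h] by blast
  then obtain c where c: "\<And>i. h i = comb of_int n w (c i)" by metis
  let ?g = "\<lambda>i. \<lambda>j\<in>{..<n}. c i j mod d"
  have fin: "finite ({..<n} \<rightarrow>\<^sub>E {0..<d})" by (intro finite_PiE) auto
  have "?g ` UNIV \<subseteq> {..<n} \<rightarrow>\<^sub>E {0..<d}" using d by (auto intro!: restrict_PiE_iff[THEN iffD2])
  then have "finite (range ?g)" using fin finite_subset by blast
  then have "\<not> inj ?g" using finite_imageD[of ?g UNIV] infinite_UNIV_nat by blast
  then obtain a b where ab: "a < b" "?g a = ?g b"
    by (metis (mono_tags, lifting) injI linorder_neqE_nat)
  have "c b j = c a j + d * ((c b j - c a j) div d)" if "j < n" for j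
  proof -
    have "c a j mod d = c b j mod d" using fun_cong[OF ab(2), of j] that by simp
    then have "d dvd c b j - c a j" by (metis mod_eq_dvd_iff)
    then show ?thesis by simp
  qed
  then have "h b = comb of_int n w (\<lambda>j. c a j + d * ((c b j - c a j) div d))"
    unfolding c by (intro of_int_hom.comb_cong) auto
  also have "\<dots> = h a + of_int d * comb of_int n w (\<lambda>j. (c b j - c a j) div d)"
    unfolding c of_int_hom.comb_scale of_int_hom.comb_add ..
  finally show ?thesis using ab(1) of_int_hom.basis_mem[OF w]
    by (intro exI[of _ a] exI[of _ b]) (auto intro!: bexI[of _ "comb of_int n w (\<lambda>j. (c b j - c a j) div d)"])
qed

definition "dmult d S = {of_int d * s | s. s \<in> S}"

lemma dmult_asub: "asub S \<Longrightarrow> asub (dmult d S)"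
proof -
  assume S: "asub S"
  show ?thesis unfolding asub_def dmult_def
  proof (intro conjI ballI)
    show "0 \<in> {of_int d * s |s. s \<in> S}" using asub_0[OF S] by force
    fix x y assume "x \<in> {of_int d * s |s. s \<in> S}" "y \<in> {of_int d * s |s. s \<in> S}"
    then show "x - y \<in> {of_int d * s |s. s \<in> S}"
      using asub_diff[OF S] by (auto simp flip: right_diff_distrib)
  qed
qed

lemma dmult_scale:
  assumes "korder S" "x \<in> S" "y \<in> dmult d S" shows "x * y \<in> dmult d S"
proof -
  obtain s where s: "s \<in> S" "y = of_int d * s" using assms by (auto simp: dmult_def)
  then have "x * y = of_int d * (x * s)" by (simp add: ac_simps)
  then show ?thesis using korderD(4)[OF assms(1,2) s(1)] unfolding dmult_def by blast
qed

text \<open>The powers of \<open>t\<close> become periodic modulo \<open>d\<close>, so some power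
  \<open>e = t ^ k\<close> is idempotent there. It is a multiple of \<open>t\<close>, and by the
  geometric sum \<open>1 - t ^ k\<close> is a multiple of \<open>1 - t\<close>.\<close>

lemma order_exchange:
  assumes S: "korder S" and d: "d > 0" and t: "t \<in> S"
  shows "\<exists>e\<in>S. e * e - e \<in> dmult d S \<and> (\<exists>u\<in>S. e - t * u \<in> dmult d S) \<and> (\<exists>u\<in>S. (1 - e) - (1 - t) * u \<in> dmult d S)"
proof -
  note o = korderD[OF S]
  have tp: "t ^ k \<in> S" for k by (induction k) (auto simp: o t)
  obtain a b s where ab: "a < b" and s: "s \<in> S" "t ^ b - t ^ a = of_int d * s"
    using order_pigeonhole[OF S d, of "\<lambda>k. t ^ k"] tp by blast
  let ?D = "dmult d S"
  note D = dmult_asub[OF o(2), of d]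
  have DS: "x * y \<in> ?D" if "x \<in> S" "y \<in> ?D" for x y
    using dmult_scale[OF S that] .
  define c where "c = b - a"
  have step: "t ^ (m + j * c) - t ^ m \<in> ?D" if m: "m \<ge> a" for m j
  proof (induction j)
    case 0 then show ?case using asub_0[OF D] by simp
  next
    case (Suc j)
    have "t ^ (m + Suc j * c) - t ^ (m + j * c) = t ^ (m - a + j * c) * (t ^ b - t ^ a)"
    proof -
      have "m + Suc j * c = (m - a + j * c) + b" "m + j * c = (m - a + j * c) + a" using m ab by (auto simp: c_def)
      then show ?thesis by (metis power_add right_diff_distrib)
    qed
    also have "\<dots> \<in> ?D" by (intro DS tp) (use s in \<open>auto simp: dmult_def\<close>)
    finally show ?case using asub_add[OF D _ Suc] by fastforce
  qed
  \<comment> \<open>\<open>c\<close> is a period of the powers of \<open>t\<close> from exponent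
    \<open>a\<close> on. The factor \<open>Suc a\<close> makes \<open>k\<close> a positive multiple
    of \<open>c\<close> that is at least \<open>a\<close>, so that doubling the exponent
    \<open>k\<close> changes nothing modulo \<open>d\<close>.\<close>
  define k where "k = Suc a * c"
  have "c \<ge> 1" using ab by (simp add: c_def)
  then have k: "k \<ge> a" "k > 0" using mult_le_mono2[of 1 c "Suc a"] by (simp_all add: k_def)
  have "t ^ k * t ^ k - t ^ k \<in> ?D" using step[OF k(1), of "Suc a"] by (simp add: k_def power_add)
  moreover have "t ^ k - t * t ^ (k - 1) = 0" using k by (simp add: power_eq_if)
  moreover have "(1 - t ^ k) - (1 - t) * (\<Sum>i<k. t ^ i) = 0" by (simp add: one_diff_power_eq)
  moreover have "(\<Sum>i<k. t ^ i) \<in> S" by (rule asub_sum[OF o(2)]) (rule tp)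
  ultimately show ?thesis using tp[of k] tp[of "k - 1"] asub_0[OF D]
    by (intro bexI[of _ "t ^ k"] conjI bexI[of _ "t ^ (k - 1)"] bexI[of _ "\<Sum>i<k. t ^ i"]) auto
qed

text \<open>The exact version, with \<open>D\<close> replaced by zero. Separability makes
  \<open>?g = gcd p F\<close> coprime to its cofactor \<open>h\<close>, so \<open>F = ?g * h\<close>
  splits \<open>K\<close> into two factors: on one \<open>t\<close> is a unit, on the other
  \<open>t = 0\<close> and \<open>1 - t = 1\<close>.\<close>

lemma K_exchange:
  assumes t: "t \<in> K"
  shows "\<exists>e\<in>K. e * e - e = 0 \<and> (\<exists>u\<in>K. e - t * u = 0) \<and> (\<exists>u\<in>K. (1 - e) - (1 - t) * u = 0)"
proof -
  obtain p where p: "t = io p" using t by (auto simp: K_def)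
  let ?g = "gcd p F"
  obtain h where h: "F = ?g * h" by (metis dvd_def gcd_dvd2)
  have "coprime ?g h"
  proof -
    obtain a b where ab: "a * F + b * pderiv F = 1" using sep by blast
    have pF: "pderiv F = ?g * pderiv h + h * pderiv ?g" by (subst h) (simp add: pderiv_mult)
    have "is_unit c" if "c dvd ?g" "c dvd h" for c
    proof -
      have "c dvd a * F + b * pderiv F"
        unfolding pF using that h by (metis dvd_add dvd_mult dvd_mult2)
      then show ?thesis using ab by simp
    qed
    then show ?thesis by (rule coprimeI)
  qed
  then obtain a b where "a * ?g + b * h = 1" using bezout_coefficients_fst_snd[of ?g h] coprime_imp_gcd_eq_1 by metis
  note ab = this
  obtain x y where xy: "x * p + y * F = ?g" using bezout_coefficients_fst_snd by blast
  have gh: "io ?g * io h = 0" using h io_zero_iff[of F] by (metis dvd_refl io.hom_mult)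
  have F0': "io F = 0" by (simp add: io_zero_iff)
  have g: "io ?g = io x * t" using arg_cong[OF xy, of io] by (simp add: io.hom_add io.hom_mult F0' p)
  have one: "io a * io ?g + io b * io h = 1" using arg_cong[OF ab, of io] by (simp add: io.hom_add io.hom_mult)
  obtain p' where p': "p = ?g * p'" by (metis dvd_def gcd_dvd1)
  have tg: "t = io ?g * io p'" using p' p by (metis io.hom_mult)
  define e where "e = io a * io ?g"
  have e1: "1 - e = io b * io h" using one by (simp add: e_def algebra_simps)
  have th: "t * io h = 0"
    unfolding tg using gh by (metis mult.assoc mult.commute mult_zero_left)
  have "e * e - e = - (e * (1 - e))" by (simp add: algebra_simps)
  also have "\<dots> = 0" unfolding e1 using gh by (simp add: e_def ac_simps)
  finally have "e * e - e = 0" .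
  moreover have "e - t * (io a * io x) = 0" by (simp add: e_def g ac_simps)
  moreover have "(1 - e) - (1 - t) * (1 - e) = 0" unfolding e1 using th by (simp add: algebra_simps)
  moreover have "e \<in> K" "io a * io x \<in> K" "1 - e \<in> K" unfolding e_def by (auto intro!: K_closed)
  ultimately show ?thesis by blast
qed

lemma kcol_scale: "korder S \<Longrightarrow> s \<in> S \<Longrightarrow> a \<in> kcol S I \<Longrightarrow> s * a \<in> kcol S I"
  using korderD(4,6)[of S] by (auto simp: kcol_def K_mult mult.assoc)

text \<open>As \<open>I\<close> is invertible, 1 is a sum of products \<open>a * v\<close>, and
  lifting idempotents yields a single such product congruent to 1 modulo \<open>c0 * c1\<close>.
  With \<open>c0\<close> in \<open>J\<close> and \<open>c1\<close> in \<open>(S : J)\<close>, the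
  error is itself a product of an element of \<open>(S : J)\<close> and one of \<open>J\<close>. The
  four elements become the entries of a matrix of determinant 1 in
  \<open>chain_normal_form\<close>.\<close>

lemma steinitz_unimodular:
  assumes S: "korder S" and I: "lat I" "\<And>s y. s \<in> S \<Longrightarrow> y \<in> I \<Longrightarrow> s * y \<in> I" "1 \<in> kprod I (kcol S I)"
    and J: "lat J" "\<And>s y. s \<in> S \<Longrightarrow> y \<in> J \<Longrightarrow> s * y \<in> J"
  shows "\<exists>a\<in>kcol S I. \<exists>v\<in>I. \<exists>b\<in>kcol S J. \<exists>c\<in>J. a * v + b * c = 1"
proof -
  note o = korderD[OF S] and lI = latD[OF I(1)]
  note lA = latD[OF lat_kcol[OF o(1) I(1)]] and lB = latD[OF lat_kcol[OF o(1) J(1)]]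
  obtain c0 where c0: "c0 > 0" "of_int c0 \<in> J" using latD(4)[OF J(1)] by blast
  obtain c1 where c1: "c1 > 0" "of_int c1 \<in> kcol S J" using lB(4) by blast
  let ?d = "c0 * c1"
  let ?D = "dmult ?d S"
  have A_S: "a * v \<in> S" if "a \<in> kcol S I" "v \<in> I" for a v using that by (simp add: kcol_def)
  have SA: "s * a \<in> kcol S I" if "a \<in> kcol S I" "s \<in> S" for a s
    using kcol_scale[OF S that(2,1)] .
  note D = dmult_asub[OF o(2), of ?d]
  have DS: "x * y \<in> ?D" if "x \<in> S" "y \<in> ?D" for x y
    using dmult_scale[OF S that] .
  define G where "G = {a * v | a v. a \<in> kcol S I \<and> v \<in> I}"
  obtain r :: nat and y a where ya: "\<And>l. l < r \<Longrightarrow> y l \<in> I" "\<And>l. l < r \<Longrightarrow> a l \<in> kcol S I" "1 = (\<Sum>l<r. y l * a l)"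
    using I(3) by (rule kprod_obtain_sum) blast
  have "\<exists>g\<in>G. g - 1 \<in> ?D"
  proof (rule lift_idempotent[OF o(2-4) D DS])
    show "\<exists>e\<in>S. e * e - e \<in> ?D \<and> (\<exists>u\<in>S. e - t * u \<in> ?D) \<and> (\<exists>u\<in>S. (1 - e) - (1 - t) * u \<in> ?D)" if "t \<in> S" for t
      using order_exchange[OF S _ that, of ?d] c0 c1 by simp
    show "G \<subseteq> S" using A_S by (auto simp: G_def)
    show "0 \<in> G" unfolding G_def using asub_0[OF lA(2)] asub_0[OF lI(2)] by force
    show "s * g \<in> G" if "g \<in> G" "s \<in> S" for g s
    proof -
      obtain a v where "g = a * v" "a \<in> kcol S I" "v \<in> I" using \<open>g \<in> G\<close> by (auto simp: G_def)
      then have "s * g = a * (s * v)" "a \<in> kcol S I" "s * v \<in> I" using I(2) that by (auto simp: ac_simps)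
      then show ?thesis unfolding G_def by blast
    qed
    fix g h e e' assume g: "g \<in> G" and h: "h \<in> G" and e: "e \<in> S" "e' \<in> S" "e * e' \<in> ?D"
    obtain a v where av: "g = a * v" "a \<in> kcol S I" "v \<in> I" using g by (auto simp: G_def)
    obtain b w where bw: "h = b * w" "b \<in> kcol S I" "w \<in> I" using h by (auto simp: G_def)
    \<comment> \<open>Single products need not be closed under addition. Multiplying the two
      combined factors gives the desired sum and a cross term with the factor \<open>e * e'\<close>,
      which lies in \<open>?D\<close>.\<close>
    have "(e * a + e' * b) * (e * v + e' * w) \<in> G"
    proof -
      have "e * a + e' * b \<in> kcol S I" "e * v + e' * w \<in> I"
        using asub_add[OF lA(2) SA[OF av(2) e(1)] SA[OF bw(2) e(2)]]
          asub_add[OF lI(2) I(2)[OF e(1) av(3)] I(2)[OF e(2) bw(3)]] by simp_all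
      then show ?thesis unfolding G_def by blast
    qed
    moreover have "(e * a + e' * b) * (e * v + e' * w) - (e * e * g + e' * e' * h) = (a * w + b * v) * (e * e')"
      by (simp add: av bw algebra_simps)
    moreover have "(a * w + b * v) * (e * e') \<in> ?D" 
      using DS[OF asub_add[OF o(2) A_S[OF av(2) bw(3)] A_S[OF bw(2) av(3)]] e(3)] .
    ultimately show "\<exists>k\<in>G. k - (e * e * g + e' * e' * h) \<in> ?D" by metis
  next
    show "(\<lambda>l. a l * y l) l \<in> G" if "l < r" for l using ya that by (auto simp: G_def)
    have "1 - (\<Sum>l<r. a l * y l) = 0" unfolding ya(3) by (simp add: mult.commute)
    then show "1 - (\<Sum>l<r. a l * y l) \<in> ?D" using asub_0[OF D] by simp
  qed (use o asub_0[OF D] in auto)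
  then obtain a v s where av: "a \<in> kcol S I" "v \<in> I" "s \<in> S" "a * v - 1 = of_int ?d * s"
    unfolding G_def dmult_def by blast
  have "(- s) * of_int c1 \<in> kcol S J"
    using kcol_scale[OF S asub_neg[OF o(2) av(3)] c1(2)] .
  moreover have "a * v + ((- s) * of_int c1) * of_int c0 = 1"
    using av(4) by (simp add: algebra_simps)
  ultimately show ?thesis using av c0 by blast
qed

end

section \<open>Matrices of fractional ideals\<close>

abbreviation "cpoly \<equiv> (map_poly of_rat :: rat poly \<Rightarrow> complex poly)"

text \<open>A root of the cofactor \<open>h\<close> of \<open>gcd F q\<close> would be a root of
  \<open>F\<close>, hence of \<open>q\<close> and of the gcd, and so a double root of
  \<open>F\<close>, against \<open>sep\<close>. By the fundamental theorem of algebra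
  \<open>h\<close> is then constant.\<close>

lemma separable_dvd_by_roots:
  fixes F q :: "rat poly"
  assumes sep: "a * F + b * pderiv F = 1"
    and roots: "\<And>z. poly (cpoly F) z = 0 \<Longrightarrow> poly (cpoly q) z = 0"
  shows "F dvd q"
proof -
  interpret cp: map_poly_comm_ring_hom "of_rat :: rat \<Rightarrow> complex" ..
  let ?e = "\<lambda>p z. poly (cpoly p) z"
  have e: "?e (p * r) z = ?e p z * ?e r z" "?e (p + r) z = ?e p z + ?e r z" "?e 1 z = 1" for p r z
    by (simp_all add: cp.hom_mult cp.hom_add)
  let ?g = "gcd F q"
  obtain h where h: "F = ?g * h" by (metis dvd_def gcd_dvd1)
  obtain x y where xy: "x * F + y * q = ?g" using bezout_coefficients_fst_snd by blast
  have "F \<noteq> 0" using sep by auto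
  then have h0: "h \<noteq> 0" using h by auto
  have "degree h = 0"
  proof (rule ccontr)
    assume "degree h \<noteq> 0"
    then have "degree (cpoly h) \<noteq> 0" by simp
    then have "\<not> constant (poly (cpoly h))" by (simp add: constant_degree)
    then obtain z where z: "?e h z = 0" using fundamental_theorem_of_algebra by blast
    have F: "?e F z = 0" using h e(1)[of ?g h z] z by simp
    then have "?e ?g z = 0" using roots[OF F] e(1)[of x F z] e(1)[of y q z] e(2)[of "x * F" "y * q" z] xy by simp
    moreover have "pderiv F = ?g * pderiv h + h * pderiv ?g" by (subst h) (simp add: pderiv_mult)
    ultimately have "?e (pderiv F) z = 0" using z by (simp add: e)
    then have "?e (a * F + b * pderiv F) z = 0" using F by (simp only: e) simp
    then show False using e(3)[of z] sep by simp
  qed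
  then have "h dvd 1" using h0 is_unit_iff_degree by blast
  then have "F dvd ?g" using h by (metis dvd_mult_unit_iff' dvd_refl mult.commute)
  then show ?thesis by (rule dvd_trans) simp
qed

context residue_alg
begin

text \<open>For a root \<open>z\<close> of \<open>F\<close>, evaluation at \<open>z\<close> is well
  defined on \<open>K\<close>, and the values of the \<open>w j\<close> at \<open>z\<close> form an
  eigenvector of the transpose of \<open>A\<close> with eigenvalue \<open>z\<close>. It is nonzero
  because 1 is a combination of the \<open>w j\<close>.\<close>

lemma matrix_root:
  assumes w: "\<And>i. i < m \<Longrightarrow> w i \<in> K" and A: "A \<in> carrier_mat m m"
    and Aw: "\<And>j. j < m \<Longrightarrow> xi * w j = comb qs m w (\<lambda>i. A $$ (i,j))"
    and one: "1 = comb qs m w c"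
  shows "F dvd char_poly A"
proof -
  obtain a b where ab: "a * F + b * pderiv F = 1" using sep by blast
  interpret cp: map_poly_comm_ring_hom "of_rat :: rat \<Rightarrow> complex" ..
  have "\<forall>i. \<exists>p. i < m \<longrightarrow> w i = io p" using w by (auto simp: K_def)
  then obtain p where p: "\<And>i. i < m \<Longrightarrow> w i = io (p i)" by metis
  have qio: "qs q * io r = io (smult q r)" for q r by (simp add: qs_def flip: io.hom_mult)
  show ?thesis
  proof (rule separable_dvd_by_roots[OF ab])
    fix z assume z: "poly (cpoly F) z = 0"
    have io_eval: "poly (cpoly r) z = poly (cpoly s) z" if "io r = io s" for r s
    proof -
      from that obtain k where "r - s = F * k" unfolding io_eq_iff by (auto simp: dvd_def)
      then have "r = s + F * k" by (simp add: algebra_simps)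
      then show ?thesis using z by (simp add: cp.hom_add cp.hom_mult)
    qed
    have comb_io: "comb qs m w g = io (\<Sum>i<m. smult (g i) (p i))" for g
      unfolding comb_def io.hom_sum using p qio by (intro sum.cong) auto
    have ev_sum: "poly (cpoly (\<Sum>i<m. smult (g i) (p i))) z = (\<Sum>i<m. of_rat (g i) * poly (cpoly (p i)) z)" for g
      by (simp add: cp.hom_sum poly_sum of_rat_hom.map_poly_hom_smult)
    define v where "v = vec m (\<lambda>i. poly (cpoly (p i)) z)"
    let ?A = "map_mat of_rat A :: complex mat"
    have At: "transpose_mat ?A \<in> carrier_mat m m" using A by simp
    have eq: "(\<Sum>i<m. of_rat (A $$ (i,j)) * poly (cpoly (p i)) z) = z * poly (cpoly (p j)) z" if j: "j < m" for j
    proof -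
      have "io ([:0,1:] * p j) = io (\<Sum>i<m. smult (A $$ (i,j)) (p i))"
        using Aw[OF j] p[OF j] unfolding comb_io xi_def by (simp only: io.hom_mult)
      from io_eval[OF this] have "poly (cpoly [:0,1:] * cpoly (p j)) z = (\<Sum>i<m. of_rat (A $$ (i,j)) * poly (cpoly (p i)) z)"
        unfolding ev_sum by (simp only: cp.hom_mult)
      then show ?thesis by simp
    qed
    have "v \<noteq> 0\<^sub>v m"
    proof
      assume v0: "v = 0\<^sub>v m"
      have "poly (cpoly (p i)) z = 0" if "i < m" for i
        using arg_cong[OF v0, of "\<lambda>v. vec_index v i"] that by (simp add: v_def)
      then have "poly (cpoly (\<Sum>i<m. smult (c i) (p i))) z = 0" unfolding ev_sum by simp
      moreover have "io 1 = io (\<Sum>i<m. smult (c i) (p i))" using one unfolding comb_io io.hom_one .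
      ultimately show False using io_eval[of 1 "\<Sum>i<m. smult (c i) (p i)"] by simp
    qed
    moreover have "transpose_mat ?A *\<^sub>v v = z \<cdot>\<^sub>v v"
      using A eq by (intro eq_vecI) (auto simp: v_def scalar_prod_def atLeast0LessThan)
    ultimately have "eigenvector (transpose_mat ?A) v z"
      using A by (simp add: eigenvector_def v_def)
    then have "eigenvalue (transpose_mat ?A) z" by (auto simp: eigenvalue_def)
    then have "poly (char_poly (transpose_mat ?A)) z = 0" using eigenvalue_root_char_poly[OF At] by blast
    then show "poly (cpoly (char_poly A)) z = 0"
      using A by (simp add: of_rat_hom.char_poly_hom)
  qed
qed

text \<open>\<open>F\<close> divides the characteristic polynomial of \<open>xi\<close> on
  \<open>I\<close>, and both are monic of degree \<open>n\<close>.\<close>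

lemma ideal_rep:
  assumes I: "lat I"
  shows "\<exists>w A. rep of_int ((*) xi) I n w A \<and> char_poly A = f"
proof -
  note l = latD[OF I]
  obtain w where w: "basis of_int n w I" "basis qs n w K" using lat_basis[OF I] by blast
  obtain A where A: "rep of_int ((*) xi) I n w A"
    using rep_exists[OF of_int_hom.comm_ring_hom_axioms w(1)] l(3) by blast
  have Ac: "A \<in> carrier_mat n n" using A by (simp add: rep_def)
  let ?A = "map_mat rat_of_int A"
  obtain c where c: "1 = comb qs n w c" using qs.basis_obtain[OF w(2) K_1] by blast
  have "F dvd char_poly ?A"
  proof (rule matrix_root[OF _ _ _ c])
    show "w i \<in> K" if "i < n" for i using qs.basis_vec[OF w(2) that] .
    show "?A \<in> carrier_mat n n" using Ac by simp
    fix j assume j: "j < n"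
    have "comb of_int n w (\<lambda>i. A $$ (i,j)) = comb qs n w (\<lambda>i. ?A $$ (i,j))"
      using Ac j unfolding comb_def by (intro sum.cong) (auto simp: qs.hom_of_int)
    then show "xi * w j = comb qs n w (\<lambda>i. ?A $$ (i,j))" using A j by (simp add: rep_def)
  qed
  then obtain h where h: "char_poly ?A = F * h" by (auto simp: dvd_def)
  have d: "degree (char_poly ?A) = n" "lead_coeff (char_poly ?A) = 1"
    using degree_monic_char_poly[of ?A n] Ac by auto
  then have h0: "h \<noteq> 0" using h by auto
  then have "degree h = 0" using d(1) F0 degF unfolding h by (simp add: degree_mult_eq)
  moreover have "lead_coeff h = 1" using d(2) monic_F unfolding h lead_coeff_mult by simp
  ultimately have "h = 1" using monic_degree_0 by blast
  then have "map_poly rat_of_int (char_poly A) = map_poly rat_of_int f"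
    using h of_int_hom.char_poly_hom[OF Ac] by (metis mult.right_neutral)
  then have "char_poly A = f" by simp
  then show ?thesis using A by blast
qed

text \<open>The preimage of \<open>a\<close> in the polynomial ring is generated by a divisor
  \<open>g\<close> of \<open>F = g * h\<close>. Then \<open>io h\<close> annihilates
  \<open>a\<close>, so it is zero, \<open>F\<close> divides \<open>h\<close>, and \<open>g\<close>
  is a unit. For a product of fields this says that a faithful ideal is everything.\<close>

lemma ideal_one:
  assumes a: "asub a" "a \<subseteq> K" "\<And>k y. k \<in> K \<Longrightarrow> y \<in> a \<Longrightarrow> k * y \<in> a"
    and ann: "\<And>y. y \<in> K \<Longrightarrow> (\<And>z. z \<in> a \<Longrightarrow> y * z = 0) \<Longrightarrow> y = 0"
  shows "1 \<in> a"
proof -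
  define P where "P = {p. io p \<in> a}"
  have FP: "F \<in> P" using io_zero_iff[of F] asub_0[OF a(1)] by (simp add: P_def)
  then have ex: "\<exists>d. \<exists>p\<in>P. p \<noteq> 0 \<and> degree p = d" using F0 by blast
  define d where "d = (LEAST d. \<exists>p\<in>P. p \<noteq> 0 \<and> degree p = d)"
  obtain g where g: "g \<in> P" "g \<noteq> 0" "degree g = d" using LeastI_ex[OF ex] by (auto simp: d_def)
  have min: "d \<le> degree p" if "p \<in> P" "p \<noteq> 0" for p
    unfolding d_def by (rule Least_le) (use that in blast)
  have gd: "g dvd p" if p: "p \<in> P" for p
  proof -
    have "p mod g = p - (p div g) * g" by (simp add: minus_div_mult_eq_mod)
    then have "io (p mod g) = io p - io (p div g) * io g" by (simp add: io.hom_minus io.hom_mult)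
    then have "p mod g \<in> P" using p g a K_I asub_diff[OF a(1)] by (auto simp: P_def)
    then have "p mod g = 0" using min[of "p mod g"] degree_mod_less[OF g(2), of p] g(3) by force
    then show ?thesis by auto
  qed
  obtain h where h: "F = g * h" using gd[OF FP] by (auto simp: dvd_def)
  have "io h = 0"
  proof (rule ann[OF K_I])
    fix z assume z: "z \<in> a"
    then obtain p where p: "z = io p" using a(2) by (auto simp: K_def)
    then have "p \<in> P" using z by (simp add: P_def)
    then obtain q where "p = g * q" using gd by (auto simp: dvd_def)
    then have "h * p = F * q" using h by simp
    then have "io (h * p) = 0" using io_zero_iff[of "h * p"] by simp
    then show "io h * z = 0" by (simp add: p io.hom_mult)
  qed
  then have "F dvd h" by (simp add: io_zero_iff)
  then have "degree F \<le> degree h" using h F0 by (intro dvd_imp_degree_le) auto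
  moreover have "degree F = degree g + degree h" using h F0 by (metis degree_mult_eq mult_eq_0_iff)
  ultimately have "is_unit g" using g(2) by (simp add: is_unit_iff_degree)
  then obtain k where "g * k = 1" by (auto simp: dvd_def)
  then have "io k * io g = 1" by (metis io.hom_mult io.hom_one mult.commute)
  then show ?thesis using a(3)[OF K_I, of "io g" k] g(1) by (simp add: P_def)
qed

end

section \<open>Lattices over \<open>R\<close> and their linear forms\<close>

text \<open>The operator and its ambient type are left open because two instances are needed: an
  integer matrix acting on rational columns, and multiplication by \<open>xi\<close> on tuples over
  \<open>K\<close>.\<close>

locale op_module = residue_alg f io for f and io :: "rat poly \<Rightarrow> 'k::comm_ring_1" +
  fixes rho :: "rat \<Rightarrow> 'v::comm_ring_1" and T :: "'v \<Rightarrow> 'v"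
  assumes rho_hom: "comm_ring_hom rho" and T_lin: "linmap rho T"
begin

sublocale rho: comm_ring_hom rho by (rule rho_hom)

lemma T_add: "T (u + v) = T u + T v" and T_rho: "T (rho c * v) = rho c * T v"
  using T_lin by (auto simp: linmap_def)

lemma T_0: "T 0 = 0" using T_add[of 0 0] by simp

lemma T_pow_add: "(T ^^ k) (u + v) = (T ^^ k) u + (T ^^ k) v" and T_pow_rho: "(T ^^ k) (rho c * v) = rho c * (T ^^ k) v"
  by (induction k) (auto simp: T_add T_rho)

lemma T_int: "linmap of_int T"
  unfolding linmap_def using T_add T_rho[of "of_int _"] by (auto simp: rho.hom_of_int)

definition "pact p v = (\<Sum>k\<le>degree p. rho (coeff p k) * (T ^^ k) v)"

lemma pact_le: "degree p \<le> m \<Longrightarrow> pact p v = (\<Sum>k\<le>m. rho (coeff p k) * (T ^^ k) v)"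
  unfolding pact_def by (rule sum.mono_neutral_left) (auto simp: coeff_eq_0)

lemma pact_add: "pact (p + q) v = pact p v + pact q v"
  using pact_le[of p "max (degree p) (degree q)"] pact_le[of q "max (degree p) (degree q)"]
    pact_le[of "p + q" "max (degree p) (degree q)"] degree_add_le_max[of p q]
  by (simp add: rho.hom_add distrib_right sum.distrib)

lemma pact_smult: "pact (smult a p) v = rho a * pact p v"
  using pact_le[of "smult a p" "degree p"] by (simp add: pact_def sum_distrib_left rho.hom_mult mult.assoc)

lemma pact_0: "pact 0 v = 0" and pact_1: "pact 1 v = v" and pact_xi: "pact [:0,1:] v = T v"
  by (simp_all add: pact_def)

lemma pact_right_add: "pact p (u + v) = pact p u + pact p v"
  by (simp add: pact_def T_pow_add distrib_left sum.distrib)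

lemma pact_right_rho: "pact p (rho c * v) = rho c * pact p v"
  by (simp add: pact_def T_pow_rho sum_distrib_left mult.left_commute)

lemma pact_monom: "pact (monom a k) v = rho a * (T ^^ k) v"
proof -
  have "pact (monom a k) v = (\<Sum>i\<le>k. rho (coeff (monom a k) i) * (T ^^ i) v)"
    by (rule pact_le) (rule degree_monom_le)
  also have "\<dots> = (\<Sum>i\<le>k. if i = k then rho a * (T ^^ i) v else 0)"
    by (intro sum.cong) auto
  finally show ?thesis by simp
qed

lemma pact_mult_xi: "pact (pCons 0 p) v = T (pact p v)"
proof (induction p)
  case (pCons a p)
  have T_sum: "T (\<Sum>i\<in>A. g i) = (\<Sum>i\<in>A. T (g i))" for A :: "nat set" and g
    by (induction A rule: infinite_finite_induct) (auto simp: T_0 T_add)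
  have "pact (pCons 0 q) v = T (pact q v)" for q
  proof -
    have "pact (pCons 0 q) v = (\<Sum>k\<le>Suc (degree q). rho (coeff (pCons 0 q) k) * (T ^^ k) v)"
      by (rule pact_le) (rule degree_pCons_le)
    also have "\<dots> = (\<Sum>k\<le>degree q. rho (coeff q k) * T ((T ^^ k) v))"
      by (subst sum.atMost_Suc_shift) simp
    finally show ?thesis by (simp add: pact_def T_sum T_rho)
  qed
  then show ?case .
qed (simp add: pact_0 T_0)

lemma pact_mult: "pact (p * q) v = pact p (pact q v)"
proof (induction p)
  case 0 then show ?case by (simp add: pact_0)
next
  case (pCons a p)
  have "pact (pCons a p) u = rho a * u + T (pact p u)" for u
  proof -
    have e: "pCons a p = smult a 1 + pCons 0 p" by (rule poly_eqI) (simp add: coeff_pCons split: nat.split)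
    show ?thesis by (subst e) (simp only: pact_add pact_smult pact_1 pact_mult_xi)
  qed
  then show ?case using pCons by (simp add: pact_add pact_smult pact_mult_xi)
qed

lemma pact_right_0: "pact p 0 = 0" using pact_right_add[of p 0 0] by simp

lemma pact_right_sum: "pact p (\<Sum>i\<in>A. g i) = (\<Sum>i\<in>A. pact p (g i))"
  by (induction A rule: infinite_finite_induct) (auto simp: pact_right_0 pact_right_add)

lemma pact_int: "pact (map_poly rat_of_int p) v \<in> L" if L: "asub L" "T ` L \<subseteq> L" "v \<in> L"
proof -
  have "(T ^^ k) v \<in> L" for k by (induction k) (use L in auto)
  then show ?thesis unfolding pact_def
    by (intro asub_sum[OF L(1)]) (simp add: rho.hom_of_int asub_of_int[OF L(1)])
qed

end

lemma int_divisible_powers: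
  fixes c d :: int
  assumes "d \<ge> 2" "\<And>k. d ^ k dvd c" shows "c = 0"
proof (rule ccontr)
  assume c: "c \<noteq> 0"
  have "\<bar>c\<bar> < 2 ^ nat \<bar>c\<bar>" using of_nat_less_two_power[of "nat \<bar>c\<bar>", where ?'a = int] by simp
  also have "\<dots> \<le> d ^ nat \<bar>c\<bar>" using assms(1) by (intro power_mono) auto
  also have "\<dots> \<le> \<bar>c\<bar>" using dvd_imp_le_int[OF c assms(2)[of "nat \<bar>c\<bar>"]] assms(1) by simp
  finally show False by simp
qed

context residue_alg
begin

lemma lam_eqI:
  assumes "x \<in> K" "y \<in> K" "\<And>z. z \<in> K \<Longrightarrow> lam (z * x) = lam (z * y)" shows "x = y"
proof -
  have "x - y = 0"
  proof (rule lam_nondeg[OF K_diff[OF assms(1,2)]])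
    fix z assume z: "z \<in> K"
    have "(x - y) * z = z * x - z * y" by (simp add: algebra_simps)
    then show "lam ((x - y) * z) = 0" using assms z by (simp add: lam_diff K_mult)
  qed
  then show ?thesis by simp
qed

text \<open>Each coordinate in an integral basis of \<open>S\<close> is an integer divisible by all
  powers of \<open>d\<close>.\<close>

lemma order_no_infinite_divisibility:
  assumes S: "korder S" and d: "d \<ge> 2" and z: "z \<in> S" "\<And>k. \<exists>s\<in>S. z = of_int (d ^ k) * s"
  shows "z = 0"
proof -
  obtain w where w: "basis of_int n w S" using lat_basis[OF korderD(1)[OF S]] by blast
  obtain c where c: "z = comb of_int n w c" using of_int_hom.basis_obtain[OF w z(1)] by blast
  have "c i = 0" if i: "i < n" for i
  proof (rule int_divisible_powers[OF d])
    fix k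
    obtain s where s: "s \<in> S" "z = of_int (d ^ k) * s" using z(2) by blast
    obtain e where e: "s = comb of_int n w e" using of_int_hom.basis_obtain[OF w s(1)] by blast
    have "comb of_int n w c = comb of_int n w (\<lambda>i. d ^ k * e i)"
      using s(2) unfolding e c of_int_hom.comb_scale .
    from of_int_hom.basis_inj[OF w this i] show "d ^ k dvd c i" by simp
  qed
  then have "comb of_int n w c = comb of_int n w (\<lambda>_. 0)" by (intro of_int_hom.comb_cong) auto
  then show ?thesis by (simp add: c of_int_hom.comb_zero)
qed

text \<open>The ideal generated by a regular element is faithful, so \<open>ideal_one\<close>
  applies.\<close>

lemma unit_if_regular:
  assumes a: "a \<in> K" "\<And>z. z \<in> K \<Longrightarrow> a * z = 0 \<Longrightarrow> z = 0"
  shows "\<exists>b\<in>K. a * b = 1"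
proof -
  have "1 \<in> {a * b | b. b \<in> K}"
  proof (rule ideal_one)
    show "asub {a * b |b. b \<in> K}" unfolding asub_def
    proof (intro conjI ballI)
      show "0 \<in> {a * b |b. b \<in> K}" using K_0 by force
      fix x y assume "x \<in> {a * b |b. b \<in> K}" "y \<in> {a * b |b. b \<in> K}"
      then show "x - y \<in> {a * b |b. b \<in> K}" using K_diff by (auto simp flip: right_diff_distrib)
    qed
    show "{a * b |b. b \<in> K} \<subseteq> K" using a K_mult by auto
    fix k y assume "k \<in> K" "y \<in> {a * b |b. b \<in> K}"
    then show "k * y \<in> {a * b |b. b \<in> K}" using K_mult by (auto simp: mult.left_commute)
  next
    fix y assume y: "y \<in> K" "\<And>z. z \<in> {a * b |b. b \<in> K} \<Longrightarrow> y * z = 0"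
    have "a * 1 \<in> {a * b |b. b \<in> K}" using K_1 by blast
    from y(2)[OF this] have "a * y = 0" by (simp add: mult.commute)
    then show "y = 0" using a y by blast
  qed
  then show ?thesis by auto
qed

end

section \<open>Lattices, their rational spans and the action of \<open>K\<close>\<close>

locale op_sub = op_module f io rho T for f and io :: "rat poly \<Rightarrow> 'k::comm_ring_1"
    and rho :: "rat \<Rightarrow> 'v::comm_ring_1" and T +
  fixes L :: "'v set" and m :: nat and w :: "nat \<Rightarrow> 'v"
  assumes bL: "basis of_int m w L" and TL: "T ` L \<subseteq> L"
begin

definition "V = range (comb rho m w)"

lemma L_asub: "asub L" using of_int_hom.basis_asub[OF bL] .

lemma comb_int_rho: "comb of_int m w c = comb rho m w (\<lambda>i. of_int (c i))"
  by (simp add: comb_def rho.hom_of_int)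

lemma bV: "basis rho m w V" unfolding basis_def
proof (intro conjI allI impI)
  show "V = range (comb rho m w)" by (simp add: V_def)
  fix q i assume 0: "comb rho m w q = 0" and i: "i < m"
  obtain N where N: "N > 0" "\<forall>i<m. of_int N * q i \<in> \<int>" using common_denominator by blast
  then have "\<forall>j. \<exists>g. j < m \<longrightarrow> of_int N * q j = of_int g" by (auto elim: Ints_cases)
  then obtain g where g: "\<And>j. j < m \<Longrightarrow> of_int N * q j = of_int (g j)" by metis
  have "comb of_int m w g = rho (of_int N) * comb rho m w q"
    unfolding comb_int_rho rho.comb_scale using g by (intro rho.comb_cong) auto
  then have "g i = 0" using bL i 0 unfolding basis_def by auto
  then show "q i = 0" using g[OF i] N by simp
qed

lemma V_asub: "asub V" using rho.basis_asub[OF bV] .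
lemma V_rho: "v \<in> V \<Longrightarrow> rho q * v \<in> V" unfolding V_def using rho.comb_scale by auto
lemma L_V: "v \<in> L \<Longrightarrow> v \<in> V" using bL comb_int_rho unfolding basis_def V_def by auto
lemma wL: "i < m \<Longrightarrow> w i \<in> L" using of_int_hom.basis_vec[OF bL] .
lemma L_T: "v \<in> L \<Longrightarrow> T v \<in> L" using TL by blast

lemma V_comb: "(\<And>i. i < m \<Longrightarrow> g i \<in> V) \<Longrightarrow> comb rho m g c \<in> V"
  unfolding comb_def by (intro asub_sum[OF V_asub] V_rho) auto

lemma V_T: "v \<in> V \<Longrightarrow> T v \<in> V"
proof -
  assume "v \<in> V"
  then obtain c where "v = comb rho m w c" by (auto simp: V_def)
  then have "T v = comb rho m (\<lambda>i. T (w i)) c" using rho.linmap_comb[OF T_lin] by simp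
  then show ?thesis using V_comb wL L_T L_V by simp
qed

lemma pact_V: "v \<in> V \<Longrightarrow> pact p v \<in> V"
proof -
  assume "v \<in> V"
  then have "(T ^^ k) v \<in> V" for k by (induction k) (auto simp: V_T)
  then show ?thesis unfolding pact_def by (intro asub_sum[OF V_asub] V_rho) auto
qed

lemma to_L: "v \<in> V \<Longrightarrow> \<exists>e>0. of_int e * v \<in> L"
proof -
  assume "v \<in> V"
  then obtain q where q: "v = comb rho m w q" by (auto simp: V_def)
  obtain N where N: "N > 0" "\<forall>i<m. of_int N * q i \<in> \<int>" using common_denominator by blast
  then have "\<forall>j. \<exists>g. j < m \<longrightarrow> of_int N * q j = of_int g" by (auto elim: Ints_cases)
  then obtain g where g: "\<And>j. j < m \<Longrightarrow> of_int N * q j = of_int (g j)" by metis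
  have "comb of_int m w g = rho (of_int N) * comb rho m w q"
    unfolding comb_int_rho rho.comb_scale using g by (intro rho.comb_cong) auto
  then have "of_int N * v \<in> L" using of_int_hom.basis_mem[OF bL, of g] q by (simp add: rho.hom_of_int)
  then show ?thesis using N by blast
qed

end

locale op_lattice = op_sub +
  assumes FL: "\<And>v. v \<in> L \<Longrightarrow> pact F v = 0"
begin

lemma FV: "v \<in> V \<Longrightarrow> pact F v = 0"
proof -
  assume "v \<in> V"
  then obtain q where "v = comb rho m w q" by (auto simp: V_def)
  then show ?thesis
    unfolding comb_def by (simp add: pact_right_sum pact_right_rho FL wL)
qed

text \<open>The chosen representative is irrelevant on \<open>V\<close>, where multiples of
  \<open>F\<close> act as zero; see \<open>kact_io\<close>.\<close>

definition "kact y v = pact (SOME p. io p = y) v"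

lemma kact_io: "v \<in> V \<Longrightarrow> kact (io p) v = pact p v"
proof -
  assume v: "v \<in> V"
  let ?q = "SOME q. io q = io p"
  have "io ?q = io p" by (rule someI[of "\<lambda>q. io q = io p" p]) simp
  then obtain k where "?q - p = F * k" unfolding io_eq_iff by (auto simp: dvd_def)
  then have "?q = p + F * k" by (simp add: algebra_simps)
  then have "pact ?q v = pact p v + pact F (pact k v)" by (simp only: pact_add pact_mult)
  then show ?thesis using FV pact_V v by (simp add: kact_def)
qed

lemma kact_V: "v \<in> V \<Longrightarrow> kact y v \<in> V" by (simp add: kact_def pact_V)

lemma kact_add_left: "y \<in> K \<Longrightarrow> z \<in> K \<Longrightarrow> v \<in> V \<Longrightarrow> kact (y + z) v = kact y v + kact z v"
  by (auto simp: K_def kact_io pact_add simp flip: io.hom_add)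

lemma kact_mult: "y \<in> K \<Longrightarrow> z \<in> K \<Longrightarrow> v \<in> V \<Longrightarrow> kact (y * z) v = kact y (kact z v)"
  by (auto simp: K_def kact_io pact_mult pact_V simp flip: io.hom_mult)

lemma kact_1: "v \<in> V \<Longrightarrow> kact 1 v = v"
  using kact_io[of v 1] by (simp add: pact_1)

lemma kact_qs: "v \<in> V \<Longrightarrow> kact (qs q) v = rho q * v"
  using kact_io[of v "monom q 0"] by (simp add: qs_def monom_0 pact_monom[of q 0, unfolded monom_0])

lemma kact_xi: "v \<in> V \<Longrightarrow> kact xi v = T v"
  unfolding xi_def using kact_io[of v "[:0,1:]"] by (simp only: pact_xi)

lemma kact_of_int: "v \<in> V \<Longrightarrow> kact (of_int c) v = of_int c * v"
  using kact_qs[of v "of_int c"] by (simp add: qs.hom_of_int rho.hom_of_int)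

lemma kact_diff_left: "y \<in> K \<Longrightarrow> z \<in> K \<Longrightarrow> v \<in> V \<Longrightarrow> kact (y - z) v = kact y v - kact z v"
  using kact_add_left[of "y - z" z v] K_diff[of y z] by simp

lemma kact_add: "kact y (u + v) = kact y u + kact y v"
  by (simp add: kact_def pact_right_add)

lemma kact_sum: "kact y (\<Sum>i\<in>A. g i) = (\<Sum>i\<in>A. kact y (g i))"
  by (simp add: kact_def pact_right_sum)

definition "co v = (SOME c. v = comb rho m w c)"

lemma co: "v \<in> V \<Longrightarrow> v = comb rho m w (co v)"
  unfolding co_def using rho.basis_obtain[OF bV] by (rule someI_ex)

lemma co_unique: "v = comb rho m w c \<Longrightarrow> i < m \<Longrightarrow> co v i = c i"
proof -
  assume v: "v = comb rho m w c" and i: "i < m"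
  have "v \<in> V" using v by (simp add: V_def)
  then have "comb rho m w (co v) = comb rho m w c" using co v by simp
  then show "co v i = c i" using rho.basis_inj[OF bV _ i] by blast
qed

lemma co_add: "u \<in> V \<Longrightarrow> v \<in> V \<Longrightarrow> i < m \<Longrightarrow> co (u + v) i = co u i + co v i"
  using co[of u] co[of v] rho.comb_add[of m w "co u" "co v"] by (intro co_unique) auto

lemma co_rho: "v \<in> V \<Longrightarrow> i < m \<Longrightarrow> co (rho q * v) i = q * co v i"
  using co[of v] rho.comb_scale[of q m w "co v"] by (intro co_unique) auto

lemma co_L: "v \<in> V \<Longrightarrow> v \<in> L \<longleftrightarrow> (\<forall>i<m. co v i \<in> \<int>)"
proof
  assume "v \<in> L"
  then obtain c where "v = comb rho m w (\<lambda>i. of_int (c i))"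
    using of_int_hom.basis_obtain[OF bL] comb_int_rho by metis
  then show "\<forall>i<m. co v i \<in> \<int>" using co_unique by simp
next
  assume v: "v \<in> V" and "\<forall>i<m. co v i \<in> \<int>"
  then have "\<forall>j. \<exists>g. j < m \<longrightarrow> co v j = of_int g" by (auto elim: Ints_cases)
  then obtain g where g: "\<And>j. j < m \<Longrightarrow> co v j = of_int (g j)" by metis
  have "v = comb rho m w (co v)" by (rule co[OF v])
  also have "\<dots> = comb of_int m w g" unfolding comb_int_rho using g by (intro rho.comb_cong) auto
  finally show "v \<in> L" using of_int_hom.basis_mem[OF bL, of g] by simp
qed

lemma co_zero: "v \<in> V \<Longrightarrow> (\<And>i. i < m \<Longrightarrow> co v i = 0) \<Longrightarrow> v = 0"
  using co[of v] rho.comb_cong[of m "co v" "\<lambda>_. 0" w w] by (simp add: rho.comb_zero)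

text \<open>The \<open>i\<close>-th coordinate form on \<open>L\<close>, lifted along \<open>lam\<close> to an \<open>R\<close>-linear form.\<close>

definition "Phi i v = comb qs n bd (\<lambda>j. co (kact (xi ^ j) v) i)"

lemma Phi_K: "Phi i v \<in> K"
  unfolding Phi_def comb_def by (intro asub_sum[OF K_asub] K_closed)

text \<open>The pairing being nondegenerate, this identity characterizes \<open>Phi i v\<close>;
  additivity and \<open>K\<close>-linearity of \<open>Phi i\<close> are deduced from it.\<close>

lemma lam_Phi:
  assumes "i < m" "v \<in> V" "y \<in> K"
  shows "lam (y * Phi i v) = co (kact y v) i"
proof -
  have "co (kact y v) i = lam (Phi i v * y)"
    unfolding Phi_def
  proof (rule lam_represent[OF _ _ assms(3)])
    show "co (kact (y + z) v) i = co (kact y v) i + co (kact z v) i" if "y \<in> K" "z \<in> K" for y z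
      using that assms by (simp add: kact_add_left co_add kact_V)
    show "co (kact (qs q * y) v) i = q * co (kact y v) i" if "y \<in> K" for q y
      using that assms by (simp add: kact_mult K_qs kact_qs kact_V co_rho)
  qed
  then show ?thesis by (simp add: mult.commute)
qed

definition "khom Psi \<longleftrightarrow> (\<forall>v\<in>V. Psi v \<in> K) \<and> (\<forall>u\<in>V. \<forall>v\<in>V. Psi (u + v) = Psi u + Psi v) \<and>
  (\<forall>y\<in>K. \<forall>v\<in>V. Psi (kact y v) = y * Psi v)"

lemma khomD:
  assumes "khom Psi"
  shows "v \<in> V \<Longrightarrow> Psi v \<in> K" "u \<in> V \<Longrightarrow> v \<in> V \<Longrightarrow> Psi (u + v) = Psi u + Psi v"
    "y \<in> K \<Longrightarrow> v \<in> V \<Longrightarrow> Psi (kact y v) = y * Psi v"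
  using assms by (auto simp: khom_def)

lemma Phi_khom: assumes i: "i < m" shows "khom (Phi i)" unfolding khom_def
proof (intro conjI ballI)
  show "Phi i v \<in> K" for v by (rule Phi_K)
  fix u v assume uv: "u \<in> V" "v \<in> V"
  show "Phi i (u + v) = Phi i u + Phi i v"
    using uv i asub_add[OF V_asub]
    by (intro lam_eqI) (auto simp: Phi_K K_add K_mult lam_Phi distrib_left lam_add kact_add co_add kact_V)
next
  fix y v assume y: "y \<in> K" and v: "v \<in> V"
  show "Phi i (kact y v) = y * Phi i v"
  proof (rule lam_eqI)
    fix z assume z: "z \<in> K"
    have "lam (z * (y * Phi i v)) = co (kact (z * y) v) i"
      using lam_Phi[OF i v, of "z * y"] y z by (simp add: K_mult mult.assoc)
    then show "lam (z * Phi i (kact y v)) = lam (z * (y * Phi i v))"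
      using lam_Phi[OF i kact_V[OF v] z] y z v by (simp add: kact_mult)
  qed (use y in \<open>auto simp: Phi_K K_mult\<close>)
qed

lemma khom_scale: "khom Psi \<Longrightarrow> e \<in> K \<Longrightarrow> khom (\<lambda>v. e * Psi v)"
  by (auto simp: khom_def K_mult distrib_left mult.left_commute)

lemma khom_add: "khom Psi \<Longrightarrow> khom Psi' \<Longrightarrow> khom (\<lambda>v. Psi v + Psi' v)"
  by (auto simp: khom_def K_add distrib_left)

text \<open>Values of different forms at different vectors cannot simply be added. The form
  \<open>e P + e' Q\<close> at the vector \<open>e v + e' u\<close> produces the weighted sum up to
  a cross term with the factor \<open>e * e'\<close>, negligible when \<open>e\<close> and
  \<open>e'\<close> are orthogonal modulo \<open>D\<close>. This supplies hypothesis
  \<open>G2\<close> of \<open>lift_idempotent\<close>.\<close>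

lemma khom_cross:
  assumes P: "khom P" "khom Q" and v: "v \<in> V" "u \<in> V" and e: "e \<in> K" "e' \<in> K"
  shows "e * P (kact e v + kact e' u) + e' * Q (kact e v + kact e' u)
    = (e * e * P v + e' * e' * Q u) + (P u + Q v) * (e * e')"
  using assms by (simp add: khomD[OF P(1)] khomD[OF P(2)] kact_V algebra_simps)

definition "mul = {y \<in> K. \<forall>v\<in>L. kact y v \<in> L}"

lemma mulD: "y \<in> mul \<Longrightarrow> y \<in> K" "y \<in> mul \<Longrightarrow> v \<in> L \<Longrightarrow> kact y v \<in> L"
  by (auto simp: mul_def)

lemma R_mul: "R \<subseteq> mul"
proof
  fix r assume r: "r \<in> R"
  then obtain p where p: "r = io (map_poly rat_of_int p)" by (auto simp: R_def)
  then show "r \<in> mul" unfolding mul_def using pact_int[OF L_asub TL] R_K r by (auto simp: kact_io L_V)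
qed

lemma mul_asub: "asub mul" unfolding asub_def
proof (intro conjI ballI)
  show "0 \<in> mul" using R_mul asub_0[OF R_asub] by blast
  fix y z assume "y \<in> mul" "z \<in> mul"
  then show "y - z \<in> mul" unfolding mul_def using asub_diff[OF L_asub] by (auto simp: K_diff kact_diff_left L_V)
qed

lemma mul_mult: "y \<in> mul \<Longrightarrow> z \<in> mul \<Longrightarrow> y * z \<in> mul"
  by (auto simp: mul_def K_mult kact_mult L_V)

end

section \<open>Trace ideals and splitting forms\<close>

locale faithful_lattice = op_lattice +
  assumes faithful: "\<And>y. y \<in> K \<Longrightarrow> (\<And>v. v \<in> L \<Longrightarrow> kact y v = 0) \<Longrightarrow> y = 0"
begin

lemma m_pos: "m > 0"
proof (rule ccontr)
  assume "\<not> m > 0"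
  then have "L = {0}" using bL by (auto simp: basis_def comb_def)
  moreover have "kact 1 0 = 0" using kact_1[of 0] asub_0[OF V_asub] by simp
  ultimately show False using faithful[OF K_1] by auto
qed

text \<open>An element \<open>y\<close> that kills all values \<open>Phi i v\<close> makes every
  coordinate of \<open>kact y v\<close> zero by \<open>lam_Phi\<close>, so it acts as zero and
  vanishes by faithfulness. The ideal is therefore faithful and contains 1.\<close>

lemma one_in_trace_K: "1 \<in> kprod K {Phi i v | i v. i < m \<and> v \<in> V}" (is "1 \<in> kprod K ?A")
proof (rule ideal_one)
  have "Phi 0 0 \<in> ?A" using m_pos asub_0[OF V_asub] by blast
  then show "asub (kprod K ?A)" by (rule kprod_asub[OF K_asub])
  show "kprod K ?A \<subseteq> K" by (rule kprod_subset[OF K_asub]) (auto simp: Phi_K K_mult)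
  show "k * y \<in> kprod K ?A" if "k \<in> K" "y \<in> kprod K ?A" for k y
    using kprod_scale[OF K_mult[OF that(1)] that(2)] .
  fix y assume y: "y \<in> K" and 0: "\<And>z. z \<in> kprod K ?A \<Longrightarrow> y * z = 0"
  show "y = 0"
  proof (rule faithful[OF y])
    fix v assume "v \<in> L"
    then have v: "v \<in> V" by (rule L_V)
    show "kact y v = 0"
    proof (rule co_zero[OF kact_V[OF v]])
      fix i assume i: "i < m"
      have "1 * Phi i v \<in> kprod K ?A" using i v by (intro kprod.mult K_1) blast
      then show "co (kact y v) i = 0" using lam_Phi[OF i v y] 0[of "Phi i v"] by (simp add: lam_0)
    qed
  qed
qed

text \<open>An application of \<open>lift_idempotent\<close> with \<open>S = K\<close> and
  \<open>D = {0}\<close>: in a product of fields the idempotents exist exactly. It compresses the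
  sum of values from \<open>one_in_trace_K\<close> into one value of one form.\<close>

lemma hom_onto_K: "\<exists>Psi. khom Psi \<and> (\<exists>v\<in>V. Psi v = 1)"
proof -
  define G where "G = {Psi v | Psi v. khom Psi \<and> v \<in> V}"
  obtain r :: nat and a b where ab: "\<And>l. l < r \<Longrightarrow> a l \<in> K" "\<And>l. l < r \<Longrightarrow> b l \<in> {Phi i v | i v. i < m \<and> v \<in> V}"
    "1 = (\<Sum>l<r. a l * b l)" using one_in_trace_K by (rule kprod_obtain_sum) blast
  have G: "g \<in> G" if "khom P" "v \<in> V" "g = P v" for g P v using that by (auto simp: G_def)
  define Z where "Z = {io 0}"
  have Z: "y \<in> Z \<longleftrightarrow> y = 0" for y by (simp add: Z_def)
  have "\<exists>g\<in>G. g - 1 \<in> Z"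
  proof (rule lift_idempotent[OF K_asub K_1 K_mult])
    show "asub Z" by (simp add: asub_def Z)
    show "y * z \<in> Z" if "y \<in> K" "z \<in> Z" for y z using that by (simp add: Z)
    show "1 * 1 - 1 \<in> Z" by (simp add: Z)
    show "\<exists>e\<in>K. e * e - e \<in> Z \<and> (\<exists>u\<in>K. e - t * u \<in> Z) \<and> (\<exists>u\<in>K. (1 - e) - (1 - t) * u \<in> Z)"
      if "t \<in> K" for t using K_exchange[OF that] by (simp add: Z)
    show "G \<subseteq> K" by (auto simp: G_def khom_def)
    show "0 \<in> G" by (rule G[of "\<lambda>_. 0" 0]) (auto simp: khom_def K_0 asub_0[OF V_asub])
    show "s * g \<in> G" if g: "g \<in> G" and s: "s \<in> K" for g s
    proof -
      obtain P v where "khom P" "v \<in> V" "g = P v" using g by (auto simp: G_def)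
      then show ?thesis using G[OF khom_scale[OF _ s]] by blast
    qed
    fix g h e e' assume g: "g \<in> G" and h: "h \<in> G" and e: "e \<in> K" "e' \<in> K" "e * e' \<in> Z"
    obtain P v where P: "khom P" "v \<in> V" "g = P v" using g by (auto simp: G_def)
    obtain Q u where Q: "khom Q" "u \<in> V" "h = Q u" using h by (auto simp: G_def)
    have "e * P (kact e v + kact e' u) + e' * Q (kact e v + kact e' u) \<in> G"
      by (rule G[OF khom_add[OF khom_scale[OF P(1) e(1)] khom_scale[OF Q(1) e(2)]] _ refl])
        (intro asub_add[OF V_asub] kact_V P Q)
    then show "\<exists>k\<in>G. k - (e * e * g + e' * e' * h) \<in> Z"
      using khom_cross[OF P(1) Q(1) P(2) Q(2) e(1,2)] e(3) P(3) Q(3) by (auto simp: Z intro!: bexI)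
  next
    show "a l * b l \<in> G" if l: "l < r" for l
    proof -
      obtain i v where b: "b l = Phi i v" "i < m" "v \<in> V" using ab(2)[OF l] by blast
      show ?thesis unfolding b(1) by (rule G[OF khom_scale[OF Phi_khom[OF b(2)] ab(1)[OF l]] b(3) refl])
    qed
    show "1 - (\<Sum>l<r. a l * b l) \<in> Z" using ab(3) by (simp add: Z)
  qed (auto simp: K_1)
  then obtain g where g: "g \<in> G" "g - 1 \<in> Z" by blast
  from g(2) have "g = 1" by (simp add: Z)
  then obtain Psi v where "khom Psi" "v \<in> V" "Psi v = 1" using g(1) unfolding G_def by auto
  then show ?thesis by blast
qed

text \<open>The trace ideal of \<open>L\<close>. It is the link to duality, since its dual is the
  multiplicator ring.\<close>

definition "tr = kprod R {Phi i v | i v. i < m \<and> v \<in> L}"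

lemma Phi_R: "i < m \<Longrightarrow> v \<in> L \<Longrightarrow> Phi i v \<in> R"
  unfolding R_iff
proof (intro conjI allI impI)
  fix j assume i: "i < m" and v: "v \<in> L" and j: "j < n"
  have "bd j \<in> mul" using R_mul R_bd by blast
  then have "kact (bd j) v \<in> L" using v mulD by blast
  then have "co (kact (bd j) v) i \<in> \<int>" using i co_L[OF L_V] by blast
  then show "cf (Phi i v) j \<in> \<int>"
    using lam_bd[OF j Phi_K] lam_Phi[OF i L_V[OF v] K_bd] by metis
qed (rule Phi_K)

lemma Phi_tr: "i < m \<Longrightarrow> v \<in> L \<Longrightarrow> Phi i v \<in> tr"
proof -
  assume "i < m" "v \<in> L"
  then have "1 * Phi i v \<in> tr" unfolding tr_def by (intro kprod.mult R_1) blast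
  then show ?thesis by simp
qed

lemma tr_R: "x \<in> tr \<Longrightarrow> r \<in> R \<Longrightarrow> r * x \<in> tr"
  unfolding tr_def using kprod_scale[of R r R x] R_mult by blast

lemma tr_add: "x \<in> tr \<Longrightarrow> y \<in> tr \<Longrightarrow> x + y \<in> tr"
  unfolding tr_def by (rule kprod.add)

lemma lat_tr: "lat tr" unfolding lat_def
proof (intro conjI ballI)
  have sub: "tr \<subseteq> R" unfolding tr_def by (rule kprod_subset[OF R_asub]) (auto simp: Phi_R R_mult)
  then show "tr \<subseteq> K" using R_K by blast
  have "Phi 0 0 \<in> {Phi i v | i v. i < m \<and> v \<in> L}" using m_pos asub_0[OF L_asub] by blast
  then show "asub tr" unfolding tr_def by (rule kprod_asub[OF R_asub])
  show "xi * y \<in> tr" if "y \<in> tr" for y using tr_R[OF that R_xi] .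
  show "\<exists>d>0. \<forall>y\<in>tr. of_int d * y \<in> R" using sub by (intro exI[of _ 1]) auto
  \<comment> \<open>Clearing denominators in \<open>one_in_trace_K\<close> produces a positive
    integer in \<open>tr\<close>.\<close>
  have "\<exists>c>0. of_int c * x \<in> tr" if "x \<in> kprod K {Phi i v | i v. i < m \<and> v \<in> V}" for x
    using that
  proof induction
    case (mult k b)
    then obtain i v where b: "b = Phi i v" "i < m" "v \<in> V" by blast
    obtain e where e: "e > 0" "of_int e * k \<in> R" using to_R[OF mult(1)] by blast
    obtain e' where e': "e' > 0" "of_int e' * v \<in> L" using to_L[OF b(3)] by blast
    have "Phi i (of_int e' * v) = of_int e' * Phi i v"
      using khomD(3)[OF Phi_khom[OF b(2)] K_of_int b(3), of e'] b(3) by (simp add: kact_of_int)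
    then have "of_int e * k * (of_int e' * Phi i v) \<in> tr" using tr_R[OF Phi_tr[OF b(2) e'(2)] e(2)] by simp
    then have "of_int (e * e') * (k * b) \<in> tr" by (simp add: b ac_simps)
    then show ?case using e e' by (intro exI[of _ "e * e'"]) auto
  next
    case (add x y)
    then obtain c d where cd: "c > 0" "of_int c * x \<in> tr" "d > 0" "of_int d * y \<in> tr" by blast
    have "of_int d * (of_int c * x) + of_int c * (of_int d * y) \<in> tr"
      using cd tr_R R_of_int tr_add by blast
    then have "of_int (c * d) * (x + y) \<in> tr" by (simp add: algebra_simps)
    then show ?case using cd by (intro exI[of _ "c * d"]) auto
  qed
  from this[OF one_in_trace_K] show "\<exists>c>0. of_int c \<in> tr" by simp
qed

text \<open>By \<open>lam_Phi\<close>, \<open>y\<close> pairs integrally with the values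
  \<open>Phi i v\<close> exactly if \<open>kact y v\<close> has integral coordinates.\<close>

lemma dual_tr: "dual tr = mul"
proof (intro equalityI subsetI)
  fix y assume y: "y \<in> dual tr"
  then have yK: "y \<in> K" by (simp add: dual_def)
  have "kact y v \<in> L" if v: "v \<in> L" for v
    unfolding co_L[OF kact_V[OF L_V[OF v]]]
    using lam_Phi[OF _ L_V[OF v] yK] dualD[OF y Phi_tr[OF _ v]] by simp
  then show "y \<in> mul" using yK by (simp add: mul_def)
next
  fix y assume y: "y \<in> mul"
  note yK = mulD(1)[OF y]
  have "tr \<subseteq> {z \<in> K. lam (y * z) \<in> \<int>}" unfolding tr_def
  proof (rule kprod_subset)
    show "asub {z \<in> K. lam (y * z) \<in> \<int>}"
      by (auto simp: asub_def K_closed lam_0 lam_diff right_diff_distrib yK)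
    fix r b assume r: "r \<in> R" and "b \<in> {Phi i v |i v. i < m \<and> v \<in> L}"
    then obtain i v where b: "b = Phi i v" "i < m" "v \<in> L" by blast
    have "y * r \<in> mul" using y r R_mul mul_mult by blast
    then have "kact (y * r) v \<in> L" using b mulD by blast
    then have "co (kact (y * r) v) i \<in> \<int>" using b co_L[OF L_V] by blast
    then have "lam (y * r * b) \<in> \<int>" using lam_Phi[OF b(2) L_V[OF b(3)] mulD(1)[OF \<open>y * r \<in> mul\<close>]] b by simp
    then show "r * b \<in> {z \<in> K. lam (y * z) \<in> \<int>}" using r R_K by (auto simp: b Phi_K K_mult mult.assoc)
  qed
  then show "y \<in> dual tr" using yK by (auto simp: dual_def)
qed

lemma mul_order: "korder mul"
  unfolding korder_def using lat_dual[OF lat_tr] mul_mult R_mul R_1 by (auto simp: dual_tr)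

text \<open>By biduality \<open>tr\<close> is the dual of \<open>mul\<close>, so the Bass condition
  gives \<open>J\<close> with \<open>u * tr * J\<close> spanning \<open>mul\<close>. The forms
  \<open>u * r * j * Phi i\<close> thus map \<open>L\<close> into \<open>mul\<close>, and 1 is a sum
  of their values; lifting idempotents modulo \<open>d\<close> merges them into one form at one
  vector.\<close>

lemma hom_onto_mod:
  assumes b: bass and d: "d > 0"
  shows "\<exists>Psi. khom Psi \<and> Psi ` L \<subseteq> mul \<and> (\<exists>v\<in>L. \<exists>s\<in>mul. Psi v - 1 = of_int d * s)"
proof -
  note o = korderD[OF mul_order]
  obtain J where J: "J \<subseteq> K" "kprod (tdual mul) J = mul" using b mul_order by (auto simp: bass_def)
  obtain u where u: "u \<in> K" "del * u = 1" using del_unit by blast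
  have ts: "t \<in> tdual mul \<longleftrightarrow> t \<in> K \<and> del * t \<in> tr" for t
  proof -
    have "tr = dual mul" using dual_dual[OF lat_tr] dual_tr by simp
    then show ?thesis by (auto simp: dual_def tdual_def K_closed mult.assoc)
  qed
  have utr: "u * x * j \<in> mul" if x: "x \<in> tr" and j: "j \<in> J" for x j
  proof -
    have "del * (u * x) = x" using u(2) by (simp add: mult.assoc[symmetric])
    then have "u * x \<in> tdual mul" using ts x u K_mult latD(6)[OF lat_tr] by simp
    then show ?thesis using kprod.mult[OF _ j] J(2) by blast
  qed
  define H where "H = {Psi. khom Psi \<and> Psi ` L \<subseteq> mul}"
  define G where "G = {Psi v | Psi v. Psi \<in> H \<and> v \<in> L}"
  have G: "g \<in> G" if "Psi \<in> H" "v \<in> L" "g = Psi v" for g Psi v using that by (auto simp: G_def)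
  have H_scale: "(\<lambda>v. s * P v) \<in> H" if "P \<in> H" "s \<in> mul" for P s
    using that khom_scale mulD(1) mul_mult by (auto simp: H_def image_subset_iff)
  have H_add: "(\<lambda>v. P v + Q v) \<in> H" if "P \<in> H" "Q \<in> H" for P Q
    using that khom_add asub_add[OF mul_asub] by (auto simp: H_def image_subset_iff)
  \<comment> \<open>\<open>kprod {1} G\<close> serves as the set of finite sums of elements of
    \<open>G\<close>, since \<open>G\<close> itself need not be closed under addition.\<close>
  have gen: "u * x * j \<in> kprod {1} G" if x: "x \<in> tr" and j: "j \<in> J" for x j
    using x unfolding tr_def
  proof induction
    case (mult r b)
    then obtain i v where b: "b = Phi i v" "i < m" "v \<in> L" by blast
    have "khom (\<lambda>v. (u * r * j) * Phi i v)"
      using u mult(1) j R_K J(1) by (intro khom_scale[OF Phi_khom[OF b(2)]]) (auto intro!: K_mult)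
    moreover have "(u * r * j) * Phi i v' \<in> mul" if "v' \<in> L" for v'
      using utr[OF tr_R[OF Phi_tr[OF b(2) that] mult(1)] j] by (simp add: ac_simps)
    ultimately have "(u * r * j) * Phi i v \<in> G"
      by (intro G[of "\<lambda>v. (u * r * j) * Phi i v" v]) (auto simp: H_def b)
    then show ?case using kprod.mult[of 1 "{1}" _ G] by (fastforce simp: b ac_simps)
  qed (auto simp: distrib_left distrib_right intro: kprod.add)
  have "1 \<in> kprod (tdual mul) J" using J o by simp
  moreover have "x \<in> kprod {1} G" if "x \<in> kprod (tdual mul) J" for x
    using that
  proof induction
    case (mult t j)
    then have "u * (del * t) * j \<in> kprod {1} G" using gen ts by blast
    moreover have "u * (del * t) * j = t * j * (del * u)" by (simp add: ac_simps)
    ultimately show ?case using u by simp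
  qed (rule kprod.add)
  ultimately have "1 \<in> kprod {1} G" by blast
  then obtain r :: nat and a b where ab: "\<And>l. l < r \<Longrightarrow> a l \<in> {1}" "\<And>l. l < r \<Longrightarrow> b l \<in> G" "1 = (\<Sum>l<r. a l * b l)"
    by (rule kprod_obtain_sum) blast
  let ?D = "dmult d mul"
  note D = dmult_asub[OF mul_asub, of d]
  have "\<exists>g\<in>G. g - 1 \<in> ?D"
  proof (rule lift_idempotent[OF mul_asub o(3) mul_mult D dmult_scale[OF mul_order]])
    show "\<exists>e\<in>mul. e * e - e \<in> ?D \<and> (\<exists>u\<in>mul. e - t * u \<in> ?D) \<and> (\<exists>u\<in>mul. (1 - e) - (1 - t) * u \<in> ?D)"
      if "t \<in> mul" for t using order_exchange[OF mul_order d that] .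
    show "G \<subseteq> mul" by (auto simp: G_def H_def)
    show "0 \<in> G"
      by (rule G[of "\<lambda>_. 0" 0]) (auto simp: H_def khom_def K_0 asub_0[OF L_asub] asub_0[OF mul_asub])
    show "s * g \<in> G" if g: "g \<in> G" and s: "s \<in> mul" for g s
    proof -
      obtain P v where "P \<in> H" "v \<in> L" "g = P v" using g by (auto simp: G_def)
      then show ?thesis using G[OF H_scale[OF _ s]] by blast
    qed
    fix g h e e' assume g: "g \<in> G" and h: "h \<in> G" and e: "e \<in> mul" "e' \<in> mul" "e * e' \<in> ?D"
    obtain P v where P: "P \<in> H" "v \<in> L" "g = P v" using g by (auto simp: G_def)
    obtain Q u where Q: "Q \<in> H" "u \<in> L" "h = Q u" using h by (auto simp: G_def)
    have "e * P (kact e v + kact e' u) + e' * Q (kact e v + kact e' u) \<in> G"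
      by (rule G[OF H_add[OF H_scale[OF P(1) e(1)] H_scale[OF Q(1) e(2)]] _ refl])
        (intro asub_add[OF L_asub] mulD(2) P Q e)
    moreover have "(P u + Q v) * (e * e') \<in> ?D"
      using P Q asub_add[OF mul_asub, of "P u" "Q v"] dmult_scale[OF mul_order _ e(3)] by (auto simp: H_def)
    moreover have "khom P" "khom Q" using P Q by (auto simp: H_def)
    ultimately show "\<exists>k\<in>G. k - (e * e * g + e' * e' * h) \<in> ?D"
      using khom_cross[OF _ _ L_V[OF P(2)] L_V[OF Q(2)] mulD(1)[OF e(1)] mulD(1)[OF e(2)], of P Q] P(3) Q(3)
      by (metis add_diff_cancel_left')
  next
    show "b l \<in> G" if "l < r" for l using ab(2)[OF that] .
    have "(\<Sum>l<r. a l * b l) = (\<Sum>l<r. b l)" using ab(1) by (intro sum.cong) auto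
    then show "1 - (\<Sum>l<r. b l) \<in> ?D" using ab(3) asub_0[OF D] by simp
  qed (use o asub_0[OF D] in auto)
  then show ?thesis unfolding G_def H_def dmult_def by blast
qed

text \<open>The Bass condition enters twice: it gives a form with a value congruent to 1, and it
  makes the image \<open>I\<close> invertible, so that the form splits. Writing 1 as the sum of
  \<open>y l * c l\<close> with \<open>y l\<close> in \<open>I\<close> and \<open>c l\<close> in
  \<open>(mul : I)\<close>, the section sends \<open>z\<close> to the sum of \<open>z * c l\<close>
  acting on a preimage of \<open>y l\<close>.\<close>

lemma split_off:
  assumes b: bass
  shows "\<exists>I Psi sg. lat I \<and> kcol I I = mul \<and> khom Psi \<and> Psi ` L = I \<and>
    (\<forall>y\<in>I. sg y \<in> L \<and> Psi (sg y) = y \<and> sg (xi * y) = T (sg y)) \<and>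
    (\<forall>y\<in>I. \<forall>z\<in>I. sg (y + z) = sg y + sg z)"
proof -
  note o = korderD[OF mul_order]
  obtain e where e: "e > 0" "\<And>S y. korder S \<Longrightarrow> y \<in> S \<Longrightarrow> of_int e * y \<in> R" using order_bound by blast
  \<comment> \<open>\<open>e\<close> clears the denominators of every order, in particular of
    \<open>(I : I)\<close>, which is identified only later. The factor 2 makes the modulus at least
    2, as the divisibility argument for \<open>?al\<close> demands.\<close>
  let ?d = "2 * e"
  obtain Psi v0 s where P: "khom Psi" "Psi ` L \<subseteq> mul" and v0: "v0 \<in> L" "s \<in> mul" "Psi v0 - 1 = of_int ?d * s"
    using hom_onto_mod[OF b, of ?d] e by auto
  note Pd = khomD[OF P(1)]
  define I where "I = Psi ` L"
  have Imul: "I \<subseteq> mul" using P by (simp add: I_def)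
  have aI: "asub I" unfolding asub_def
  proof (intro conjI ballI)
    have "Psi 0 = 0" using Pd(2)[of 0 0] asub_0[OF V_asub] by simp
    then show "0 \<in> I" using asub_0[OF L_asub] unfolding I_def by (metis imageI)
    fix x y assume "x \<in> I" "y \<in> I"
    then obtain a b where ab: "a \<in> L" "b \<in> L" "x = Psi a" "y = Psi b" by (auto simp: I_def)
    have "Psi ((a - b) + b) = Psi (a - b) + Psi b" using ab L_V asub_diff[OF L_asub] by (intro Pd(2)) auto
    then have "x - y = Psi (a - b)" using ab by simp
    then show "x - y \<in> I" using ab asub_diff[OF L_asub] by (auto simp: I_def)
  qed
  have smul: "t * y \<in> I" if t: "t \<in> mul" and y: "y \<in> I" for t y
  proof -
    obtain a where a: "a \<in> L" "y = Psi a" using y by (auto simp: I_def)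
    have "t * y = Psi (kact t a)" using Pd(3)[OF mulD(1)[OF t] L_V[OF a(1)]] a by simp
    then show ?thesis using mulD(2)[OF t a(1)] by (auto simp: I_def)
  qed
  let ?al = "Psi v0"
  have al: "?al \<in> I" "?al \<in> K" using v0 P Pd(1) L_V by (auto simp: I_def)
  have al_eq: "?al = 1 + of_int ?d * s" using v0(3) by (simp add: algebra_simps)
  \<comment> \<open>As \<open>?al\<close> is 1 modulo \<open>?d\<close>, an element killed by
    \<open>?al\<close>, once scaled into \<open>mul\<close>, is divisible by every power of
    \<open>?d\<close> and hence zero.\<close>
  have "\<exists>b\<in>K. ?al * b = 1"
  proof (rule unit_if_regular[OF al(2)])
    fix z assume z: "z \<in> K" "?al * z = 0"
    obtain c where c: "c > 0" "of_int c * z \<in> R" using to_R[OF z(1)] by blast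
    let ?z = "of_int c * z"
    have zm: "?z \<in> mul" using c R_mul by blast
    have "?al * ?z = 0" using z(2) by (simp add: mult.left_commute)
    then have step: "?z = of_int ?d * (- s * ?z)" unfolding al_eq by (simp add: algebra_simps eq_neg_iff_add_eq_0)
    have all: "\<exists>t\<in>mul. ?z = of_int (?d ^ k) * t" for k
    proof (induction k)
      case 0 then show ?case using zm by auto
    next
      case (Suc k)
      then obtain t where t: "t \<in> mul" "?z = of_int (?d ^ k) * t" by blast
      have "?z = of_int ?d * (- s * (of_int (?d ^ k) * t))" using step t(2) by metis
      also have "\<dots> = of_int (?d ^ Suc k) * (- s * t)" by (simp add: ac_simps)
      finally show ?case using mul_mult[OF asub_neg[OF mul_asub v0(2)] t(1)] by blast
    qed
    then have "?z = 0" using e(1) by (intro order_no_infinite_divisibility[OF mul_order _ zm all]) simp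
    then show "z = 0" using of_int_inv[of c z] c by simp
  qed
  then obtain be where be: "be \<in> K" "?al * be = 1" by blast
  have I: "lat I" unfolding lat_def
  proof (intro conjI ballI aI)
    show "I \<subseteq> K" using Imul mulD by blast
    show "xi * y \<in> I" if "y \<in> I" for y using smul[OF _ that] R_mul R_xi by blast
    obtain c where c: "c > 0" "of_int c * be \<in> R" using to_R[OF be(1)] by blast
    have "of_int c * be * ?al \<in> I" using smul c R_mul al by blast
    moreover have "of_int c * be * ?al = of_int c * (?al * be)" by (simp only: ac_simps)
    ultimately have "of_int c \<in> I" using be(2) by simp
    then show "\<exists>c>0. of_int c \<in> I" using c by blast
    show "\<exists>d>0. \<forall>y\<in>I. of_int d * y \<in> R" using e(1) e(2)[OF mul_order] Imul by blast
  qed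
  have kc: "kcol I I = mul"
  proof (intro equalityI subsetI)
    fix x assume "x \<in> mul" then show "x \<in> kcol I I" using smul mulD(1) by (auto simp: kcol_def)
  next
    \<comment> \<open>\<open>x * ?al\<close> lies in \<open>I\<close>, hence in \<open>mul\<close>,
      and differs from \<open>x\<close> by \<open>2 * (e * x) * s\<close>. This lies in
      \<open>mul\<close> because \<open>e * x\<close> is in \<open>R\<close> by the uniform
      bound.\<close>
    fix x assume x: "x \<in> kcol I I"
    have "x * ?al \<in> mul" using x al Imul by (auto simp: kcol_def)
    moreover have "of_int e * x \<in> mul" using e(2)[OF order_kcol[OF I] x] R_mul by blast
    then have "of_int 2 * (of_int e * x) * s \<in> mul" using v0 mul_mult asub_of_int[OF mul_asub] by blast
    ultimately have "x * ?al - of_int 2 * (of_int e * x) * s \<in> mul" using asub_diff[OF mul_asub] by blast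
    moreover have "x * ?al - of_int 2 * (of_int e * x) * s = x" unfolding al_eq by (simp add: algebra_simps)
    ultimately show "x \<in> mul" by simp
  qed
  have "1 \<in> kprod I (kcol mul I)" using bass_invertible[OF b I] kc by simp
  then obtain r :: nat and y c where yc: "\<And>l. l < r \<Longrightarrow> y l \<in> I" "\<And>l. l < r \<Longrightarrow> c l \<in> kcol mul I" "1 = (\<Sum>l<r. y l * c l)"
    by (rule kprod_obtain_sum) blast
  have "\<forall>l. \<exists>a. l < r \<longrightarrow> a \<in> L \<and> y l = Psi a" using yc(1) by (auto simp: I_def)
  then obtain a where a: "\<And>l. l < r \<Longrightarrow> a l \<in> L" "\<And>l. l < r \<Longrightarrow> y l = Psi (a l)" by metis
  define sg where "sg z = (\<Sum>l<r. kact (z * c l) (a l))" for z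
  have cK: "c l \<in> K" if "l < r" for l using yc(2)[OF that] by (simp add: kcol_def)
  have cm: "z * c l \<in> mul" if "l < r" "z \<in> I" for l z using yc(2)[OF that(1)] that(2) by (simp add: kcol_def mult.commute)
  have P_sum: "Psi (\<Sum>l<k. g l) = (\<Sum>l<k. Psi (g l))" if "\<And>l. l < k \<Longrightarrow> g l \<in> V" for g and k :: nat
    using that
  proof (induction k)
    case 0 show ?case using Pd(2)[of 0 0] asub_0[OF V_asub] by simp
  next
    case (Suc k) then show ?case using Pd(2)[OF asub_sum[OF V_asub], of "{..<k}" g "g k"] by simp
  qed
  have sgL: "sg z \<in> L" if z: "z \<in> I" for z
    unfolding sg_def using cm z a mulD by (intro asub_sum[OF L_asub]) auto
  have sgP: "Psi (sg z) = z" if z: "z \<in> I" for z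
  proof -
    have "Psi (sg z) = (\<Sum>l<r. Psi (kact (z * c l) (a l)))"
      unfolding sg_def using a L_V kact_V by (intro P_sum) auto
    also have "\<dots> = (\<Sum>l<r. z * (y l * c l))"
      using a L_V mulD(1)[OF cm[OF _ z]] by (intro sum.cong) (auto simp: Pd(3) ac_simps)
    also have "\<dots> = z" unfolding sum_distrib_left[symmetric] yc(3)[symmetric] by simp
    finally show ?thesis .
  qed
  have sgT: "sg (xi * z) = T (sg z)" if z: "z \<in> I" for z
  proof -
    have "T (sg z) = kact xi (sg z)" using kact_xi[OF L_V[OF sgL[OF z]]] by simp
    also have "\<dots> = sg (xi * z)" unfolding sg_def kact_sum
      using mulD(1)[OF cm[OF _ z]] a L_V K_xi by (intro sum.cong) (auto simp: kact_mult mult.assoc)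
    finally show ?thesis ..
  qed
  have sgA: "sg (z + z') = sg z + sg z'" if z: "z \<in> I" "z' \<in> I" for z z'
    unfolding sg_def sum.distrib[symmetric]
    using mulD(1)[OF cm[OF _ z(1)]] mulD(1)[OF cm[OF _ z(2)]] a L_V
    by (intro sum.cong) (auto simp: distrib_right kact_add_left)
  show ?thesis
    by (intro exI[of _ I] exI[of _ Psi] exI[of _ sg] conjI ballI I kc P(1) I_def[symmetric] sgL sgP sgT sgA)
qed

end

context op_lattice
begin

lemma khom_0: "khom P \<Longrightarrow> P 0 = 0"
  using khomD(2)[of P 0 0] asub_0[OF V_asub] by simp

lemma khom_diff: "khom P \<Longrightarrow> u \<in> V \<Longrightarrow> v \<in> V \<Longrightarrow> P (u - v) = P u - P v"
  using khomD(2)[of P "u - v" v] asub_diff[OF V_asub] by (simp add: eq_diff_eq)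

lemma khom_T: "khom P \<Longrightarrow> v \<in> V \<Longrightarrow> P (T v) = xi * P v"
  using khomD(3)[of P xi v] K_xi by (simp add: kact_xi)

lemma khom_image_asub: "khom P \<Longrightarrow> asub (P ` L)" unfolding asub_def
proof (intro conjI ballI)
  assume P: "khom P"
  show "0 \<in> P ` L" using khom_0[OF P] asub_0[OF L_asub] by force
  fix x y assume "x \<in> P ` L" "y \<in> P ` L"
  then obtain a b where "a \<in> L" "b \<in> L" "x = P a" "y = P b" by blast
  then show "x - y \<in> P ` L" using khom_diff[OF P, of a b] L_V asub_diff[OF L_asub] by (metis imageI)
qed

lemma khom_kernel: 
  assumes P: "khom P"
  shows "asub {v \<in> L. P v = 0}" "T ` {v \<in> L. P v = 0} \<subseteq> {v \<in> L. P v = 0}"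
  using khom_0[OF P] khom_diff[OF P] asub_0[OF L_asub] asub_diff[OF L_asub] L_V L_T khom_T[OF P]
  by (auto simp: asub_def)

end

section \<open>Polynomials in an operator and in its matrix\<close>

context op_sub
begin

lemma T_pow_basis:
  assumes A: "A \<in> carrier_mat m m" "\<And>j. j < m \<Longrightarrow> T (w j) = comb of_int m w (\<lambda>i. A $$ (i,j))"
  shows "j < m \<Longrightarrow> (T ^^ k) (w j) = comb of_int m w (\<lambda>i. (A ^\<^sub>m k) $$ (i,j))"
proof (induction k arbitrary: j)
  case 0
  then have "w j = comb of_int m w (\<lambda>i. if i = j then 1 else 0)" using of_int_hom.comb_unit by metis
  also have "\<dots> = comb of_int m w (\<lambda>i. (A ^\<^sub>m 0) $$ (i,j))"
    using A 0 by (intro of_int_hom.comb_cong) auto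
  finally show ?case by simp
next
  case (Suc k)
  have lk: "linmap of_int (T ^^ k)"
    unfolding linmap_def using T_pow_add T_pow_rho[of _ "of_int _"] by (auto simp: rho.hom_of_int)
  have "(T ^^ Suc k) (w j) = (T ^^ k) (comb of_int m w (\<lambda>i. A $$ (i,j)))"
    using A(2)[OF Suc.prems] by (simp add: funpow_swap1)
  also have "\<dots> = comb of_int m (\<lambda>l. comb of_int m w (\<lambda>i. (A ^\<^sub>m k) $$ (i,l))) (\<lambda>l. A $$ (l,j))"
    unfolding of_int_hom.linmap_comb[OF lk] using Suc.IH by (intro of_int_hom.comb_cong) auto
  also have "\<dots> = comb of_int m w (\<lambda>i. (A ^\<^sub>m Suc k) $$ (i,j))"
    unfolding of_int_hom.comb_comb
    using index_mult_sum[OF pow_carrier_mat[OF A(1)] A(1) _ Suc.prems, of _ k] by (intro of_int_hom.comb_cong) auto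
  finally show ?case .
qed

lemma pact_basis:
  assumes A: "A \<in> carrier_mat m m" "\<And>j. j < m \<Longrightarrow> T (w j) = comb of_int m w (\<lambda>i. A $$ (i,j))" and j: "j < m"
  shows "pact p (w j) = comb rho m w (\<lambda>i. mat_eval p (map_mat rat_of_int A) $$ (i,j))"
proof -
  have "pact p (w j) = (\<Sum>k\<le>degree p. rho (coeff p k) * comb rho m w (\<lambda>i. of_int ((A ^\<^sub>m k) $$ (i,j))))"
  proof -
    have "(T ^^ k) (w j) = comb of_int m w (\<lambda>i. (A ^\<^sub>m k) $$ (i,j))" for k
      using T_pow_basis[OF A(1)] A(2) j by blast
    then show ?thesis by (simp only: pact_def comb_int_rho)
  qed
  also have "\<dots> = (\<Sum>k\<le>degree p. comb rho m w (\<lambda>i. coeff p k * of_int ((A ^\<^sub>m k) $$ (i,j))))"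
    by (simp add: rho.comb_scale)
  also have "\<dots> = comb rho m w (\<lambda>i. \<Sum>k\<le>degree p. coeff p k * of_int ((A ^\<^sub>m k) $$ (i,j)))"
    unfolding comb_def rho.hom_sum sum_distrib_right by (rule sum.swap)
  also have "\<dots> = comb rho m w (\<lambda>i. mat_eval p (map_mat rat_of_int A) $$ (i,j))"
  proof (intro rho.comb_cong refl)
    fix i assume i: "i < m"
    have "(map_mat rat_of_int A ^\<^sub>m k) $$ (i,j) = of_int ((A ^\<^sub>m k) $$ (i,j))" for k
      using of_int_hom.mat_hom_pow[OF A(1), of k, where ?'a = rat] pow_carrier_mat[OF A(1), of k] i j by (metis carrier_matD index_map_mat(1))
    then show "(\<Sum>k\<le>degree p. coeff p k * of_int ((A ^\<^sub>m k) $$ (i,j))) = mat_eval p (map_mat rat_of_int A) $$ (i,j)"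
      using A(1) i j by (simp add: mat_eval_def)
  qed
  finally show ?thesis .
qed

lemma pact_zero_iff:
  assumes A: "A \<in> carrier_mat m m" "\<And>j. j < m \<Longrightarrow> T (w j) = comb of_int m w (\<lambda>i. A $$ (i,j))"
  shows "(\<forall>v\<in>L. pact p v = 0) \<longleftrightarrow> mat_eval p (map_mat rat_of_int A) = 0\<^sub>m m m"
proof
  assume 0: "\<forall>v\<in>L. pact p v = 0"
  show "mat_eval p (map_mat rat_of_int A) = 0\<^sub>m m m"
  proof (rule eq_matI)
    fix i j assume ij: "i < dim_row (0\<^sub>m m m)" "j < dim_col (0\<^sub>m m m)"
    then have "comb rho m w (\<lambda>i. mat_eval p (map_mat rat_of_int A) $$ (i,j)) = 0"
      using 0 wL pact_basis[OF A, of j p] by auto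
    then show "mat_eval p (map_mat rat_of_int A) $$ (i,j) = 0\<^sub>m m m $$ (i,j)"
      using bV ij unfolding basis_def by auto
  qed (use A in \<open>auto simp: mat_eval_def\<close>)
next
  assume 0: "mat_eval p (map_mat rat_of_int A) = 0\<^sub>m m m"
  have w0: "pact p (w j) = 0" if j: "j < m" for j
  proof -
    have "pact p (w j) = comb rho m w (\<lambda>i. mat_eval p (map_mat rat_of_int A) $$ (i,j))"
      using pact_basis[OF A(1)] A(2) j by blast
    also have "\<dots> = comb rho m w (\<lambda>_. 0)"
      unfolding 0 using j by (intro rho.comb_cong) auto
    finally have "pact p (w j) = comb rho m w (\<lambda>_. 0)" .
    then show ?thesis by (simp add: rho.comb_zero)
  qed
  show "\<forall>v\<in>L. pact p v = 0"
  proof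
    fix v assume "v \<in> L"
    then obtain c where "v = comb rho m w (\<lambda>i. of_int (c i))"
      using of_int_hom.basis_obtain[OF bL] comb_int_rho by metis
    then show "pact p v = 0" by (simp add: comb_def pact_right_sum pact_right_rho w0)
  qed
qed

end

section \<open>Decomposition into ideals\<close>

text \<open>On an eigenvector for \<open>z\<close> the matrix \<open>p(A)\<close> acts as the scalar
  \<open>p(z)\<close>. The computation runs coordinatewise because \<open>mat_eval\<close> is
  defined by its entries.\<close>

lemma mat_eval_zero_root:
  fixes A :: "rat mat"
  assumes A: "A \<in> carrier_mat m m" and 0: "mat_eval p A = 0\<^sub>m m m"
    and z: "poly (cpoly (char_poly A)) z = 0"
  shows "poly (cpoly p) z = 0"
proof -
  let ?A = "map_mat of_rat A :: complex mat"
  have Ac: "?A \<in> carrier_mat m m" using A by simp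
  have "poly (char_poly ?A) z = 0" using z by (simp add: of_rat_hom.char_poly_hom[OF A])
  then obtain u where "eigenvector ?A u z" using eigenvalue_root_char_poly[OF Ac] by (auto simp: eigenvalue_def)
  then have u: "u \<in> carrier_vec m" "u \<noteq> 0\<^sub>v m" and ev: "eigenvector ?A u z" using A by (auto simp: eigenvector_def)
  have pow: "?A ^\<^sub>m k *\<^sub>v u = z ^ k \<cdot>\<^sub>v u" for k using eigenvector_pow[OF Ac ev] .
  have powi: "(\<Sum>j<m. (?A ^\<^sub>m k) $$ (i,j) * vec_index u j) = z ^ k * vec_index u i" if "i < m" for i k
    using arg_cong[OF pow[of k], of "\<lambda>v. vec_index v i"] that
      carrier_vecD[OF u(1)] carrier_matD[OF pow_carrier_mat[OF Ac, of k]]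
    by (simp add: scalar_prod_def atLeast0LessThan)
  have pe: "poly (cpoly p) z * vec_index u i = 0" if i: "i < m" for i
  proof -
    have "poly (cpoly p) z * vec_index u i = (\<Sum>k\<le>degree p. of_rat (coeff p k) * (z ^ k * vec_index u i))"
      by (simp add: poly_altdef sum_distrib_right mult.assoc)
    also have "\<dots> = (\<Sum>k\<le>degree p. \<Sum>j<m. of_rat (coeff p k) * ((?A ^\<^sub>m k) $$ (i,j) * vec_index u j))"
      unfolding powi[OF i, symmetric] by (simp add: sum_distrib_left)
    also have "\<dots> = (\<Sum>j<m. \<Sum>k\<le>degree p. of_rat (coeff p k) * ((?A ^\<^sub>m k) $$ (i,j) * vec_index u j))" by (rule sum.swap)
    also have "\<dots> = (\<Sum>j<m. of_rat (mat_eval p A $$ (i,j)) * vec_index u j)"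
    proof (intro sum.cong refl)
      fix j assume "j \<in> {..<m}"
      then have j: "j < m" by simp
      have "(?A ^\<^sub>m k) $$ (i,j) = of_rat ((A ^\<^sub>m k) $$ (i,j))" for k
        using of_rat_hom.mat_hom_pow[OF A, of k, where ?'a = complex] pow_carrier_mat[OF A, of k] i j by (metis carrier_matD index_map_mat(1))
      then show "(\<Sum>k\<le>degree p. of_rat (coeff p k) * ((?A ^\<^sub>m k) $$ (i,j) * vec_index u j)) = of_rat (mat_eval p A $$ (i,j)) * vec_index u j"
        using A i j by (simp add: mat_eval_def of_rat_sum of_rat_mult sum_distrib_right mult.assoc)
    qed
    also have "\<dots> = 0" unfolding 0 using i by simp
    finally show ?thesis .
  qed
  obtain i where "i < m" "vec_index u i \<noteq> 0" using u by (metis eq_vecI carrier_vecD index_zero_vec)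
  then show ?thesis using pe by force
qed

context residue_alg
begin

definition "xs g = (\<lambda>i::nat. xi * g i)"
text \<open>Tuples are padded by zeros, so that sums of any length live in one type and are added
  pointwise.\<close>

definition "dprod N I = {g::nat \<Rightarrow> 'k. (\<forall>i<N. g i \<in> I i) \<and> (\<forall>i\<ge>N. g i = 0)}"
definition "chain N I \<longleftrightarrow> (\<forall>i<N. lat (I i)) \<and>
  (\<forall>i. Suc i < N \<longrightarrow> kcol (I i) (I i) \<subseteq> kcol (I (Suc i)) (I (Suc i)))"

text \<open>The exponent \<open>Suc N\<close> is positive, so all roots of \<open>f\<close> are
  eigenvalues; a polynomial annihilating \<open>A\<close> vanishes at them, and \<open>F\<close> is
  separable. This provides the faithfulness of the action of \<open>K\<close>.\<close>

lemma charpoly_faithful: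
  assumes A: "A \<in> carrier_mat m m" and c: "char_poly A = f ^ Suc N"
    and 0: "mat_eval p (map_mat rat_of_int A) = 0\<^sub>m m m"
  shows "F dvd p"
proof -
  obtain a b where ab: "a * F + b * pderiv F = 1" using sep by blast
  interpret cp: map_poly_comm_ring_hom "of_rat :: rat \<Rightarrow> complex" ..
  show ?thesis
  proof (rule separable_dvd_by_roots[OF ab])
    fix z assume z: "poly (cpoly F) z = 0"
    have "char_poly (map_mat rat_of_int A) = F ^ Suc N"
      unfolding of_int_hom.char_poly_hom[OF A] c by (rule of_int_poly_hom.hom_power)
    then have "poly (cpoly (char_poly (map_mat rat_of_int A))) z = 0"
      using z by (simp add: cp.hom_power cp.hom_mult)
    then show "poly (cpoly p) z = 0" using mat_eval_zero_root[OF _ 0] A by simp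
  qed
qed

end

context op_module
begin

lemma faithful_lattice_intro:
  assumes r: "rep of_int T L m w A" and FL: "\<And>v. v \<in> L \<Longrightarrow> pact F v = 0" and c: "char_poly A = f ^ Suc N"
  shows "faithful_lattice f io rho T L m w"
proof -
  have b: "basis of_int m w L" and A: "A \<in> carrier_mat m m"
    and Aw: "\<And>j. j < m \<Longrightarrow> T (w j) = comb of_int m w (\<lambda>i. A $$ (i,j))" using r by (auto simp: rep_def)
  have TL: "T ` L \<subseteq> L"
  proof clarify
    fix v assume "v \<in> L"
    then obtain c where "v = comb of_int m w c" using of_int_hom.basis_obtain[OF b] by blast
    then have "T v = comb of_int m (\<lambda>i. T (w i)) c" using of_int_hom.linmap_comb[OF T_int] by simp
    also have "\<dots> = comb of_int m (\<lambda>j. comb of_int m w (\<lambda>i. A $$ (i,j))) c"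
      using Aw by (intro of_int_hom.comb_cong) auto
    finally show "T v \<in> L" unfolding of_int_hom.comb_comb using of_int_hom.basis_mem[OF b] by simp
  qed
  interpret op_lattice f io rho T L m w
    by unfold_locales (use b TL FL in auto)
  show ?thesis
  proof unfold_locales
    fix y assume y: "y \<in> K" and 0: "\<And>v. v \<in> L \<Longrightarrow> kact y v = 0"
    obtain p where p: "y = io p" using y by (auto simp: K_def)
    then have "\<forall>v\<in>L. pact p v = 0" using 0 by (simp add: kact_io L_V)
    then have "mat_eval p (map_mat rat_of_int A) = 0\<^sub>m m m" using pact_zero_iff[OF A Aw] by simp
    then have "F dvd p" using charpoly_faithful[OF A c] by simp
    then show "y = 0" by (simp add: p io_zero_iff)
  qed
qed

text \<open>\<open>L\<close> splits into an ideal and the kernel of a form, and the characteristic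
  polynomial \<open>f\<close> of the ideal cancels, leaving \<open>f ^ N\<close> on the kernel. The
  middle clause strengthens the induction: it compares the multiplicator ring of \<open>L\<close>,
  written through \<open>pact\<close> so that it makes sense for every \<open>L\<close>, with the
  ring of the first ideal. This is how the chain condition passes from the kernel to
  \<open>L\<close>.\<close>

theorem bass_decomposition:
  assumes b: bass
  shows "rep of_int T L m w A \<Longrightarrow> (\<And>v. v \<in> L \<Longrightarrow> pact F v = 0) \<Longrightarrow> char_poly A = f ^ N \<Longrightarrow>
    \<exists>I h. chain N I \<and> (N > 0 \<longrightarrow> {io p | p. pact p ` L \<subseteq> L} \<subseteq> kcol (I 0) (I 0)) \<and> op_iso T L xs (dprod N I) h"
proof (induction N arbitrary: L m w A)
  case 0
  have A: "A \<in> carrier_mat m m" and bs: "basis of_int m w L" using 0 by (auto simp: rep_def)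
  have "degree (char_poly A) = m" using degree_monic_char_poly[OF A] by simp
  then have "L = {0}" using 0 bs by (simp add: basis_def comb_def)
  then have "op_iso T L xs (dprod 0 (\<lambda>_. K)) (\<lambda>_ _. 0)"
    by (auto simp: op_iso_def dprod_def bij_betw_def xs_def zero_fun_def plus_fun_def)
  moreover have "chain 0 (\<lambda>_. K)" by (simp add: chain_def)
  ultimately show ?case by blast
next
  case (Suc N)
  interpret faithful_lattice f io rho T L m w
    using faithful_lattice_intro[OF Suc.prems(1,2,3)] .
  obtain I0 P sg where I0: "lat I0" "kcol I0 I0 = mul" and P: "khom P" "P ` L = I0"
    and sg: "\<And>y. y \<in> I0 \<Longrightarrow> sg y \<in> L" "\<And>y. y \<in> I0 \<Longrightarrow> P (sg y) = y" "\<And>y. y \<in> I0 \<Longrightarrow> sg (xi * y) = T (sg y)"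
      "\<And>y z. y \<in> I0 \<Longrightarrow> z \<in> I0 \<Longrightarrow> sg (y + z) = sg y + sg z" using split_off[OF b] by metis
  let ?L1 = "sg ` I0" and ?L2 = "{v \<in> L. P v = 0}"
  have iso1: "op_iso ((*) xi) I0 T ?L1 sg"
    unfolding op_iso_def bij_betw_def inj_on_def using sg by (auto, metis)
  obtain w1 A1 where r1: "rep of_int ((*) xi) I0 n w1 A1" "char_poly A1 = f" using ideal_rep[OF I0(1)] by blast
  note r1' = rep_transport[OF r1(1) iso1]
  obtain m2 w2 where b2: "basis of_int m2 w2 ?L2" using sub_basis[OF bL khom_kernel(1)[OF P(1)]] by blast
  obtain A2 where r2: "rep of_int T ?L2 m2 w2 A2"
    using rep_exists[OF of_int_hom.comm_ring_hom_axioms b2 khom_kernel(2)[OF P(1)]] by blast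
  have PL: "P v \<in> I0" if "v \<in> L" for v using that P by blast
  have L2: "v - sg (P v) \<in> ?L2" if "v \<in> L" for v
    using khom_diff[OF P(1), of v "sg (P v)"] sg(1,2)[OF PL[OF that]] that L_V asub_diff[OF L_asub] by auto
  have "?L1 \<inter> ?L2 \<subseteq> {0}"
  proof clarify
    fix y assume "y \<in> I0" "P (sg y) = 0"
    then have "y = 0" using sg(2) by simp
    moreover have "sg 0 = 0" using sg(4)[of 0 0] asub_0[OF latD(2)[OF I0(1)]] by simp
    ultimately show "sg y = 0" by simp
  qed
  moreover have "L = {x + y | x y. x \<in> ?L1 \<and> y \<in> ?L2}"
  proof (intro equalityI subsetI)
    fix v assume v: "v \<in> L"
    have "v = sg (P v) + (v - sg (P v))" by simp
    then show "v \<in> {x + y | x y. x \<in> ?L1 \<and> y \<in> ?L2}" using L2[OF v] PL[OF v] by blast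
  qed (use sg(1) asub_add[OF L_asub] in auto)
  ultimately have "rep of_int T L (n + m2) (\<lambda>i. if i < n then sg (w1 i) else w2 (i - n)) (four_block_mat A1 (0\<^sub>m n m2) (0\<^sub>m m2 n) A2)"
    using rep_direct_sum[OF of_int_hom.comm_ring_hom_axioms r1' r2] by blast
  then have "similar_mat A (four_block_mat A1 (0\<^sub>m n m2) (0\<^sub>m m2 n) A2)"
    using rep_unique[OF of_int_hom.comm_ring_hom_axioms T_int Suc.prems(1)] by blast
  then have "char_poly A = char_poly (four_block_mat A1 (0\<^sub>m n m2) (0\<^sub>m m2 n) A2)"
    by (rule char_poly_similar)
  also have "\<dots> = f * char_poly A2"
    using char_poly_four_block_diag[of A1 n A2 m2] r1 r2 by (simp add: rep_def)
  finally have "f * char_poly A2 = f * f ^ N" using Suc.prems(3) by (metis power_Suc)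
  moreover have "f \<noteq> 0" using monic by auto
  ultimately have c2: "char_poly A2 = f ^ N" by simp
  obtain I' h' where I': "chain N I'" "N > 0 \<longrightarrow> {io p | p. pact p ` ?L2 \<subseteq> ?L2} \<subseteq> kcol (I' 0) (I' 0)"
    and h': "op_iso T ?L2 xs (dprod N I') h'"
    using Suc.IH[OF r2 _ c2] FL by blast
  define I where "I = case_nat I0 I'"
  define h where "h v = case_nat (P v) (h' (v - sg (P v)))" for v
  have h'D: "bij_betw h' ?L2 (dprod N I')" "\<And>u v. u \<in> ?L2 \<Longrightarrow> v \<in> ?L2 \<Longrightarrow> h' (u + v) = h' u + h' v"
    "\<And>v. v \<in> ?L2 \<Longrightarrow> h' (T v) = xs (h' v)" using h' unfolding op_iso_def by blast+
  have mul_eq: "{io p | p. pact p ` L \<subseteq> L} = mul"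
    unfolding mul_def K_def using kact_io L_V by (auto simp: image_subset_iff)
  \<comment> \<open>The form is \<open>K\<close>-linear, so its kernel is stable under the
    multiplicator ring of \<open>L\<close>. Together with the induction hypothesis this is the
    inclusion between the first two rings of the chain.\<close>
  have "mul \<subseteq> {io p | p. pact p ` ?L2 \<subseteq> ?L2}"
  proof
    fix y assume y: "y \<in> mul"
    then obtain p where p: "y = io p" using mulD(1) by (auto simp: K_def)
    have "pact p v \<in> ?L2" if v: "v \<in> ?L2" for v
    proof -
      have "pact p v = kact y v" using v L_V by (simp add: p kact_io)
      then show ?thesis using v mulD[OF y] khomD(3)[OF P(1), of y v] L_V by auto
    qed
    then show "y \<in> {io p | p. pact p ` ?L2 \<subseteq> ?L2}" using p by blast
  qed
  then have "chain (Suc N) I"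
    using I' I0 unfolding chain_def I_def by (auto simp: less_Suc_eq_0_disj split: nat.split)
  moreover have "op_iso T L xs (dprod (Suc N) I) h" unfolding op_iso_def
  proof (intro conjI ballI)
    have Pd: "P (sg y + u) = y" if "y \<in> I0" "u \<in> ?L2" for y u
      using khomD(2)[OF P(1), of "sg y" u] that sg L_V by simp
    show "bij_betw h L (dprod (Suc N) I)" unfolding bij_betw_def
    proof (intro conjI inj_onI equalityI subsetI)
      fix u v assume uv: "u \<in> L" "v \<in> L" "h u = h v"
      have 1: "P u = P v" using fun_cong[OF uv(3), of 0] by (simp add: h_def)
      have "h' (u - sg (P u)) = h' (v - sg (P v))"
        using fun_cong[OF uv(3), of "Suc _"] by (intro ext) (simp add: h_def)
      then have "u - sg (P u) = v - sg (P v)"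
        using h'D(1) L2 uv unfolding bij_betw_def inj_on_def by blast
      then show "u = v" using 1 by simp
    next
      fix g assume "g \<in> h ` L"
      then obtain v where v: "v \<in> L" "g = h v" by blast
      have "h' (v - sg (P v)) \<in> dprod N I'" using h'D(1) L2[OF v(1)] by (auto simp: bij_betw_def)
      then show "g \<in> dprod (Suc N) I"
        using PL[OF v(1)] v(2) by (auto simp: dprod_def h_def I_def split: nat.split)
    next
      fix g assume g: "g \<in> dprod (Suc N) I"
      then have g0: "g 0 \<in> I0" by (auto simp: dprod_def I_def)
      have "(\<lambda>i. g (Suc i)) \<in> dprod N I'" using g by (auto simp: dprod_def I_def)
      then have "(\<lambda>i. g (Suc i)) \<in> h' ` ?L2" using bij_betw_imp_surj_on[OF h'D(1)] by simp
      then obtain u where u: "u \<in> ?L2" "h' u = (\<lambda>i. g (Suc i))" by (elim imageE) simp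
      have "h (sg (g 0) + u) = g"
        unfolding h_def Pd[OF g0 u(1)] using u(2) by (intro ext) (simp split: nat.split)
      then show "g \<in> h ` L" using u(1) sg(1)[OF g0] asub_add[OF L_asub] by force
    qed
    fix u v assume uv: "u \<in> L" "v \<in> L"
    have "h' (u + v - sg (P (u + v))) = h' (u - sg (P u)) + h' (v - sg (P v))"
      using h'D(2)[OF L2[OF uv(1)] L2[OF uv(2)]] khomD(2)[OF P(1) L_V[OF uv(1)] L_V[OF uv(2)]] sg(4)[OF PL[OF uv(1)] PL[OF uv(2)]]
      by (simp add: algebra_simps)
    then show "h (u + v) = h u + h v"
      using khomD(2)[OF P(1) L_V[OF uv(1)] L_V[OF uv(2)]] by (intro ext) (simp add: h_def split: nat.split)
  next
    fix v assume v: "v \<in> L"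
    have PT: "P (T v) = xi * P v" using khom_T[OF P(1) L_V[OF v]] .
    have "T v - sg (P (T v)) = T (v - sg (P v))"
      unfolding PT using sg(3)[OF PL[OF v]] T_add[of "v - sg (P v)" "sg (P v)"] by simp
    then show "h (T v) = xs (h v)"
      using h'D(3)[OF L2[OF v]] PT by (intro ext) (simp add: h_def xs_def split: nat.split)
  qed
  moreover have "Suc N > 0 \<longrightarrow> {io p | p. pact p ` L \<subseteq> L} \<subseteq> kcol (I 0) (I 0)"
    using I0 mul_eq by (simp add: I_def)
  ultimately show ?case by blast
qed

text \<open>Over general \<open>R\<close> a form with value 1 need not split, but its image is a
  fractional ideal, free of rank \<open>n\<close> over the integers. So \<open>L\<close> splits as a
  group into the span of preimages \<open>u\<close> of a basis and the kernel. As \<open>L\<close>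
  has rank \<open>n\<close> too, the kernel has rank 0 and the form is injective.\<close>

theorem cyclic_ideal:
  assumes r: "rep of_int T L m w A" and FL: "\<And>v. v \<in> L \<Longrightarrow> pact F v = 0" and c: "char_poly A = f"
  shows "\<exists>I h. lat I \<and> op_iso T L ((*) xi) I h"
proof -
  interpret faithful_lattice f io rho T L m w
    using faithful_lattice_intro[OF r FL, of 0] c by simp
  have A: "A \<in> carrier_mat m m" using r by (auto simp: rep_def)
  have mn: "m = n" using degree_monic_char_poly[OF A] c by simp
  obtain P v0 where P: "khom P" and v0: "v0 \<in> V" "P v0 = 1" using hom_onto_K by blast
  let ?I = "P ` L" and ?L2 = "{v \<in> L. P v = 0}"
  have Pc: "P (comb of_int k g c) = comb of_int k (\<lambda>i. P (g i)) c" if "\<And>i. i < k \<Longrightarrow> g i \<in> L" for k g c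
    by (rule additive_comb[OF L_asub _ that]) (use khomD(2)[OF P] L_V in auto)
  have I: "lat ?I" unfolding lat_def
  proof (intro conjI ballI khom_image_asub[OF P])
    show "?I \<subseteq> K" using khomD(1)[OF P] L_V by blast
    show "xi * y \<in> ?I" if y: "y \<in> ?I" for y
    proof -
      obtain v where "v \<in> L" "y = P v" using y by blast
      then show ?thesis using khom_T[OF P, of v] L_V L_T by (metis imageI)
    qed
    obtain e where e: "e > 0" "of_int e * v0 \<in> L" using to_L[OF v0(1)] by blast
    have "P (of_int e * v0) = of_int e" using khomD(3)[OF P K_of_int v0(1), of e] v0 by (simp add: kact_of_int)
    then show "\<exists>c>0. of_int c \<in> ?I" using e by (metis imageI)
    have "\<exists>e>0. \<forall>i<k. of_int e * P (w i) \<in> R" if "k \<le> m" for k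
      using that
    proof (induction k)
      case 0 show ?case by (intro exI[of _ 1]) auto
    next
      case (Suc k)
      then obtain e where e: "e > 0" "\<forall>i<k. of_int e * P (w i) \<in> R" by auto
      have "P (w k) \<in> K" using khomD(1)[OF P] L_V wL Suc.prems by simp
      then obtain e' where e': "e' > 0" "of_int e' * P (w k) \<in> R" using to_R by blast
      have "of_int (e * e') * P (w i) \<in> R" if "i < Suc k" for i
      proof (cases "i = k")
        case True
        then show ?thesis using R_mult[OF R_of_int e'(2), of e] by (simp add: mult.assoc)
      next
        case False
        then have "of_int e' * (of_int e * P (w i)) \<in> R" using R_mult[OF R_of_int] e that by simp
        then show ?thesis by (simp add: ac_simps)
      qed
      then show ?case using e e' by (intro exI[of _ "e * e'"]) auto
    qed
    then obtain e where e: "e > 0" "\<forall>i<m. of_int e * P (w i) \<in> R" by blast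
    have "of_int e * P v \<in> R" if v: "v \<in> L" for v
    proof -
      obtain c where "v = comb of_int m w c" using of_int_hom.basis_obtain[OF bL v] by blast
      then have "of_int e * P v = (\<Sum>i<m. of_int (c i) * (of_int e * P (w i)))"
        using Pc[OF wL] by (simp add: comb_def sum_distrib_left mult.left_commute)
      also have "\<dots> \<in> R" using R_mult[OF R_of_int] e(2) by (intro asub_sum[OF R_asub]) blast
      finally show ?thesis .
    qed
    then show "\<exists>d>0. \<forall>y\<in>?I. of_int d * y \<in> R" using e(1) by blast
  qed
  obtain w1 where w1: "basis of_int n w1 ?I" using lat_basis[OF I] by blast
  have "\<forall>i. \<exists>u. i < n \<longrightarrow> u \<in> L \<and> w1 i = P u" using of_int_hom.basis_vec[OF w1] by blast
  then obtain u where u: "\<And>i. i < n \<Longrightarrow> u i \<in> L" "\<And>i. i < n \<Longrightarrow> w1 i = P (u i)" by metis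
  have Pu: "P (comb of_int n u c) = comb of_int n w1 c" for c
  proof -
    have "P (comb of_int n u c) = comb of_int n (\<lambda>i. P (u i)) c" using Pc u(1) by blast
    also have "\<dots> = comb of_int n w1 c" by (intro of_int_hom.comb_cong) (auto simp: u)
    finally show ?thesis .
  qed
  let ?L1 = "range (comb (of_int :: int \<Rightarrow> _) n u)"
  have uL: "comb of_int n u c \<in> L" for c using asub_comb[OF L_asub u(1)] .
  have b1: "basis of_int n u ?L1" unfolding basis_def
  proof (intro conjI allI impI refl)
    fix c i assume "comb of_int n u c = 0" and i: "i < n"
    then have "comb of_int n w1 c = 0" using Pu[of c] khom_0[OF P] by simp
    then show "c i = 0" using w1 i unfolding basis_def by blast
  qed
  obtain m2 w2 where b2: "basis of_int m2 w2 ?L2" using sub_basis[OF bL khom_kernel(1)[OF P]] by blast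
  have "?L1 \<inter> ?L2 \<subseteq> {0}"
  proof clarify
    fix c assume "P (comb of_int n u c) = 0"
    then have "\<forall>i<n. c i = 0" using w1 unfolding Pu basis_def by blast
    then have "comb of_int n u c = comb of_int n u (\<lambda>_. 0)" by (intro of_int_hom.comb_cong) auto
    then show "comb of_int n u c = 0" by (simp add: of_int_hom.comb_zero)
  qed
  moreover have "L = {x + y | x y. x \<in> ?L1 \<and> y \<in> ?L2}"
  proof (intro equalityI subsetI)
    fix v assume v: "v \<in> L"
    obtain c where c: "P v = comb of_int n w1 c" using of_int_hom.basis_obtain[OF w1] v by blast
    have "P (v - comb of_int n u c) = 0" using khom_diff[OF P L_V[OF v] L_V[OF uL]] Pu c by simp
    then have "v - comb of_int n u c \<in> ?L2" using v uL asub_diff[OF L_asub] by blast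
    moreover have "v = comb of_int n u c + (v - comb of_int n u c)" by simp
    ultimately show "v \<in> {x + y | x y. x \<in> ?L1 \<and> y \<in> ?L2}" by blast
  qed (use uL asub_add[OF L_asub] in auto)
  ultimately have "basis of_int (n + m2) (\<lambda>i. if i < n then u i else w2 (i - n)) L"
    using basis_direct_sum[OF of_int_hom.comm_ring_hom_axioms b1 b2] by blast
  then have "m = n + m2" using basis_size_unique[OF of_int_hom.comm_ring_hom_axioms bL] by blast
  then have "m2 = 0" using mn by simp
  then have L2: "?L2 = {0}" using b2 by (simp add: basis_def comb_def)
  have "inj_on P L"
  proof (rule inj_onI)
    fix a b assume ab: "a \<in> L" "b \<in> L" "P a = P b"
    then have "a - b \<in> ?L2" using khom_diff[OF P, of a b] L_V asub_diff[OF L_asub] by auto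
    then show "a = b" using L2 by auto
  qed
  then have "op_iso T L ((*) xi) ?I P"
    unfolding op_iso_def using khomD(2)[OF P] khom_T[OF P] L_V by (auto simp: bij_betw_def)
  then show ?thesis using I by blast
qed

end

section \<open>Isomorphisms between sums of ideals\<close>

lemma op_isoI:
  assumes "\<And>u. u \<in> L \<Longrightarrow> h u \<in> L'" "\<And>u. u \<in> L' \<Longrightarrow> k u \<in> L" "\<And>u. u \<in> L \<Longrightarrow> k (h u) = u" "\<And>u. u \<in> L' \<Longrightarrow> h (k u) = u"
    "\<And>u v. u \<in> L \<Longrightarrow> v \<in> L \<Longrightarrow> h (u + v) = h u + h v" "\<And>v. v \<in> L \<Longrightarrow> h (T v) = T' (h v)"
  shows "op_iso T L T' L' h"
  unfolding op_iso_def using assms by (auto intro!: bij_betw_byWitness[where f' = k])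

lemma op_isoD:
  assumes "op_iso T L T' L' h"
  shows "bij_betw h L L'" "\<And>u. u \<in> L \<Longrightarrow> h u \<in> L'" "\<And>u v. u \<in> L \<Longrightarrow> v \<in> L \<Longrightarrow> h (u + v) = h u + h v" "\<And>v. v \<in> L \<Longrightarrow> h (T v) = T' (h v)"
  using assms by (auto simp: op_iso_def dest: bij_betwE)

lemma prod_mem:
  assumes "1 \<in> S" "\<And>x y. x \<in> S \<Longrightarrow> y \<in> S \<Longrightarrow> x * y \<in> S" "\<And>i. i \<in> A \<Longrightarrow> g i \<in> S"
  shows "prod g A \<in> (S :: 'k::comm_ring_1 set)"
  using assms(3) by (induction A rule: infinite_finite_induct) (auto simp: assms(1,2))

lemma prod_mem_ideal:
  assumes S: "1 \<in> S" "\<And>x y. x \<in> S \<Longrightarrow> y \<in> S \<Longrightarrow> x * y \<in> S" and C: "\<And>x y. x \<in> S \<Longrightarrow> y \<in> C \<Longrightarrow> x * y \<in> C"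
    and g: "finite A" "\<And>i. i \<in> A \<Longrightarrow> g i \<in> S" "j \<in> A" "g j \<in> C"
  shows "prod g A \<in> (C :: 'k::comm_ring_1 set)"
proof -
  have "prod g A = prod g (A - {j}) * g j" using g by (simp add: prod.remove mult.commute)
  then show ?thesis using C g prod_mem[OF S, of "A - {j}" g] by auto
qed

lemma prod_diff_mem_ideal:
  assumes S: "1 \<in> S" "\<And>x y. x \<in> S \<Longrightarrow> y \<in> S \<Longrightarrow> x * y \<in> S" and C: "asub C" "C \<subseteq> S" "\<And>x y. x \<in> S \<Longrightarrow> y \<in> C \<Longrightarrow> x * y \<in> C"
    and g: "finite A" "\<And>i. i \<in> A \<Longrightarrow> u i \<in> S" "\<And>i. i \<in> A \<Longrightarrow> u i - z i \<in> C" "\<And>i. i \<in> A \<Longrightarrow> z i \<in> S"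
  shows "prod u A - prod z A \<in> (C :: 'k::comm_ring_1 set)"
  using g
proof (induction A rule: finite_induct)
  case empty then show ?case using asub_0[OF C(1)] by simp
next
  case (insert x A)
  have "prod u (insert x A) - prod z (insert x A) = u x * (prod u A - prod z A) + prod z A * (u x - z x)"
    using insert by (simp add: algebra_simps)
  moreover have "prod z A \<in> S" using insert by (intro prod_mem[OF S]) auto
  ultimately show ?case using insert C asub_add[OF C(1)] by simp
qed

lemma permutes_lt: "p permutes {0..<k::nat} \<Longrightarrow> i < k \<Longrightarrow> p i < k"
  using permutes_in_image[of p "{0..<k}" i] by simp

lemma det_zero_column:
  fixes U :: "'k::comm_ring_1 mat"
  assumes U: "U \<in> carrier_mat k k" "j < k" "\<And>i. i < k \<Longrightarrow> U $$ (i,j) = 0"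
  shows "det U = 0"
  using laplace_expansion_column[OF U(1,2)] U(3) by simp

context residue_alg
begin

text \<open>Induction on a polynomial representing \<open>r\<close>. The embeddings are the identity
  in the case of ideals and constant functions in the case of tuples.\<close>

lemma module_R_linear:
  fixes emb :: "'k \<Rightarrow> 'v::comm_ring_1" and emb' :: "'k \<Rightarrow> 'u::comm_ring_1"
  assumes e: "comm_ring_hom emb" "comm_ring_hom emb'"
    and L: "asub L" "\<And>v. v \<in> L \<Longrightarrow> emb xi * v \<in> L"
    and g: "\<And>u v. u \<in> L \<Longrightarrow> v \<in> L \<Longrightarrow> g (u + v) = g u + g v" "\<And>v. v \<in> L \<Longrightarrow> g (emb xi * v) = emb' xi * g v"
    and r: "r \<in> R" and v: "v \<in> L"
  shows "emb r * v \<in> L \<and> g (emb r * v) = emb' r * g v"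
proof -
  interpret e: comm_ring_hom emb by fact
  interpret e': comm_ring_hom emb' by fact
  have g0: "g 0 = 0" using g(1)[OF asub_0[OF L(1)] asub_0[OF L(1)]] by simp
  have gi: "g (of_int a * v) = of_int a * g v" for a
    using additive_comb[OF L(1) g(1), of 1 "\<lambda>_. v" "\<lambda>_. a"] v by (simp add: comb_def)
  obtain p where p: "r = io (map_poly rat_of_int p)" using r by (auto simp: R_def)
  have "emb (io (map_poly rat_of_int p)) * v \<in> L \<and>
      g (emb (io (map_poly rat_of_int p)) * v) = emb' (io (map_poly rat_of_int p)) * g v"
  proof (induction p)
    case 0 then show ?case by (simp add: g0 asub_0[OF L(1)])
  next
    case (pCons a p)
    let ?y = "io (map_poly rat_of_int p)"
    have e: "io (map_poly rat_of_int (pCons a p)) = of_int a + xi * ?y"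
      using io_pCons[of "of_int a" "map_poly rat_of_int p"] by (simp only: qs.hom_of_int of_int_hom.map_poly_pCons_hom)
    have 1: "emb (of_int a + xi * ?y) * v = of_int a * v + emb xi * (emb ?y * v)"
      by (simp add: e.hom_add e.hom_mult e.hom_of_int distrib_right mult.assoc)
    have 2: "emb' (of_int a + xi * ?y) * g v = of_int a * g v + emb' xi * (emb' ?y * g v)"
      by (simp add: e'.hom_add e'.hom_mult e'.hom_of_int distrib_right mult.assoc)
    show ?case unfolding e 1 2
      using pCons.IH g L(2) asub_of_int[OF L(1) v] gi asub_add[OF L(1)] by simp
  qed
  then show ?thesis by (simp add: p)
qed

text \<open>The factor is \<open>g (of_int c0)\<close> divided by \<open>c0\<close> for a positive
  integer \<open>c0\<close> in \<open>I\<close>, since 1 need not lie in \<open>I\<close>.\<close>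

lemma lat_hom_mult:
  assumes I: "lat I"
    and g: "\<And>y z. y \<in> I \<Longrightarrow> z \<in> I \<Longrightarrow> g (y + z) = g y + g z" "\<And>y. y \<in> I \<Longrightarrow> g (xi * y) = xi * g y" "\<And>y. y \<in> I \<Longrightarrow> g y \<in> K"
  shows "\<exists>c\<in>K. \<forall>y\<in>I. g y = c * y"
proof -
  note l = latD[OF I]
  have lin: "g (r * y) = r * g y" if "r \<in> R" "y \<in> I" for r y
    using module_R_linear[of "\<lambda>x. x" "\<lambda>x. x" I g] by (simp add: l g that comm_ring_hom_ident)
  obtain c0 where c0: "c0 > 0" "of_int c0 \<in> I" using l(4) by blast
  define c where "c = qs (1 / of_int c0) * g (of_int c0)"
  have cc: "of_int c0 * c = g (of_int c0)"
    using of_int_inv[of c0 "g (of_int c0)"] c0 by (simp add: c_def mult.left_commute)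
  have "g y = c * y" if y: "y \<in> I" for y
  proof -
    obtain e where e: "e > 0" "of_int e * y \<in> R" using to_R[OF l(6)[OF y]] by blast
    have "of_int (e * c0) * g y = g (of_int (e * c0) * y)" using lin[OF R_of_int y] by metis
    also have "of_int (e * c0) * y = (of_int e * y) * of_int c0" by simp
    also have "g \<dots> = (of_int e * y) * g (of_int c0)" by (rule lin[OF e(2) c0(2)])
    also have "\<dots> = of_int (e * c0) * (c * y)" unfolding cc[symmetric] by (simp add: ac_simps)
    finally show ?thesis using K_of_int_cancel[of "e * c0"] e c0 by simp
  qed
  moreover have "c \<in> K" unfolding c_def using g(3)[OF c0(2)] by (intro K_mult K_qs)
  ultimately show ?thesis by blast
qed

definition "single j y = (\<lambda>i::nat. if i = j then y else (0::'k))"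

lemma dprod_asub: "(\<And>i. i < N \<Longrightarrow> asub (I i)) \<Longrightarrow> asub (dprod N I)"
  by (auto simp: asub_def dprod_def)

lemma single_dprod: "(\<And>i. i < N \<Longrightarrow> asub (I i)) \<Longrightarrow> j < N \<Longrightarrow> y \<in> I j \<Longrightarrow> single j y \<in> dprod N I"
  by (auto simp: dprod_def single_def asub_0)

lemma hom_matrix:
  assumes I: "\<And>i. i < N \<Longrightarrow> lat (I i)" and I': "\<And>i. i < N \<Longrightarrow> lat (I' i)"
    and h: "\<And>u. u \<in> dprod N I \<Longrightarrow> h u \<in> dprod N I'" "\<And>u v. u \<in> dprod N I \<Longrightarrow> v \<in> dprod N I \<Longrightarrow> h (u + v) = h u + h v"
      "\<And>v. v \<in> dprod N I \<Longrightarrow> h (xs v) = xs (h v)"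
  shows "\<exists>P. (\<forall>i<N. \<forall>j<N. P i j \<in> K) \<and> (\<forall>g\<in>dprod N I. \<forall>i<N. h g i = (\<Sum>j<N. P i j * g j)) \<and>
    (\<forall>i<N. \<forall>j<N. \<forall>y\<in>I j. P i j * y \<in> I' i)"
proof -
  have aI: "\<And>i. i < N \<Longrightarrow> asub (I i)" using I latD(2) by blast
  have sd: "single j y \<in> dprod N I" if "j < N" "y \<in> I j" for j y
    using single_dprod[of N I j y] aI that by blast
  have "\<exists>c\<in>K. \<forall>y\<in>I j. h (single j y) i = c * y" if ij: "i < N" "j < N" for i j
  proof (rule lat_hom_mult[OF I[OF ij(2)]])
    fix y z assume yz: "y \<in> I j" "z \<in> I j"
    have "single j (y + z) = single j y + single j z" by (auto simp: single_def)
    then show "h (single j (y + z)) i = h (single j y) i + h (single j z) i"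
      using h(2)[OF sd[OF ij(2) yz(1)] sd[OF ij(2) yz(2)]] by simp
  next
    fix y assume y: "y \<in> I j"
    have "single j (xi * y) = xs (single j y)" by (auto simp: single_def xs_def)
    then show "h (single j (xi * y)) i = xi * h (single j y) i" using h(3)[OF sd[OF ij(2) y]] by (simp add: xs_def)
    show "h (single j y) i \<in> K" using h(1)[OF sd[OF ij(2) y]] ij(1) latD(6)[OF I'[OF ij(1)]] by (auto simp: dprod_def)
  qed
  then have "\<forall>i j. \<exists>c. i < N \<longrightarrow> j < N \<longrightarrow> c \<in> K \<and> (\<forall>y\<in>I j. h (single j y) i = c * y)" by blast
  then obtain P where P: "\<And>i j. i < N \<Longrightarrow> j < N \<Longrightarrow> P i j \<in> K \<and> (\<forall>y\<in>I j. h (single j y) i = P i j * y)" by metis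
  have "h g i = (\<Sum>j<N. P i j * g j)" if g: "g \<in> dprod N I" and i: "i < N" for g i
  proof -
    let ?t = "\<lambda>k. (\<lambda>i. if i < k then g i else 0)"
    have td: "?t k \<in> dprod N I" for k using g by (auto simp: dprod_def asub_0[OF aI])
    have h0: "h 0 = 0"
      using h(2)[of 0 0] asub_0[OF dprod_asub[OF aI]] by simp
    have "h (?t k) i = (\<Sum>j<k. P i j * g j)" if "k \<le> N" for k
      using that
    proof (induction k)
      case 0 then show ?case using h0 by (simp add: zero_fun_def)
    next
      case (Suc k)
      have "?t (Suc k) = ?t k + single k (g k)" by (auto simp: single_def less_Suc_eq)
      moreover have "g k \<in> I k" using g Suc.prems by (auto simp: dprod_def)
      ultimately show ?case using h(2)[OF td[of k] sd[of k "g k"]] Suc P[OF i, of k] by simp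
    qed
    moreover have "?t N = g" using g by (auto simp: dprod_def)
    ultimately show ?thesis by (metis order_refl)
  qed
  moreover have "P i j * y \<in> I' i" if "i < N" "j < N" "y \<in> I j" for i j y
    using h(1)[OF sd[OF that(2,3)]] P that by (auto simp: dprod_def)
  ultimately show ?thesis using P by blast
qed

lemma iso_matrices:
  assumes I: "\<And>i. i < N \<Longrightarrow> lat (I i)" and I': "\<And>i. i < N \<Longrightarrow> lat (I' i)"
    and iso: "op_iso xs (dprod N I) xs (dprod N I') h"
  shows "\<exists>P Q. (\<forall>i<N. \<forall>j<N. P i j \<in> K) \<and> (\<forall>i<N. \<forall>j<N. Q i j \<in> K) \<and>
    (\<forall>i<N. \<forall>j<N. \<forall>y\<in>I j. P i j * y \<in> I' i) \<and> (\<forall>i<N. \<forall>j<N. \<forall>y\<in>I' j. Q i j * y \<in> I i) \<and>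
    (\<forall>i<N. \<forall>j<N. (\<Sum>l<N. Q i l * P l j) = (if i = j then 1 else 0))"
proof -
  have aI: "\<And>i. i < N \<Longrightarrow> asub (I i)" using I latD(2) by blast
  note h = op_isoD[OF iso]
  have xsd: "xs ` dprod N I \<subseteq> dprod N I" using latD(3)[OF I] by (auto simp: dprod_def xs_def)
  let ?k = "inv_into (dprod N I) h"
  note k = op_isoD[OF op_iso_sym[OF iso dprod_asub[OF aI] xsd]]
  obtain P where P: "\<forall>i<N. \<forall>j<N. P i j \<in> K" "\<forall>g\<in>dprod N I. \<forall>i<N. h g i = (\<Sum>j<N. P i j * g j)"
    "\<forall>i<N. \<forall>j<N. \<forall>y\<in>I j. P i j * y \<in> I' i"
    using hom_matrix[of N I I' h] I I' h(2,3,4) by blast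
  obtain Q where Q: "\<forall>i<N. \<forall>j<N. Q i j \<in> K" "\<forall>g\<in>dprod N I'. \<forall>i<N. ?k g i = (\<Sum>j<N. Q i j * g j)"
    "\<forall>i<N. \<forall>j<N. \<forall>y\<in>I' j. Q i j * y \<in> I i"
    using hom_matrix[of N I' I ?k] I' I k(2,3,4) by blast
  have "(\<Sum>l<N. Q i l * P l j) = (if i = j then 1 else 0)" if ij: "i < N" "j < N" for i j
  proof -
    \<comment> \<open>1 need not lie in \<open>I j\<close>, so the matrix product is tested on a
      positive integer, which is cancelled at the end.\<close>
    obtain c0 where c0: "c0 > 0" "of_int c0 \<in> I j" using latD(4)[OF I[OF ij(2)]] by blast
    let ?g = "single j (of_int c0)"
    have g: "?g \<in> dprod N I" using single_dprod[of N I j "of_int c0"] aI ij(2) c0(2) by blast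
    have hg: "h ?g l = P l j * of_int c0" if "l < N" for l
    proof -
      have "h ?g l = (\<Sum>j'<N. P l j' * ?g j')" using P(2) g that by blast
      also have "\<dots> = (\<Sum>j'<N. if j' = j then P l j * of_int c0 else 0)" by (intro sum.cong) (auto simp: single_def)
      finally show ?thesis using ij by simp
    qed
    have "?g i = ?k (h ?g) i" using h(1) g by (simp add: bij_betw_inv_into_left)
    also have "\<dots> = (\<Sum>l<N. Q i l * h ?g l)" using Q(2) h(2)[OF g] ij by blast
    also have "\<dots> = (\<Sum>l<N. of_int c0 * (Q i l * P l j))" by (intro sum.cong) (auto simp: hg ac_simps)
    also have "\<dots> = of_int c0 * (\<Sum>l<N. Q i l * P l j)" by (simp add: sum_distrib_left)
    finally have "of_int c0 * (if i = j then 1 else 0) = of_int c0 * (\<Sum>l<N. Q i l * P l j)"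
      by (simp add: single_def split: if_splits)
    then show ?thesis using K_of_int_cancel[of c0 "if i = j then 1 else 0"] c0 by simp
  qed
  then show ?thesis using P Q by blast
qed

section \<open>Products of ideals, determinants and minors\<close>

primrec pr :: "(nat \<Rightarrow> 'k set) \<Rightarrow> nat \<Rightarrow> 'k set" where
  "pr I 0 = R"
| "pr I (Suc k) = kprod (pr I k) (I k)"

lemma lat_pr: "(\<And>i. i < k \<Longrightarrow> lat (I i)) \<Longrightarrow> lat (pr I k)"
  by (induction k) (auto simp: lat_RR lat_kprod)

lemma pr_prod: "(\<And>i. i < k \<Longrightarrow> y i \<in> I i) \<Longrightarrow> (\<Prod>i<k. y i) \<in> pr I k"
  by (induction k) (auto simp: R_1 intro: kprod.mult)

lemma pr_subset:
  assumes "asub D" "\<And>r x. r \<in> R \<Longrightarrow> x \<in> D \<Longrightarrow> r * x \<in> D" "\<And>y. (\<And>i. i < k \<Longrightarrow> y i \<in> I i) \<Longrightarrow> (\<Prod>i<k. y i) \<in> D"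
  shows "pr I k \<subseteq> D"
  using assms
proof (induction k arbitrary: D)
  case 0
  show ?case using 0(2)[of _ 1] 0(3)[of "\<lambda>_. 0"] by auto
next
  case (Suc k)
  show ?case unfolding pr.simps
  proof (rule kprod_subset[OF Suc.prems(1)])
    fix a b assume a: "a \<in> pr I k" and b: "b \<in> I k"
    have "pr I k \<subseteq> {x. x * b \<in> D}"
    proof (rule Suc.IH)
      show "asub {x. x * b \<in> D}" using Suc.prems(1) by (auto simp: asub_def left_diff_distrib)
      show "r * x \<in> {x. x * b \<in> D}" if "r \<in> R" "x \<in> {x. x * b \<in> D}" for r x
        using that Suc.prems(2) by (simp add: mult.assoc)
      fix y assume y: "\<And>i. i < k \<Longrightarrow> y i \<in> I i"
      have "(\<Prod>i<Suc k. (y(k := b)) i) \<in> D" using y b by (intro Suc.prems(3)) (auto simp: less_Suc_eq)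
      then show "(\<Prod>i<k. y i) \<in> {x. x * b \<in> D}" by simp
    qed
    then show "a * b \<in> D" using a by blast
  qed
qed

text \<open>In the Leibniz expansion of the determinant times the product of the \<open>y i\<close>,
  reordering the latter by the permutation turns each term into a product of elements
  \<open>P i (p i) * y (p i)\<close> of \<open>I' i\<close>.\<close>

lemma det_pr:
  assumes I': "\<And>i. i < N \<Longrightarrow> lat (I' i)" and P: "\<And>i j y. i < N \<Longrightarrow> j < N \<Longrightarrow> y \<in> I j \<Longrightarrow> P i j * y \<in> I' i"
    and x: "x \<in> pr I N"
  shows "det (mat N N (\<lambda>(i,j). P i j)) * x \<in> pr I' N"
proof -
  let ?P = "mat N N (\<lambda>(i,j). P i j)"
  note l = latD(2)[OF lat_pr[of N I', OF I']]
  have "pr I N \<subseteq> {x. det ?P * x \<in> pr I' N}"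
  proof (rule pr_subset)
    show "asub {x. det ?P * x \<in> pr I' N}" using l by (auto simp: asub_def right_diff_distrib)
    show "r * x \<in> {x. det ?P * x \<in> pr I' N}" if "r \<in> R" "x \<in> {x. det ?P * x \<in> pr I' N}" for r x
      using that lat_R[OF lat_pr[of N I', OF I']] by (simp add: mult.left_commute)
    fix y assume y: "\<And>i. i < N \<Longrightarrow> y i \<in> I i"
    have "det ?P * (\<Prod>i<N. y i) = (\<Sum>p | p permutes {0..<N}. signof p * (\<Prod>i=0..<N. P i (p i)) * (\<Prod>i<N. y i))"
    proof -
      have "det ?P = (\<Sum>p | p permutes {0..<N}. signof p * (\<Prod>i=0..<N. P i (p i)))"
        unfolding det_def'[of ?P N, OF mat_carrier]
        by (intro sum.cong arg_cong2[of _ _ _ _ "(*)"] prod.cong refl) (simp add: permutes_lt)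
      then show ?thesis by (simp add: sum_distrib_right)
    qed
    also have "\<dots> = (\<Sum>p | p permutes {0..<N}. signof p * (\<Prod>i<N. P i (p i) * y (p i)))"
    proof (intro sum.cong refl)
      fix p assume "p \<in> {p. p permutes {0..<N}}"
      then have "(\<Prod>i<N. y i) = (\<Prod>i<N. y (p i))"
        using prod.permute[of p "{0..<N}" y] by (simp add: lessThan_atLeast0 o_def)
      then show "signof p * (\<Prod>i=0..<N. P i (p i)) * (\<Prod>i<N. y i) = signof p * (\<Prod>i<N. P i (p i) * y (p i))"
        by (simp add: prod.distrib lessThan_atLeast0 mult.assoc)
    qed
    also have "\<dots> \<in> pr I' N"
    proof (rule asub_sum[OF l])
      fix p assume p: "p \<in> {p. p permutes {0..<N}}"
      have "(\<Prod>i<N. P i (p i) * y (p i)) \<in> pr I' N"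
        using p y permutes_lt[of p N] by (intro pr_prod P) auto
      then show "signof p * (\<Prod>i<N. P i (p i) * y (p i)) \<in> pr I' N"
        using asub_neg[OF l] by (auto simp: sign_def)
    qed
    finally show "(\<Prod>i<N. y i) \<in> {x. det ?P * x \<in> pr I' N}" by simp
  qed
  then show ?thesis using x by blast
qed

lemma chain_mono:
  assumes "chain N I" "i \<le> j" "j < N" shows "kcol (I i) (I i) \<subseteq> kcol (I j) (I j)"
  using assms(2,3)
proof (induction j rule: dec_induct)
  case (step k)
  then show ?case using assms(1) unfolding chain_def by (meson Suc_lessD dual_order.trans)
qed simp

text \<open>Each hypothesis writes 1 as a sum of products; multiplying these \<open>M\<close>
  expressions together writes 1 as a sum of the products tested in the last hypothesis.\<close>

lemma one_mem_by_products:
  assumes "\<And>j. j < (M::nat) \<Longrightarrow> 1 \<in> kprod (I j) (A j)" "asub D"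
    "\<And>a y. (\<And>j. j < M \<Longrightarrow> a j \<in> A j) \<Longrightarrow> (\<And>j. j < M \<Longrightarrow> y j \<in> I j) \<Longrightarrow> (\<Prod>j<M. a j * y j) \<in> D"
  shows "(1::'k) \<in> D"
  using assms
proof (induction M)
  case 0 show ?case using 0(3)[of undefined undefined] by simp
next
  case (Suc M)
  show ?case
  proof (rule Suc.IH)
    fix a y assume ay: "\<And>j. j < M \<Longrightarrow> a j \<in> A j" "\<And>j. j < M \<Longrightarrow> y j \<in> I j"
    let ?z = "\<Prod>j<M. a j * y j"
    have "kprod (I M) (A M) \<subseteq> {t. ?z * t \<in> D}"
    proof (rule kprod_subset)
      show "asub {t. ?z * t \<in> D}" using Suc.prems(2) by (auto simp: asub_def right_diff_distrib)
      fix v b assume vb: "v \<in> I M" "b \<in> A M"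
      have "(\<Prod>j<Suc M. (a(M := b)) j * (y(M := v)) j) \<in> D"
        using ay vb by (intro Suc.prems(3)) (auto simp: less_Suc_eq)
      then show "v * b \<in> {t. ?z * t \<in> D}" by (simp add: mult.commute)
    qed
    then show "?z \<in> D" using Suc.prems(1)[of M] by auto
  qed (use Suc.prems in auto)
qed

text \<open>The aim is that 1 lies in \<open>?C\<close>, the ideal of those elements of
  \<open>?T\<close> that multiply the k-th ring of \<open>I'\<close> into \<open>?T\<close>.
  Invertibility of the ideals up to index k expands 1 into products of \<open>a j * y j\<close> over
  j <= k. The matrix with entries \<open>a j * (Q P) j j' * y j'\<close> of size k + 1 is diagonal
  with exactly these entries. Write it as \<open>Z + E\<close>, where \<open>Z\<close> collects the
  inner summation indices below k and \<open>E\<close> the others. Then \<open>Z\<close> has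
  determinant 0, since only k inner indices occur, while \<open>E\<close> has entries in
  \<open>?C\<close>. Modulo \<open>?C\<close> the determinant of \<open>Z\<close> is the product of
  the \<open>a j * y j\<close>, which therefore lies in \<open>?C\<close>.\<close>

lemma multiplicator_rings_le:
  assumes b: bass and c: "chain N I" "chain N I'" and iso: "op_iso xs (dprod N I) xs (dprod N I') h" and k: "k < N"
  shows "kcol (I' k) (I' k) \<subseteq> kcol (I k) (I k)"
proof -
  have I: "\<And>i. i < N \<Longrightarrow> lat (I i)" and I': "\<And>i. i < N \<Longrightarrow> lat (I' i)" using c by (auto simp: chain_def)
  have "\<exists>P Q. (\<forall>i<N. \<forall>j<N. P i j \<in> K) \<and> (\<forall>i<N. \<forall>j<N. Q i j \<in> K) \<and>
    (\<forall>i<N. \<forall>j<N. \<forall>y\<in>I j. P i j * y \<in> I' i) \<and> (\<forall>i<N. \<forall>j<N. \<forall>y\<in>I' j. Q i j * y \<in> I i) \<and>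
    (\<forall>i<N. \<forall>j<N. (\<Sum>l<N. Q i l * P l j) = (if i = j then 1 else 0))"
    by (rule iso_matrices[OF I I' iso])
  then obtain P Q where PQ0:
    "(\<forall>i<N. \<forall>j<N. P i j \<in> K) \<and> (\<forall>i<N. \<forall>j<N. Q i j \<in> K) \<and>
    (\<forall>i<N. \<forall>j<N. \<forall>y\<in>I j. P i j * y \<in> I' i) \<and> (\<forall>i<N. \<forall>j<N. \<forall>y\<in>I' j. Q i j * y \<in> I i) \<and>
    (\<forall>i<N. \<forall>j<N. (\<Sum>l<N. Q i l * P l j) = (if i = j then 1 else 0))"
    by (elim exE)
  then have PQ: "\<And>i j. i < N \<Longrightarrow> j < N \<Longrightarrow> P i j \<in> K" "\<And>i j. i < N \<Longrightarrow> j < N \<Longrightarrow> Q i j \<in> K"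
    "\<And>i j y. i < N \<Longrightarrow> j < N \<Longrightarrow> y \<in> I j \<Longrightarrow> P i j * y \<in> I' i" "\<And>i j y. i < N \<Longrightarrow> j < N \<Longrightarrow> y \<in> I' j \<Longrightarrow> Q i j * y \<in> I i"
    "\<And>i j. i < N \<Longrightarrow> j < N \<Longrightarrow> (\<Sum>l<N. Q i l * P l j) = (if i = j then 1 else 0)"
    by (simp_all add: PQ0)
  let ?S = "\<lambda>i. kcol (I i) (I i)" and ?S' = "\<lambda>i. kcol (I' i) (I' i)"
  let ?T = "?S k" and ?C = "kcol (?S k) (?S' k)"
  note o = korderD[OF order_kcol[OF I[OF k]]] and o' = korderD[OF order_kcol[OF I'[OF k]]]
  have aC: "asub ?C" using latD(2)[OF lat_kcol[OF o(1) o'(1)]] .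
  have CT: "?C \<subseteq> ?T" using o'(3) by (auto simp: kcol_def[of "?S k"])
  have TC: "x * y \<in> ?C" if "x \<in> ?T" "y \<in> ?C" for x y
    using kcol_scale[OF order_kcol[OF I[OF k]] that] .
  have "1 \<in> ?C"
  proof (rule one_mem_by_products[of "Suc k" I "\<lambda>j. kcol (?S j) (I j)", OF _ aC])
    show "1 \<in> kprod (I j) (kcol (?S j) (I j))" if "j < Suc k" for j using bass_invertible[OF b I] that k by simp
    fix a y assume a: "\<And>j. j < Suc k \<Longrightarrow> a j \<in> kcol (?S j) (I j)" and y: "\<And>j. j < Suc k \<Longrightarrow> y j \<in> I j"
    have ST: "?S j \<subseteq> ?T" if "j < Suc k" for j using chain_mono[OF c(1), of j k] that k by simp
    have ay: "a j * z \<in> ?T" if "j < Suc k" "z \<in> I j" for j z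
      using a[OF that(1)] that(2) ST[OF that(1)] by (auto simp: kcol_def[of "kcol _ _"])
    define E where "E j j' = a j * (\<Sum>i\<in>{k..<N}. Q j i * P i j') * y j'" for j j'
    define Z where "Z j j' = a j * (\<Sum>i<k. Q j i * P i j') * y j'" for j j'
    have ZE: "Z j j' + E j j' = (if j = j' then a j * y j else 0)" if "j < Suc k" "j' < Suc k" for j j'
    proof -
      have "(\<Sum>i<k. Q j i * P i j') + (\<Sum>i\<in>{k..<N}. Q j i * P i j') = (\<Sum>i<N. Q j i * P i j')"
        unfolding lessThan_atLeast0 by (rule sum.atLeastLessThan_concat) (use k in auto)
      then have "Z j j' + E j j' = a j * (\<Sum>i<N. Q j i * P i j') * y j'"
        unfolding Z_def E_def by (simp add: distrib_left[symmetric] distrib_right[symmetric])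
      then show ?thesis using PQ(5)[of j j'] that k by simp
    qed
    \<comment> \<open>For an inner index \<open>i\<close> at least \<open>k\<close>, the chain
      condition puts the k-th ring of \<open>I'\<close> into the i-th one, so \<open>I' i\<close> is
      stable under \<open>s\<close>; this absorbs \<open>s\<close> in front of
      \<open>P i j' * y j'\<close>.\<close>
    have EC: "E j j' \<in> ?C" if j: "j < Suc k" "j' < Suc k" for j j'
      unfolding kcol_def[of "?S k"]
    proof (intro CollectI conjI ballI)
      have ak: "a j \<in> K" "y j' \<in> K" using a[OF j(1)] latD(6)[OF I y[OF j(2)]] j k by (auto simp: kcol_def)
      show "E j j' \<in> K" unfolding E_def using ak PQ(1,2) j k by (intro K_mult asub_sum[OF K_asub]) auto
      fix s assume s: "s \<in> ?S' k"
      have "E j j' * s = a j * (\<Sum>i\<in>{k..<N}. Q j i * (s * (P i j' * y j')))"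
        unfolding E_def by (simp add: sum_distrib_left sum_distrib_right ac_simps)
      moreover have "(\<Sum>i\<in>{k..<N}. Q j i * (s * (P i j' * y j'))) \<in> I j"
      proof (rule asub_sum)
        show "asub (I j)" using latD(2)[OF I] j k by simp
        fix i assume i: "i \<in> {k..<N}"
        have "s \<in> ?S' i" using s chain_mono[OF c(2), of k i] i by auto
        moreover have "P i j' * y j' \<in> I' i" using PQ(3)[OF _ _ y[OF j(2)]] i j k by simp
        ultimately have "s * (P i j' * y j') \<in> I' i" by (simp add: kcol_def)
        then show "Q j i * (s * (P i j' * y j')) \<in> I j" using PQ(4) i j k by simp
      qed
      ultimately show "E j j' * s \<in> ?S k" using ay[OF j(1)] by simp
    qed
    have ZT: "Z j j' \<in> ?T" if "j < Suc k" "j' < Suc k" for j j'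
    proof -
      have "Z j j' = (if j = j' then a j * y j else 0) - E j j'" using ZE[OF that] by (simp add: algebra_simps)
      moreover have "(if j = j' then a j * y j else 0) \<in> ?T" using ay[OF that(1) y[OF that(1)]] asub_0[OF o(2)] by auto
      ultimately show ?thesis using asub_diff[OF o(2) _ subsetD[OF CT EC[OF that]]] by metis
    qed
    define Zm where "Zm = mat (Suc k) (Suc k) (\<lambda>(j,j'). Z j j')"
    \<comment> \<open>\<open>Z\<close> is a product of a (k+1) x k and a k x (k+1) matrix. Both are
      padded to square matrices, and column \<open>k\<close> of \<open>U\<close> is filled with
      zeros.\<close>
    have det0: "det Zm = 0"
    proof -
      define U where "U = mat (Suc k) (Suc k) (\<lambda>(j,i). if i < k then a j * Q j i else 0)"
      define W where "W = mat (Suc k) (Suc k) (\<lambda>(i,j'). P i j' * y j')"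
      have UW: "U \<in> carrier_mat (Suc k) (Suc k)" "W \<in> carrier_mat (Suc k) (Suc k)" by (auto simp: U_def W_def)
      have "Zm = U * W"
      proof (rule eq_matI)
        fix i j assume "i < dim_row (U * W)" "j < dim_col (U * W)"
        then have ij: "i < Suc k" "j < Suc k" using UW by auto
        have "(U * W) $$ (i,j) = (\<Sum>l<Suc k. U $$ (i,l) * W $$ (l,j))" by (rule index_mult_sum[OF UW ij])
        also have "\<dots> = (\<Sum>l<k. a i * Q i l * (P l j * y j))" using ij by (simp add: U_def W_def)
        also have "\<dots> = Z i j" by (simp add: Z_def sum_distrib_left sum_distrib_right ac_simps)
        finally show "Zm $$ (i,j) = (U * W) $$ (i,j)" using ij by (simp add: Zm_def)
      qed (use UW in \<open>auto simp: Zm_def\<close>)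
      moreover have "det U = 0" by (rule det_zero_column[OF UW(1), of k]) (auto simp: U_def)
      ultimately show ?thesis using det_mult[OF UW] by simp
    qed
    have "det Zm = (\<Sum>p | p permutes {0..<Suc k}. signof p * (\<Prod>i=0..<Suc k. Z i (p i)))"
    proof -
      have "Zm \<in> carrier_mat (Suc k) (Suc k)" by (simp add: Zm_def)
      then show ?thesis unfolding det_def'[OF \<open>Zm \<in> _\<close>]
        by (intro sum.cong arg_cong2[of _ _ _ _ "(*)"] prod.cong refl) (auto simp: Zm_def permutes_lt simp del: upt_Suc)
    qed
    also have "\<dots> = signof id * (\<Prod>i=0..<Suc k. Z i (id i)) +
        (\<Sum>p\<in>{p. p permutes {0..<Suc k}} - {id}. signof p * (\<Prod>i=0..<Suc k. Z i (p i)))"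
      by (rule sum.remove) (auto simp: finite_permutations permutes_id)
    finally have e: "(\<Prod>i<Suc k. Z i i) = - (\<Sum>p\<in>{p. p permutes {0..<Suc k}} - {id}. signof p * (\<Prod>i=0..<Suc k. Z i (p i)))"
      unfolding det0 by (simp add: lessThan_atLeast0 eq_neg_iff_add_eq_0 del: prod.op_ivl_Suc)
    \<comment> \<open>A permutation other than the identity moves some \<open>j\<close>, and off the
      diagonal \<open>Z\<close> equals \<open>- E\<close>. One factor of the term therefore lies in
      the ideal \<open>?C\<close> and the others lie in \<open>?T\<close>.\<close>
    have "(\<Sum>p\<in>{p. p permutes {0..<Suc k}} - {id}. signof p * (\<Prod>i=0..<Suc k. Z i (p i))) \<in> ?C"
    proof (rule asub_sum[OF aC])
      fix p assume "p \<in> {p. p permutes {0..<Suc k}} - {id}"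
      then have p: "p permutes {0..<Suc k}" "p \<noteq> id" by auto
      then obtain j where "p j \<noteq> j" by fastforce
      then have j: "j < Suc k" "p j \<noteq> j" using permutes_not_in[OF p(1)] by force+
      have pl: "p i < Suc k" if "i < Suc k" for i using permutes_lt[OF p(1) that] .
      have "Z j (p j) = - E j (p j)" using ZE[OF j(1) pl[OF j(1)]] j(2) by (simp add: eq_neg_iff_add_eq_0)
      then have "Z j (p j) \<in> ?C" using asub_neg[OF aC EC[OF j(1) pl[OF j(1)]]] by simp
      then have "(\<Prod>i=0..<Suc k. Z i (p i)) \<in> ?C"
        using j(1) by (intro prod_mem_ideal[OF o(3,4) TC, where j = j]) (auto intro: ZT pl simp del: prod.op_ivl_Suc)
      then show "signof p * (\<Prod>i=0..<Suc k. Z i (p i)) \<in> ?C"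
        using asub_neg[OF aC] by (auto simp: sign_def simp del: prod.op_ivl_Suc)
    qed
    then have 1: "(\<Prod>i<Suc k. Z i i) \<in> ?C" unfolding e using asub_neg[OF aC] by blast
    have "(\<Prod>j<Suc k. a j * y j) - (\<Prod>j<Suc k. Z j j) \<in> ?C"
    proof (rule prod_diff_mem_ideal[OF o(3,4) aC CT TC])
      fix j assume "j \<in> {..<Suc k}"
      then have j: "j < Suc k" by simp
      show "a j * y j \<in> ?T" by (rule ay[OF j y[OF j]])
      have "a j * y j - Z j j = E j j" using ZE[OF j j] by (simp add: algebra_simps)
      then show "a j * y j - Z j j \<in> ?C" using EC[OF j j] by simp
      show "Z j j \<in> ?T" by (rule ZT[OF j j])
    qed auto
    from asub_add[OF aC this 1] show "(\<Prod>j<Suc k. a j * y j) \<in> ?C" by simp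
  qed
  then show ?thesis by (auto simp: kcol_def[of "?S k"])
qed

text \<open>The matrices of the isomorphism and of its inverse have inverse determinants, and
  \<open>det_pr\<close> in both directions makes multiplication by one of them an isomorphism of the
  products. The rings are compared by \<open>multiplicator_rings_le\<close> for the isomorphism and
  for its inverse.\<close>

lemma chain_iso_invariants:
  assumes b: bass and c: "chain N I" "chain N I'" and iso: "op_iso xs (dprod N I) xs (dprod N I') h"
  shows "(\<forall>i<N. kcol (I i) (I i) = kcol (I' i) (I' i)) \<and> (\<exists>h. op_iso ((*) xi) (pr I N) ((*) xi) (pr I' N) h)"
proof -
  have I: "\<And>i. i < N \<Longrightarrow> lat (I i)" and I': "\<And>i. i < N \<Longrightarrow> lat (I' i)" using c by (auto simp: chain_def)
  have aI: "\<And>i. i < N \<Longrightarrow> asub (I i)" using I latD(2) by blast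
  have xsd: "xs ` dprod N I \<subseteq> dprod N I" using latD(3)[OF I] by (auto simp: dprod_def xs_def)
  note iso' = op_iso_sym[OF iso dprod_asub[OF aI] xsd]
  have "\<exists>P Q. (\<forall>i<N. \<forall>j<N. P i j \<in> K) \<and> (\<forall>i<N. \<forall>j<N. Q i j \<in> K) \<and>
    (\<forall>i<N. \<forall>j<N. \<forall>y\<in>I j. P i j * y \<in> I' i) \<and> (\<forall>i<N. \<forall>j<N. \<forall>y\<in>I' j. Q i j * y \<in> I i) \<and>
    (\<forall>i<N. \<forall>j<N. (\<Sum>l<N. Q i l * P l j) = (if i = j then 1 else 0))"
    by (rule iso_matrices[OF I I' iso])
  then obtain P Q where PQ0:
    "(\<forall>i<N. \<forall>j<N. P i j \<in> K) \<and> (\<forall>i<N. \<forall>j<N. Q i j \<in> K) \<and>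
    (\<forall>i<N. \<forall>j<N. \<forall>y\<in>I j. P i j * y \<in> I' i) \<and> (\<forall>i<N. \<forall>j<N. \<forall>y\<in>I' j. Q i j * y \<in> I i) \<and>
    (\<forall>i<N. \<forall>j<N. (\<Sum>l<N. Q i l * P l j) = (if i = j then 1 else 0))"
    by (elim exE)
  then have PQ: "\<And>i j y. i < N \<Longrightarrow> j < N \<Longrightarrow> y \<in> I j \<Longrightarrow> P i j * y \<in> I' i" "\<And>i j y. i < N \<Longrightarrow> j < N \<Longrightarrow> y \<in> I' j \<Longrightarrow> Q i j * y \<in> I i"
    "\<And>i j. i < N \<Longrightarrow> j < N \<Longrightarrow> (\<Sum>l<N. Q i l * P l j) = (if i = j then 1 else 0)"
    by (simp_all add: PQ0)
  let ?P = "mat N N (\<lambda>(i,j). P i j)" and ?Q = "mat N N (\<lambda>(i,j). Q i j)"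
  have c1: "?P \<in> carrier_mat N N" "?Q \<in> carrier_mat N N" by auto
  have "?Q * ?P = 1\<^sub>m N"
  proof (rule eq_matI)
    fix i j assume "i < dim_row (1\<^sub>m N)" "j < dim_col (1\<^sub>m N)"
    then show "(?Q * ?P) $$ (i,j) = 1\<^sub>m N $$ (i,j)"
      using PQ(3)[of i j] index_mult_sum[OF c1(2,1), of i j] by simp
  qed auto
  then have d: "det ?Q * det ?P = 1" using det_mult[OF c1(2,1)] by simp
  have "op_iso ((*) xi) (pr I N) ((*) xi) (pr I' N) ((*) (det ?P))"
  proof (rule op_isoI[where k = "(*) (det ?Q)"])
    show "det ?P * u \<in> pr I' N" if "u \<in> pr I N" for u using det_pr[of N I' I P, OF I' PQ(1) that] .
    show "det ?Q * u \<in> pr I N" if "u \<in> pr I' N" for u using det_pr[of N I I' Q, OF I PQ(2) that] .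
    show "det ?Q * (det ?P * u) = u" for u
      using arg_cong[OF d, of "\<lambda>x. x * u"] by (simp add: mult.assoc)
    show "det ?P * (det ?Q * u) = u" for u
      using arg_cong[OF d, of "\<lambda>x. x * u"] by (simp add: mult.assoc mult.left_commute)
  qed (auto simp: distrib_left mult.left_commute)
  moreover have "kcol (I i) (I i) = kcol (I' i) (I' i)" if "i < N" for i
    using multiplicator_rings_le[OF b c iso that] multiplicator_rings_le[OF b c(2,1) iso' that] by blast
  ultimately show ?thesis by blast
qed

lemma kprod_R: "lat I \<Longrightarrow> kprod R I = I"
proof (intro equalityI subsetI)
  assume I: "lat I"
  show "x \<in> I" if "x \<in> kprod R I" for x using kprod_subset[OF latD(2)[OF I] lat_R[OF I]] that by blast
  show "x \<in> kprod R I" if "x \<in> I" for x using kprod.mult[OF R_1 that] by simp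
qed

text \<open>By induction and the chain condition, the ring of \<open>pr I k\<close> is contained in
  that of \<open>I k\<close>, so multiplying by the inverse of \<open>pr I k\<close> leads from
  \<open>pr I (Suc k)\<close> back to \<open>I k\<close>. The induction starts from
  \<open>R\<close>, which is contained in every order.\<close>

lemma pr_multiplicator:
  assumes b: bass and c: "chain N I" shows "k < N \<Longrightarrow> kcol (pr I (Suc k)) (pr I (Suc k)) = kcol (I k) (I k)"
proof (induction k)
  have I: "\<And>i. i < N \<Longrightarrow> lat (I i)" using c by (auto simp: chain_def)
  have main: "kcol (pr I (Suc k)) (pr I (Suc k)) = kcol (I k) (I k)"
    if k: "k < N" and sub: "kcol (pr I k) (pr I k) \<subseteq> kcol (I k) (I k)" for k
  proof (intro equalityI subsetI)
    let ?B = "pr I k"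
    have B: "lat ?B" using I k by (intro lat_pr) auto
    note lI = latD[OF I[OF k]]
    {
      fix x assume x: "x \<in> kcol (I k) (I k)"
      have "x * z \<in> pr I (Suc k)" if "z \<in> pr I (Suc k)" for z
        using kprod_scale[of "I k" x "I k" z ?B] that x by (simp add: kprod_commute kcol_def)
      then show "x \<in> kcol (pr I (Suc k)) (pr I (Suc k))" using x by (simp add: kcol_def)
    next
      fix x assume x: "x \<in> kcol (pr I (Suc k)) (pr I (Suc k))"
      then have xK: "x \<in> K" by (simp add: kcol_def)
      have "x * y \<in> I k" if y: "y \<in> I k" for y
      proof -
        have "kprod ?B (kcol (kcol ?B ?B) ?B) \<subseteq> {t. t * (x * y) \<in> I k}"
        proof (rule kprod_subset)
          show "asub {t. t * (x * y) \<in> I k}" using lI(2) by (auto simp: asub_def left_diff_distrib)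
          fix u v assume u: "u \<in> ?B" and v: "v \<in> kcol (kcol ?B ?B) ?B"
          have "u * y \<in> pr I (Suc k)" using kprod.mult[OF u y] by simp
          then have xuy: "x * (u * y) \<in> kprod ?B (I k)" using x by (simp add: kcol_def)
          have "kprod ?B (I k) \<subseteq> {t. v * t \<in> I k}"
          proof (rule kprod_subset)
            show "asub {t. v * t \<in> I k}" using lI(2) by (auto simp: asub_def right_diff_distrib)
            fix p q assume p: "p \<in> ?B" and q: "q \<in> I k"
            have "v * p \<in> kcol (I k) (I k)" using v p sub by (auto simp: kcol_def[of "kcol _ _"])
            then show "p * q \<in> {t. v * t \<in> I k}" using q by (simp add: kcol_def mult.assoc)
          qed
          then have "v * (x * (u * y)) \<in> I k" using xuy by blast
          then show "u * v \<in> {t. t * (x * y) \<in> I k}" by (simp add: ac_simps)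
        qed
        then show ?thesis using bass_invertible[OF b B] by auto
      qed
      then show "x \<in> kcol (I k) (I k)" using xK by (simp add: kcol_def)
    }
  qed
  {
    case 0
    have "kcol R R \<subseteq> kcol (I 0) (I 0)"
      using R_1 R_subset_order[OF order_kcol[OF I[OF 0]]] by (auto simp: kcol_def[of R])
    then show ?case using main[OF 0] by simp
  next
    case (Suc k)
    then have "kcol (pr I (Suc k)) (pr I (Suc k)) = kcol (I k) (I k)" by simp
    then show ?case using main[OF Suc.prems] chain_mono[OF c, of k "Suc k"] Suc.prems by simp
  }
qed

text \<open>Steinitz' step: the product \<open>?A\<close> accumulated at position \<open>k\<close>
  and the next ideal \<open>?J\<close> are replaced by the ring \<open>?S\<close> and by the product
  of \<open>?A\<close> and \<open>?J\<close>. It applies because \<open>?A\<close> is invertible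
  over its multiplicator ring \<open>?S\<close> and \<open>?J\<close> is stable under
  \<open>?S\<close> by the chain condition.\<close>

lemma chain_normal_form:
  assumes b: bass and c: "chain N I"
  shows "k < N \<Longrightarrow> \<exists>h. op_iso xs (dprod N I) xs
    (dprod N (\<lambda>i. if i < k then kcol (I i) (I i) else if i = k then pr I (Suc k) else I i)) h"
proof (induction k)
  case 0
  have "(\<lambda>i. if i < 0 then kcol (I i) (I i) else if i = 0 then pr I (Suc 0) else I i) = I"
  proof
    have "pr I (Suc 0) = I 0" using kprod_R[of "I 0"] c 0 by (simp add: chain_def)
    then show "(if i < 0 then kcol (I i) (I i) else if i = 0 then pr I (Suc 0) else I i) = I i" for i by simp
  qed
  moreover have "op_iso xs (dprod N I) xs (dprod N I) (\<lambda>x. x)" by (rule op_isoI[where k = "\<lambda>x. x"]) auto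
  ultimately show ?case by auto
next
  case (Suc k)
  have I: "\<And>i. i < N \<Longrightarrow> lat (I i)" using c by (auto simp: chain_def)
  let ?A = "pr I (Suc k)" and ?J = "I (Suc k)" and ?S = "kcol (I k) (I k)"
  have S: "korder ?S" using order_kcol I Suc.prems by simp
  note o = korderD[OF S]
  have A: "lat ?A" using I Suc.prems by (intro lat_pr) auto
  have J: "lat ?J" using I Suc.prems by auto
  have mA: "kcol ?A ?A = ?S" using pr_multiplicator[OF b c, of k] Suc.prems by simp
  have SA: "s * y \<in> ?A" if "s \<in> ?S" "y \<in> ?A" for s y using that unfolding mA[symmetric] by (simp add: kcol_def)
  have SJ: "s * y \<in> ?J" if "s \<in> ?S" "y \<in> ?J" for s y
    using chain_mono[OF c, of k "Suc k"] Suc.prems that by (auto simp: kcol_def)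
  obtain a v b' c' where av: "a \<in> kcol ?S ?A" "v \<in> ?A" "b' \<in> kcol ?S ?J" "c' \<in> ?J" "a * v + b' * c' = 1"
    using steinitz_unimodular[OF S A SA _ J SJ] bass_invertible[OF b A] mA by metis
  let ?I = "\<lambda>k i. if i < k then kcol (I i) (I i) else if i = k then pr I (Suc k) else I i"
  \<comment> \<open>The matrix with rows (a, -b') and (c', v) has determinant
    \<open>a * v + b' * c' = 1\<close>, and \<open>h'\<close> is given by its adjugate.\<close>
  define h where "h g = (\<lambda>i. if i = k then a * g k - b' * g (Suc k) else if i = Suc k then c' * g k + v * g (Suc k) else g i)" for g :: "nat \<Rightarrow> 'k"
  define h' where "h' g = (\<lambda>i. if i = k then v * g k + b' * g (Suc k) else if i = Suc k then a * g (Suc k) - c' * g k else g i)" for g :: "nat \<Rightarrow> 'k"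
  have id: "v * (a * s - b' * t) + b' * (c' * s + v * t) = s" "a * (c' * s + v * t) - c' * (a * s - b' * t) = t"
    "a * (v * s + b' * t) - b' * (a * t - c' * s) = s" "c' * (v * s + b' * t) + v * (a * t - c' * s) = t" for s t
  proof -
    have "v * (a * s - b' * t) + b' * (c' * s + v * t) = (a * v + b' * c') * s"
      "a * (c' * s + v * t) - c' * (a * s - b' * t) = (a * v + b' * c') * t"
      "a * (v * s + b' * t) - b' * (a * t - c' * s) = (a * v + b' * c') * s"
      "c' * (v * s + b' * t) + v * (a * t - c' * s) = (a * v + b' * c') * t"
      by (simp_all add: algebra_simps)
    then show "v * (a * s - b' * t) + b' * (c' * s + v * t) = s" "a * (c' * s + v * t) - c' * (a * s - b' * t) = t"
      "a * (v * s + b' * t) - b' * (a * t - c' * s) = s" "c' * (v * s + b' * t) + v * (a * t - c' * s) = t"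
      unfolding av(5) by simp_all
  qed
  note lA = latD(2)[OF A] and lJ = latD(2)[OF J] and lAJ = latD(2)[OF lat_kprod[OF A J]]
  have aA: "a * y \<in> ?S" if "y \<in> ?A" for y using av(1) that by (simp add: kcol_def[of "kcol _ _"])
  have bJ: "b' * y \<in> ?S" if "y \<in> ?J" for y using av(3) that by (simp add: kcol_def[of "kcol _ _"])
  have bAJ: "b' * p \<in> ?A" if "p \<in> kprod ?A ?J" for p
  proof -
    have "kprod ?A ?J \<subseteq> {t. b' * t \<in> ?A}"
    proof (rule kprod_subset)
      show "asub {t. b' * t \<in> ?A}" using lA by (auto simp: asub_def right_diff_distrib)
      show "x * y \<in> {t. b' * t \<in> ?A}" if "x \<in> ?A" "y \<in> ?J" for x y
        using SA[OF bJ[OF that(2)] that(1)] by (simp add: ac_simps)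
    qed
    then show ?thesis using that by blast
  qed
  have aAJ: "a * p \<in> ?J" if "p \<in> kprod ?A ?J" for p
  proof -
    have "kprod ?A ?J \<subseteq> {t. a * t \<in> ?J}"
    proof (rule kprod_subset)
      show "asub {t. a * t \<in> ?J}" using lJ by (auto simp: asub_def right_diff_distrib)
      show "x * y \<in> {t. a * t \<in> ?J}" if "x \<in> ?A" "y \<in> ?J" for x y
        using SJ[OF aA[OF that(1)] that(2)] by (simp add: ac_simps)
    qed
    then show ?thesis using that by blast
  qed
  have "op_iso xs (dprod N (?I k)) xs (dprod N (?I (Suc k))) h"
  proof (rule op_isoI[where k = h'])
    fix g assume g: "g \<in> dprod N (?I k)"
    then have gi: "g i \<in> ?I k i" if "i < N" for i using that unfolding dprod_def by blast
    then have gk: "g k \<in> ?A" "g (Suc k) \<in> ?J" using gi[of k] gi[of "Suc k"] Suc.prems by simp_all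
    have "a * g k - b' * g (Suc k) \<in> ?S" using asub_diff[OF o(2) aA[OF gk(1)] bJ[OF gk(2)]] .
    then have mem: "a * g k - b' * g (Suc k) \<in> ?S" "c' * g k + v * g (Suc k) \<in> kprod ?A ?J"
      using asub_add[OF lAJ kprod.mult[OF gk(1) av(4)] kprod.mult[OF av(2) gk(2)]] by (simp_all add: mult.commute)
    show "h g \<in> dprod N (?I (Suc k))"
      unfolding dprod_def
    proof (intro CollectI conjI allI impI)
      fix i assume "i < N"
      then show "h g i \<in> ?I (Suc k) i" using gi[of i] mem
        by (cases "i = k"; cases "i = Suc k") (auto simp: h_def less_Suc_eq split: if_splits)
    next
      fix i assume "i \<ge> N"
      then show "h g i = 0" using g Suc.prems by (simp add: h_def dprod_def)
    qed
    show "h' (h g) = g"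
      unfolding h_def h'_def by (rule ext) (simp add: id)
  next
    fix g assume g: "g \<in> dprod N (?I (Suc k))"
    then have gi: "g i \<in> ?I (Suc k) i" if "i < N" for i using that unfolding dprod_def by blast
    then have gk: "g k \<in> ?S" "g (Suc k) \<in> kprod ?A ?J" using gi[of k] gi[of "Suc k"] Suc.prems by simp_all
    have mem: "v * g k + b' * g (Suc k) \<in> ?A" "a * g (Suc k) - c' * g k \<in> ?J"
      using asub_add[OF lA SA[OF gk(1) av(2)] bAJ[OF gk(2)]] asub_diff[OF lJ aAJ[OF gk(2)] SJ[OF gk(1) av(4)]]
      by (simp_all add: mult.commute)
    show "h' g \<in> dprod N (?I k)"
      unfolding dprod_def
    proof (intro CollectI conjI allI impI)
      fix i assume "i < N"
      then show "h' g i \<in> ?I k i" using gi[of i] mem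
        by (cases "i = k"; cases "i = Suc k") (auto simp: h'_def less_Suc_eq split: if_splits)
    next
      fix i assume "i \<ge> N"
      then show "h' g i = 0" using g Suc.prems by (simp add: h'_def dprod_def)
    qed
    show "h (h' g) = g"
      unfolding h_def h'_def by (rule ext) (simp add: id)
  qed (auto simp: h_def xs_def algebra_simps fun_eq_iff)
  moreover obtain h0 where "op_iso xs (dprod N I) xs (dprod N (?I k)) h0" using Suc by auto
  ultimately show ?case using op_iso_trans by blast
qed

text \<open>In normal form the two sums consist of the same rings and can differ only in the last
  place, where the two products stand; there \<open>k\<close> is applied.\<close>

lemma invariants_chain_iso:
  assumes b: bass and c: "chain N I" "chain N I'" and N: "N > 0"
    and S: "\<And>i. i < N \<Longrightarrow> kcol (I i) (I i) = kcol (I' i) (I' i)" and iso: "op_iso ((*) xi) (pr I N) ((*) xi) (pr I' N) k"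
  shows "\<exists>h. op_iso xs (dprod N I) xs (dprod N I') h"
proof -
  obtain M where M: "N = Suc M" using N by (cases N) auto
  let ?I = "\<lambda>I i. if i < M then kcol (I i) (I i) else if i = M then pr I (Suc M) else (I i :: 'k set)"
  obtain h1 where h1: "op_iso xs (dprod N I) xs (dprod N (?I I)) h1" using chain_normal_form[OF b c(1), of M] M by auto
  obtain h2 where h2: "op_iso xs (dprod N I') xs (dprod N (?I I')) h2" using chain_normal_form[OF b c(2), of M] M by auto
  have I': "\<And>i. i < N \<Longrightarrow> lat (I' i)" using c by (auto simp: chain_def)
  have "asub (dprod N I')" using I' latD(2) by (intro dprod_asub) blast
  moreover have "xs ` dprod N I' \<subseteq> dprod N I'" using latD(3)[OF I'] by (auto simp: dprod_def xs_def)
  ultimately obtain h3 where h3: "op_iso xs (dprod N (?I I')) xs (dprod N I') h3" using op_iso_sym[OF h2] by blast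
  note k = op_isoD[OF iso]
  define h where "h g = (\<lambda>i. if i = M then k (g M) else g i)" for g :: "nat \<Rightarrow> 'k"
  define h' where "h' g = (\<lambda>i. if i = M then inv_into (pr I N) k (g M) else g i)" for g :: "nat \<Rightarrow> 'k"
  have gM: "g M \<in> pr J N" if "g \<in> dprod N (?I J)" for g J
  proof -
    have "\<forall>i<N. g i \<in> ?I J i" using that unfolding dprod_def by blast
    then have "g M \<in> ?I J M" using M by blast
    then show ?thesis using M by simp
  qed
  have gS: "g i \<in> kcol (J i) (J i)" if "g \<in> dprod N (?I J)" "i < M" for g J i
  proof -
    have "\<forall>i<N. g i \<in> ?I J i" using that(1) unfolding dprod_def by blast
    then have "g i \<in> ?I J i" using M that(2) less_SucI by blast
    then show ?thesis using that(2) by simp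
  qed
  have "op_iso xs (dprod N (?I I)) xs (dprod N (?I I')) h"
  proof (rule op_isoI[where k = h'])
    show "h g \<in> dprod N (?I I')" if g: "g \<in> dprod N (?I I)" for g
      using g k(2)[OF gM[OF g]] gS[OF g] S M unfolding dprod_def h_def by auto
    have "inv_into (pr I N) k y \<in> pr I N" if "y \<in> pr I' N" for y
      using k(1) that by (metis bij_betwE bij_betw_inv_into)
    then show "h' g \<in> dprod N (?I I)" if g: "g \<in> dprod N (?I I')" for g
      using g gM[OF g] gS[OF g] S M unfolding dprod_def h'_def by auto
    show "h' (h g) = g" if g: "g \<in> dprod N (?I I)" for g
      using bij_betw_inv_into_left[OF k(1) gM[OF g]] by (auto simp: h_def h'_def)
    show "h (h' g) = g" if g: "g \<in> dprod N (?I I')" for g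
      using bij_betw_inv_into_right[OF k(1) gM[OF g]] by (auto simp: h_def h'_def)
    show "h (g + g') = h g + h g'" if "g \<in> dprod N (?I I)" "g' \<in> dprod N (?I I)" for g g'
      using k(3)[OF gM[OF that(1)] gM[OF that(2)]] by (auto simp: h_def)
    show "h (xs g) = xs (h g)" if "g \<in> dprod N (?I I)" for g
      using k(4)[OF gM[OF that]] by (auto simp: h_def xs_def)
  qed
  then show ?thesis using h1 h3 op_iso_trans by blast
qed

end

section \<open>Integer matrices and chains of ideals\<close>

lemma of_int_fun: "(of_int c :: 'a \<Rightarrow> 'k::comm_ring_1) = (\<lambda>_. of_int c)"
proof -
  have nat: "(of_nat k :: 'a \<Rightarrow> 'k) = (\<lambda>_. of_nat k)" for k
    by (induction k) (auto simp: fun_eq_iff)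
  show ?thesis by (cases c rule: int_cases2) (auto simp: nat fun_eq_iff)
qed

lemma const_fun_hom: "comm_ring_hom h \<Longrightarrow> comm_ring_hom (\<lambda>y. (\<lambda>_::nat. h y))"
proof -
  assume "comm_ring_hom h"
  then interpret comm_ring_hom h .
  show ?thesis by unfold_locales (auto simp: fun_eq_iff hom_add hom_mult)
qed

lemma char_poly_dim_zero: "A \<in> carrier_mat 0 0 \<Longrightarrow> char_poly (A :: 'd::comm_ring_1 mat) = 1"
  by (simp add: char_poly_def)

text \<open>Columns are functions supported below the dimension, because a lattice has to be a
  subset of a commutative ring. The cutoff keeps the image within the span of the first unit
  vectors.\<close>

definition mat_op :: "int mat \<Rightarrow> (nat \<Rightarrow> rat) \<Rightarrow> nat \<Rightarrow> rat" where
  "mat_op A v = (\<lambda>i. if i < dim_row A then \<Sum>j<dim_row A. of_int (A $$ (i,j)) * v j else 0)"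

definition unit_fun :: "nat \<Rightarrow> nat \<Rightarrow> rat" where
  "unit_fun j = (\<lambda>i. if i = j then 1 else 0)"

lemma comb_unit_fun: "comb of_int m unit_fun c = (\<lambda>i. if i < m then of_int (c i) else 0)"
proof
  fix i
  have s: "(\<Sum>j\<in>S. g j) i = (\<Sum>j\<in>S. g j i)" for g :: "nat \<Rightarrow> nat \<Rightarrow> rat" and S
    by (induction S rule: infinite_finite_induct) auto
  have "comb of_int m unit_fun c i = (\<Sum>j<m. if j = i then of_int (c j) else 0)"
    unfolding comb_def s by (intro sum.cong) (auto simp: of_int_fun unit_fun_def)
  then show "comb of_int m unit_fun c i = (if i < m then of_int (c i) else 0)" by simp
qed

lemma mat_op_rep:
  assumes A: "A \<in> carrier_mat m m"
  shows "rep of_int (mat_op A) (range (comb (of_int :: int \<Rightarrow> _) m unit_fun)) m unit_fun A"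
  unfolding rep_def basis_def
proof (intro conjI allI impI refl A)
  fix c i assume "comb of_int m unit_fun c = 0" "i < m"
  then show "c i = 0" unfolding comb_unit_fun by (auto simp: fun_eq_iff dest: spec[of _ i])
next
  fix j assume j: "j < m"
  show "mat_op A (unit_fun j) = comb of_int m unit_fun (\<lambda>i. A $$ (i,j))"
  proof
    fix i
    have "(\<Sum>l<m. of_int (A $$ (i,l)) * unit_fun j l) = (\<Sum>l<m. if l = j then of_int (A $$ (i,l)) else (0::rat))"
      by (intro sum.cong) (auto simp: unit_fun_def)
    then show "mat_op A (unit_fun j) i = comb of_int m unit_fun (\<lambda>i. A $$ (i,j)) i"
      using A j by (simp add: mat_op_def comb_unit_fun)
  qed
qed

context residue_alg
begin

lemma xs_eq: "xs = (\<lambda>v. (\<lambda>_. xi) * v)"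
  by (simp add: xs_def fun_eq_iff)

lemma linmap_mult: "linmap h ((*) (y::'k))"
  by (simp add: linmap_def algebra_simps)

lemma linmap_xs: "linmap h xs"
  by (simp add: linmap_def xs_eq algebra_simps)

lemma single_iso: "op_iso ((*) xi) I xs (single N ` I) (single N)"
proof -
  have "inj_on (single N) I" by (rule inj_onI) (metis single_def)
  then show ?thesis unfolding op_iso_def by (auto simp: bij_betw_def single_def xs_def fun_eq_iff)
qed

text \<open>Every summand contributes a diagonal block whose characteristic polynomial is
  \<open>f\<close> by \<open>ideal_rep\<close>.\<close>

lemma dprod_rep:
  "(\<And>i. i < N \<Longrightarrow> lat (I i)) \<Longrightarrow> \<exists>m w A. rep of_int xs (dprod N I) m w A \<and> char_poly A = f ^ N"
proof (induction N)
  case 0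
  have "dprod 0 I = {0}" by (auto simp: dprod_def fun_eq_iff)
  then have "rep of_int xs (dprod 0 I) 0 (\<lambda>_. 0) (0\<^sub>m 0 0)"
    by (auto simp: rep_def basis_def comb_def)
  then show ?case using char_poly_dim_zero[of "0\<^sub>m 0 0"] by (metis power_0 zero_carrier_mat)
next
  case (Suc N)
  obtain m w A where r: "rep of_int xs (dprod N I) m w A" "char_poly A = f ^ N" using Suc by auto
  have IN: "lat (I N)" using Suc.prems by simp
  obtain w1 A1 where r1: "rep of_int ((*) xi) (I N) n w1 A1" "char_poly A1 = f" using ideal_rep[OF IN] by blast
  note r1' = rep_transport[OF r1(1) single_iso]
  have "dprod N I \<inter> single N ` I N \<subseteq> {0}"
  proof clarify
    fix y assume "single N y \<in> dprod N I" "y \<in> I N"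
    then have "single N y N = 0" by (simp add: dprod_def)
    then show "single N y = 0" by (simp add: single_def fun_eq_iff)
  qed
  moreover have "dprod (Suc N) I = {x + y | x y. x \<in> dprod N I \<and> y \<in> single N ` I N}"
  proof (intro equalityI subsetI)
    fix g assume g: "g \<in> dprod (Suc N) I"
    have "g = (\<lambda>i. if i < N then g i else 0) + single N (g N)"
      using g by (auto simp: dprod_def single_def fun_eq_iff)
    moreover have "(\<lambda>i. if i < N then g i else 0) \<in> dprod N I" "g N \<in> I N" using g by (auto simp: dprod_def)
    ultimately show "g \<in> {x + y | x y. x \<in> dprod N I \<and> y \<in> single N ` I N}" by blast
  next
    fix g assume "g \<in> {x + y | x y. x \<in> dprod N I \<and> y \<in> single N ` I N}"
    then show "g \<in> dprod (Suc N) I" by (auto simp: dprod_def single_def less_Suc_eq)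
  qed
  ultimately have "rep of_int xs (dprod (Suc N) I) (m + n) (\<lambda>i. if i < m then w i else single N (w1 (i - m)))
      (four_block_mat A (0\<^sub>m m n) (0\<^sub>m n m) A1)"
    using rep_direct_sum[OF of_int_hom.comm_ring_hom_axioms r(1) r1'] by blast
  moreover have "char_poly (four_block_mat A (0\<^sub>m m n) (0\<^sub>m n m) A1) = f ^ Suc N"
    using char_poly_four_block_diag[of A m A1 n] r r1 by (simp add: rep_def mult.commute)
  ultimately show ?case by blast
qed

lemma op_module_xs: "op_module f io (\<lambda>q _. qs q) xs"
  by (intro op_module.intro residue_alg_axioms op_module_axioms.intro const_fun_hom qs.comm_ring_hom_axioms linmap_xs)

text \<open>A polynomial \<open>q\<close> in \<open>xs\<close> is multiplication by
  \<open>io q\<close>. It kills the sum only if \<open>io q = 0\<close>, because the first summand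
  contains a positive integer. So the polynomials annihilating \<open>A\<close> are exactly the
  multiples of \<open>F\<close>.\<close>

lemma dprod_int_mats:
  assumes N: "N > 0" and I: "\<And>i. i < N \<Longrightarrow> lat (I i)"
    and r: "rep of_int xs (dprod N I) m w A" and c: "char_poly A = f ^ N"
  shows "A \<in> int_mats f (f ^ N)"
proof -
  have A: "A \<in> carrier_mat m m" and b: "basis of_int m w (dprod N I)"
    and Aw: "\<And>j. j < m \<Longrightarrow> xs (w j) = comb of_int m w (\<lambda>i. A $$ (i,j))" using r by (auto simp: rep_def)
  interpret op_module f io "\<lambda>q _. qs q" xs by (rule op_module_xs)
  interpret op_sub f io "\<lambda>q _. qs q" xs "dprod N I" m w
    by unfold_locales (use b latD(3)[OF I] in \<open>auto simp: dprod_def xs_def\<close>)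
  have pact: "pact p v = (\<lambda>i. io p * v i)" for p v
  proof
    fix i
    have s: "(\<Sum>j\<in>S. g j) i = (\<Sum>j\<in>S. g j i)" for g :: "nat \<Rightarrow> nat \<Rightarrow> 'k" and S
      by (induction S rule: infinite_finite_induct) auto
    have x: "(xs ^^ k) v i = xi ^ k * v i" for k by (induction k) (auto simp: xs_def mult.assoc)
    have "io p = (\<Sum>k\<le>degree p. qs (coeff p k) * xi ^ k)"
      using io_expand[of p "Suc (degree p)"] by (simp add: comb_def lessThan_Suc_atMost)
    then show "pact p v i = io p * v i"
      by (simp add: pact_def s x sum_distrib_right mult.assoc)
  qed
  have zero: "mat_eval q (map_mat rat_of_int A) = 0\<^sub>m m m \<longleftrightarrow> io q = 0" for q
  proof -
    have "(\<forall>v\<in>dprod N I. pact q v = 0) \<longleftrightarrow> io q = 0"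
    proof
      assume "io q = 0" then show "\<forall>v\<in>dprod N I. pact q v = 0" by (simp add: pact fun_eq_iff)
    next
      assume 0: "\<forall>v\<in>dprod N I. pact q v = 0"
      obtain c0 where c0: "c0 > 0" "of_int c0 \<in> I 0" using latD(4)[OF I[OF N]] by blast
      have "single 0 (of_int c0) \<in> dprod N I"
        using single_dprod[of N I 0 "of_int c0"] latD(2)[OF I] N c0 by blast
      then have "pact q (single 0 (of_int c0)) 0 = 0" using 0 by simp
      then have "of_int c0 * io q = of_int c0 * 0" by (simp add: pact single_def mult.commute)
      then show "io q = 0" using K_of_int_cancel[of c0 "io q" 0] c0 by simp
    qed
    then show ?thesis using pact_zero_iff[OF A, of q] Aw by blast
  qed
  have m: "m = degree (f ^ N)" using degree_monic_char_poly[OF A] c by simp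
  have "is_minimal_poly (map_mat rat_of_int A) F" unfolding is_minimal_poly_def
  proof (intro conjI allI impI)
    show "lead_coeff F = 1" by (rule monic_F)
    have "io F = 0" by (simp add: io_zero_iff)
    then show "mat_eval F (map_mat rat_of_int A) = 0\<^sub>m (dim_row (map_mat rat_of_int A)) (dim_row (map_mat rat_of_int A))"
      using zero A by simp
    fix q :: "rat poly" assume q: "q \<noteq> 0"
      "mat_eval q (map_mat rat_of_int A) = 0\<^sub>m (dim_row (map_mat rat_of_int A)) (dim_row (map_mat rat_of_int A))"
    then have "F dvd q" using zero[of q] A io_zero_iff by simp
    then show "degree F \<le> degree q" using q(1) by (rule dvd_imp_degree_le)
  qed
  then show ?thesis using A c m by (simp add: int_mats_def)
qed

lemma ideal_int_mats:
  assumes I: "lat I" and r: "rep of_int ((*) xi) I n w A" and c: "char_poly A = f"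
  shows "A \<in> int_mats f f"
proof -
  have "single 0 ` I = dprod (Suc 0) (\<lambda>_. I)"
  proof (intro equalityI subsetI)
    fix g assume g: "g \<in> dprod (Suc 0) (\<lambda>_. I)"
    then have "g = single 0 (g 0)" by (auto simp: dprod_def single_def fun_eq_iff)
    then show "g \<in> single 0 ` I" using g by (auto simp: dprod_def)
  qed (auto simp: dprod_def single_def)
  then show ?thesis
    using dprod_int_mats[of 1 "\<lambda>_. I" n "\<lambda>i. single 0 (w i)" A] I rep_transport[OF r single_iso[of I 0]] c by simp
qed

lemma op_module_mat: "op_module f io (\<lambda>q _. q) (mat_op A)"
proof (intro op_module.intro residue_alg_axioms op_module_axioms.intro)
  show "comm_ring_hom (\<lambda>(q::rat) (_::nat). q)" by unfold_locales (auto simp: fun_eq_iff)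
  show "linmap (\<lambda>q _. q) (mat_op A)"
    by (auto simp: linmap_def mat_op_def fun_eq_iff sum.distrib distrib_left sum_distrib_left mult.left_commute)
qed

lemma int_mats_rep:
  assumes A: "A \<in> int_mats f (f ^ N)"
  shows "A \<in> carrier_mat (degree (f ^ N)) (degree (f ^ N))" "char_poly A = f ^ N"
    "v \<in> range (comb (of_int :: int \<Rightarrow> _) (degree (f ^ N)) unit_fun) \<Longrightarrow> op_module.pact (\<lambda>q _. q) (mat_op A) F v = 0"
proof -
  let ?m = "degree (f ^ N)" and ?L = "range (comb (of_int :: int \<Rightarrow> _) (degree (f ^ N)) unit_fun)"
  show Ac: "A \<in> carrier_mat ?m ?m" and c: "char_poly A = f ^ N" using A by (auto simp: int_mats_def)
  have 0: "mat_eval F (map_mat rat_of_int A) = 0\<^sub>m ?m ?m"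
    using A by (auto simp: int_mats_def is_minimal_poly_def)
  note r = mat_op_rep[OF Ac]
  then have b: "basis of_int ?m unit_fun ?L" and Aw: "\<And>j. j < ?m \<Longrightarrow> mat_op A (unit_fun j) = comb of_int ?m unit_fun (\<lambda>i. A $$ (i,j))"
    by (auto simp: rep_def)
  interpret op_module f io "\<lambda>q _. q" "mat_op A" by (rule op_module_mat)
  interpret op_sub f io "\<lambda>q _. q" "mat_op A" ?L ?m unit_fun
  proof unfold_locales
    show "mat_op A ` ?L \<subseteq> ?L"
    proof clarify
      fix c
      have "mat_op A (comb of_int ?m unit_fun c) = comb of_int ?m (\<lambda>j. comb of_int ?m unit_fun (\<lambda>i. A $$ (i,j))) c"
        unfolding of_int_hom.linmap_comb[OF T_int] using Aw by (intro of_int_hom.comb_cong) auto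
      then show "mat_op A (comb of_int ?m unit_fun c) \<in> ?L" unfolding of_int_hom.comb_comb by simp
    qed
  qed (rule b)
  show "pact F v = 0" if "v \<in> ?L" using pact_zero_iff[OF Ac, of F] Aw 0 that by blast
qed

lemma int_mats_chain:
  assumes b: bass and A: "A \<in> int_mats f (f ^ N)"
  shows "\<exists>I m w. chain N I \<and> rep of_int xs (dprod N I) m w A"
proof -
  note h = int_mats_rep[OF A]
  note r = mat_op_rep[OF h(1)]
  obtain I k where I: "chain N I" "op_iso (mat_op A) (range (comb (of_int :: int \<Rightarrow> _) (degree (f ^ N)) unit_fun)) xs (dprod N I) k"
    using op_module.bass_decomposition[OF op_module_mat b r h(3) h(2)] by blast
  show ?thesis using rep_transport[OF r I(2)] I(1) by blast
qed

lemma int_mats_ideal: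
  assumes A: "A \<in> int_mats f f"
  shows "\<exists>I m w. lat I \<and> rep of_int ((*) xi) I m w A"
proof -
  have A1: "A \<in> int_mats f (f ^ 1)" using A by simp
  note h = int_mats_rep[OF A1]
  note r = mat_op_rep[OF h(1)]
  obtain I k where I: "lat I" "op_iso (mat_op A) (range (comb (of_int :: int \<Rightarrow> _) (degree (f ^ 1)) unit_fun)) ((*) xi) I k"
    using op_module.cyclic_ideal[OF op_module_mat r h(3)] h(2) by auto
  show ?thesis using rep_transport[OF r I(2)] I(1) by blast
qed

section \<open>Transfer to \<open>\<rat>[x]/(f)\<close>\<close>

text \<open>On \<open>CK\<close> this is a ring isomorphism onto \<open>K\<close>, independent of
  the chosen representative; all notions for residue classes are carried over along it.\<close>

definition "th c = io (SOME p. p \<in> c)"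
abbreviation "CK \<equiv> carrier (K_alg f)"

lemma CK_range: "CK = range (res_class F)" by (simp add: K_alg_def carrier_quot_ring)

lemma th_res: "th (res_class F p) = io p"
proof -
  have "p \<in> res_class F p" by (auto simp: res_class_eq intro: exI[of _ 0])
  then have "(SOME q. q \<in> res_class F p) \<in> res_class F p" by (rule someI)
  then obtain x where "(SOME q. q \<in> res_class F p) = x * F + p" by (auto simp: res_class_eq)
  moreover have "io F = 0" by (simp add: io_zero_iff)
  ultimately show ?thesis by (simp add: th_def io.hom_add io.hom_mult)
qed

lemma CK_cases: "a \<in> CK \<Longrightarrow> (\<And>p. a = res_class F p \<Longrightarrow> P) \<Longrightarrow> P"
  by (auto simp: CK_range)

lemma th_inj: "inj_on th CK"
  by (rule inj_onI) (metis CK_cases th_res res_class_eq_iff io_eq_iff)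

lemma th_image: "th ` CK = K"
  unfolding CK_range image_image th_res K_def ..

lemma th_K: "a \<in> CK \<Longrightarrow> th a \<in> K" using th_image by blast

lemma th_ring:
  assumes "a \<in> CK" "b \<in> CK"
  shows "th (a \<otimes>\<^bsub>K_alg f\<^esub> b) = th a * th b" "th (a \<oplus>\<^bsub>K_alg f\<^esub> b) = th a + th b"
    "a \<otimes>\<^bsub>K_alg f\<^esub> b \<in> CK" "a \<oplus>\<^bsub>K_alg f\<^esub> b \<in> CK"
  using assms by (auto elim!: CK_cases simp: K_alg_def mult_res_class add_res_class th_res io.hom_mult io.hom_add carrier_quot_ring)

lemma th_one: "th \<one>\<^bsub>K_alg f\<^esub> = 1" and th_zero: "th \<zero>\<^bsub>K_alg f\<^esub> = 0"
  by (simp_all add: K_alg_def one_res_class zero_res_class th_res)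

sublocale KA: cring "K_alg f" by (rule K_alg_cring)

lemma th_neg: "a \<in> CK \<Longrightarrow> th (\<ominus>\<^bsub>K_alg f\<^esub> a) = - th a"
proof -
  assume a: "a \<in> CK"
  have "th (a \<oplus>\<^bsub>K_alg f\<^esub> \<ominus>\<^bsub>K_alg f\<^esub> a) = 0" using KA.r_neg[OF a] by (simp add: th_zero)
  then have "th a + th (\<ominus>\<^bsub>K_alg f\<^esub> a) = 0" using th_ring(2)[OF a KA.a_inv_closed[OF a]] by simp
  then show ?thesis by (rule minus_unique[symmetric])
qed

lemma th_mem: "H \<subseteq> CK \<Longrightarrow> a \<in> CK \<Longrightarrow> th a \<in> th ` H \<longleftrightarrow> a \<in> H"
  using th_inj by (auto simp: inj_on_def subset_iff)

lemma th_image_eq: "H \<subseteq> CK \<Longrightarrow> H' \<subseteq> CK \<Longrightarrow> th ` H = th ` H' \<longleftrightarrow> H = H'"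
  using inj_on_image_eq_iff[OF th_inj] by blast

lemma th_image_subset: "H \<subseteq> CK \<Longrightarrow> H' \<subseteq> CK \<Longrightarrow> th ` H \<subseteq> th ` H' \<longleftrightarrow> H \<subseteq> H'"
  using th_mem[of H'] by blast

lemma th_R: "th ` R_ord f = R"
  unfolding R_ord_def R_def image_image th_res ..

lemma R_ord_CK: "R_ord f \<subseteq> CK"
  by (auto simp: R_ord_def CK_range)

definition "tb J = {a \<in> CK. th a \<in> J}"

lemma tb: "J \<subseteq> K \<Longrightarrow> th ` tb J = J" "tb J \<subseteq> CK"
  using th_image by (auto simp: tb_def)

lemma submodule_iff:
  "submodule H (subring_of f S) (K_module f) \<longleftrightarrow>
     H \<subseteq> CK \<and> asub (th ` H) \<and> (\<forall>s\<in>S. \<forall>x\<in>H. s \<otimes>\<^bsub>K_alg f\<^esub> x \<in> H)"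
proof -
  have am: "subgroup H (add_monoid (K_module f)) \<longleftrightarrow> subgroup H (add_monoid (K_alg f))"
    by (simp add: subgroup_def m_inv_def sub_module_def)
  have "subgroup H (add_monoid (K_alg f)) \<longleftrightarrow> H \<subseteq> CK \<and> asub (th ` H)"
  proof
    assume H: "subgroup H (add_monoid (K_alg f))"
    have HC: "H \<subseteq> CK" using subgroup.subset[OF H] by simp
    have "asub (th ` H)" unfolding asub_def
    proof (intro conjI ballI)
      show "0 \<in> th ` H" using subgroup.one_closed[OF H] th_zero by (metis imageI monoid.select_convs(2))
      fix x y assume "x \<in> th ` H" "y \<in> th ` H"
      then obtain a b where ab: "a \<in> H" "b \<in> H" "x = th a" "y = th b" by blast
      have nb: "\<ominus>\<^bsub>K_alg f\<^esub> b \<in> H" using subgroup.m_inv_closed[OF H ab(2)] by (simp add: a_inv_def)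
      have "a \<oplus>\<^bsub>K_alg f\<^esub> \<ominus>\<^bsub>K_alg f\<^esub> b \<in> H" using subgroup.m_closed[OF H ab(1) nb] by simp
      moreover have "th (a \<oplus>\<^bsub>K_alg f\<^esub> \<ominus>\<^bsub>K_alg f\<^esub> b) = x - y"
        using ab nb HC by (auto simp: th_ring th_neg subset_iff)
      ultimately show "x - y \<in> th ` H" by (metis imageI)
    qed
    then show "H \<subseteq> CK \<and> asub (th ` H)" using HC by simp
  next
    assume H: "H \<subseteq> CK \<and> asub (th ` H)"
    note a = asub_0[OF conjunct2[OF H]] asub_neg[OF conjunct2[OF H]] asub_add[OF conjunct2[OF H]]
    show "subgroup H (add_monoid (K_alg f))"
    proof (rule group.subgroupI[OF KA.a_group])
      show "H \<subseteq> carrier (add_monoid (K_alg f))" using H by simp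
      show "H \<noteq> {}" using a(1) by blast
      show "inv\<^bsub>add_monoid (K_alg f)\<^esub> x \<in> H" if "x \<in> H" for x
      proof -
        have x: "x \<in> CK" using that H by blast
        have "th (\<ominus>\<^bsub>K_alg f\<^esub> x) \<in> th ` H" using a(2)[of "th x"] that th_neg[OF x] by simp
        then have "\<ominus>\<^bsub>K_alg f\<^esub> x \<in> H" using th_mem[of H] H KA.a_inv_closed[OF x] by blast
        then show ?thesis by (simp add: a_inv_def)
      qed
      show "x \<otimes>\<^bsub>add_monoid (K_alg f)\<^esub> y \<in> H" if "x \<in> H" "y \<in> H" for x y
      proof -
        have x: "x \<in> CK" "y \<in> CK" using that H by blast+
        have "th (x \<oplus>\<^bsub>K_alg f\<^esub> y) \<in> th ` H" using a(3)[of "th x" "th y"] that th_ring(2)[OF x] by simp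
        then show ?thesis using th_mem[of H] H th_ring(4)[OF x] by simp
      qed
    qed
  qed
  then show ?thesis
    unfolding submodule_def submodule_axioms_def am by (auto simp: subring_of_def sub_module_def)
qed

lemma span_subset: "submodule H (subring_of f S) (K_module f) \<Longrightarrow> A \<subseteq> H \<Longrightarrow> module_span (subring_of f S) (K_module f) A \<subseteq> H"
  unfolding module_span_def hull_def by blast

lemma frac_ideal_subset: "frac_ideal f S I \<Longrightarrow> I \<subseteq> CK"
  by (simp add: frac_ideal_def submodule_iff)

text \<open>Finite generation and full rank are statements about spans, so each is exploited by
  exhibiting a submodule that contains the generators and hence the whole span.\<close>

lemma frac_ideal_lat:
  assumes I: "frac_ideal f (R_ord f) I" shows "lat (th ` I)"
proof -
  from I have sm: "I \<subseteq> CK" "asub (th ` I)" "\<And>s x. s \<in> R_ord f \<Longrightarrow> x \<in> I \<Longrightarrow> s \<otimes>\<^bsub>K_alg f\<^esub> x \<in> I"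
    and fg: "\<exists>A. finite A \<and> A \<subseteq> CK \<and> I = module_span (subring_of f (R_ord f)) (K_module f) A"
    and full: "module_span (subring_of f (Q_const f)) (K_module f) I = CK"
    by (auto simp: frac_ideal_def submodule_iff)
  show ?thesis unfolding lat_def
  proof (intro conjI ballI sm(2))
    show "th ` I \<subseteq> K" using sm(1) th_K by blast
    show "xi * y \<in> th ` I" if "y \<in> th ` I" for y
    proof -
      obtain a where a: "a \<in> I" "y = th a" using \<open>y \<in> th ` I\<close> by blast
      obtain s where s: "s \<in> R_ord f" "xi = th s" using R_xi th_R by blast
      have "th (s \<otimes>\<^bsub>K_alg f\<^esub> a) = xi * y" using th_ring(1)[of s a] s a sm(1) R_ord_CK by auto
      then show ?thesis using sm(3)[OF s(1) a(1)] by (metis imageI)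
    qed
    obtain A where A: "finite A" "A \<subseteq> CK" "I = module_span (subring_of f (R_ord f)) (K_module f) A" using fg by blast
    have "\<exists>d>0. \<forall>a\<in>A. of_int d * th a \<in> R" using A(1,2)
    proof (induction A rule: finite_induct)
      case empty show ?case by (intro exI[of _ 1]) auto
    next
      case (insert x A)
      then obtain d where d: "d > 0" "\<forall>a\<in>A. of_int d * th a \<in> R" by auto
      obtain e where e: "e > 0" "of_int e * th x \<in> R" using to_R[OF th_K[of x]] insert.prems by blast
      have "of_int (d * e) * th a \<in> R" if "a \<in> insert x A" for a
      proof (cases "a = x")
        case True
        then show ?thesis using R_mult[OF R_of_int e(2), of d] by (simp add: mult.assoc)
      next
        case False
        then have "of_int e * (of_int d * th a) \<in> R" using R_mult[OF R_of_int] d that by simp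
        then show ?thesis by (simp add: ac_simps)
      qed
      then show ?case using d e by (intro exI[of _ "d * e"]) auto
    qed
    then obtain d where d: "d > 0" "\<forall>a\<in>A. of_int d * th a \<in> R" by blast
    \<comment> \<open>The elements with denominator \<open>d\<close>; as a submodule containing the
      generators this contains \<open>I\<close>.\<close>
    let ?H = "tb {y \<in> K. of_int d * y \<in> R}"
    have "I \<subseteq> ?H" unfolding A(3)
    proof (rule span_subset)
      have tH: "th ` ?H = {y \<in> K. of_int d * y \<in> R}" by (rule tb) auto
      show "submodule ?H (subring_of f (R_ord f)) (K_module f)" unfolding submodule_iff tH
      proof (intro conjI ballI tb(2))
        show "asub {y \<in> K. of_int d * y \<in> R}" using R_asub by (auto simp: asub_def K_0 K_diff right_diff_distrib)
        fix s x assume s: "s \<in> R_ord f" and x: "x \<in> ?H"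
        have sx: "s \<in> CK" "x \<in> CK" using s R_ord_CK x by (auto simp: tb_def)
        have "th s \<in> R" "of_int d * th x \<in> R" using s x th_R by (auto simp: tb_def)
        then have "th s * (of_int d * th x) \<in> R" by (rule R_mult)
        then show "s \<otimes>\<^bsub>K_alg f\<^esub> x \<in> ?H" using th_ring[OF sx] th_K[OF th_ring(3)[OF sx]] by (simp add: tb_def mult.left_commute)
      qed
      show "A \<subseteq> ?H" using A(2) d th_K by (auto simp: tb_def)
    qed
    then show "\<exists>d>0. \<forall>y\<in>th ` I. of_int d * y \<in> R" using d(1) by (auto simp: tb_def)
    \<comment> \<open>A rational subspace containing the image of \<open>I\<close>, hence all of
      \<open>K\<close> by full rank. That 1 belongs to it is the required positive integer in the
      ideal.\<close>
    let ?G = "{y \<in> K. \<exists>c>0. of_int c * y \<in> th ` I}"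
    have "module_span (subring_of f (Q_const f)) (K_module f) I \<subseteq> tb ?G"
    proof (rule span_subset)
      have tG: "th ` tb ?G = ?G" by (rule tb) auto
      show "submodule (tb ?G) (subring_of f (Q_const f)) (K_module f)" unfolding submodule_iff tG
      proof (intro conjI ballI tb(2))
        show "asub ?G" unfolding asub_def
        proof (intro conjI ballI)
          show "0 \<in> ?G" using asub_0[OF sm(2)] K_0 by (auto intro: exI[of _ 1])
          fix x y assume "x \<in> ?G" "y \<in> ?G"
          then obtain c d where cd: "x \<in> K" "y \<in> K" "c > 0" "d > 0" "of_int c * x \<in> th ` I" "of_int d * y \<in> th ` I" by blast
          have "of_int d * (of_int c * x) - of_int c * (of_int d * y) \<in> th ` I"
            by (intro asub_diff[OF sm(2)] asub_of_int[OF sm(2)] cd)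
          then have "of_int (c * d) * (x - y) \<in> th ` I" by (simp add: algebra_simps)
          then show "x - y \<in> ?G" using cd K_diff by (auto intro!: exI[of _ "c * d"])
        qed
        fix s x assume s: "s \<in> Q_const f" and x: "x \<in> tb ?G"
        obtain q where q: "s = res_class F [:q:]" using s by (auto simp: Q_const_def)
        then have sx: "s \<in> CK" "x \<in> CK" using x by (auto simp: tb_def CK_range)
        have ts: "th s = qs q" by (simp add: q th_res qs_def)
        obtain a b where ab: "quotient_of q = (a, b)" by force
        have b: "b > 0" "q = of_int a / of_int b" using quotient_of_denom_pos[OF ab] quotient_of_div[OF ab] by auto
        obtain c where c: "c > 0" "of_int c * th x \<in> th ` I" using x by (auto simp: tb_def)
        have "of_int b * qs q = of_int a"
          unfolding qs.hom_of_int[symmetric] qs.hom_mult[symmetric] using b by simp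
        then have "of_int (b * c) * (qs q * th x) = of_int a * (of_int c * th x)"
          by (simp add: mult.assoc mult.left_commute[of _ "of_int c"]) (metis mult.assoc)
        then have "of_int (b * c) * (qs q * th x) \<in> th ` I" using asub_of_int[OF sm(2) c(2), of a] by simp
        then show "s \<otimes>\<^bsub>K_alg f\<^esub> x \<in> tb ?G"
          using th_ring[OF sx] th_K[OF th_ring(3)[OF sx]] ts b c by (auto simp: tb_def intro!: exI[of _ "b * c"])
      qed
      show "I \<subseteq> tb ?G" using sm(1) th_K by (auto simp: tb_def intro!: exI[of _ 1])
    qed
    then have "\<one>\<^bsub>K_alg f\<^esub> \<in> tb ?G" using KA.one_closed full by blast
    then have "1 \<in> ?G" using th_one by (simp add: tb_def)
    then show "\<exists>c>0. of_int c \<in> th ` I" by simp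
  qed
qed

text \<open>A basis over the integers serves as the finite generating set. For full rank,
  \<open>x\<close> is the rational constant \<open>1 / (e * c)\<close> times an element of
  \<open>I\<close>, where \<open>e\<close> brings \<open>x\<close> into \<open>R\<close> and
  \<open>c\<close> is a positive integer in the ideal.\<close>

lemma lat_frac_ideal:
  assumes I: "I \<subseteq> CK" "lat (th ` I)" shows "frac_ideal f (R_ord f) I"
proof -
  note l = latD[OF I(2)]
  have sm: "submodule I (subring_of f (R_ord f)) (K_module f)" unfolding submodule_iff
  proof (intro conjI ballI I(1) l(2))
    fix s x assume sx: "s \<in> R_ord f" "x \<in> I"
    then have c: "s \<in> CK" "x \<in> CK" using I R_ord_CK by auto
    have "th s * th x \<in> th ` I" using lat_R[OF I(2)] sx th_R by blast
    then show "s \<otimes>\<^bsub>K_alg f\<^esub> x \<in> I" using th_ring[OF c] th_mem[OF I(1) th_ring(3)[OF c]] by simp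
  qed
  moreover have "\<exists>A. finite A \<and> A \<subseteq> CK \<and> I = module_span (subring_of f (R_ord f)) (K_module f) A"
  proof -
    obtain w where w: "basis of_int n w (th ` I)" using lat_basis[OF I(2)] by blast
    let ?A = "{a \<in> I. th a \<in> w ` {..<n}}"
    have "th ` ?A \<subseteq> w ` {..<n}" by blast
    then have "finite ?A" using finite_imageD[of th ?A] finite_subset inj_on_subset[OF th_inj, of ?A] I(1) by blast
    moreover have "I = module_span (subring_of f (R_ord f)) (K_module f) ?A"
    proof (intro equalityI)
      show "module_span (subring_of f (R_ord f)) (K_module f) ?A \<subseteq> I" by (rule span_subset[OF sm]) auto
      show "I \<subseteq> module_span (subring_of f (R_ord f)) (K_module f) ?A" unfolding module_span_def hull_def
      proof (intro Inter_greatest subsetI)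
        fix H x assume H: "H \<in> {H. submodule H (subring_of f (R_ord f)) (K_module f) \<and> ?A \<subseteq> H}" and x: "x \<in> I"
        then have H': "H \<subseteq> CK" "asub (th ` H)" "?A \<subseteq> H" by (auto simp: submodule_iff)
        obtain c where c: "th x = comb of_int n w c" using of_int_hom.basis_obtain[OF w] x by blast
        have "w i \<in> th ` H" if "i < n" for i
        proof -
          have "w i \<in> th ` I" using of_int_hom.basis_vec[OF w that] .
          then obtain a where a: "a \<in> I" "w i = th a" by blast
          then have "a \<in> ?A" using that by (metis (mono_tags, lifting) imageI lessThan_iff mem_Collect_eq)
          then show ?thesis unfolding a(2) using H'(3) by blast
        qed
        then have "th x \<in> th ` H" unfolding c by (intro asub_comb[OF H'(2)])
        then show "x \<in> H" using th_mem[OF H'(1)] x I(1) by blast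
      qed
    qed
    moreover have "?A \<subseteq> CK" using I(1) by blast
    ultimately show ?thesis by blast
  qed
  moreover have "module_span (subring_of f (Q_const f)) (K_module f) I = CK"
  proof (intro equalityI)
    have "th ` CK = K" by (rule th_image)
    show "module_span (subring_of f (Q_const f)) (K_module f) I \<subseteq> CK"
    proof (rule span_subset[OF _ I(1)])
      show "submodule CK (subring_of f (Q_const f)) (K_module f)"
        unfolding submodule_iff th_image using K_asub th_ring(3) by (auto simp: Q_const_def CK_range)
    qed
    show "CK \<subseteq> module_span (subring_of f (Q_const f)) (K_module f) I" unfolding module_span_def hull_def
    proof (intro Inter_greatest subsetI)
      fix H x assume H: "H \<in> {H. submodule H (subring_of f (Q_const f)) (K_module f) \<and> I \<subseteq> H}" and x: "x \<in> CK"
      then have H': "H \<subseteq> CK" "I \<subseteq> H" "\<And>s y. s \<in> Q_const f \<Longrightarrow> y \<in> H \<Longrightarrow> s \<otimes>\<^bsub>K_alg f\<^esub> y \<in> H" by (auto simp: submodule_iff)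
      obtain c where c: "c > 0" "of_int c \<in> th ` I" using l(4) by blast
      obtain e where e: "e > 0" "of_int e * th x \<in> R" using to_R[OF th_K[OF x]] by blast
      obtain y where y: "y \<in> I" "th y = of_int e * th x * of_int c" using lat_R[OF I(2) e(2) c(2)] by (metis imageE)
      let ?q = "1 / rat_of_int (e * c)"
      let ?s = "res_class F [:?q:]"
      have s: "?s \<in> Q_const f" "?s \<in> CK" by (auto simp: Q_const_def CK_range)
      have yC: "y \<in> CK" using y I by blast
      have "th (?s \<otimes>\<^bsub>K_alg f\<^esub> y) = qs ?q * (of_int (e * c) * th x)"
        using th_ring(1)[OF s(2) yC] y(2) by (simp add: th_res qs_def ac_simps)
      also have "\<dots> = th x" using of_int_inv[of "e * c" "th x"] e c by simp
      finally have "?s \<otimes>\<^bsub>K_alg f\<^esub> y = x" using th_inj th_ring(3)[OF s(2) yC] x by (auto simp: inj_on_def)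
      then show "x \<in> H" using H'(3)[OF s(1)] H'(2) y(1) by blast
    qed
  qed
  ultimately show ?thesis by (simp add: frac_ideal_def)
qed

lemma frac_ideal_iff: "frac_ideal f (R_ord f) I \<longleftrightarrow> I \<subseteq> CK \<and> lat (th ` I)"
  using frac_ideal_lat lat_frac_ideal frac_ideal_subset by blast

section \<open>Colon ideals, products and the trace under the transfer\<close>

lemma th_colon: "I \<subseteq> CK \<Longrightarrow> J \<subseteq> CK \<Longrightarrow> th ` colon f I J = kcol (th ` I) (th ` J)"
proof (intro equalityI subsetI)
  assume IJ: "I \<subseteq> CK" "J \<subseteq> CK"
  show "y \<in> kcol (th ` I) (th ` J)" if "y \<in> th ` colon f I J" for y
  proof -
    obtain a where a: "a \<in> colon f I J" "y = th a" using \<open>y \<in> th ` _\<close> by blast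
    then show ?thesis using IJ th_K th_ring(1)[of a] unfolding colon_def kcol_def
      by (auto simp: subset_iff) (metis imageI)
  qed
  show "y \<in> th ` colon f I J" if "y \<in> kcol (th ` I) (th ` J)" for y
  proof -
    have "y \<in> th ` CK" using that th_image by (simp add: kcol_def)
    then obtain a where a: "a \<in> CK" "y = th a" by blast
    have "a \<otimes>\<^bsub>K_alg f\<^esub> b \<in> I" if b: "b \<in> J" for b
    proof -
      have bC: "b \<in> CK" using b IJ by blast
      have "th (a \<otimes>\<^bsub>K_alg f\<^esub> b) \<in> th ` I" using \<open>y \<in> kcol _ _\<close> b a th_ring(1)[OF a(1) bC] by (auto simp: kcol_def)
      then show ?thesis using th_mem[OF IJ(1) th_ring(3)[OF a(1) bC]] by simp
    qed
    then show ?thesis using a by (auto simp: colon_def)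
  qed
qed

lemma colon_CK: "colon f I J \<subseteq> CK" by (auto simp: colon_def)

lemma ideal_prod_CK: "I \<subseteq> CK \<Longrightarrow> J \<subseteq> CK \<Longrightarrow> ideal_prod (K_alg f) I J \<subseteq> CK"
proof
  fix x assume IJ: "I \<subseteq> CK" "J \<subseteq> CK" and "x \<in> ideal_prod (K_alg f) I J"
  from this(3) show "x \<in> CK" by induction (use IJ th_ring in auto)
qed

lemma th_ideal_prod: "I \<subseteq> CK \<Longrightarrow> J \<subseteq> CK \<Longrightarrow> th ` ideal_prod (K_alg f) I J = kprod (th ` I) (th ` J)"
proof (intro equalityI subsetI)
  assume IJ: "I \<subseteq> CK" "J \<subseteq> CK"
  have "th a \<in> kprod (th ` I) (th ` J)" if "a \<in> ideal_prod (K_alg f) I J" for a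
    using that
  proof induction
    case (prod i j)
    then have "th (i \<otimes>\<^bsub>K_alg f\<^esub> j) = th i * th j" using th_ring(1)[of i j] IJ by blast
    then show ?case using prod kprod.mult[of "th i" "th ` I" "th j" "th ` J"] by simp
  next
    case (sum a b)
    then have "a \<in> CK" "b \<in> CK" using ideal_prod_CK[OF IJ] by auto
    then show ?case using sum th_ring(2)[of a b] kprod.add by auto
  qed
  then show "y \<in> kprod (th ` I) (th ` J)" if "y \<in> th ` ideal_prod (K_alg f) I J" for y using that by blast
  show "y \<in> th ` ideal_prod (K_alg f) I J" if "y \<in> kprod (th ` I) (th ` J)" for y
    using that
  proof induction
    case (mult x y)
    then obtain i j where ij: "i \<in> I" "j \<in> J" "x = th i" "y = th j" by blast
    have "th (i \<otimes>\<^bsub>K_alg f\<^esub> j) = x * y" using th_ring(1)[of i j] ij IJ by auto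
    then show ?case using ideal_prod.prod[OF ij(1,2), of "K_alg f"] by (metis imageI)
  next
    case (add x y)
    then obtain a b where ab: "a \<in> ideal_prod (K_alg f) I J" "b \<in> ideal_prod (K_alg f) I J" "x = th a" "y = th b" by blast
    then have "th (a \<oplus>\<^bsub>K_alg f\<^esub> b) = x + y" using th_ring(2)[of a b] ideal_prod_CK[OF IJ] by auto
    then show ?case using ideal_prod.sum[OF ab(1,2)] by (metis imageI)
  qed
qed

lemma ideals_prod_pr: "(\<And>i. i < N \<Longrightarrow> I i \<subseteq> CK) \<Longrightarrow> ideals_prod f I N \<subseteq> CK \<and> th ` ideals_prod f I N = pr (\<lambda>i. th ` I i) N"
proof (induction N)
  case 0 show ?case by (simp add: th_R R_ord_CK)
next
  case (Suc N)
  then have 1: "ideals_prod f I N \<subseteq> CK" "th ` ideals_prod f I N = pr (\<lambda>i. th ` I i) N" "I N \<subseteq> CK" by auto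
  show ?case using ideal_prod_CK[OF 1(1,3)] th_ideal_prod[OF 1(1,3)] 1(2) by simp
qed

text \<open>The j-th diagonal entry is read off by pairing with \<open>bd j\<close>, and the sum of
  the \<open>bd j * xi ^ j\<close> is \<open>del\<close>.\<close>

lemma K_trace_lam: "a \<in> CK \<Longrightarrow> K_trace f a = lam (del * th a)"
proof -
  assume "a \<in> CK"
  then obtain p where p: "a = res_class F p" by (rule CK_cases)
  have "K_trace f a = (\<Sum>j<n. cf (io p * xi ^ j) j)"
    unfolding p K_trace_res_class by (intro sum.cong) (simp_all add: cf_io[symmetric] io.hom_mult monom_altdef io.hom_power xi_def)
  also have "\<dots> = (\<Sum>j<n. lam (bd j * (io p * xi ^ j)))"
    by (intro sum.cong) (auto simp: lam_bd K_closed)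
  also have "\<dots> = lam (del * io p)"
    unfolding del_eq sum_distrib_right by (subst lam_sum) (auto simp: K_closed ac_simps)
  finally show ?thesis by (simp add: p th_res)
qed

lemma th_trace_dual: "S \<subseteq> CK \<Longrightarrow> th ` trace_dual f S = tdual (th ` S)"
proof -
  assume S: "S \<subseteq> CK"
  have "a \<in> trace_dual f S \<longleftrightarrow> th a \<in> tdual (th ` S)" if a: "a \<in> CK" for a
  proof -
    have "K_trace f (a \<otimes>\<^bsub>K_alg f\<^esub> s) = lam (del * (th a * th s))" if "s \<in> S" for s
      using K_trace_lam[OF th_ring(3)[OF a, of s]] th_ring(1)[OF a, of s] S that by auto
    then show ?thesis using a th_K by (simp add: trace_dual_def tdual_def)
  qed
  then have "trace_dual f S = tb (tdual (th ` S))" by (auto simp: tb_def trace_dual_def)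
  then show ?thesis using tb(1)[of "tdual (th ` S)"] by (auto simp: tdual_def)
qed

text \<open>Every \<open>korder\<close> is the image of an over-order of \<open>R\<close>, and its
  trace dual corresponds to \<open>tdual\<close> by \<open>th_trace_dual\<close>.\<close>

lemma bass_if_R_bass:
  assumes "R_bass f" shows bass
  unfolding bass_def
proof (intro allI impI)
  fix S assume S: "korder S"
  note o = korderD[OF S]
  have t: "th ` tb S = S" "tb S \<subseteq> CK" using tb o(5) by auto
  have "subring (tb S) (K_alg f)"
  proof (rule KA.subringI)
    show "tb S \<subseteq> CK" by (rule t)
    show "\<one>\<^bsub>K_alg f\<^esub> \<in> tb S" using o(3) by (simp add: tb_def th_one)
    show "\<ominus>\<^bsub>K_alg f\<^esub> h \<in> tb S" if "h \<in> tb S" for h using that asub_neg[OF o(2)] by (auto simp: tb_def th_neg)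
    show "h1 \<otimes>\<^bsub>K_alg f\<^esub> h2 \<in> tb S" "h1 \<oplus>\<^bsub>K_alg f\<^esub> h2 \<in> tb S" if "h1 \<in> tb S" "h2 \<in> tb S" for h1 h2
      using that o(4) asub_add[OF o(2)] by (auto simp: tb_def th_ring)
  qed
  moreover have "frac_ideal f (R_ord f) (tb S)" using lat_frac_ideal t o by simp
  ultimately have "gorenstein f (tb S)" using assms by (auto simp: R_bass_def over_order_def)
  then obtain J where J: "frac_ideal f (tb S) J" "ideal_prod (K_alg f) (trace_dual f (tb S)) J = tb S"
    by (auto simp: gorenstein_def invertible_ideal_def)
  have JC: "J \<subseteq> CK" using frac_ideal_subset[OF J(1)] .
  have "kprod (tdual S) (th ` J) = S"
    using th_ideal_prod[of "trace_dual f (tb S)" J] JC J(2) th_trace_dual[OF t(2)] t by (auto simp: trace_dual_def)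
  moreover have "th ` J \<subseteq> K" using JC th_K by blast
  ultimately show "\<exists>J\<subseteq>K. kprod (tdual S) J = S" by blast
qed

lemma ideal_chain_iff:
  "ideal_chain f N I \<longleftrightarrow> (\<forall>i<N. I i \<subseteq> CK) \<and> chain N (\<lambda>i. th ` I i)"
proof -
  have e: "colon f (I i) (I i) \<subseteq> colon f (I (Suc i)) (I (Suc i)) \<longleftrightarrow>
      kcol (th ` I i) (th ` I i) \<subseteq> kcol (th ` I (Suc i)) (th ` I (Suc i))"
    if "Suc i < N" "\<forall>i<N. I i \<subseteq> CK" for i
    using that th_colon[of "I i" "I i"] th_colon[of "I (Suc i)" "I (Suc i)"] th_image_subset[OF colon_CK colon_CK]
    by (metis Suc_lessD)
  show ?thesis
  proof (cases "\<forall>i<N. I i \<subseteq> CK")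
    case True
    then show ?thesis unfolding ideal_chain_def chain_def frac_ideal_iff by (simp add: e)
  next
    case False
    then show ?thesis unfolding ideal_chain_def frac_ideal_iff by blast
  qed
qed

text \<open>Stated for abstract bijections \<open>t\<close> and \<open>t'\<close> onto lattices, so
  that ideals and direct sums are both instances. Conjugation by them translates the isomorphisms;
  passing from compatibility with \<open>xi\<close> to scalars from all of \<open>R\<close> is
  \<open>module_R_linear\<close>.\<close>

lemma modules_iso_transport:
  fixes emb :: "'k \<Rightarrow> 'v::comm_ring_1" and emb' :: "'k \<Rightarrow> 'u::comm_ring_1"
  assumes e: "comm_ring_hom emb" "comm_ring_hom emb'"
    and L: "asub L" "\<And>v. v \<in> L \<Longrightarrow> emb xi * v \<in> L"
    and t: "bij_betw t (carrier M) L" "\<And>x y. x \<in> carrier M \<Longrightarrow> y \<in> carrier M \<Longrightarrow> x \<oplus>\<^bsub>M\<^esub> y \<in> carrier M \<and> t (x \<oplus>\<^bsub>M\<^esub> y) = t x + t y"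
      "\<And>r x. r \<in> R_ord f \<Longrightarrow> x \<in> carrier M \<Longrightarrow> r \<odot>\<^bsub>M\<^esub> x \<in> carrier M \<and> t (r \<odot>\<^bsub>M\<^esub> x) = emb (th r) * t x"
    and t': "bij_betw t' (carrier M') L'" "\<And>x y. x \<in> carrier M' \<Longrightarrow> y \<in> carrier M' \<Longrightarrow> x \<oplus>\<^bsub>M'\<^esub> y \<in> carrier M' \<and> t' (x \<oplus>\<^bsub>M'\<^esub> y) = t' x + t' y"
      "\<And>r x. r \<in> R_ord f \<Longrightarrow> x \<in> carrier M' \<Longrightarrow> r \<odot>\<^bsub>M'\<^esub> x \<in> carrier M' \<and> t' (r \<odot>\<^bsub>M'\<^esub> x) = emb' (th r) * t' x"
  shows "modules_iso (subring_of f (R_ord f)) M M' \<longleftrightarrow> (\<exists>h. op_iso (\<lambda>v. emb xi * v) L (\<lambda>v. emb' xi * v) L' h)"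
proof
  have car: "carrier (subring_of f (R_ord f)) = R_ord f" by (simp add: subring_of_def)
  let ?s = "inv_into (carrier M) t" and ?s' = "inv_into (carrier M') t'"
  have s: "bij_betw ?s L (carrier M)" "\<And>v. v \<in> L \<Longrightarrow> t (?s v) = v" "\<And>x. x \<in> carrier M \<Longrightarrow> ?s (t x) = x" "\<And>v. v \<in> L \<Longrightarrow> ?s v \<in> carrier M"
    using bij_betw_inv_into[OF t(1)] bij_betw_inv_into_right[OF t(1)] bij_betw_inv_into_left[OF t(1)]
      bij_betwE[OF bij_betw_inv_into[OF t(1)]] by blast+
  have s': "bij_betw ?s' L' (carrier M')" "\<And>v. v \<in> L' \<Longrightarrow> t' (?s' v) = v" "\<And>x. x \<in> carrier M' \<Longrightarrow> ?s' (t' x) = x" "\<And>v. v \<in> L' \<Longrightarrow> ?s' v \<in> carrier M'"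
    using bij_betw_inv_into[OF t'(1)] bij_betw_inv_into_right[OF t'(1)] bij_betw_inv_into_left[OF t'(1)]
      bij_betwE[OF bij_betw_inv_into[OF t'(1)]] by blast+
  have tM: "\<And>x. x \<in> carrier M \<Longrightarrow> t x \<in> L" and tM': "\<And>x. x \<in> carrier M' \<Longrightarrow> t' x \<in> L'" using t(1) t'(1) by (auto simp: bij_betw_def)
  {
    assume "modules_iso (subring_of f (R_ord f)) M M'"
    then obtain h where h: "h \<in> hom (add_monoid M) (add_monoid M')" "bij_betw h (carrier M) (carrier M')"
      "\<And>r x. r \<in> R_ord f \<Longrightarrow> x \<in> carrier M \<Longrightarrow> h (r \<odot>\<^bsub>M\<^esub> x) = r \<odot>\<^bsub>M'\<^esub> h x"
      by (auto simp: modules_iso_def iso_def car)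
    have hM: "\<And>x. x \<in> carrier M \<Longrightarrow> h x \<in> carrier M'" using h(2) by (auto simp: bij_betw_def)
    have hadd: "h (x \<oplus>\<^bsub>M\<^esub> y) = h x \<oplus>\<^bsub>M'\<^esub> h y" if "x \<in> carrier M" "y \<in> carrier M" for x y
      using h(1) that by (auto simp: hom_def)
    let ?k = "\<lambda>v. t' (h (?s v))"
    obtain rx where rx: "rx \<in> R_ord f" "xi = th rx" using R_xi th_R by blast
    have "op_iso (\<lambda>v. emb xi * v) L (\<lambda>v. emb' xi * v) L' ?k" unfolding op_iso_def
    proof (intro conjI ballI)
      show "bij_betw ?k L L'" using bij_betw_trans[OF bij_betw_trans[OF s(1) h(2)] t'(1)] by (simp add: o_def)
      fix u v assume uv: "u \<in> L" "v \<in> L"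
      have "?s (u + v) = ?s u \<oplus>\<^bsub>M\<^esub> ?s v"
        using t(2)[OF s(4)[OF uv(1)] s(4)[OF uv(2)]] s(2)[OF uv(1)] s(2)[OF uv(2)] s(3) by metis
      then show "?k (u + v) = ?k u + ?k v"
        using hadd[OF s(4)[OF uv(1)] s(4)[OF uv(2)]] t'(2)[OF hM[OF s(4)[OF uv(1)]] hM[OF s(4)[OF uv(2)]]] by simp
    next
      fix v assume v: "v \<in> L"
      have "?s (emb xi * v) = rx \<odot>\<^bsub>M\<^esub> ?s v"
        using t(3)[OF rx(1) s(4)[OF v]] s(2)[OF v] s(3) rx(2) by metis
      then show "?k (emb xi * v) = emb' xi * ?k v"
        using h(3)[OF rx(1) s(4)[OF v]] t'(3)[OF rx(1) hM[OF s(4)[OF v]]] rx(2) by simp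
    qed
    then show "\<exists>h. op_iso (\<lambda>v. emb xi * v) L (\<lambda>v. emb' xi * v) L' h" by blast
  next
    assume "\<exists>h. op_iso (\<lambda>v. emb xi * v) L (\<lambda>v. emb' xi * v) L' h"
    then obtain h where h: "op_iso (\<lambda>v. emb xi * v) L (\<lambda>v. emb' xi * v) L' h" ..
    note hD = op_isoD[OF h]
    let ?k = "\<lambda>x. ?s' (h (t x))"
    have kM: "\<And>x. x \<in> carrier M \<Longrightarrow> ?k x \<in> carrier M'" using s'(4) hD(2) tM by blast
    have tk: "\<And>x. x \<in> carrier M \<Longrightarrow> t' (?k x) = h (t x)" using s'(2) hD(2) tM by blast
    have inj': "x = y" if "x \<in> carrier M'" "y \<in> carrier M'" "t' x = t' y" for x y using s'(3) that by metis
    have "bij_betw ?k (carrier M) (carrier M')" using bij_betw_trans[OF bij_betw_trans[OF t(1) hD(1)] s'(1)] by (simp add: o_def)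
    moreover have "?k (x \<oplus>\<^bsub>M\<^esub> y) = ?k x \<oplus>\<^bsub>M'\<^esub> ?k y" if xy: "x \<in> carrier M" "y \<in> carrier M" for x y
    proof (rule inj')
      have "t' (?k (x \<oplus>\<^bsub>M\<^esub> y)) = h (t (x \<oplus>\<^bsub>M\<^esub> y))" using tk t(2)[OF xy] by blast
      also have "\<dots> = h (t x) + h (t y)" using t(2)[OF xy] hD(3)[OF tM[OF xy(1)] tM[OF xy(2)]] by simp
      also have "\<dots> = t' (?k x \<oplus>\<^bsub>M'\<^esub> ?k y)"
        using t'(2)[OF kM[OF xy(1)] kM[OF xy(2)]] tk[OF xy(1)] tk[OF xy(2)] by simp
      finally show "t' (?k (x \<oplus>\<^bsub>M\<^esub> y)) = t' (?k x \<oplus>\<^bsub>M'\<^esub> ?k y)" .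
    qed (use t(2)[OF xy] t'(2)[OF kM[OF xy(1)] kM[OF xy(2)]] kM in blast)+
    moreover have "?k (r \<odot>\<^bsub>M\<^esub> x) = r \<odot>\<^bsub>M'\<^esub> ?k x" if r: "r \<in> R_ord f" and x: "x \<in> carrier M" for r x
    proof (rule inj')
      have "th r \<in> R" using r th_R by blast
      then have "h (emb (th r) * t x) = emb' (th r) * h (t x)"
        using module_R_linear[OF e L(1) L(2), of h "th r" "t x"] hD(3,4) tM[OF x] by blast
      moreover have "t' (?k (r \<odot>\<^bsub>M\<^esub> x)) = h (t (r \<odot>\<^bsub>M\<^esub> x))" using tk t(3)[OF r x] by blast
      ultimately show "t' (?k (r \<odot>\<^bsub>M\<^esub> x)) = t' (r \<odot>\<^bsub>M'\<^esub> ?k x)"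
        using t(3)[OF r x] t'(3)[OF r kM[OF x]] tk[OF x] by simp
    qed (use t(3)[OF r x] t'(3)[OF r kM[OF x]] kM in blast)+
    ultimately show "modules_iso (subring_of f (R_ord f)) M M'"
      unfolding modules_iso_def iso_def car using kM by (intro bexI[of _ ?k]) (auto simp: hom_def)
  }
qed

lemma ideal_iso_iff:
  assumes I: "frac_ideal f (R_ord f) I" and J: "frac_ideal f (R_ord f) J"
  shows "modules_iso (subring_of f (R_ord f)) (sub_module f I) (sub_module f J) \<longleftrightarrow>
    (\<exists>h. op_iso ((*) xi) (th ` I) ((*) xi) (th ` J) h)"
proof -
  have e: "comm_ring_hom (\<lambda>y::'k. y)" by unfold_locales auto
  have t: "bij_betw th (carrier (sub_module f I)) (th ` I)"
    "\<And>x y. x \<in> carrier (sub_module f I) \<Longrightarrow> y \<in> carrier (sub_module f I) \<Longrightarrow>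
      x \<oplus>\<^bsub>sub_module f I\<^esub> y \<in> carrier (sub_module f I) \<and> th (x \<oplus>\<^bsub>sub_module f I\<^esub> y) = th x + th y"
    "\<And>r x. r \<in> R_ord f \<Longrightarrow> x \<in> carrier (sub_module f I) \<Longrightarrow>
      r \<odot>\<^bsub>sub_module f I\<^esub> x \<in> carrier (sub_module f I) \<and> th (r \<odot>\<^bsub>sub_module f I\<^esub> x) = th r * th x"
    if I: "frac_ideal f (R_ord f) I" for I
  proof -
    have IC: "I \<subseteq> CK" and l: "lat (th ` I)" using I frac_ideal_iff by auto
    show "bij_betw th (carrier (sub_module f I)) (th ` I)"
      using inj_on_subset[OF th_inj IC] by (simp add: sub_module_def bij_betw_def)
    fix x assume x: "x \<in> carrier (sub_module f I)"
    then have x': "x \<in> I" "x \<in> CK" using IC by (auto simp: sub_module_def)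
    { fix y assume "y \<in> carrier (sub_module f I)"
      then have y: "y \<in> I" "y \<in> CK" using IC by (auto simp: sub_module_def)
      have "th x + th y \<in> th ` I" using asub_add[OF latD(2)[OF l]] x' y by blast
      then have "x \<oplus>\<^bsub>K_alg f\<^esub> y \<in> I" using th_mem[OF IC th_ring(4)[OF x'(2) y(2)]] th_ring(2)[OF x'(2) y(2)] by simp
      then show "x \<oplus>\<^bsub>sub_module f I\<^esub> y \<in> carrier (sub_module f I) \<and> th (x \<oplus>\<^bsub>sub_module f I\<^esub> y) = th x + th y"
        using th_ring(2)[OF x'(2) y(2)] by (simp add: sub_module_def) }
    { fix r assume r: "r \<in> R_ord f"
      then have rC: "r \<in> CK" using R_ord_CK by blast
      have "th r * th x \<in> th ` I" using lat_R[OF l] r x' th_R by blast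
      then have "r \<otimes>\<^bsub>K_alg f\<^esub> x \<in> I" using th_mem[OF IC th_ring(3)[OF rC x'(2)]] th_ring(1)[OF rC x'(2)] by simp
      then show "r \<odot>\<^bsub>sub_module f I\<^esub> x \<in> carrier (sub_module f I) \<and> th (r \<odot>\<^bsub>sub_module f I\<^esub> x) = th r * th x"
        using th_ring(1)[OF rC x'(2)] by (simp add: sub_module_def) }
  qed
  have l: "asub (th ` I)" "\<And>v. v \<in> th ` I \<Longrightarrow> xi * v \<in> th ` I" using latD(2,3)[OF frac_ideal_lat[OF I]] by auto
  show ?thesis by (rule modules_iso_transport[OF e e l t[OF I] t[OF J]])
qed

definition "Th N g = (\<lambda>i. if i < N then th (g i) else (0::'k))" for N :: nat

lemma dsum_iso_iff:
  assumes I: "\<And>i. i < N \<Longrightarrow> frac_ideal f (R_ord f) (I i)" and J: "\<And>i. i < N \<Longrightarrow> frac_ideal f (R_ord f) (J i)"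
  shows "modules_iso (subring_of f (R_ord f)) (dsum f N I) (dsum f N J) \<longleftrightarrow>
    (\<exists>h. op_iso xs (dprod N (\<lambda>i. th ` I i)) xs (dprod N (\<lambda>i. th ` J i)) h)"
proof -
  have e: "comm_ring_hom (\<lambda>y::'k. (\<lambda>_::nat. y))" by unfold_locales (auto simp: fun_eq_iff)
  have t: "bij_betw (Th N) (carrier (dsum f N I)) (dprod N (\<lambda>i. th ` I i))"
    "\<And>x y. x \<in> carrier (dsum f N I) \<Longrightarrow> y \<in> carrier (dsum f N I) \<Longrightarrow>
      x \<oplus>\<^bsub>dsum f N I\<^esub> y \<in> carrier (dsum f N I) \<and> Th N (x \<oplus>\<^bsub>dsum f N I\<^esub> y) = Th N x + Th N y"
    "\<And>r x. r \<in> R_ord f \<Longrightarrow> x \<in> carrier (dsum f N I) \<Longrightarrow>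
      r \<odot>\<^bsub>dsum f N I\<^esub> x \<in> carrier (dsum f N I) \<and> Th N (r \<odot>\<^bsub>dsum f N I\<^esub> x) = (\<lambda>_. th r) * Th N x"
    if I: "\<And>i. i < N \<Longrightarrow> frac_ideal f (R_ord f) (I i)" for I
  proof -
    have IC: "\<And>i. i < N \<Longrightarrow> I i \<subseteq> CK" and l: "\<And>i. i < N \<Longrightarrow> lat (th ` I i)" using I frac_ideal_iff by auto
    have car: "carrier (dsum f N I) = (\<Pi>\<^sub>E i\<in>{..<N}. I i)" by (simp add: dsum_def)
    show "bij_betw (Th N) (carrier (dsum f N I)) (dprod N (\<lambda>i. th ` I i))" unfolding bij_betw_def
    proof (intro conjI inj_onI equalityI subsetI)
      fix x y assume xy: "x \<in> carrier (dsum f N I)" "y \<in> carrier (dsum f N I)" "Th N x = Th N y"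
      show "x = y"
      proof (rule PiE_ext[OF xy(1)[unfolded car] xy(2)[unfolded car]])
        fix i assume "i \<in> {..<N}"
        then have i: "i < N" by simp
        have "th (x i) = th (y i)" using fun_cong[OF xy(3), of i] i by (simp add: Th_def)
        moreover have "x i \<in> CK" "y i \<in> CK" using xy(1,2) i IC[OF i] by (auto simp: car)
        ultimately show "x i = y i" using th_inj by (auto simp: inj_on_def)
      qed
    next
      fix g assume "g \<in> Th N ` carrier (dsum f N I)"
      then show "g \<in> dprod N (\<lambda>i. th ` I i)" by (auto simp: car Th_def dprod_def)
    next
      fix g assume g: "g \<in> dprod N (\<lambda>i. th ` I i)"
      then have "\<forall>i. \<exists>a. i < N \<longrightarrow> a \<in> I i \<and> g i = th a" by (auto simp: dprod_def)
      then obtain a where a: "\<And>i. i < N \<Longrightarrow> a i \<in> I i \<and> g i = th (a i)" by metis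
      have "g = Th N (restrict a {..<N})" using a g by (auto simp: Th_def dprod_def fun_eq_iff)
      moreover have "restrict a {..<N} \<in> carrier (dsum f N I)" using a by (auto simp: car)
      ultimately show "g \<in> Th N ` carrier (dsum f N I)" by blast
    qed
    fix x assume x: "x \<in> carrier (dsum f N I)"
    then have x': "\<And>i. i < N \<Longrightarrow> x i \<in> I i" "\<And>i. i < N \<Longrightarrow> x i \<in> CK" using IC by (auto simp: car)
    { fix y assume y: "y \<in> carrier (dsum f N I)"
      then have y': "\<And>i. i < N \<Longrightarrow> y i \<in> I i" "\<And>i. i < N \<Longrightarrow> y i \<in> CK" using IC by (auto simp: car)
      have "x i \<oplus>\<^bsub>K_alg f\<^esub> y i \<in> I i" if i: "i < N" for i
      proof -
        have "th (x i) + th (y i) \<in> th ` I i" using asub_add[OF latD(2)[OF l[OF i]]] x'(1)[OF i] y'(1)[OF i] by blast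
        then show ?thesis
          using th_mem[OF IC[OF i] th_ring(4)[OF x'(2)[OF i] y'(2)[OF i]]] th_ring(2)[OF x'(2)[OF i] y'(2)[OF i]] by simp
      qed
      then show "x \<oplus>\<^bsub>dsum f N I\<^esub> y \<in> carrier (dsum f N I) \<and> Th N (x \<oplus>\<^bsub>dsum f N I\<^esub> y) = Th N x + Th N y"
        using th_ring(2) x'(2) y'(2) by (auto simp: dsum_def Th_def fun_eq_iff) }
    { fix r assume r: "r \<in> R_ord f"
      then have rC: "r \<in> CK" using R_ord_CK by blast
      have "r \<otimes>\<^bsub>K_alg f\<^esub> x i \<in> I i" if i: "i < N" for i
      proof -
        have "th r * th (x i) \<in> th ` I i" using lat_R[OF l[OF i]] r x'(1)[OF i] th_R by blast
        then show ?thesis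
          using th_mem[OF IC[OF i] th_ring(3)[OF rC x'(2)[OF i]]] th_ring(1)[OF rC x'(2)[OF i]] by simp
      qed
      then show "r \<odot>\<^bsub>dsum f N I\<^esub> x \<in> carrier (dsum f N I) \<and> Th N (r \<odot>\<^bsub>dsum f N I\<^esub> x) = (\<lambda>_. th r) * Th N x"
        using th_ring(1)[OF rC] x'(2) by (auto simp: dsum_def Th_def fun_eq_iff) }
  qed
  have aL: "asub (dprod N (\<lambda>i. th ` I i))"
    using latD(2)[OF frac_ideal_lat[OF I]] by (intro dprod_asub) blast
  have xL: "(\<lambda>_. xi) * v \<in> dprod N (\<lambda>i. th ` I i)" if "v \<in> dprod N (\<lambda>i. th ` I i)" for v
    using that latD(3)[OF frac_ideal_lat[OF I]] by (auto simp: dprod_def)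
  show ?thesis unfolding xs_eq
    by (rule modules_iso_transport[OF e e aL xL t[OF I] t[OF J]])
qed

lemma dprod_cong: "(\<And>i. i < N \<Longrightarrow> I i = J i) \<Longrightarrow> dprod N I = dprod N J"
  by (auto simp: dprod_def)

lemma chain_cong: "(\<And>i. i < N \<Longrightarrow> I i = J i) \<Longrightarrow> chain N I = chain N J"
  unfolding chain_def by (metis Suc_lessD)

lemma ideal_class_eq_iff:
  assumes P: "frac_ideal f (R_ord f) P" and Q: "frac_ideal f (R_ord f) Q"
  shows "ideal_class f P = ideal_class f Q \<longleftrightarrow> (\<exists>h. op_iso ((*) xi) (th ` P) ((*) xi) (th ` Q) h)"
proof -
  have refl: "(Q, Q) \<in> ideals_iso f"
    using Q ideal_iso_iff[OF Q Q] op_isoI[of "th ` Q" "\<lambda>x. x" "th ` Q" "\<lambda>x. x" "(*) xi" "(*) xi"] by (auto simp: ideals_iso_def)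
  have cl: "(P, Q) \<in> ideals_iso f \<longleftrightarrow> (\<exists>h. op_iso ((*) xi) (th ` P) ((*) xi) (th ` Q) h)"
    if "frac_ideal f (R_ord f) P" "frac_ideal f (R_ord f) Q" for P Q
    using that ideal_iso_iff by (auto simp: ideals_iso_def)
  show ?thesis
  proof
    assume "ideal_class f P = ideal_class f Q"
    then have "(P, Q) \<in> ideals_iso f" using refl by (auto simp: ideal_class_def)
    then show "\<exists>h. op_iso ((*) xi) (th ` P) ((*) xi) (th ` Q) h" using cl[OF P Q] by blast
  next
    assume "\<exists>h. op_iso ((*) xi) (th ` P) ((*) xi) (th ` Q) h"
    then obtain h where h: "op_iso ((*) xi) (th ` P) ((*) xi) (th ` Q) h" ..
    have lP: "asub (th ` P)" "(*) xi ` (th ` P) \<subseteq> th ` P" using latD(2,3)[OF frac_ideal_lat[OF P]] by auto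
    note h' = op_iso_sym[OF h lP]
    have "(P, J) \<in> ideals_iso f \<longleftrightarrow> (Q, J) \<in> ideals_iso f" for J
    proof (cases "frac_ideal f (R_ord f) J")
      case True
      then show ?thesis using cl[OF P True] cl[OF Q True] op_iso_trans[OF h] op_iso_trans[OF h'] by blast
    qed (simp add: ideals_iso_def)
    then show "ideal_class f P = ideal_class f Q" by (auto simp: ideal_class_def)
  qed
qed

lemma similar_equiv: "A \<in> int_mats m c \<Longrightarrow> similar_mat A A"
  by (rule similar_mat_refl) (auto simp: int_mats_def)

section \<open>The two bijections and the isomorphism criterion\<close>

theorem matrices_ideals: "\<exists>\<phi>. bij_betw \<phi> (int_mat_classes f f) (carrier (ICM f))"
proof -
  let ?Y = "{I. frac_ideal f (R_ord f) I}"
  let ?iso = "\<lambda>I J. modules_iso (subring_of f (R_ord f)) (sub_module f I) (sub_module f J)"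
  have "\<exists>\<phi>. bij_betw \<phi> (int_mats f f // {(A, B). A \<in> int_mats f f \<and> B \<in> int_mats f f \<and> similar_mat A B})
     (?Y // {(I, J). I \<in> ?Y \<and> J \<in> ?Y \<and> ?iso I J})"
  proof (rule quotient_bij[where R = "\<lambda>A I. \<exists>m w. rep of_int ((*) xi) (th ` I) m w A"])
    show "similar_mat B A" if "similar_mat A B" for A B :: "int mat" using that by (rule similar_mat_sym)
    show "similar_mat A C" if "similar_mat A B" "similar_mat B C" for A B C :: "int mat" using that by (rule similar_mat_trans)
    show "similar_mat A A" if "A \<in> int_mats f f" for A using that by (rule similar_equiv)
    show "\<exists>I\<in>?Y. \<exists>m w. rep of_int ((*) xi) (th ` I) m w A" if A: "A \<in> int_mats f f" for A
    proof -
      obtain I m w where I: "lat I" "rep of_int ((*) xi) I m w A" using int_mats_ideal[OF A] by blast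
      then have "th ` tb I = I" "tb I \<subseteq> CK" using tb latD(1) by auto
      then show ?thesis using I lat_frac_ideal by (intro bexI[of _ "tb I"]) auto
    qed
    show "\<exists>A\<in>int_mats f f. \<exists>m w. rep of_int ((*) xi) (th ` I) m w A" if I: "I \<in> ?Y" for I
    proof -
      have l: "lat (th ` I)" using frac_ideal_lat I by simp
      obtain w A where "rep of_int ((*) xi) (th ` I) n w A" "char_poly A = f" using ideal_rep[OF l] by blast
      then show ?thesis using ideal_int_mats[OF l] by blast
    qed
    fix A I B J assume IJ: "I \<in> ?Y" "J \<in> ?Y" and "\<exists>m w. rep of_int ((*) xi) (th ` I) m w A" "\<exists>m w. rep of_int ((*) xi) (th ` J) m w B"
    then obtain m w m' w' where r: "rep of_int ((*) xi) (th ` I) m w A" "rep of_int ((*) xi) (th ` J) m' w' B" by blast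
    show "similar_mat A B \<longleftrightarrow> ?iso I J"
      using rep_iso_iff_similar[OF r linmap_mult linmap_mult] ideal_iso_iff[of I J] IJ by simp
  qed
  moreover have "{(I, J). I \<in> ?Y \<and> J \<in> ?Y \<and> ?iso I J} = ideals_iso f" by (auto simp: ideals_iso_def)
  ultimately show ?thesis by (simp add: int_mat_classes_def ICM_def)
qed

theorem matrices_chains:
  assumes b: bass and N: "N > 0"
  shows "\<exists>\<psi>. bij_betw \<psi> (int_mat_classes f (f ^ N)) (chain_module_classes f N)"
proof -
  let ?Y = "chain_modules f N"
  let ?iso = "modules_iso (subring_of f (R_ord f))"
  \<comment> \<open>A member of \<open>chain_modules\<close> is a bare record, so the ideals that
    form it are quantified; \<open>dsum_iso_iff\<close> holds for any choice of them.\<close>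
  let ?R = "\<lambda>A M. \<exists>I m w. M = dsum f N I \<and> ideal_chain f N I \<and> rep of_int xs (dprod N (\<lambda>i. th ` I i)) m w A"
  have "\<exists>\<phi>. bij_betw \<phi> (int_mats f (f ^ N) // {(A, B). A \<in> int_mats f (f ^ N) \<and> B \<in> int_mats f (f ^ N) \<and> similar_mat A B})
     (?Y // {(M, M'). M \<in> ?Y \<and> M' \<in> ?Y \<and> ?iso M M'})"
  proof (rule quotient_bij[where R = ?R])
    show "similar_mat B A" if "similar_mat A B" for A B :: "int mat" using that by (rule similar_mat_sym)
    show "similar_mat A C" if "similar_mat A B" "similar_mat B C" for A B C :: "int mat" using that by (rule similar_mat_trans)
    show "similar_mat A A" if "A \<in> int_mats f (f ^ N)" for A using that by (rule similar_equiv)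
    show "\<exists>M\<in>?Y. ?R A M" if A: "A \<in> int_mats f (f ^ N)" for A
    proof -
      obtain I m w where I: "chain N I" "rep of_int xs (dprod N I) m w A" using int_mats_chain[OF b A] by blast
      have t: "th ` tb (I i) = I i" if "i < N" for i using I(1) that latD(1) by (intro tb) (auto simp: chain_def)
      have "ideal_chain f N (\<lambda>i. tb (I i))"
        unfolding ideal_chain_iff using I(1) tb(2) chain_cong[of N "\<lambda>i. th ` tb (I i)" I] t by auto
      moreover have "rep of_int xs (dprod N (\<lambda>i. th ` tb (I i))) m w A"
        using I(2) dprod_cong[of N "\<lambda>i. th ` tb (I i)" I] t by simp
      ultimately show ?thesis by (auto simp: chain_modules_def)
    qed
    show "\<exists>A\<in>int_mats f (f ^ N). ?R A M" if M: "M \<in> ?Y" for M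
    proof -
      obtain I where I: "M = dsum f N I" "ideal_chain f N I" using M by (auto simp: chain_modules_def)
      have l: "\<And>i. i < N \<Longrightarrow> lat (th ` I i)" using I(2) by (auto simp: ideal_chain_iff chain_def)
      obtain m w A where r: "rep of_int xs (dprod N (\<lambda>i. th ` I i)) m w A" "char_poly A = f ^ N"
        using dprod_rep[of N "\<lambda>i. th ` I i"] l by blast
      have "A \<in> int_mats f (f ^ N)" by (rule dprod_int_mats[OF N l r])
      then show ?thesis using I r(1) by blast
    qed
    fix A M B M' assume "?R A M" "?R B M'"
    then obtain I m w J m' w' where h: "M = dsum f N I" "ideal_chain f N I" "rep of_int xs (dprod N (\<lambda>i. th ` I i)) m w A"
      "M' = dsum f N J" "ideal_chain f N J" "rep of_int xs (dprod N (\<lambda>i. th ` J i)) m' w' B" by blast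
    have fr: "\<And>i. i < N \<Longrightarrow> frac_ideal f (R_ord f) (I i)" "\<And>i. i < N \<Longrightarrow> frac_ideal f (R_ord f) (J i)"
      using h(2,5) by (auto simp: ideal_chain_def)
    show "similar_mat A B \<longleftrightarrow> ?iso M M'"
      using rep_iso_iff_similar[OF h(3,6) linmap_xs linmap_xs] dsum_iso_iff[OF fr] h(1,4) by simp
  qed
  then show ?thesis by (simp add: int_mat_classes_def chain_module_classes_def)
qed

theorem chain_modules_iso_iff:
  assumes b: bass and N: "N > 0" and c: "ideal_chain f N I" "ideal_chain f N I'"
  shows "modules_iso (subring_of f (R_ord f)) (dsum f N I) (dsum f N I') \<longleftrightarrow>
    (\<forall>i<N. colon f (I i) (I i) = colon f (I' i) (I' i)) \<and>
    ideal_class f (ideals_prod f I N) = ideal_class f (ideals_prod f I' N)"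
proof -
  have fr: "\<And>i. i < N \<Longrightarrow> frac_ideal f (R_ord f) (I i)" "\<And>i. i < N \<Longrightarrow> frac_ideal f (R_ord f) (I' i)"
    using c by (auto simp: ideal_chain_def)
  have ch: "chain N (\<lambda>i. th ` I i)" "chain N (\<lambda>i. th ` I' i)" and IC: "\<And>i. i < N \<Longrightarrow> I i \<subseteq> CK" "\<And>i. i < N \<Longrightarrow> I' i \<subseteq> CK"
    using c by (auto simp: ideal_chain_iff)
  have pr: "ideals_prod f I N \<subseteq> CK" "th ` ideals_prod f I N = pr (\<lambda>i. th ` I i) N"
    "ideals_prod f I' N \<subseteq> CK" "th ` ideals_prod f I' N = pr (\<lambda>i. th ` I' i) N"
    using ideals_prod_pr[of N I] ideals_prod_pr[of N I'] IC by auto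
  have frp: "frac_ideal f (R_ord f) (ideals_prod f I N)" "frac_ideal f (R_ord f) (ideals_prod f I' N)"
    using pr lat_pr[of N "\<lambda>i. th ` I i"] lat_pr[of N "\<lambda>i. th ` I' i"] ch by (auto simp: frac_ideal_iff chain_def)
  have col: "colon f (I i) (I i) = colon f (I' i) (I' i) \<longleftrightarrow> kcol (th ` I i) (th ` I i) = kcol (th ` I' i) (th ` I' i)" if "i < N" for i
    using th_image_eq[OF colon_CK colon_CK] th_colon[OF IC(1)[OF that] IC(1)[OF that]] th_colon[OF IC(2)[OF that] IC(2)[OF that]] by metis
  have "modules_iso (subring_of f (R_ord f)) (dsum f N I) (dsum f N I') \<longleftrightarrow>
      (\<exists>h. op_iso xs (dprod N (\<lambda>i. th ` I i)) xs (dprod N (\<lambda>i. th ` I' i)) h)" by (rule dsum_iso_iff[OF fr])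
  also have "\<dots> \<longleftrightarrow> (\<forall>i<N. kcol (th ` I i) (th ` I i) = kcol (th ` I' i) (th ` I' i)) \<and>
      (\<exists>h. op_iso ((*) xi) (pr (\<lambda>i. th ` I i) N) ((*) xi) (pr (\<lambda>i. th ` I' i) N) h)"
    using chain_iso_invariants[OF b ch] invariants_chain_iso[OF b ch N] by blast
  finally show ?thesis using col ideal_class_eq_iff[OF frp] pr by simp
qed

end

text \<open>A factor of positive degree is no unit, so its square does not divide \<open>f\<close>.
  This persists over the rationals, and in characteristic 0 it means that \<open>f\<close> is
  coprime to its derivative, whence the Bezout relation.\<close>

lemma squarefree_separable:
  fixes f :: "int poly"
  assumes "squarefree f" "lead_coeff f = 1"
  shows "\<exists>a b. a * map_poly rat_of_int f + b * pderiv (map_poly rat_of_int f) = 1"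
proof -
  have f0: "f \<noteq> 0" using assms(2) by auto
  have "square_free f" unfolding square_free_def
  proof (intro conjI allI impI f0)
    fix q :: "int poly" assume q: "degree q > 0"
    show "\<not> q * q dvd f"
    proof
      assume "q * q dvd f"
      then have "q dvd 1" using assms(1) unfolding squarefree_def power2_eq_square by blast
      then show False using q by (auto simp: is_unit_poly_iff)
    qed
  qed
  then have "square_free (map_poly rat_of_int f)" by (rule square_free_int_rat)
  then have "coprime (map_poly rat_of_int f) (pderiv (map_poly rat_of_int f))"
    using square_free_imp_separable[of "map_poly rat_of_int f"] by (simp add: separable_def)
  then have "gcd (map_poly rat_of_int f) (pderiv (map_poly rat_of_int f)) = 1" by (rule coprime_imp_gcd_eq_1)
  then show ?thesis
    using bezout_coefficients_fst_snd[of "map_poly rat_of_int f" "pderiv (map_poly rat_of_int f)"] by metis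
qed

text \<open>Away from the roots of \<open>f\<close> the value at a fixed root is used, so that \<open>root_eval f\<close> is a ring homomorphism
  with kernel \<open>(f)\<close>.\<close>

definition root_eval :: "int poly \<Rightarrow> rat poly \<Rightarrow> complex \<Rightarrow> complex" where
  "root_eval f p = (\<lambda>z. poly (cpoly p)
     (if poly (map_poly of_int f) z = 0 then z else (SOME z. poly (map_poly of_int f) z = (0::complex))))"

lemma root_eval_residue_alg:
  fixes f :: "int poly"
  assumes f: "lead_coeff f = 1" "squarefree f" "f \<noteq> 1"
  shows "residue_alg f (root_eval f)"
proof
  let ?F = "map_poly rat_of_int f"
  interpret cp: map_poly_comm_ring_hom "of_rat :: rat \<Rightarrow> complex" ..
  show "lead_coeff f = 1" by fact
  obtain a b where ab: "a * ?F + b * pderiv ?F = 1" using squarefree_separable[OF f(2,1)] by blast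
  then show "\<exists>a b. a * ?F + b * pderiv ?F = 1" by blast
  show "root_eval f (x + y) = root_eval f x + root_eval f y" "root_eval f (x * y) = root_eval f x * root_eval f y"
    "root_eval f 1 = 1" "root_eval f 0 = 0" for x y
    by (auto simp: root_eval_def fun_eq_iff cp.hom_add cp.hom_mult)
  have cF: "cpoly ?F = map_poly of_int f" by (simp add: map_poly_map_poly o_def)
  \<comment> \<open>A monic \<open>f\<close> other than 1 has positive degree, so the default root
    in \<open>root_eval\<close> exists.\<close>
  have "degree f \<noteq> 0" using f(1,3) monic_degree_0 by blast
  then have "degree (map_poly of_int f :: complex poly) \<noteq> 0" by simp
  then have "\<not> constant (poly (map_poly of_int f :: complex poly))" by (simp add: constant_degree)
  then have ex: "\<exists>z. poly (map_poly of_int f) z = (0::complex)" by (rule fundamental_theorem_of_algebra)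
  fix p
  show "root_eval f p = 0 \<longleftrightarrow> ?F dvd p"
  proof
    assume 0: "root_eval f p = 0"
    show "?F dvd p"
    proof (rule separable_dvd_by_roots[OF ab])
      fix z assume "poly (cpoly ?F) z = 0"
      then show "poly (cpoly p) z = 0" using fun_cong[OF 0, of z] by (simp add: root_eval_def cF)
    qed
  next
    assume "?F dvd p"
    then obtain k where k: "p = ?F * k" by (auto simp: dvd_def)
    have "poly (cpoly p) z = 0" if "poly (map_poly of_int f) z = 0" for z
      unfolding k cp.hom_mult poly_mult cF that by simp
    then show "root_eval f p = 0" using someI_ex[OF ex] by (auto simp: root_eval_def fun_eq_iff)
  qed
qed

section \<open>The case \<open>f = 1\<close>\<close>

text \<open>Here \<open>K\<close> is the zero ring, which \<open>residue_alg\<close> excludes because the ring classes require \<open>0 \<noteq> 1\<close>.\<close>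

lemma carrier_K_alg_1: "carrier (K_alg 1) = {UNIV}"
proof -
  have "res_class 1 p = UNIV" for p :: "rat poly"
    unfolding res_class_eq by (auto intro: exI[of _ "_ - p"])
  then show ?thesis by (auto simp: K_alg_def carrier_quot_ring)
qed

lemma submodule_K_1:
  assumes "S \<subseteq> carrier (K_alg 1)"
  shows "submodule {UNIV} (subring_of 1 S) (K_module 1)"
proof -
  interpret cring "K_alg 1" by (rule K_alg_cring)
  have "subgroup {UNIV} (add_monoid (K_alg 1))"
    using group.subgroup_self[OF a_group] by (simp add: carrier_K_alg_1)
  moreover have "subgroup H (add_monoid (K_module 1)) \<longleftrightarrow> subgroup H (add_monoid (K_alg 1))" for H
    by (simp add: subgroup_def m_inv_def sub_module_def)
  ultimately have "subgroup {UNIV} (add_monoid (K_module 1))" by blast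
  moreover have "s \<otimes>\<^bsub>K_alg 1\<^esub> x = UNIV" if "s \<in> S" "x = UNIV" for s x
    using m_closed[of s x] that assms carrier_K_alg_1 by blast
  ultimately show ?thesis
    by (simp add: submodule_def submodule_axioms_def subring_of_def sub_module_def)
qed

lemma module_span_1:
  assumes "S \<subseteq> carrier (K_alg 1)"
  shows "module_span (subring_of 1 S) (K_module 1) {UNIV} = {UNIV}"
  unfolding module_span_def by (rule hull_same) (rule submodule_K_1[OF assms])

text \<open>\<open>UNIV\<close> is the only residue class modulo 1, so the zero ring itself is the
  only nonempty candidate.\<close>

lemma frac_ideal_1_iff: "frac_ideal 1 (R_ord 1) I \<longleftrightarrow> I = {UNIV}"
proof
  assume "frac_ideal 1 (R_ord 1) I"
  then have "subgroup I (add_monoid (K_module 1))" by (simp add: frac_ideal_def submodule_def)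
  then have "I \<subseteq> {UNIV}" "I \<noteq> {}"
    using subgroup.subset subgroup.one_closed by (fastforce simp: sub_module_def carrier_K_alg_1)+
  then show "I = {UNIV}" by blast
next
  assume I: "I = {UNIV}"
  have R: "R_ord 1 \<subseteq> carrier (K_alg 1)" and Q: "Q_const 1 \<subseteq> carrier (K_alg 1)"
    by (auto simp: R_ord_def Q_const_def K_alg_def carrier_quot_ring)
  have "\<exists>A. finite A \<and> A \<subseteq> carrier (K_alg 1) \<and> {UNIV} = module_span (subring_of 1 (R_ord 1)) (K_module 1) A"
    using module_span_1[OF R] by (intro exI[of _ "{UNIV}"]) (simp add: carrier_K_alg_1)
  then show "frac_ideal 1 (R_ord 1) I"
    unfolding frac_ideal_def I using submodule_K_1[OF R] module_span_1[OF Q] carrier_K_alg_1 by auto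
qed

lemma modules_iso_refl: "modules_iso R M M"
  unfolding modules_iso_def by (rule bexI[OF _ iso_set_refl]) simp

text \<open>In size 0 the identity matrix is the zero matrix, so the constant polynomial 1
  annihilates it and is minimal.\<close>

lemma int_mats_1: "int_mats 1 1 = {mat 0 0 (\<lambda>_. 0)}"
proof -
  have "A \<in> int_mats 1 1" if "A \<in> carrier_mat 0 0" for A :: "int mat"
    using that by (auto simp: int_mats_def is_minimal_poly_def mat_eval_def char_poly_def char_poly_matrix_def)
  then show ?thesis by (auto simp: int_mats_def)
qed

lemma quotient_singleton: "(a, a) \<in> r \<Longrightarrow> {a} // r = {r `` {a}}"
  by (auto simp: quotient_def)

lemma ex_bij_betw_singletons: "\<exists>\<phi>. bij_betw \<phi> {a} {b}"
  by (rule exI[of _ "\<lambda>_. b"]) (simp add: bij_betw_def)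

lemma int_mat_classes_1: "\<exists>C. int_mat_classes 1 1 = {C}"
  unfolding int_mat_classes_def int_mats_1
  using similar_mat_refl[of "mat 0 0 (\<lambda>_. 0) :: int mat" 0] by (simp add: quotient_singleton)

lemma dsum_cong: "(\<And>i. i < N \<Longrightarrow> I i = I' i) \<Longrightarrow> dsum f N I = dsum f N I'"
  by (auto simp: dsum_def intro: PiE_cong)

lemma ideals_prod_cong: "(\<And>i. i < N \<Longrightarrow> I i = I' i) \<Longrightarrow> ideals_prod f I N = ideals_prod f I' N"
  by (induction N) auto

lemma ideal_chain_1D: "ideal_chain 1 N I \<Longrightarrow> i < N \<Longrightarrow> I i = {UNIV}"
  by (simp add: ideal_chain_def frac_ideal_1_iff)

lemma ICM_1: "\<exists>C. carrier (ICM 1) = {C}"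
proof -
  have "{I. frac_ideal 1 (R_ord 1) I} = {{UNIV}}" by (auto simp: frac_ideal_1_iff)
  moreover have "({UNIV}, {UNIV}) \<in> ideals_iso 1" by (simp add: ideals_iso_def frac_ideal_1_iff modules_iso_refl)
  ultimately show ?thesis by (simp add: ICM_def quotient_singleton)
qed

lemma chain_module_classes_1: "\<exists>C. chain_module_classes 1 N = {C}"
proof -
  have "ideal_chain 1 N (\<lambda>_. {UNIV})" by (simp add: ideal_chain_def frac_ideal_1_iff)
  moreover have "dsum 1 N I = dsum 1 N (\<lambda>_. {UNIV})" if "ideal_chain 1 N I" for I
    using ideal_chain_1D[OF that] by (rule dsum_cong)
  ultimately have "chain_modules 1 N = {dsum 1 N (\<lambda>_. {UNIV})}" unfolding chain_modules_def by blast
  then show ?thesis by (simp add: chain_module_classes_def quotient_singleton modules_iso_refl)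
qed

theorem corollary8p2:
  fixes f :: "int poly"
  assumes "lead_coeff f = 1" and "squarefree f"
  shows "(\<exists>\<phi>. bij_betw \<phi> (int_mat_classes f f) (carrier (ICM f))) \<and>
    (R_bass f \<longrightarrow> (\<forall>N::nat. 0 < N \<longrightarrow>
       (\<exists>\<psi>. bij_betw \<psi> (int_mat_classes f (f ^ N)) (chain_module_classes f N)) \<and>
       (\<forall>I I'. ideal_chain f N I \<longrightarrow> ideal_chain f N I' \<longrightarrow>
          (modules_iso (subring_of f (R_ord f)) (dsum f N I) (dsum f N I') \<longleftrightarrow>
             (\<forall>i<N. colon f (I i) (I i) = colon f (I' i) (I' i)) \<and>
             ideal_class f (ideals_prod f I N) = ideal_class f (ideals_prod f I' N)))))"
proof (cases "f = 1")
  case False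
  interpret residue_alg f "root_eval f" by (rule root_eval_residue_alg[OF assms False])
  show ?thesis
    by (intro conjI impI allI matrices_ideals matrices_chains chain_modules_iso_iff bass_if_R_bass)
next
  case True
  obtain C C' where C: "int_mat_classes 1 1 = {C}" "carrier (ICM 1) = {C'}"
    using int_mat_classes_1 ICM_1 by auto
  have "\<exists>\<phi>. bij_betw \<phi> (int_mat_classes f f) (carrier (ICM f))"
    unfolding True C by (rule ex_bij_betw_singletons)
  moreover have "\<exists>\<psi>. bij_betw \<psi> (int_mat_classes f (f ^ N)) (chain_module_classes f N)" for N
  proof -
    obtain D where D: "chain_module_classes 1 N = {D}" using chain_module_classes_1 by blast
    show ?thesis unfolding True power_one C D by (rule ex_bij_betw_singletons)
  qed
  moreover have "modules_iso (subring_of f (R_ord f)) (dsum f N I) (dsum f N I') \<longleftrightarrow>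
      (\<forall>i<N. colon f (I i) (I i) = colon f (I' i) (I' i)) \<and>
      ideal_class f (ideals_prod f I N) = ideal_class f (ideals_prod f I' N)"
    if c: "ideal_chain f N I" "ideal_chain f N I'" for N I I'
  proof -
    have eq: "I i = I' i" if "i < N" for i
      using ideal_chain_1D[OF _ that] c unfolding True by metis
    have "dsum f N I = dsum f N I'" "ideals_prod f I N = ideals_prod f I' N"
      by (intro dsum_cong ideals_prod_cong eq; assumption)+
    then show ?thesis using eq by (simp add: modules_iso_refl)
  qed
  ultimately show ?thesis by blast
qed

end
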